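(* If $A$ and $B$ are two operator systems, or two approximately unital operator algebras, then $C^*_{\rm e}(B \otimes_{\rm min} A) = C^*_{\rm e}(B) \otimes_{\rm min} C^*_{\rm e}(A)$; that is, $C^*_{\rm e}(B) \otimes_{\rm min} C^*_{\rm e}(A)$, together with the canonical embedding of $B \otimes_{\rm min} A$ into it, is a $C^*$-envelope of $B \otimes_{\rm min} A$.
   Context: An operator algebra is a norm-closed, not necessarily selfadjoint, subalgebra of a $C^*$-algebra, with the inherited matrix norms; approximately unital means having a contractive two-sided approximate identity. An operator system is a unital selfadjoint subspace of a unital $C^*$-algebra. $\otimes_{\rm min}$ is the minimal (spatial) tensor product: the closure of $B \otimes A$ in $B(H\otimes K)$ when $B\subset B(H)$, $A\subset B(K)$ completely isometrically. A $C^*$-cover of an operator algebra (resp. operator system) $X$ is a $C^*$-algebra $\mathcal{E}$ with a completely isometric homomorphism (resp. unital complete isometry) $j : X\to\mathcal{E}$ whose range generates $\mathcal{E}$ as a $C^*$-algebra. The $C^*$-envelope $C^*_{\rm e}(X)$ is the minimal $C^*$-cover: every $C^*$-cover of $X$ has a $*$-homomorphism onto $C^*_{\rm e}(X)$ compatible with the embeddings of $X$. (For a nonunital operator algebra $X$, $C^*_{\rm e}(X)$ is the $C^*$-algebra generated by $X$ inside $C^*_{\rm e}(X^1)$, $X^1$ being the unitization.) *)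

theory Defs
  imports "HOL-Analysis.Analysis"
begin

section \<open>Complex Hilbert spaces\<close>

class complex_vector = real_vector +
  fixes scaleC :: "complex \<Rightarrow> 'a \<Rightarrow> 'a"  (infixr \<open>*\<^sub>C\<close> 75)
  assumes scaleC_add_right: "c *\<^sub>C (x + y) = c *\<^sub>C x + c *\<^sub>C y"
    and scaleC_add_left: "(c + d) *\<^sub>C x = c *\<^sub>C x + d *\<^sub>C x"
    and scaleC_scaleC: "c *\<^sub>C d *\<^sub>C x = (c * d) *\<^sub>C x"
    and scaleR_scaleC: "r *\<^sub>R x = complex_of_real r *\<^sub>C x"

class complex_normed_vector = complex_vector + real_normed_vector +
  assumes norm_scaleC: "norm (c *\<^sub>C x) = cmod c * norm x"

text \<open>The inner product is conjugate-linear in the first variable.\<close>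

class chilbert_space = complex_normed_vector + complete_space +
  fixes cinner :: "'a \<Rightarrow> 'a \<Rightarrow> complex"
  assumes cinner_commute: "cinner x y = cnj (cinner y x)"
    and cinner_add_left: "cinner (x + y) z = cinner x z + cinner y z"
    and cinner_scaleC_left: "cinner (c *\<^sub>C x) z = cnj c * cinner x z"
    and cinner_self: "cinner x x = complex_of_real ((norm x)\<^sup>2)"

definition csubspace :: "'a::complex_vector set \<Rightarrow> bool" where
  "csubspace S \<longleftrightarrow> 0 \<in> S \<and> (\<forall>x\<in>S. \<forall>y\<in>S. x + y \<in> S) \<and> (\<forall>c. \<forall>x\<in>S. c *\<^sub>C x \<in> S)"

definition clinear_on :: "'a::complex_vector set \<Rightarrow> ('a \<Rightarrow> 'b::complex_vector) \<Rightarrow> bool" where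
  "clinear_on S f \<longleftrightarrow>
     (\<forall>x\<in>S. \<forall>y\<in>S. f (x + y) = f x + f y) \<and> (\<forall>c. \<forall>x\<in>S. f (c *\<^sub>C x) = c *\<^sub>C f x)"

text \<open>
  \<open>hilbert_tensor t\<close>: the space \<open>'l\<close>, with elementary tensors \<open>t x y\<close>, is the Hilbert space tensor
  product of \<open>'h\<close> and \<open>'k\<close>.  This determines \<open>('l, t)\<close> up to a unique unitary.
\<close>

definition hilbert_tensor ::
    "('h::chilbert_space \<Rightarrow> 'k::chilbert_space \<Rightarrow> 'l::chilbert_space) \<Rightarrow> bool" where
  "hilbert_tensor t \<longleftrightarrow>
     (\<forall>y. clinear_on UNIV (\<lambda>x. t x y)) \<and> (\<forall>x. clinear_on UNIV (t x)) \<and>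
     (\<forall>x y x' y'. cinner (t x y) (t x' y') = cinner x x' * cinner y y') \<and>
     closure (csubspace hull {t x y | x y. True}) = UNIV"

subsection \<open>The Hilbert space of square-summable families\<close>

typedef 'i ell2 = "{f :: 'i \<Rightarrow> complex. (\<lambda>i. (cmod (f i))\<^sup>2) summable_on UNIV}"
  morphisms ell2_coord Abs_ell2
  by (rule exI[of _ "\<lambda>_. 0"]) simp

lemma ell2_eqI: "(\<And>i. ell2_coord f i = ell2_coord g i) \<Longrightarrow> f = g"
  using ell2_coord_inject by blast

lemma ell2_summable: "(\<lambda>i. (cmod (ell2_coord f i))\<^sup>2) summable_on UNIV"
  using ell2_coord[of f] by simp

lemma ell2_summableI:
  assumes "\<And>F. finite F \<Longrightarrow> L2_set (\<lambda>i. cmod (f i)) F \<le> C"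
  shows "(\<lambda>i. (cmod (f i))\<^sup>2) summable_on UNIV"
proof (rule nonneg_bdd_above_summable_on)
  show "bdd_above (sum (\<lambda>i. (cmod (f i))\<^sup>2) ` {F. F \<subseteq> UNIV \<and> finite F})"
  proof (rule bdd_aboveI2)
    fix F :: "'a set" assume "F \<in> {F. F \<subseteq> UNIV \<and> finite F}"
    then have *: "L2_set (\<lambda>i. cmod (f i)) F \<le> C" using assms by simp
    have "(\<Sum>i\<in>F. (cmod (f i))\<^sup>2) = (L2_set (\<lambda>i. cmod (f i)) F)\<^sup>2"
      by (simp add: L2_set_def sum_nonneg)
    also have "\<dots> \<le> C\<^sup>2" using * by (intro power_mono) auto
    finally show "(\<Sum>i\<in>F. (cmod (f i))\<^sup>2) \<le> C\<^sup>2" .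
  qed
qed simp

instantiation ell2 :: (type) real_normed_vector
begin

definition "zero_ell2 = Abs_ell2 (\<lambda>_. 0)"
definition "plus_ell2 f g = Abs_ell2 (\<lambda>i. ell2_coord f i + ell2_coord g i)"
definition "minus_ell2 f g = Abs_ell2 (\<lambda>i. ell2_coord f i - ell2_coord g i)"
definition "uminus_ell2 f = Abs_ell2 (\<lambda>i. - ell2_coord f i)"
definition "scaleR_ell2 r f = Abs_ell2 (\<lambda>i. complex_of_real r * ell2_coord f i)"
definition "norm_ell2 f = sqrt (\<Sum>\<^sub>\<infinity>i. (cmod (ell2_coord f i))\<^sup>2)"
definition "sgn_ell2 f = inverse (norm f) *\<^sub>R (f :: 'a ell2)"
definition "dist_ell2 f g = norm (f - g :: 'a ell2)"
definition "(uniformity :: ('a ell2 \<times> 'a ell2) filter) = (INF e\<in>{0<..}. principal {(x, y). dist x y < e})"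
definition "open_ell2 S = (\<forall>x\<in>S. \<forall>\<^sub>F (x', y) in uniformity. x' = (x :: 'a ell2) \<longrightarrow> y \<in> S)"

lemma L2_le_norm_ell2: "L2_set (\<lambda>i. cmod (ell2_coord f i)) F \<le> norm f"
proof (cases "finite F")
  case True
  then show ?thesis
    unfolding L2_set_def norm_ell2_def
    by (intro real_sqrt_le_mono finite_sum_le_infsum ell2_summable) auto
next
  case False
  then show ?thesis by (simp add: norm_ell2_def infsum_nonneg)
qed

lemma norm_ell2_le:
  assumes "\<And>F. finite F \<Longrightarrow> L2_set (\<lambda>i. cmod (ell2_coord f i)) F \<le> C"
  shows "norm f \<le> C"
proof -
  have C: "0 \<le> C" using assms[of "{}"] by simp
  have "(\<Sum>\<^sub>\<infinity>i. (cmod (ell2_coord f i))\<^sup>2) \<le> C\<^sup>2"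
  proof (rule infsum_le_finite_sums[OF ell2_summable])
    fix F :: "'a set" assume "finite F"
    then have *: "L2_set (\<lambda>i. cmod (ell2_coord f i)) F \<le> C" using assms by simp
    have "(\<Sum>i\<in>F. (cmod (ell2_coord f i))\<^sup>2) = (L2_set (\<lambda>i. cmod (ell2_coord f i)) F)\<^sup>2"
      by (simp add: L2_set_def sum_nonneg)
    also have "\<dots> \<le> C\<^sup>2" using * by (intro power_mono) auto
    finally show "(\<Sum>i\<in>F. (cmod (ell2_coord f i))\<^sup>2) \<le> C\<^sup>2" .
  qed
  then show ?thesis
    unfolding norm_ell2_def using C real_le_lsqrt by blast
qed

lemma L2_set_add_le:
  "L2_set (\<lambda>i. cmod (ell2_coord f i + ell2_coord g i)) F \<le> norm f + norm g"
proof -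
  have "L2_set (\<lambda>i. cmod (ell2_coord f i + ell2_coord g i)) F
      \<le> L2_set (\<lambda>i. cmod (ell2_coord f i) + cmod (ell2_coord g i)) F"
    by (intro L2_set_mono norm_triangle_ineq) auto
  also have "\<dots> \<le> L2_set (\<lambda>i. cmod (ell2_coord f i)) F + L2_set (\<lambda>i. cmod (ell2_coord g i)) F"
    by (rule L2_set_triangle_ineq)
  also have "\<dots> \<le> norm f + norm g"
    by (intro add_mono L2_le_norm_ell2)
  finally show ?thesis .
qed

lemma ell2_scale_summable:
  "(\<lambda>i. (cmod (c * ell2_coord f i))\<^sup>2) summable_on UNIV"
  using summable_on_cmult_right[OF ell2_summable[of f], of "(cmod c)\<^sup>2"]
  by (simp add: norm_mult power_mult_distrib)

lemma coord_zero [simp]: "ell2_coord 0 i = 0"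
  by (simp add: zero_ell2_def Abs_ell2_inverse)

lemma coord_plus [simp]: "ell2_coord (f + g) i = ell2_coord f i + ell2_coord g i"
  unfolding plus_ell2_def
  by (subst Abs_ell2_inverse) (use ell2_summableI[OF L2_set_add_le] in auto)

lemma coord_uminus [simp]: "ell2_coord (- f) i = - ell2_coord f i"
  unfolding uminus_ell2_def
  by (subst Abs_ell2_inverse) (use ell2_summable in auto)

lemma coord_minus [simp]: "ell2_coord (f - g) i = ell2_coord f i - ell2_coord g i"
proof -
  have "f - g = f + (- g)"
    by (simp add: minus_ell2_def plus_ell2_def)
  then show ?thesis by simp
qed

lemma coord_scaleR [simp]: "ell2_coord (r *\<^sub>R f) i = complex_of_real r * ell2_coord f i"
  unfolding scaleR_ell2_def
  by (subst Abs_ell2_inverse) (use ell2_scale_summable in auto)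

lemma coord_le_norm: "cmod (ell2_coord f i) \<le> norm f"
  using L2_le_norm_ell2[of f "{i}"] by (simp add: L2_set_def)

lemma norm_ell2_scale:
  assumes "\<And>i. ell2_coord g i = c * ell2_coord f i"
  shows "norm g = cmod c * norm f"
  by (simp add: norm_ell2_def assms norm_mult power_mult_distrib infsum_cmult_right' real_sqrt_mult)

instance
proof
  fix f g :: "'a ell2" and r :: real
  show "norm (f + g) \<le> norm f + norm g"
    by (rule norm_ell2_le) (simp add: L2_set_add_le)
  show "norm (r *\<^sub>R f) = \<bar>r\<bar> * norm f"
    by (subst norm_ell2_scale[of _ "complex_of_real r" f]) auto
  have "norm f = 0 \<Longrightarrow> f = 0"
    using coord_le_norm[of f] by (intro ell2_eqI) auto
  moreover have "norm (0 :: 'a ell2) = 0" by (simp add: norm_ell2_def)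
  ultimately show "(norm f = 0) = (f = 0)" by auto
  show "sgn f = inverse (norm f) *\<^sub>R f" by (simp add: sgn_ell2_def)
  show "dist f g = norm (f - g)" by (simp add: dist_ell2_def)
  show "(uniformity :: ('a ell2 \<times> 'a ell2) filter) = (INF e\<in>{0<..}. principal {(x, y). dist x y < e})"
    by (rule uniformity_ell2_def)
  show "open U = (\<forall>x\<in>U. \<forall>\<^sub>F (x', y) in uniformity. x' = x \<longrightarrow> y \<in> U)" for U :: "'a ell2 set"
    by (rule open_ell2_def)
qed (auto intro!: ell2_eqI simp: algebra_simps)

end

instance ell2 :: (type) complete_space
proof
  fix X :: "nat \<Rightarrow> 'a ell2" assume X: "Cauchy X"
  have "Cauchy (\<lambda>n. ell2_coord (X n) i)" for i
  proof (rule metric_CauchyI)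
    fix e :: real assume "0 < e"
    then obtain N where N: "\<And>m n. m \<ge> N \<Longrightarrow> n \<ge> N \<Longrightarrow> dist (X m) (X n) < e"
      using metric_CauchyD[OF X] by blast
    show "\<exists>N. \<forall>m\<ge>N. \<forall>n\<ge>N. dist (ell2_coord (X m) i) (ell2_coord (X n) i) < e"
    proof (intro exI allI impI)
      fix m n assume "m \<ge> N" "n \<ge> N"
      with N show "dist (ell2_coord (X m) i) (ell2_coord (X n) i) < e"
        using coord_le_norm[of "X m - X n" i] by (fastforce simp: dist_norm)
    qed
  qed
  then have "\<exists>l. (\<lambda>n. ell2_coord (X n) i) \<longlonglongrightarrow> l" for i
    using Cauchy_convergent_iff convergent_def by blast
  then obtain l where l: "\<And>i. (\<lambda>n. ell2_coord (X n) i) \<longlonglongrightarrow> l i" by metis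
  have bound: "L2_set (\<lambda>i. cmod (ell2_coord (X m) i - l i)) F \<le> e"
    if N: "\<And>m n. m \<ge> N \<Longrightarrow> n \<ge> N \<Longrightarrow> dist (X m) (X n) < e" and m: "m \<ge> N" for e N m F
  proof (rule LIMSEQ_le_const2)
    show "(\<lambda>n. L2_set (\<lambda>i. cmod (ell2_coord (X m) i - ell2_coord (X n) i)) F)
        \<longlonglongrightarrow> L2_set (\<lambda>i. cmod (ell2_coord (X m) i - l i)) F"
      unfolding L2_set_def by (intro tendsto_intros l)
    show "\<exists>N. \<forall>n\<ge>N. L2_set (\<lambda>i. cmod (ell2_coord (X m) i - ell2_coord (X n) i)) F \<le> e"
    proof (intro exI allI impI)
      fix n assume "n \<ge> N"
      then have "norm (X m - X n) < e" using N[OF m] by (simp add: dist_norm)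
      then show "L2_set (\<lambda>i. cmod (ell2_coord (X m) i - ell2_coord (X n) i)) F \<le> e"
        using L2_le_norm_ell2[of "X m - X n" F] by simp
    qed
  qed
  obtain N1 where N1: "\<And>m n. m \<ge> N1 \<Longrightarrow> n \<ge> N1 \<Longrightarrow> dist (X m) (X n) < 1"
    using metric_CauchyD[OF X, of 1] by auto
  let ?d = "Abs_ell2 (\<lambda>i. ell2_coord (X N1) i - l i)"
  have "(\<lambda>i. (cmod (ell2_coord (X N1) i - l i))\<^sup>2) summable_on UNIV"
    by (rule ell2_summableI[of _ 1]) (rule bound[OF N1], auto)
  then have d: "ell2_coord ?d i = ell2_coord (X N1) i - l i" for i
    by (simp add: Abs_ell2_inverse)
  let ?L = "X N1 - ?d"
  have L: "ell2_coord ?L i = l i" for i by (simp add: d)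
  have "X \<longlonglongrightarrow> ?L"
  proof (rule metric_LIMSEQ_I)
    fix e :: real assume e: "0 < e"
    then obtain N where N: "\<And>m n. m \<ge> N \<Longrightarrow> n \<ge> N \<Longrightarrow> dist (X m) (X n) < e / 2"
      using metric_CauchyD[OF X, of "e / 2"] by auto
    show "\<exists>N. \<forall>n\<ge>N. dist (X n) ?L < e"
    proof (intro exI allI impI)
      fix n assume n: "n \<ge> N"
      have "norm (X n - ?L) \<le> e / 2"
      proof (rule norm_ell2_le)
        fix F :: "'a set"
        show "L2_set (\<lambda>i. cmod (ell2_coord (X n - ?L) i)) F \<le> e / 2"
          using bound[OF N n, of F] by (simp only: coord_minus[of "X n" ?L] L)
      qed
      then show "dist (X n) ?L < e" using e by (simp add: dist_norm)
    qed
  qed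
  then show "convergent X" by (auto simp: convergent_def)
qed

lemma ell2_cinner_summable:
  "(\<lambda>i. cnj (ell2_coord f i) * ell2_coord g i) summable_on UNIV"
proof (rule abs_summable_summable)
  show "(\<lambda>i. norm (cnj (ell2_coord f i) * ell2_coord g i)) summable_on UNIV"
  proof (rule summable_on_comparison_test)
    show "(\<lambda>i. (cmod (ell2_coord f i))\<^sup>2 + (cmod (ell2_coord g i))\<^sup>2) summable_on UNIV"
      by (intro summable_on_add ell2_summable)
    show "norm (cnj (ell2_coord f i) * ell2_coord g i)
        \<le> (cmod (ell2_coord f i))\<^sup>2 + (cmod (ell2_coord g i))\<^sup>2" for i
    proof -
      have "0 \<le> (cmod (ell2_coord f i) - cmod (ell2_coord g i))\<^sup>2" by simp
      moreover have "0 \<le> cmod (ell2_coord f i) * cmod (ell2_coord g i)" by simp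
      ultimately have "cmod (ell2_coord f i) * cmod (ell2_coord g i)
          \<le> (cmod (ell2_coord f i))\<^sup>2 + (cmod (ell2_coord g i))\<^sup>2"
        unfolding power2_diff by linarith
      then show ?thesis by (simp add: norm_mult)
    qed
  qed auto
qed

instantiation ell2 :: (type) chilbert_space
begin

definition "scaleC_ell2 c f = Abs_ell2 (\<lambda>i. c * ell2_coord f i)"
definition "cinner_ell2 f g = (\<Sum>\<^sub>\<infinity>i. cnj (ell2_coord f i) * ell2_coord g i)"

instance
proof
  have [simp]: "ell2_coord (c *\<^sub>C f) i = c * ell2_coord f i" for c i and f :: "'a ell2"
    unfolding scaleC_ell2_def
    by (subst Abs_ell2_inverse) (use ell2_scale_summable in auto)
  fix f g h :: "'a ell2" and c d :: complex and r :: real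
  show "c *\<^sub>C (f + g) = c *\<^sub>C f + c *\<^sub>C g" "(c + d) *\<^sub>C f = c *\<^sub>C f + d *\<^sub>C f"
    "c *\<^sub>C d *\<^sub>C f = (c * d) *\<^sub>C f" "r *\<^sub>R f = complex_of_real r *\<^sub>C f"
    by (auto intro!: ell2_eqI simp: algebra_simps)
  show "norm (c *\<^sub>C f) = cmod c * norm f"
    by (rule norm_ell2_scale) simp
  show "cinner f g = cnj (cinner g f)"
    unfolding cinner_ell2_def by (simp flip: infsum_cnj add: mult.commute)
  show "cinner (f + g) h = cinner f h + cinner g h"
    unfolding cinner_ell2_def
    by (simp add: distrib_right infsum_add ell2_cinner_summable)
  show "cinner (c *\<^sub>C f) h = cnj c * cinner f h"
    unfolding cinner_ell2_def by (simp add: mult.assoc infsum_cmult_right')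
  have "cinner f f = (\<Sum>\<^sub>\<infinity>i. complex_of_real ((cmod (ell2_coord f i))\<^sup>2))"
    unfolding cinner_ell2_def
    by (intro infsum_cong) (simp only: complex_norm_square mult.commute)
  also have "\<dots> = complex_of_real (\<Sum>\<^sub>\<infinity>i. (cmod (ell2_coord f i))\<^sup>2)"
    by (intro infsumI has_sum_bounded_linear[OF bounded_linear_of_real] has_sum_infsum ell2_summable)
  also have "\<dots> = complex_of_real ((norm f)\<^sup>2)"
    by (simp add: norm_ell2_def infsum_nonneg)
  finally show "cinner f f = complex_of_real ((norm f)\<^sup>2)" .
qed

end

section \<open>Operators\<close>

text \<open>
  The type \<open>'h \<Rightarrow>\<^sub>L 'k\<close> consists of the bounded real-linear maps; \<open>cops\<close> below is \<open>B(H)\<close>.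
\<close>

instantiation blinfun :: (real_normed_vector, complex_normed_vector) complex_normed_vector
begin

lift_definition scaleC_blinfun :: "complex \<Rightarrow> ('a \<Rightarrow>\<^sub>L 'b) \<Rightarrow> 'a \<Rightarrow>\<^sub>L 'b"
  is "\<lambda>c f x. c *\<^sub>C f x"
proof -
  fix c :: complex and f :: "'a \<Rightarrow> 'b" assume "bounded_linear f"
  then interpret f: bounded_linear f .
  obtain K where K: "\<And>x. norm (f x) \<le> norm x * K" using f.bounded by blast
  show "bounded_linear (\<lambda>x. c *\<^sub>C f x)"
  proof (rule bounded_linear_intro[where K = "cmod c * K"])
    show "c *\<^sub>C f (x + y) = c *\<^sub>C f x + c *\<^sub>C f y" for x y
      by (simp add: f.add scaleC_add_right)
    show "c *\<^sub>C f (r *\<^sub>R x) = r *\<^sub>R (c *\<^sub>C f x)" for r x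
      by (simp add: f.scaleR scaleR_scaleC scaleC_scaleC mult.commute)
    show "norm (c *\<^sub>C f x) \<le> norm x * (cmod c * K)" for x
      using mult_left_mono[OF K[of x] norm_ge_zero[of c]] by (simp add: norm_scaleC ac_simps)
  qed
qed

instance
proof
  fix f g :: "'a \<Rightarrow>\<^sub>L 'b" and c d :: complex and r :: real
  show "c *\<^sub>C (f + g) = c *\<^sub>C f + c *\<^sub>C g" by transfer (simp add: scaleC_add_right)
  show "(c + d) *\<^sub>C f = c *\<^sub>C f + d *\<^sub>C f" by transfer (simp add: scaleC_add_left)
  show "c *\<^sub>C d *\<^sub>C f = (c * d) *\<^sub>C f" by transfer (simp add: scaleC_scaleC)
  show "r *\<^sub>R f = complex_of_real r *\<^sub>C f" by transfer (simp add: scaleR_scaleC)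
  show "norm (c *\<^sub>C f) = cmod c * norm f"
  proof (rule antisym)
    have le: "norm (c *\<^sub>C f) \<le> cmod c * norm f" for c and f :: "'a \<Rightarrow>\<^sub>L 'b"
    proof (rule norm_blinfun_bound)
      fix x
      have "norm (blinfun_apply (c *\<^sub>C f) x) = cmod c * norm (blinfun_apply f x)"
        by (simp add: scaleC_blinfun.rep_eq norm_scaleC)
      then show "norm (blinfun_apply (c *\<^sub>C f) x) \<le> cmod c * norm f * norm x"
        using mult_left_mono[OF norm_blinfun[of f x] norm_ge_zero[of c]] by (simp add: ac_simps)
    qed simp
    show "norm (c *\<^sub>C f) \<le> cmod c * norm f" by (rule le)
    show "cmod c * norm f \<le> norm (c *\<^sub>C f)"
    proof (cases "c = 0")
      case False
      have "inverse c *\<^sub>C c *\<^sub>C f = f"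
        using False by transfer (simp add: scaleC_scaleC flip: scaleR_scaleC[of 1, simplified])
      then have "norm f \<le> inverse (cmod c) * norm (c *\<^sub>C f)"
        using le[of "inverse c" "c *\<^sub>C f"] by (simp add: norm_inverse)
      then show ?thesis using False by (simp add: field_simps)
    qed simp
  qed
qed

end

definition cops :: "('h::chilbert_space \<Rightarrow>\<^sub>L 'h) set" where
  "cops = {T. \<forall>c x. blinfun_apply T (c *\<^sub>C x) = c *\<^sub>C blinfun_apply T x}"

definition adj :: "('h::chilbert_space \<Rightarrow>\<^sub>L 'h) \<Rightarrow> 'h \<Rightarrow>\<^sub>L 'h" where
  "adj T = (THE S. \<forall>x y. cinner (blinfun_apply S x) y = cinner x (blinfun_apply T y))"

text \<open>
  The norm of \<open>M\<^sub>n(B(H)) = B(H\<^sup>n)\<close>; only the entries \<open>T i j\<close> with \<open>i, j < n\<close> matter.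
\<close>

definition mat_norm :: "nat \<Rightarrow> (nat \<Rightarrow> nat \<Rightarrow> ('h::chilbert_space \<Rightarrow>\<^sub>L 'h)) \<Rightarrow> real" where
  "mat_norm n T = Sup {sqrt (\<Sum>i<n. (norm (\<Sum>j<n. blinfun_apply (T i j) (\<xi> j)))\<^sup>2) | \<xi>.
                         (\<Sum>j<n. (norm (\<xi> j))\<^sup>2) \<le> 1}"

text \<open>Maps on a subspace \<open>X \<subseteq> B(H)\<close> are represented by total functions; only values on \<open>X\<close> matter.\<close>

definition completely_isometric ::
    "('h::chilbert_space \<Rightarrow>\<^sub>L 'h) set \<Rightarrow> (('h \<Rightarrow>\<^sub>L 'h) \<Rightarrow> ('k::chilbert_space \<Rightarrow>\<^sub>L 'k)) \<Rightarrow> bool" where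
  "completely_isometric X j \<longleftrightarrow> clinear_on X j \<and>
     (\<forall>n T. (\<forall>i<n. \<forall>k<n. T i k \<in> X) \<longrightarrow> mat_norm n (\<lambda>i k. j (T i k)) = mat_norm n T)"

section \<open>C*-algebras, operator systems and operator algebras\<close>

text \<open>
  By the Gelfand--Naimark theorem, C*-algebras are the norm-closed selfadjoint subalgebras of \<open>B(H)\<close>.
  They need not act nondegenerately: the identity of a unital C*-algebra may be a proper projection.
\<close>

definition cstar_algebra :: "('h::chilbert_space \<Rightarrow>\<^sub>L 'h) set \<Rightarrow> bool" where
  "cstar_algebra C \<longleftrightarrow> C \<subseteq> cops \<and> csubspace C \<and> closed C \<and>
     (\<forall>S\<in>C. \<forall>T\<in>C. S o\<^sub>L T \<in> C) \<and> (\<forall>T\<in>C. adj T \<in> C)"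

definition identity_of :: "('h::chilbert_space \<Rightarrow>\<^sub>L 'h) \<Rightarrow> ('h \<Rightarrow>\<^sub>L 'h) set \<Rightarrow> bool" where
  "identity_of e X \<longleftrightarrow> e \<in> X \<and> (\<forall>x\<in>X. e o\<^sub>L x = x \<and> x o\<^sub>L e = x)"

definition star_hom ::
    "('h::chilbert_space \<Rightarrow>\<^sub>L 'h) set \<Rightarrow> ('k::chilbert_space \<Rightarrow>\<^sub>L 'k) set
      \<Rightarrow> (('h \<Rightarrow>\<^sub>L 'h) \<Rightarrow> ('k \<Rightarrow>\<^sub>L 'k)) \<Rightarrow> bool" where
  "star_hom C D p \<longleftrightarrow> p ` C \<subseteq> D \<and> clinear_on C p \<and>
     (\<forall>S\<in>C. \<forall>T\<in>C. p (S o\<^sub>L T) = p S o\<^sub>L p T) \<and> (\<forall>T\<in>C. p (adj T) = adj (p T))"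

definition operator_system :: "('h::chilbert_space \<Rightarrow>\<^sub>L 'h) set \<Rightarrow> bool" where
  "operator_system X \<longleftrightarrow>
     (\<exists>C e. cstar_algebra C \<and> identity_of e C \<and> e \<in> X \<and> X \<subseteq> C \<and>
            csubspace X \<and> (\<forall>x\<in>X. adj x \<in> X))"

definition operator_algebra :: "('h::chilbert_space \<Rightarrow>\<^sub>L 'h) set \<Rightarrow> bool" where
  "operator_algebra X \<longleftrightarrow> X \<subseteq> cops \<and> csubspace X \<and> closed X \<and> (\<forall>x\<in>X. \<forall>y\<in>X. x o\<^sub>L y \<in> X)"

definition unital_algebra :: "('h::chilbert_space \<Rightarrow>\<^sub>L 'h) set \<Rightarrow> bool" where
  "unital_algebra X \<longleftrightarrow> (\<exists>e. identity_of e X)"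

text \<open>The approximate identity is a net, given by its (proper) filter of tails.\<close>

definition approximately_unital :: "('h::chilbert_space \<Rightarrow>\<^sub>L 'h) set \<Rightarrow> bool" where
  "approximately_unital X \<longleftrightarrow>
     (\<exists>\<F>. \<F> \<noteq> bot \<and> (\<forall>\<^sub>F e in \<F>. e \<in> X \<and> norm e \<le> 1) \<and>
          (\<forall>x\<in>X. ((\<lambda>e. e o\<^sub>L x) \<longlongrightarrow> x) \<F> \<and> ((\<lambda>e. x o\<^sub>L e) \<longlongrightarrow> x) \<F>))"

text \<open>
  The unitization of a nonunital operator algebra \<open>X \<subseteq> B(H)\<close>.  By Meyer's theorem it does not
  depend, up to completely isometric isomorphism, on the representation of \<open>X\<close>.
\<close>

definition unitization :: "('h::chilbert_space \<Rightarrow>\<^sub>L 'h) set \<Rightarrow> ('h \<Rightarrow>\<^sub>L 'h) set" where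
  "unitization X = {x + c *\<^sub>C id_blinfun | x c. x \<in> X}"

section \<open>C*-covers and C*-envelopes\<close>

definition system_cover ::
    "('h::chilbert_space \<Rightarrow>\<^sub>L 'h) set \<Rightarrow> ('k::chilbert_space \<Rightarrow>\<^sub>L 'k) set
      \<Rightarrow> (('h \<Rightarrow>\<^sub>L 'h) \<Rightarrow> ('k \<Rightarrow>\<^sub>L 'k)) \<Rightarrow> bool" where
  "system_cover X E j \<longleftrightarrow> cstar_algebra E \<and> completely_isometric X j \<and>
     (\<forall>e. identity_of e X \<longrightarrow> identity_of (j e) E) \<and> cstar_algebra hull (j ` X) = E"

definition algebra_cover ::
    "('h::chilbert_space \<Rightarrow>\<^sub>L 'h) set \<Rightarrow> ('k::chilbert_space \<Rightarrow>\<^sub>L 'k) set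
      \<Rightarrow> (('h \<Rightarrow>\<^sub>L 'h) \<Rightarrow> ('k \<Rightarrow>\<^sub>L 'k)) \<Rightarrow> bool" where
  "algebra_cover X E j \<longleftrightarrow> cstar_algebra E \<and> completely_isometric X j \<and>
     (\<forall>x\<in>X. \<forall>y\<in>X. j (x o\<^sub>L y) = j x o\<^sub>L j y) \<and> cstar_algebra hull (j ` X) = E"

definition maps_onto ::
    "('h::chilbert_space \<Rightarrow>\<^sub>L 'h) set
      \<Rightarrow> ('m::chilbert_space \<Rightarrow>\<^sub>L 'm) set \<Rightarrow> (('h \<Rightarrow>\<^sub>L 'h) \<Rightarrow> ('m \<Rightarrow>\<^sub>L 'm))
      \<Rightarrow> ('k::chilbert_space \<Rightarrow>\<^sub>L 'k) set \<Rightarrow> (('h \<Rightarrow>\<^sub>L 'h) \<Rightarrow> ('k \<Rightarrow>\<^sub>L 'k)) \<Rightarrow> bool" where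
  "maps_onto X F i E j \<longleftrightarrow> (\<exists>p. star_hom F E p \<and> p ` F = E \<and> (\<forall>x\<in>X. p (i x) = j x))"

text \<open>
  A definition cannot quantify over types, so minimality refers to the C*-covers acting on one
  Hilbert space \<open>'m\<close>, passed as a type argument.  A free type variable \<open>'m\<close> in the conclusion of a
  theorem covers all Hilbert spaces.  For \<open>E \<subseteq> B('k)\<close> the choice
  \<open>'m = ('k \<Rightarrow>\<^sub>L 'k) ell2\<close> is as good as all Hilbert spaces: the C*-envelope of \<open>X\<close> is a quotient
  of \<open>E\<close>, so GNS represents it faithfully on a space of Hilbert dimension at most
  \<open>card ('k \<Rightarrow>\<^sub>L 'k)\<close>, hence on \<open>'m\<close>, and a cover lying below the C*-envelope
  is the C*-envelope.
\<close>

definition system_envelope ::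
    "'m::chilbert_space itself \<Rightarrow> ('h::chilbert_space \<Rightarrow>\<^sub>L 'h) set \<Rightarrow> ('k::chilbert_space \<Rightarrow>\<^sub>L 'k) set
      \<Rightarrow> (('h \<Rightarrow>\<^sub>L 'h) \<Rightarrow> ('k \<Rightarrow>\<^sub>L 'k)) \<Rightarrow> bool" where
  "system_envelope (_ :: 'm itself) X E j \<longleftrightarrow> system_cover X E j \<and>
     (\<forall>(F :: ('m \<Rightarrow>\<^sub>L 'm) set) i. system_cover X F i \<longrightarrow> maps_onto X F i E j)"

definition minimal_algebra_cover ::
    "'m::chilbert_space itself \<Rightarrow> ('h::chilbert_space \<Rightarrow>\<^sub>L 'h) set \<Rightarrow> ('k::chilbert_space \<Rightarrow>\<^sub>L 'k) set
      \<Rightarrow> (('h \<Rightarrow>\<^sub>L 'h) \<Rightarrow> ('k \<Rightarrow>\<^sub>L 'k)) \<Rightarrow> bool" where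
  "minimal_algebra_cover (_ :: 'm itself) X E j \<longleftrightarrow> algebra_cover X E j \<and>
     (\<forall>(F :: ('m \<Rightarrow>\<^sub>L 'm) set) i. algebra_cover X F i \<longrightarrow> maps_onto X F i E j)"

text \<open>
  For nonunital \<open>X\<close> the envelope is in addition required to be the C*-algebra generated by \<open>X\<close> in
  the C*-envelope \<open>E1\<close> of the unitization.  Taking \<open>E1\<close> on the same Hilbert space as \<open>E\<close> loses
  nothing when \<open>X\<close> is approximately unital: then \<open>E\<close> is nonunital and \<open>E + \<complex>I\<close> is a copy of \<open>E1\<close>.
\<close>

definition algebra_envelope ::
    "'m::chilbert_space itself \<Rightarrow> ('h::chilbert_space \<Rightarrow>\<^sub>L 'h) set \<Rightarrow> ('k::chilbert_space \<Rightarrow>\<^sub>L 'k) set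
      \<Rightarrow> (('h \<Rightarrow>\<^sub>L 'h) \<Rightarrow> ('k \<Rightarrow>\<^sub>L 'k)) \<Rightarrow> bool" where
  "algebra_envelope m X E j \<longleftrightarrow> minimal_algebra_cover m X E j \<and>
     (\<not> unital_algebra X \<longrightarrow>
       (\<exists>(E1 :: ('k \<Rightarrow>\<^sub>L 'k) set) j1. minimal_algebra_cover m (unitization X) E1 j1 \<and>
          (\<forall>x\<in>X. j1 x = j x) \<and> E = cstar_algebra hull (j1 ` X)))"

section \<open>The minimal tensor product\<close>

definition op_tensor ::
    "('h::chilbert_space \<Rightarrow> 'k::chilbert_space \<Rightarrow> 'l::chilbert_space)
      \<Rightarrow> ('h \<Rightarrow>\<^sub>L 'h) \<Rightarrow> ('k \<Rightarrow>\<^sub>L 'k) \<Rightarrow> ('l \<Rightarrow>\<^sub>L 'l)" where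
  "op_tensor t S T = (THE R. R \<in> cops \<and> (\<forall>x y. blinfun_apply R (t x y) = t (blinfun_apply S x) (blinfun_apply T y)))"

definition min_tensor ::
    "('h::chilbert_space \<Rightarrow> 'k::chilbert_space \<Rightarrow> 'l::chilbert_space)
      \<Rightarrow> ('h \<Rightarrow>\<^sub>L 'h) set \<Rightarrow> ('k \<Rightarrow>\<^sub>L 'k) set \<Rightarrow> ('l \<Rightarrow>\<^sub>L 'l) set" where
  "min_tensor t B A = closure (csubspace hull {op_tensor t b a | b a. b \<in> B \<and> a \<in> A})"

text \<open>
  \<open>extends_tensor\<close>: the map \<open>j\<close> on \<open>B \<otimes>\<^sub>m\<^sub>i\<^sub>n A\<close> is \<open>jB \<otimes> jA\<close> on elementary tensors.  A linear
  isometry \<open>j\<close> on \<open>B \<otimes>\<^sub>m\<^sub>i\<^sub>n A\<close> is uniquely determined by this.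
\<close>

definition extends_tensor ::
    "('h::chilbert_space \<Rightarrow> 'k::chilbert_space \<Rightarrow> 'l::chilbert_space)
      \<Rightarrow> ('p::chilbert_space \<Rightarrow> 'q::chilbert_space \<Rightarrow> 'r::chilbert_space)
      \<Rightarrow> ('h \<Rightarrow>\<^sub>L 'h) set \<Rightarrow> ('k \<Rightarrow>\<^sub>L 'k) set
      \<Rightarrow> (('h \<Rightarrow>\<^sub>L 'h) \<Rightarrow> ('p \<Rightarrow>\<^sub>L 'p)) \<Rightarrow> (('k \<Rightarrow>\<^sub>L 'k) \<Rightarrow> ('q \<Rightarrow>\<^sub>L 'q))
      \<Rightarrow> (('l \<Rightarrow>\<^sub>L 'l) \<Rightarrow> ('r \<Rightarrow>\<^sub>L 'r)) \<Rightarrow> bool" where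
  "extends_tensor t s B A jB jA j \<longleftrightarrow>
     (\<forall>b\<in>B. \<forall>a\<in>A. j (op_tensor t b a) = op_tensor s (jB b) (jA a))"

end

theory Submission
 imports Defs "HOL-Library.Function_Algebras"
begin

text \<open>Each factor has a completely positive idempotent that fixes it and whose image is rigid over it
  (Hamana); the image is an injective C*-algebra for the Choi--Effros product and contains the envelope of the factor.
  Let \<open>\<Lambda>\<close> be the tensor product of the two resulting maps.  The embedding of \<open>B \<otimes> A\<close> into a competing
  cover and its inverse extend, by Arveson's theorem, to completely positive maps \<open>V\<close> and \<open>W\<close>.  A
  completely positive map that fixes \<open>B \<otimes> A\<close> is controlled by its slices, each of which is subject to the rigidity of
  one factor; hence \<open>\<Lambda> \<circ> W \<circ> V = \<Lambda>\<close> on the tensor product of the envelopes.  By multiplicative domains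
  \<open>\<Lambda> \<circ> W\<close> is then multiplicative on the competing cover, and composed with \<open>\<Lambda>\<^sup>-\<^sup>1\<close> it is the
  required *-homomorphism.  In the nonunital case the limit of the approximate identity serves as the unit.\<close>

section \<open>Complex Hilbert spaces\<close>

text \<open>What blocks the direct route: a tensor product of injective algebras is in general not
  injective, and \<open>\<Lambda>\<close>, built from maps that need not be normal, is in general
  neither idempotent nor rigid over \<open>B \<otimes> A\<close>. So no rigidity is available for
  maps on the tensor product itself. Freezing one factor leaves a map on the other that fixes its
  generators only up to a scalar such as \<open>(norm (Q $ y))^2\<close>; normalizing that scalar
  makes the rigidity of a single factor apply.

  Freezing means looking at \<open>b \<otimes> Q\<close> and \<open>P \<otimes> a\<close>, where
  \<open>P\<close> and \<open>Q\<close> are the units of the factors. In the nonunital case these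
  need not lie in the envelope, and that they are fixed has to be forced by strong limits along
  approximate identities.

  Maps are described by their matrix coefficients. One construction of a completely positive map
  from a positive kernel serves for Arveson's theorem, point-weak limits, the representation of the
  Choi--Effros algebra and amplifications. That representation acts on a space indexed by operators,
  the space to which the assumed minimality of the envelopes of the factors refers.\<close>

notation cinner ("<<_, _>>")
no_notation vec_nth (infixl "$" 90)
type_synonym 'a op = "'a \<Rightarrow>\<^sub>L 'a"
no_notation fps_compose (infixl "oo" 55)
notation blinfun_compose (infixl "oo" 55)
notation scaleC (infixr "*C" 75)
notation tendsto (infixr "~~>" 55)
notation LIMSEQ ("((_)/ ---> (_))" [60, 60] 60)
notation id_blinfun ("\<one>")
notation blinfun_apply (infixl "$" 80)

lemma scaleC_zero_right [simp]: "c *C (0::'a::complex_vector) = 0"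
 using scaleC_add_right[of c 0 "0::'a"] by simp

lemma scaleC_zero_left [simp]: "0 *C (x::'a::complex_vector) = 0"
 using scaleC_add_left[of 0 0 x] by simp

lemma scaleC_one [simp]: "1 *C (x::'a::complex_vector) = x"
 using scaleR_scaleC[of 1 x] by simp

lemma scaleC_minus_left [simp]: "(- c) *C (x::'a::complex_vector) = - (c *C x)"
 using scaleC_add_left[of c "- c" x] by (simp add: eq_neg_iff_add_eq_0 add.commute)

lemma scaleC_minus_right [simp]: "c *C (- x::'a::complex_vector) = - (c *C x)"
 using scaleC_add_right[of c x "- x"] by (simp add: eq_neg_iff_add_eq_0 add.commute)

lemma scaleC_diff_right: "c *C (x - y::'a::complex_vector) = c *C x - c *C y"
 using scaleC_add_right[of c x "- y"] by simp

lemma scaleC_diff_left: "(c - d) *C (x::'a::complex_vector) = c *C x - d *C x"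
 using scaleC_add_left[of c "- d" x] by simp

lemma scaleC_sum_right: "c *C (\<Sum>i\<in>F. f i) = (\<Sum>i\<in>F. c *C (f i::'a::complex_vector))"
 by (induction F rule: infinite_finite_induct) (auto simp: scaleC_add_right)

lemma cinner_add_right: "<<x, y + z>> = <<x, y>> + <<x, z>>"
 by (metis cinner_commute cinner_add_left complex_cnj_add)

lemma cinner_scaleC_right: "<<x, c *C y>> = c * <<x, y>>"
 by (metis cinner_commute cinner_scaleC_left complex_cnj_mult complex_cnj_cnj)

lemma cinner_scaleR_left: "<<r *\<^sub>R x, y>> = complex_of_real r * <<x, y>>"
 by (simp add: scaleR_scaleC cinner_scaleC_left)

lemma cinner_scaleR_right: "<<x, r *\<^sub>R y>> = complex_of_real r * <<x, y>>"
 by (simp add: scaleR_scaleC cinner_scaleC_right)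

lemma cinner_zero_left [simp]: "<<0, y>> = 0"
 using cinner_scaleC_left[of 0 0 y] by simp

lemma cinner_zero_right [simp]: "<<x, 0>> = 0"
 using cinner_scaleC_right[of x 0 0] by simp

lemma cinner_minus_left [simp]: "<<- x, y>> = - <<x, y>>"
 using cinner_scaleC_left[of "-1" x y] by simp

lemma cinner_minus_right [simp]: "<<x, - y>> = - <<x, y>>"
 using cinner_scaleC_right[of x "-1" y] by simp

lemma cinner_diff_left: "<<x - y, z>> = <<x, z>> - <<y, z>>"
 using cinner_add_left[of x "- y" z] by simp

lemma cinner_diff_right: "<<x, y - z>> = <<x, y>> - <<x, z>>"
 using cinner_add_right[of x y "- z"] by simp

lemma cinner_sum_left: "<<\<Sum>i\<in>F. f i, y>> = (\<Sum>i\<in>F. <<f i, y>>)"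
 by (induction F rule: infinite_finite_induct) (auto simp: cinner_add_left)

lemma cinner_sum_right: "<<x, \<Sum>i\<in>F. f i>> = (\<Sum>i\<in>F. <<x, f i>>)"
 by (induction F rule: infinite_finite_induct) (auto simp: cinner_add_right)

lemmas cinner_simps = cinner_add_left cinner_add_right cinner_scaleC_left cinner_scaleC_right
 cinner_diff_left cinner_diff_right cinner_scaleR_left cinner_scaleR_right

lemma Re_cinner_commute: "Re <<y, x>> = Re <<x, y>>"
 by (subst cinner_commute) simp

lemma Re_cinner_self: "Re <<x, x>> = (norm x)^2"
 by (simp add: cinner_self)

lemma norm_add_sq: "(norm (x + y))^2 = (norm x)^2 + 2 * Re <<x, y>> + (norm y)^2"
 for x y :: "'a::chilbert_space"
 using Re_cinner_commute[of y x]
 by (simp add: cinner_simps flip: Re_cinner_self)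

lemma norm_diff_sq: "(norm (x - y))^2 = (norm x)^2 - 2 * Re <<x, y>> + (norm y)^2"
 for x y :: "'a::chilbert_space"
 using norm_add_sq[of x "- y"] by simp

lemma cauchy_schwarz: "cmod <<x, y>> <= norm x * norm y"
proof (cases "y = 0")
 case False
 \<comment> \<open>\<open>c *C y\<close> is the orthogonal projection of \<open>x\<close> onto the
   line through \<open>y\<close>; the inequality is
   \<open>0 <= (norm (x - c *C y))^2\<close>.\<close>
 define c where "c = <<y, x>> / complex_of_real ((norm y)^2)"
 have "<<x, y>> * <<y, x>> = complex_of_real ((cmod <<x, y>>)^2)"
  by (metis cinner_commute complex_norm_square)
 hence "Re <<x, c *C y>> = (cmod <<x, y>>)^2 / (norm y)^2"
  unfolding c_def by (simp add: cinner_simps mult.commute flip: of_real_power of_real_divide)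
 moreover have "cmod <<y, x>> = cmod <<x, y>>"
  by (metis cinner_commute complex_mod_cnj)
 hence "(norm (c *C y))^2 = (cmod <<x, y>>)^2 / (norm y)^2"
  using False by (simp add: c_def norm_scaleC norm_divide norm_mult power2_eq_square)
 ultimately have "0 <= (norm x)^2 - (cmod <<x, y>>)^2 / (norm y)^2"
  using norm_diff_sq[of x "c *C y"] zero_le_power2[of "norm (x - c *C y)"] by linarith
 hence "(cmod <<x, y>>)^2 <= (norm x * norm y)^2"
  using False by (simp add: field_simps power_mult_distrib)
 thus ?thesis
  by (rule power2_le_imp_le) simp
qed simp

lemma Re_cinner_le: "\<bar>Re <<x, y>>\<bar> <= norm x * norm y"
 using cauchy_schwarz[of x y] abs_Re_le_cmod[of "<<x, y>>"] by linarith

lemma bounded_bilinear_cinner: "bounded_bilinear cinner"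
 by unfold_locales
  (auto simp: cinner_simps scaleR_conv_of_real intro!: exI[of _ 1] cauchy_schwarz)

lemmas tendsto_cinner [tendsto_intros] = bounded_bilinear.tendsto[OF bounded_bilinear_cinner]

lemma cinner_eqI: "(!!y. <<y, x>> = <<y, x'>>) ==> x = x'"
 using cinner_self[of "x - x'"] by (simp add: cinner_diff_right)

lemma bounded_linear_scaleC: "bounded_linear (%x::'a::complex_normed_vector. c *C x)"
 by (rule bounded_linear_intro[of _ "cmod c"])
  (auto simp: scaleC_add_right scaleR_scaleC scaleC_scaleC norm_scaleC mult.commute)

lemma tendsto_scaleC [tendsto_intros]:
 "(f ~~> x) F ==> ((%a. c *C f a) ~~> c *C (x::'a::complex_normed_vector)) F"
 by (rule bounded_linear.tendsto[OF bounded_linear_scaleC])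

lemma norm_leI_cinner:
 assumes "!!y. cmod <<y, x>> <= C * norm y" "0 <= C"
 shows "norm x <= C"
 using assms(1)[of x] assms(2)
 by (cases "x = 0") (simp_all add: cinner_self power2_eq_square norm_mult)

section \<open>Linear spans and closed spans\<close>

abbreviation cspan :: "'a::complex_vector set => 'a set" where
 "cspan S \<equiv> csubspace hull S"

lemma csubspaceD:
 assumes "csubspace S"
 shows "0 \<in> S" "x \<in> S ==> y \<in> S ==> x + y \<in> S" "x \<in> S ==> c *C x \<in> S"
  "x \<in> S ==> - x \<in> S" "x \<in> S ==> y \<in> S ==> x - y \<in> S"
proof -
 show *: "0 \<in> S" "x \<in> S ==> y \<in> S ==> x + y \<in> S" "x \<in> S ==> c *C x \<in> S" for x y c
  using assms by (auto simp: csubspace_def)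
 show **: "x \<in> S ==> - x \<in> S" for x using *(3)[of x "-1"] by simp
 show "x \<in> S ==> y \<in> S ==> x - y \<in> S" using *(2)[of x "- y"] **[of y] by simp
qed

lemma csubspace_sum: "csubspace S ==> (!!i. i \<in> F ==> f i \<in> S) ==> (\<Sum>i\<in>F. f i) \<in> S"
 by (induction F rule: infinite_finite_induct) (auto intro: csubspaceD(1,2))

lemma csubspace_Inter: "(!!S. S \<in> \<S> ==> csubspace S) ==> csubspace (\<Inter>\<S>)"
 by (simp add: csubspace_def)

lemma csubspace_cspan: "csubspace (cspan S)"
 by (rule hull_in) (auto intro: csubspace_Inter)

lemma csubspace_closure:
 fixes S :: "'a::complex_normed_vector set"
 assumes "csubspace S" shows "csubspace (closure S)"
 unfolding csubspace_def
proof (intro conjI ballI allI)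
 show "0 \<in> closure S" using csubspaceD(1)[OF assms] closure_subset by blast
 fix x y c assume "x \<in> closure S" "y \<in> closure S"
 then obtain f g where f: "!!n. f n \<in> S" "f ---> x" and g: "!!n. g n \<in> S" "g ---> y"
  by (auto simp: closure_sequential)
 have "\<forall>n. f n + g n \<in> S" "(%n. f n + g n) ---> x + y"
  using csubspaceD(2)[OF assms] f g by (auto intro: tendsto_add)
 thus "x + y \<in> closure S" unfolding closure_sequential by (intro exI conjI)
next
 fix x c assume "x \<in> closure S"
 then obtain f where f: "!!n. f n \<in> S" "f ---> x" by (auto simp: closure_sequential)
 have "\<forall>n. c *C f n \<in> S" "(%n. c *C f n) ---> c *C x"
  using csubspaceD(3)[OF assms] f by (auto intro: tendsto_scaleC)
 thus "c *C x \<in> closure S" unfolding closure_sequential by (intro exI conjI)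
qed

text \<open>Both sums are extended by zero to the union of the index sets, so that finite
  combinations with different supports can be added termwise.\<close>

lemma sum_merge:
 fixes f g :: "'i => 'b::comm_monoid_add"
 assumes "finite F" "finite G"
 shows "(\<Sum>i\<in>F. f i) + (\<Sum>i\<in>G. g i)
  = (\<Sum>i\<in>F\<union>G. (if i \<in> F then f i else 0) + (if i \<in> G then g i else 0))"
proof -
 have "(\<Sum>i\<in>F. f i) = (\<Sum>i\<in>F\<union>G. if i \<in> F then f i else 0)"
  using assms by (intro sum.mono_neutral_cong_left) auto
 moreover have "(\<Sum>i\<in>G. g i) = (\<Sum>i\<in>F\<union>G. if i \<in> G then g i else 0)"
  using assms by (intro sum.mono_neutral_cong_left) auto
 ultimately show ?thesis by (simp add: sum.distrib)
qed

text \<open>The graph of the conjugate-linear functional that sends \<open>v i\<close> to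
  \<open>a i\<close>. It is kept as a relation because nothing yet guarantees that equal
  combinations have equal values; the bound assumed in \<open>riesz_family\<close> does.\<close>

definition combs :: "'i set => ('i => 'a::complex_vector) => ('i => complex) => ('a \<times> complex) set" where
 "combs I v a = {(\<Sum>i\<in>F. c i *C v i, \<Sum>i\<in>F. cnj (c i) * a i) | F c. finite F & F <= I}"

lemma combs_add:
 assumes "(u, l) \<in> combs I v a" "(u', l') \<in> combs I v a"
 shows "(u + u', l + l') \<in> combs I v a"
proof -
 obtain F c where F: "finite F" "F <= I" and u: "u = (\<Sum>i\<in>F. c i *C v i)" "l = (\<Sum>i\<in>F. cnj (c i) * a i)"
  using assms(1) unfolding combs_def by auto
 obtain G d where G: "finite G" "G <= I" and u': "u' = (\<Sum>i\<in>G. d i *C v i)" "l' = (\<Sum>i\<in>G. cnj (d i) * a i)"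
  using assms(2) unfolding combs_def by auto
 let ?e = "%i. (if i \<in> F then c i else 0) + (if i \<in> G then d i else 0)"
 have "u + u' = (\<Sum>i\<in>F\<union>G. ?e i *C v i)"
  unfolding u u' sum_merge[OF F(1) G(1)] by (intro sum.cong) (auto simp: scaleC_add_left)
 moreover have "l + l' = (\<Sum>i\<in>F\<union>G. cnj (?e i) * a i)"
  unfolding u u' sum_merge[OF F(1) G(1)] by (intro sum.cong) (auto simp: algebra_simps)
 ultimately show ?thesis
  unfolding combs_def using F G by (intro CollectI exI[of _ "F \<union> G"] exI[of _ ?e]) auto
qed

lemma combs_scale:
 assumes "(u, l) \<in> combs I v a" shows "(k *C u, cnj k * l) \<in> combs I v a"
proof -
 obtain F c where F: "finite F" "F <= I" and u: "u = (\<Sum>i\<in>F. c i *C v i)" "l = (\<Sum>i\<in>F. cnj (c i) * a i)"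
  using assms(1) unfolding combs_def by auto
 show ?thesis unfolding combs_def u
  by (intro CollectI exI[of _ F] exI[of _ "%i. k * c i"])
   (auto simp: F scaleC_sum_right scaleC_scaleC sum_distrib_left algebra_simps)
qed

lemma combs_base: "i \<in> I ==> (v i, a i) \<in> combs I v a"
 unfolding combs_def by (intro CollectI exI[of _ "{i}"] exI[of _ "%_. 1"]) auto

lemma cspan_eq: "cspan (v ` I) = {\<Sum>i\<in>F. c i *C v i | F c. finite F & F <= I}"
proof -
 let ?S = "{\<Sum>i\<in>F. c i *C v i | F c. finite F & F <= I}"
 have S: "x \<in> ?S \<longleftrightarrow> (\<exists>l. (x, l) \<in> combs I v (%_. 0))" for x
  unfolding combs_def by auto
 have "csubspace ?S"
  unfolding csubspace_def
 proof (intro conjI ballI allI)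
  show "0 \<in> ?S" by (intro CollectI exI[of _ "{}"]) auto
 next
  fix x y assume "x \<in> ?S" "y \<in> ?S"
  thus "x + y \<in> ?S" unfolding S using combs_add by blast
 next
  fix c x assume "x \<in> ?S"
  thus "c *C x \<in> ?S" unfolding S using combs_scale by blast
 qed
 moreover have "v ` I <= ?S"
 proof
  fix x assume "x \<in> v ` I"
  then obtain i where "i \<in> I" "x = v i" by auto
  thus "x \<in> ?S" unfolding S using combs_base[of i I v "%_. 0"] by auto
 qed
 ultimately have "cspan (v ` I) <= ?S" by (intro hull_minimal)
 moreover have "?S <= cspan (v ` I)"
  by (auto intro!: csubspace_sum csubspaceD(3)[OF csubspace_cspan] csubspace_cspan intro: hull_inc)
 ultimately show ?thesis by blast
qed

lemma closure_cspan_induct: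
 fixes P :: "'a::complex_normed_vector => bool"
 assumes "x \<in> closure (cspan S)" "closed {x. P x}" "csubspace {x. P x}" "!!x. x \<in> S ==> P x"
 shows "P x"
proof -
 have "cspan S <= {x. P x}" using assms by (intro hull_minimal) auto
 hence "closure (cspan S) <= {x. P x}" using assms(2) by (rule closure_minimal)
 thus ?thesis using assms(1) by auto
qed

lemma closed_orth: "closed {x. <<y, x>> = 0}"
 by (intro closed_Collect_eq continuous_at_imp_continuous_on ballI)
  (auto simp: continuous_at intro!: tendsto_intros)

lemma orth_closure_cspan:
 assumes "x \<in> closure (cspan S)" "!!s. s \<in> S ==> <<y, s>> = 0"
 shows "<<y, x>> = 0"
 using assms(2)
 by (intro closure_cspan_induct[OF assms(1), of "%x. <<y, x>> = 0"])
  (auto simp: closed_orth csubspace_def cinner_simps)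

lemma orth_commute: "<<x, y>> = 0 \<longleftrightarrow> <<y, x>> = 0"
 by (metis cinner_commute complex_cnj_zero)

lemma orth_closure_cspan_eq:
 assumes "x \<in> closure (cspan S)" "x' \<in> closure (cspan S)" "!!s. s \<in> S ==> <<s, x>> = <<s, x'>>"
 shows "x = x'"
proof -
 have mem: "x - x' \<in> closure (cspan S)"
  using assms by (intro csubspaceD csubspace_closure csubspace_cspan)
 have "<<s, x - x'>> = 0" if "s \<in> S" for s using assms(3)[OF that] by (simp add: cinner_simps)
 hence "<<x - x', x - x'>> = 0"
  using orth_closure_cspan[OF mem, of "x - x'"] orth_commute by blast
 thus ?thesis by (simp add: cinner_self)
qed

text \<open>The representing vector minimizes \<open>\<parallel>u\<parallel>\<^sup>2 - 2 Re l\<close>.\<close>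

lemma riesz_family:
 fixes v :: "'i => 'a::chilbert_space"
 assumes bound: "!!F c. finite F ==> F <= I ==>
   cmod (\<Sum>i\<in>F. cnj (c i) * a i) <= N * norm (\<Sum>i\<in>F. c i *C v i)"
  and N: "0 <= N"
 shows "\<exists>z. (\<forall>i\<in>I. <<v i, z>> = a i) & norm z <= N & z \<in> closure (cspan (v ` I))"
proof -
 let ?D = "combs I v a"
 define J where "J = (%(u::'a, l). (norm u)^2 - 2 * Re l)"
 have bd: "cmod l <= N * norm u" if "(u, l) \<in> ?D" for u l
  using that bound unfolding combs_def by auto
 have lower: "- (N^2) <= J p" if "p \<in> ?D" for p
 proof -
  obtain u l where p: "p = (u, l)" by fastforce
  have "Re l <= N * norm u" using bd[of u l] that p complex_Re_le_cmod[of l] by simp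
  moreover have "0 <= (norm u - N)^2" by simp
  ultimately show ?thesis by (simp add: p J_def power2_diff mult.commute)
 qed
 define m where "m = Inf (J ` ?D)"
 have bdd: "bdd_below (J ` ?D)" using lower by (intro bdd_belowI2)
 have ne: "J ` ?D ~= {}" unfolding combs_def by blast
 have m_le: "m <= J p" if "p \<in> ?D" for p
  unfolding m_def using bdd that by (intro cInf_lower) auto
 have "\<exists>p\<in>?D. J p < m + 1 / Suc n" for n
 proof -
  have "Inf (J ` ?D) < m + 1 / Suc n" by (simp add: m_def)
  thus ?thesis using cInf_lessD[OF ne] by blast
 qed
 then obtain p where p: "!!n. p n \<in> ?D" "!!n. J (p n) < m + 1 / Suc n" by metis
 define u where "u n = fst (p n)" for n
 define l where "l n = snd (p n)" for n
 have ul: "(u n, l n) \<in> ?D" and Jul: "J (u n, l n) < m + 1 / Suc n" for n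
  using p by (auto simp: u_def l_def)
 \<comment> \<open>The midpoint of two points of the graph is again in the graph, so its value is at
   least \<open>m\<close>; the parallelogram law converts this into a bound on the distance of two
   almost minimal points.\<close>
 have close: "(norm (u j - u k))^2 < 2 * (1 / Suc j + 1 / Suc k)" for j k
 proof -
  have "((1/2) *C (u j + u k), cnj (1/2) * (l j + l k)) \<in> ?D"
   using ul by (intro combs_scale combs_add)
  hence "m <= J ((1/2) *C (u j + u k), cnj (1/2) * (l j + l k))" by (rule m_le)
  hence "4 * m <= (norm (u j + u k))^2 - 4 * Re (l j + l k)"
   by (simp add: J_def norm_scaleC power_mult_distrib power2_eq_square field_simps)
  moreover have "(norm (u j + u k))^2 + (norm (u j - u k))^2 = 2 * (norm (u j))^2 + 2 * (norm (u k))^2"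
   by (simp add: norm_add_sq norm_diff_sq)
  ultimately show ?thesis using Jul[of j] Jul[of k] by (simp add: J_def algebra_simps)
 qed
 have "Cauchy u"
 proof (rule metric_CauchyI)
  fix e :: real assume e: "0 < e"
  obtain M where M: "inverse (real (Suc M)) < e^2 / 4"
   using e reals_Archimedean[of "e^2 / 4"] by auto
  show "\<exists>M. \<forall>j\<ge>M. \<forall>k\<ge>M. dist (u j) (u k) < e"
  proof (intro exI allI impI)
   fix j k assume "M <= j" "M <= k"
   hence "1 / Suc j <= inverse (real (Suc M))" "1 / Suc k <= inverse (real (Suc M))"
    by (auto simp: field_simps)
   hence "2 * (1 / Suc j + 1 / Suc k) <= 4 * inverse (real (Suc M))" by argo
   hence "(norm (u j - u k))^2 < e^2" using M close[of j k] by argo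
   thus "dist (u j) (u k) < e" using e by (simp add: dist_norm power2_less_imp_less)
  qed
 qed
 then obtain z where z: "u ---> z" using Cauchy_convergent_iff convergent_def by blast
 have inn: "<<w, z>> = b" if wb: "(w, b) \<in> ?D" for w b
 proof -
  \<comment> \<open>First variation at the minimum: moving by \<open>k *C w\<close> cannot bring
    \<open>J\<close> below \<open>m\<close>, for any complex \<open>k\<close>.\<close>
  have *: "0 <= 2 * Re (cnj k * (<<w, z>> - b)) + (cmod k)^2 * (norm w)^2" for k
  proof -
   have "m <= J (u n + k *C w, l n + cnj k * b)" for n
    using ul wb by (intro m_le combs_add combs_scale)
   moreover have "Re <<u n, k *C w>> = Re (cnj k * <<w, u n>>)" for n
    by (subst Re_cinner_commute) (simp add: cinner_simps)
   moreover have "Re (l n + cnj k * b) = Re (l n) + Re (cnj k * b)" for n by simp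
   ultimately have "0 <= 2 * (Re (cnj k * <<w, u n>>) - Re (cnj k * b)) + (cmod k)^2 * (norm w)^2 + 1 / Suc n" for n
    using Jul[of n] unfolding J_def prod.case norm_add_sq norm_scaleC power_mult_distrib
    by (smt (verit, ccfv_SIG))
   hence "0 <= 2 * Re (cnj k * (<<w, u n>> - b)) + (cmod k)^2 * (norm w)^2 + 1 / Suc n" for n
    by (simp only: right_diff_distrib minus_complex.sel)
   moreover have "(%n. 2 * Re (cnj k * (<<w, u n>> - b)) + (cmod k)^2 * (norm w)^2 + 1 / Suc n)
     ---> 2 * Re (cnj k * (<<w, z>> - b)) + (cmod k)^2 * (norm w)^2 + 0"
    using LIMSEQ_inverse_real_of_nat by (intro tendsto_intros z) (simp add: inverse_eq_divide)
   ultimately show ?thesis by (intro LIMSEQ_le_const) auto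
  qed
  show ?thesis
  proof (rule ccontr)
   define d where "d = <<w, z>> - b"
   assume "<<w, z>> ~= b"
   hence d: "d ~= 0" by (simp add: d_def)
   \<comment> \<open>Moving against \<open>d\<close> by this amount, the linear gain exceeds the
     quadratic loss, because \<open>t * (norm w)^2 < 1\<close>.\<close>
   define t where "t = 1 / (1 + (norm w)^2)"
   have t: "0 < t" "t * (norm w)^2 < 1"
    by (auto simp: t_def field_simps add_pos_nonneg)
   have "Re (cnj d * d) = (cmod d)^2" by (simp add: cmod_power2) (simp add: power2_eq_square)
   hence "Re (cnj (- complex_of_real t * d) * d) = - t * (cmod d)^2"
    by (simp add: mult.assoc del: mult_minus_left)
   with *[of "- complex_of_real t * d"]
   have "0 <= - 2 * (t * (cmod d)^2) + (t * (cmod d))^2 * (norm w)^2"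
    using t by (simp add: d_def[symmetric] norm_mult)
   also have "... = t * (cmod d)^2 * (t * (norm w)^2 - 2)" by (simp add: power2_eq_square algebra_simps)
   also have "... < 0" using t d by (intro mult_pos_neg) auto
   finally show False by simp
  qed
 qed
 show ?thesis
 proof (intro exI conjI ballI)
  show "<<v i, z>> = a i" if "i \<in> I" for i using inn combs_base[OF that] .
  show "norm z <= N"
  proof (rule ccontr)
   assume less: "\<not> norm z <= N"
   have "cmod <<u n, z>> <= N * norm (u n)" for n using bd[OF ul] inn[OF ul] by simp
   moreover have "(%n. cmod <<u n, z>>) ---> cmod <<z, z>>" "(%n. N * norm (u n)) ---> N * norm z"
    by (intro tendsto_intros z)+
   ultimately have "cmod <<z, z>> <= N * norm z" by (intro LIMSEQ_le) auto
   hence "norm z * norm z <= N * norm z" by (simp add: cinner_self power2_eq_square norm_mult)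
   thus False using less N by (simp add: mult_le_cancel_right not_le)
  qed
  have "u n \<in> cspan (v ` I)" for n using ul[of n] unfolding cspan_eq combs_def by auto
  thus "z \<in> closure (cspan (v ` I))" unfolding closure_sequential using z by blast
 qed
qed

section \<open>Complex-linear operators and adjoints\<close>

definition clin :: "('a::complex_normed_vector \<Rightarrow>\<^sub>L 'b::complex_normed_vector) => bool" where
 "clin T \<longleftrightarrow> (\<forall>c x. T $ (c *C x) = c *C T $ x)"

lemma cops_iff: "T \<in> cops \<longleftrightarrow> clin T"
 by (simp add: cops_def clin_def)

lemma clin_scaleC: "clin T ==> T $ (c *C x) = c *C T $ x"
 by (simp add: clin_def)

lemma clin_sum: "clin T ==> T $ (\<Sum>i\<in>F. c i *C x i) = (\<Sum>i\<in>F. c i *C T $ x i)"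
 by (simp add: blinfun.sum_right clin_scaleC)

lemma mk_op:
 fixes g :: "'a::complex_normed_vector => 'b::complex_normed_vector"
 assumes "!!x y. g (x + y) = g x + g y" "!!c x. g (c *C x) = c *C g x"
  and "!!x. norm (g x) <= M * norm x" "0 <= M"
 obtains T where "clin T" "!!x. T $ x = g x" "norm T <= M"
proof
 have bl: "bounded_linear g"
  by (rule bounded_linear_intro[of _ M])
   (use assms in \<open>auto simp: scaleR_scaleC mult.commute\<close>)
 thus *: "Blinfun g $ x = g x" for x by (simp add: bounded_linear_Blinfun_apply)
 show "clin (Blinfun g)" by (simp add: clin_def * assms)
 show "norm (Blinfun g) <= M"
  by (rule norm_blinfun_bound) (use assms in \<open>auto simp: *\<close>)
qed

definition hadj :: "('a::chilbert_space \<Rightarrow>\<^sub>L 'b::chilbert_space) => 'b \<Rightarrow>\<^sub>L 'a" where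
 "hadj T = (THE S. \<forall>x y. <<S $ x, y>> = <<x, T $ y>>)"

lemma adj_hadj: "adj = hadj"
 by (auto simp: fun_eq_iff adj_def hadj_def)

text \<open>For fixed \<open>y\<close> the family \<open><<T $ x, y>>\<close>, indexed by all
  vectors \<open>x\<close>, is bounded, so it has a representing vector; uniqueness makes that
  vector depend linearly on \<open>y\<close>.\<close>

lemma hadj_ex:
 fixes T :: "'a::chilbert_space \<Rightarrow>\<^sub>L 'b::chilbert_space"
 assumes T: "clin T"
 obtains S where "clin S" "!!x y. <<S $ x, y>> = <<x, T $ y>>" "norm S <= norm T"
proof -
 have "\<exists>w. (\<forall>x. <<x, w>> = <<T $ x, y>>) & norm w <= norm T * norm y" for y
 proof -
  have "cmod (\<Sum>i\<in>F. cnj (c i) * <<T $ i, y>>) <= (norm T * norm y) * norm (\<Sum>i\<in>F. c i *C i)" for F c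
  proof -
   have "(\<Sum>i\<in>F. cnj (c i) * <<T $ i, y>>) = <<T $ (\<Sum>i\<in>F. c i *C i), y>>"
    using T by (simp add: clin_sum cinner_sum_left cinner_simps)
   also have "cmod ... <= norm (T $ (\<Sum>i\<in>F. c i *C i)) * norm y" by (rule cauchy_schwarz)
   also have "... <= (norm T * norm (\<Sum>i\<in>F. c i *C i)) * norm y"
    by (intro mult_right_mono norm_blinfun) auto
   finally show ?thesis by (simp add: ac_simps)
  qed
  from riesz_family[of UNIV "%x. <<T $ x, y>>" "norm T * norm y" "%x. x", OF this]
  show ?thesis by auto
 qed
 then obtain g where g: "!!x y. <<x, g y>> = <<T $ x, y>>" "!!y. norm (g y) <= norm T * norm y"
  by metis
 obtain S where S: "clin S" "!!x. S $ x = g x" "norm S <= norm T"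
 proof (rule mk_op[of g "norm T"])
  show "g (x + y) = g x + g y" for x y by (rule cinner_eqI) (simp add: g cinner_simps)
  show "g (c *C x) = c *C g x" for c x by (rule cinner_eqI) (simp add: g cinner_simps)
 qed (auto simp: g)
 moreover have "<<S $ x, y>> = <<x, T $ y>>" for x y
  using g(1)[of y x] S(2) by (metis cinner_commute)
 ultimately show ?thesis using that by blast
qed

lemma cinner_eqI_left: "(!!y. <<x, y>> = <<x', y>>) ==> x = x'"
 using cinner_self[of "x - x'"] by (simp add: cinner_diff_left)

lemma hadj_unique:
 assumes "!!x y. <<S $ x, y>> = <<x, T $ y>>"
 shows "hadj T = S"
 unfolding hadj_def
proof (rule the_equality)
 fix S' assume "\<forall>x y. <<S' $ x, y>> = <<x, T $ y>>"
 thus "S' = S" by (intro blinfun_eqI cinner_eqI_left) (simp add: assms)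
qed (simp add: assms)

context
 fixes T :: "'a::chilbert_space \<Rightarrow>\<^sub>L 'b::chilbert_space"
 assumes T: "clin T"
begin

lemma hadj_left: "<<hadj T $ x, y>> = <<x, T $ y>>"
 using hadj_ex[OF T] hadj_unique by metis

lemma hadj_right: "<<x, hadj T $ y>> = <<T $ x, y>>"
 using hadj_left by (metis cinner_commute)

lemma clin_hadj: "clin (hadj T)"
 using hadj_ex[OF T] hadj_unique by metis

lemma hadj_hadj: "hadj (hadj T) = T"
 by (rule hadj_unique) (simp add: hadj_right)

lemma norm_hadj_le: "norm (hadj T) <= norm T"
 using hadj_ex[OF T] hadj_unique by metis

end

lemma norm_hadj: "clin T ==> norm (hadj T) = norm T"
 using norm_hadj_le[of T] norm_hadj_le[of "hadj T"] by (simp add: hadj_hadj clin_hadj)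

lemma clin_intros [intro, simp]:
 "clin 0" "clin \<one>" "clin S ==> clin T ==> clin (S + T)"
 "clin S ==> clin T ==> clin (S - T)" "clin T ==> clin (- T)" "clin T ==> clin (c *C T)"
 "clin R ==> clin T ==> clin (R oo T)" "clin T ==> clin (r *\<^sub>R T)"
 "clin R ==> clin (hadj R)"
 for S T :: "'a::chilbert_space \<Rightarrow>\<^sub>L 'b::chilbert_space" and R :: "'b \<Rightarrow>\<^sub>L 'c::chilbert_space"
 by (simp_all add: clin_hadj)
  (simp_all add: clin_def blinfun.bilinear_simps scaleC_blinfun.rep_eq scaleC_add_right scaleC_diff_right
   scaleC_scaleC mult.commute scaleR_scaleC)

lemma clin_sum_ops [intro, simp]: "(!!i. i \<in> F ==> clin (T i)) ==> clin (\<Sum>i\<in>F. T i)"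
 for T :: "_ => 'a::chilbert_space \<Rightarrow>\<^sub>L 'b::chilbert_space"
 by (induction F rule: infinite_finite_induct) auto

lemma scaleC_blinfun_apply [simp]: "(c *C T) $ x = c *C T $ x"
 by (simp add: scaleC_blinfun.rep_eq)

lemma blinfun_simps [simp]:
 "(S + T) $ x = S $ x + T $ x" "(S - T) $ x = S $ x - T $ x" "(- T) $ x = - (T $ x)"
 "(0 :: 'a::real_normed_vector \<Rightarrow>\<^sub>L 'b::real_normed_vector) $ x = 0" "T $ 0 = 0"
 by (simp_all add: blinfun.bilinear_simps)

lemma hadj_simps [simp]:
 fixes S T :: "'a::chilbert_space \<Rightarrow>\<^sub>L 'b::chilbert_space" and R :: "'b \<Rightarrow>\<^sub>L 'c::chilbert_space"
 shows "hadj (0 :: 'a \<Rightarrow>\<^sub>L 'b) = 0"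
  "hadj (\<one> :: 'a op) = \<one>"
  "clin S ==> clin T ==> hadj (S + T) = hadj S + hadj T"
  "clin S ==> clin T ==> hadj (S - T) = hadj S - hadj T"
  "clin T ==> hadj (- T) = - hadj T"
  "clin T ==> hadj (c *C T) = cnj c *C hadj T"
  "clin R ==> clin T ==> hadj (R oo T) = hadj T oo hadj R"
  "clin T ==> hadj (hadj T) = T"
 by (simp_all add: hadj_hadj hadj_unique hadj_left cinner_simps)

text \<open>The operator is constructed as the adjoint of the map \<open>y \<mapsto> w\<close> with
  \<open>\<langle>v\<^sub>i, w\<rangle> = \<langle>z\<^sub>i, y\<rangle>\<close>; this avoids extending from the span of the \<open>v\<^sub>i\<close> by continuity.\<close>

lemma family_op:
 fixes v :: "'i => 'a::chilbert_space" and z :: "'i => 'b::chilbert_space"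
 assumes bound: "!!F c. finite F ==> F <= I ==>
   norm (\<Sum>i\<in>F. c i *C z i) <= M * norm (\<Sum>i\<in>F. c i *C v i)"
  and M: "0 <= M"
 obtains T where "clin T" "!!i. i \<in> I ==> T $ v i = z i" "norm T <= M"
  "!!x. (!!i. i \<in> I ==> <<v i, x>> = 0) ==> T $ x = 0"
  "!!x y. (!!i. i \<in> I ==> <<z i, y>> = 0) ==> <<y, T $ x>> = 0"
proof -
 let ?C = "closure (cspan (v ` I))"
 have C: "csubspace ?C" by (intro csubspace_closure csubspace_cspan)
 have "\<exists>w. (\<forall>i\<in>I. <<v i, w>> = <<z i, y>>) & norm w <= M * norm y & w \<in> ?C" for y
 proof -
  have "cmod (\<Sum>i\<in>F. cnj (c i) * <<z i, y>>) <= (M * norm y) * norm (\<Sum>i\<in>F. c i *C v i)"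
   if F: "finite F" "F <= I" for F c
  proof -
   have "(\<Sum>i\<in>F. cnj (c i) * <<z i, y>>) = <<\<Sum>i\<in>F. c i *C z i, y>>"
    by (simp add: cinner_sum_left cinner_simps)
   also have "cmod ... <= norm (\<Sum>i\<in>F. c i *C z i) * norm y" by (rule cauchy_schwarz)
   also have "... <= (M * norm (\<Sum>i\<in>F. c i *C v i)) * norm y"
    using F by (intro mult_right_mono bound) auto
   finally show ?thesis by (simp add: ac_simps)
  qed
  from riesz_family[of I "%i. <<z i, y>>" "M * norm y" v, OF this]
  show ?thesis using M by auto
 qed
 then obtain g where g: "!!i y. i \<in> I ==> <<v i, g y>> = <<z i, y>>" "!!y. norm (g y) <= M * norm y"
  "!!y. g y \<in> ?C"
  by metis
 \<comment> \<open>The representing vector is chosen in the closed span, where it is unique;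
   linearity of \<open>g\<close> follows.\<close>
 have uniq: "g y = w" if "w \<in> ?C" "!!i. i \<in> I ==> <<v i, w>> = <<z i, y>>" for y w
  using that g by (intro orth_closure_cspan_eq[of _ "v ` I"]) auto
 obtain S where S: "clin S" "!!x. S $ x = g x" "norm S <= M"
 proof (rule mk_op[of g M])
  show "g (x + y) = g x + g y" for x y
   using g csubspaceD[OF C] by (intro uniq) (auto simp: cinner_simps)
  show "g (c *C x) = c *C g x" for c x
   using g csubspaceD[OF C] by (intro uniq) (auto simp: cinner_simps)
 qed (auto simp: g M)
 show ?thesis
 proof
  show "clin (hadj S)" using S by simp
  show "norm (hadj S) <= M" using S by (simp add: norm_hadj)
  show "hadj S $ v i = z i" if "i \<in> I" for i
   by (rule cinner_eqI_left) (use S g that in \<open>simp add: hadj_left\<close>)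
  show "hadj S $ x = 0" if "!!i. i \<in> I ==> <<v i, x>> = 0" for x
  proof (rule cinner_eqI)
   fix y
   have "<<x, g y>> = 0" by (rule orth_closure_cspan[OF g(3)]) (metis that orth_commute imageE)
   thus "<<y, hadj S $ x>> = <<y, 0>>" using orth_commute[of x "g y"] by (simp add: hadj_right S)
  qed
  show "<<y, hadj S $ x>> = 0" if "!!i. i \<in> I ==> <<z i, y>> = 0" for x y
  proof -
   have "g y = 0" using that by (intro uniq) (auto simp: csubspaceD[OF C])
   thus ?thesis by (simp add: hadj_right S)
  qed
 qed
qed

section \<open>Orthonormal bases\<close>

definition ortho :: "'a::chilbert_space set => bool" where
 "ortho S \<longleftrightarrow> (\<forall>x\<in>S. \<forall>y\<in>S. <<x, y>> = (if x = y then 1 else 0))"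

text \<open>A maximal orthonormal set, by Zorn's lemma: a nonzero vector orthogonal to it could be
  normalized and added.\<close>

lemma onb_ex:
 obtains S :: "'a::chilbert_space set" where "ortho S" "!!x. (!!e. e \<in> S ==> <<e, x>> = 0) ==> x = 0"
proof -
 have "\<exists>M\<in>{S :: 'a set. ortho S}. \<forall>X\<in>{S. ortho S}. M <= X --> X = M"
 proof (rule subset_Zorn_nonempty)
  have "ortho ({} :: 'a set)" by (simp add: ortho_def)
  thus "{S :: 'a set. ortho S} ~= {}" by blast
 next
  fix \<C> assume C: "\<C> ~= {}" "subset.chain {S :: 'a set. ortho S} \<C>"
  have "<<x, y>> = (if x = y then 1 else 0)" if "x \<in> X" "X \<in> \<C>" "y \<in> Y" "Y \<in> \<C>" for x X y Y
  proof -
   have "X <= Y \<or> Y <= X" "ortho X" "ortho Y" using C that by (auto simp: subset_chain_def)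
   thus ?thesis using that unfolding ortho_def by blast
  qed
  thus "\<Union>\<C> \<in> {S. ortho S}" unfolding ortho_def by blast
 qed
 then obtain M :: "'a set" where M: "ortho M" and max: "!!X. ortho X ==> M <= X ==> X = M" by auto
 have "x = 0" if x: "!!e. e \<in> M ==> <<e, x>> = 0" for x
 proof (rule ccontr)
  assume nz: "x ~= 0"
  define e where "e = (1 / norm x) *\<^sub>R x"
  have e: "<<e, e>> = 1" using nz by (simp add: e_def cinner_simps cinner_self power2_eq_square)
  have orth: "<<f, e>> = 0" "<<e, f>> = 0" if "f \<in> M" for f
   using x[OF that] orth_commute[of f x] by (auto simp: e_def cinner_simps)
  have "ortho (insert e M)" using M orth e unfolding ortho_def by auto
  hence "e \<in> M" using max[of "insert e M"] by blast
  thus False using orth e by fastforce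
 qed
 thus ?thesis using M that by blast
qed

subsection \<open>Kolmogorov decomposition of positive definite kernels\<close>

definition ebasis :: "'i => 'i ell2" where
 "ebasis k = Abs_ell2 (%i. if i = k then 1 else 0)"

lemma coord_ebasis: "ell2_coord (ebasis k) i = (if i = k then 1 else 0)"
proof -
 have "(%i. (cmod (if i = k then 1 else 0))^2) summable_on UNIV"
  using finite_nonzero_values_imp_summable_on[of UNIV "%i. (cmod (if i = k then 1 else 0))^2"] by simp
 thus ?thesis unfolding ebasis_def by (subst Abs_ell2_inverse) auto
qed

lemma cinner_ebasis: "<<ebasis k, f>> = ell2_coord f k"
proof -
 have "<<ebasis k, f>> = (\<Sum>\<^sub>\<infinity>i\<in>{k}. cnj (ell2_coord (ebasis k) i) * ell2_coord f i)"
  unfolding cinner_ell2_def by (intro infsum_cong_neutral) (auto simp: coord_ebasis)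
 thus ?thesis by (simp add: coord_ebasis)
qed

definition psd_kernel :: "'i set => ('i => 'i => complex) => bool" where
 "psd_kernel I K \<longleftrightarrow> (\<forall>i\<in>I. \<forall>j\<in>I. K i j = cnj (K j i)) &
   (\<forall>F c. finite F & F <= I --> 0 <= Re (\<Sum>i\<in>F. \<Sum>j\<in>F. cnj (c i) * c j * K i j))"

lemma psd_kernel_diag: "psd_kernel I K ==> i \<in> I ==> 0 <= Re (K i i)"
proof -
 assume K: "psd_kernel I K" and i: "i \<in> I"
 have "\<forall>F c. finite F & F <= I --> 0 <= Re (\<Sum>i\<in>F. \<Sum>j\<in>F. cnj (c i) * c j * K i j)"
  using K unfolding psd_kernel_def by (rule conjunct2)
 from this[rule_format, of "{i}" "%_. 1"] show ?thesis using i by simp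
qed

lemma cinner_sum_sum:
 "<<\<Sum>i\<in>F. c i *C v i, \<Sum>j\<in>G. d j *C w j>> = (\<Sum>i\<in>F. \<Sum>j\<in>G. cnj (c i) * d j * <<v i, w j>>)"
 unfolding cinner_sum_left by (simp add: cinner_sum_right cinner_simps ac_simps sum_distrib_left)

text \<open>Positivity on \<open>insert i F\<close>, with a free coefficient \<open>d\<close> at
  \<open>i\<close>, is a quadratic inequality in \<open>d\<close>. Optimizing it gives the
  Cauchy--Schwarz inequality between the new index and the vectors already realized.\<close>

lemma psd_kernel_bound:
 assumes K: "psd_kernel I K" and v: "!!j k. j \<in> J ==> k \<in> J ==> <<v j, v k>> = K j k"
  and J: "J <= I" "i \<in> I" "i \<notin> J" and F: "finite F" "F <= J"
 shows "cmod (\<Sum>j\<in>F. cnj (c j) * K j i) <= sqrt (Re (K i i)) * norm (\<Sum>j\<in>F. c j *C v j)"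
proof -
 define u where "u = (\<Sum>j\<in>F. c j *C v j)"
 define l where "l = (\<Sum>j\<in>F. cnj (c j) * K j i)"
 have iF: "i \<notin> F" using J F by blast
 have uu: "(\<Sum>j\<in>F. \<Sum>k\<in>F. cnj (c j) * c k * K j k) = <<u, u>>"
 proof -
  have "<<u, u>> = (\<Sum>j\<in>F. \<Sum>k\<in>F. cnj (c j) * c k * <<v j, v k>>)"
   unfolding u_def by (rule cinner_sum_sum)
  also have "... = (\<Sum>j\<in>F. \<Sum>k\<in>F. cnj (c j) * c k * K j k)"
   using v F by (intro sum.cong refl) auto
  finally show ?thesis by simp
 qed
 have herm: "K i j = cnj (K j i)" if "j \<in> F" for j
  using K J F that unfolding psd_kernel_def by blast
 have main: "0 <= (norm u)^2 + 2 * Re (d * l) + (cmod d)^2 * Re (K i i)" for d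
 proof -
  define e where "e = c(i := d)"
  have e: "e j = c j" if "j \<in> F" for j using that iF by (auto simp: e_def)
  have ei: "e i = d" by (simp add: e_def)
  have "0 <= Re (\<Sum>j\<in>insert i F. \<Sum>k\<in>insert i F. cnj (e j) * e k * K j k)"
   using K J F unfolding psd_kernel_def by auto
  also have "(\<Sum>j\<in>insert i F. \<Sum>k\<in>insert i F. cnj (e j) * e k * K j k)
    = cnj d * d * K i i + (\<Sum>k\<in>F. cnj d * c k * K i k) + ((\<Sum>j\<in>F. cnj (c j) * d * K j i) + <<u, u>>)"
   using F iF e ei by (simp add: sum.distrib uu)
  also have "(\<Sum>k\<in>F. cnj d * c k * K i k) = cnj (d * l)"
   using herm by (simp add: l_def sum_distrib_left ac_simps)
  also have "(\<Sum>j\<in>F. cnj (c j) * d * K j i) = d * l"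
   by (simp add: l_def sum_distrib_left ac_simps)
  also have "cnj d * d = complex_of_real ((cmod d)^2)"
   by (metis complex_norm_square mult.commute)
  finally show ?thesis by (simp add: cinner_self)
 qed
 have Kii: "0 <= Re (K i i)" by (rule psd_kernel_diag[OF K J(2)])
 have "cmod l ^ 2 <= Re (K i i) * (norm u)^2"
 proof (cases "l = 0")
  case False
  have *: "0 <= (norm u)^2 - 2 * t * (cmod l)^2 + t^2 * (cmod l)^2 * Re (K i i)" for t
  proof -
   have "cnj l * l = complex_of_real ((cmod l)^2)" by (metis complex_norm_square mult.commute)
   thus ?thesis using main[of "- (of_real t * cnj l)"]
    by (simp add: mult.assoc norm_mult power_mult_distrib)
  qed
  show ?thesis
  proof (cases "Re (K i i) = 0")
   case True
   \<comment> \<open>Without the quadratic term the inequality is affine in \<open>t\<close>; this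
     \<open>t\<close> gives it the value \<open>- (norm u)^2 - 2\<close>.\<close>
   thus ?thesis
    using *[of "((norm u)^2 + 1) / (cmod l)^2"] False zero_le_power2[of "norm u"] by (simp del: zero_le_power2)
  next
   case False
   thus ?thesis
    using *[of "1 / Re (K i i)"] Kii by (simp add: field_simps power2_eq_square)
  qed
 qed (use Kii in simp)
 also have "Re (K i i) * (norm u)^2 = (sqrt (Re (K i i)) * norm u)^2"
  using Kii by (simp add: power_mult_distrib)
 finally show ?thesis unfolding l_def u_def
  by (rule power2_le_imp_le) (use Kii in auto)
qed

text \<open>Gram vectors are built one index at a time by Zorn's lemma. Every vector of a partial
  family vanishes outside the domain of the family, so the coordinate of a new index is still free
  and can supply whatever length the inner products with the old vectors leave undetermined.\<close>

lemma kolmogorov: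
 fixes K :: "'i => 'i => complex"
 assumes K: "psd_kernel I K"
 obtains v :: "'i => 'i ell2" where "!!i j. i \<in> I ==> j \<in> I ==> <<v i, v j>> = K i j"
proof -
 define A where "A = {G :: ('i \<times> 'i ell2) set. \<forall>(i, x)\<in>G. i \<in> I & (\<forall>(j, y)\<in>G. <<x, y>> = K i j) &
  (\<forall>k. k \<notin> Domain G --> ell2_coord x k = 0)}"
 have AD: "i \<in> I" "(j, y) \<in> G ==> <<x, y>> = K i j" "k \<notin> Domain G ==> ell2_coord x k = 0"
  if "G \<in> A" "(i, x) \<in> G" for G i j x y k using that unfolding A_def by blast+
 have "\<exists>M\<in>A. \<forall>X\<in>A. M <= X --> X = M"
 proof (rule subset_Zorn_nonempty)
  show "A ~= {}" unfolding A_def by blast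
  fix \<C> assume C: "\<C> ~= {}" "subset.chain A \<C>"
  have "i \<in> I & (\<forall>(j, y)\<in>\<Union>\<C>. <<x, y>> = K i j) & (\<forall>k. k \<notin> Domain (\<Union>\<C>) --> ell2_coord x k = 0)"
   if ix: "(i, x) \<in> \<Union>\<C>" for i x
  proof -
   obtain X where X: "(i, x) \<in> X" "X \<in> \<C>" using ix by blast
   have XA: "X \<in> A" using C X by (auto simp: subset_chain_def)
   have "<<x, y>> = K i j" if "(j, y) \<in> Y" "Y \<in> \<C>" for j y Y
   proof -
    have "X <= Y \<or> Y <= X" "Y \<in> A" using C X that by (auto simp: subset_chain_def)
    thus ?thesis using X that XA AD(2) by blast
   qed
   moreover have "ell2_coord x k = 0" if "k \<notin> Domain (\<Union>\<C>)" for k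
    using AD(3)[OF XA X(1)] that X(2) by blast
   ultimately show ?thesis using AD(1)[OF XA X(1)] by blast
  qed
  thus "\<Union>\<C> \<in> A" unfolding A_def by blast
 qed
 then obtain G where G: "G \<in> A" and max: "!!X. X \<in> A ==> G <= X ==> X = G" by auto
 define v where "v i = (SOME x. (i, x) \<in> G)" for i
 have v: "(i, v i) \<in> G" if "i \<in> Domain G" for i
  using that unfolding v_def by (meson DomainE someI_ex)
 have DI: "Domain G <= I" using AD(1)[OF G] by blast
 have "I <= Domain G"
 proof (rule ccontr)
  assume "\<not> I <= Domain G"
  then obtain i where i: "i \<in> I" "i \<notin> Domain G" by blast
  let ?J = "Domain G" and ?N = "sqrt (Re (K i i))"
  have Kii: "0 <= Re (K i i)" by (rule psd_kernel_diag[OF K i(1)])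
  have vv: "<<v j, v k>> = K j k" if "j \<in> ?J" "k \<in> ?J" for j k
   using AD(2)[OF G v v] that by blast
  have "\<exists>z. (\<forall>j\<in>?J. <<v j, z>> = K j i) & norm z <= ?N & z \<in> closure (cspan (v ` ?J))"
   using psd_kernel_bound[OF K vv DI i] Kii by (intro riesz_family) auto
  then obtain z where z: "!!j. j \<in> ?J ==> <<v j, z>> = K j i" "norm z <= ?N" "z \<in> closure (cspan (v ` ?J))"
   by blast
  have zc: "ell2_coord z k = 0" if "k \<notin> ?J" for k
   using orth_closure_cspan[OF z(3), of "ebasis k"] AD(3)[OF G v that] by (auto simp: cinner_ebasis)
  \<comment> \<open>\<open>z\<close> has the right inner products with the old vectors but may be
    too short; the fresh coordinate makes up the difference.\<close>
  define s where "s = sqrt (Re (K i i) - (norm z)^2)"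
  have "(norm z)^2 <= ?N^2" using z(2) by (intro power_mono) auto
  hence s: "s^2 = Re (K i i) - (norm z)^2" using Kii unfolding s_def by simp
  define w where "w = z + complex_of_real s *C ebasis i"
  have orth: "<<x, ebasis i>> = 0" if "(j, x) \<in> G" for j x
   using AD(3)[OF G that i(2)] orth_commute by (metis cinner_ebasis)
  have zi: "<<z, ebasis i>> = 0" "<<ebasis i, z>> = 0"
   using zc[OF i(2)] orth_commute by (metis cinner_ebasis)+
  have xw: "<<x, w>> = K j i" if "(j, x) \<in> G" for j x
  proof -
   have j: "j \<in> ?J" using that by blast
   \<comment> \<open>The graph is single-valued: two vectors at one index have a difference of norm
     zero.\<close>
   have "x = v j"
   proof -
    have "<<x - v j, x - v j>> = 0"
     using AD(2)[OF G that that] AD(2)[OF G that v[OF j]] AD(2)[OF G v[OF j] that] vv[OF j j]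
     by (simp add: cinner_simps)
    thus ?thesis by (simp add: cinner_self)
   qed
   thus ?thesis using z(1)[OF j] orth[OF that] by (simp add: w_def cinner_simps)
  qed
  have ww: "<<w, w>> = K i i"
  proof -
   have "<<w, w>> = complex_of_real ((norm z)^2 + s^2)"
    by (simp add: w_def cinner_simps zi cinner_ebasis[of i "ebasis i"] coord_ebasis)
     (simp add: cinner_self power2_eq_square)
   also have "... = complex_of_real (Re (K i i))" using s by simp
   also have "... = K i i"
   proof -
    have "K i i = cnj (K i i)" using K i(1) unfolding psd_kernel_def by blast
    hence "Im (K i i) = 0" by (metis Reals_cnj_iff complex_is_Real_iff)
    thus ?thesis by (simp add: complex_eq_iff)
   qed
   finally show ?thesis .
  qed
  have wx: "<<w, x>> = K i j" if "(j, x) \<in> G" for j x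
  proof -
   have "K i j = cnj (K j i)" using K i(1) AD(1)[OF G that] unfolding psd_kernel_def by blast
   thus ?thesis using xw[OF that] by (metis cinner_commute)
  qed
  have wc: "ell2_coord w k = 0" if "k \<notin> insert i ?J" for k
  proof -
   have "ell2_coord w k = <<ebasis k, w>>" by (simp add: cinner_ebasis)
   also have "... = 0" using zc[of k] that by (simp add: w_def cinner_simps cinner_ebasis coord_ebasis)
   finally show ?thesis .
  qed
  have "insert (i, w) G \<in> A"
   unfolding A_def using AD[OF G] xw ww wx wc i(1) by auto
  hence "insert (i, w) G = G" using max[of "insert (i, w) G"] by blast
  thus False using i by blast
 qed
 thus ?thesis using AD(2)[OF G v v] that by blast
qed

section \<open>Completely positive contractions\<close>

lemma cinner_sum_sum': "<<\<Sum>i\<in>F. f i, \<Sum>j\<in>G. g j>> = (\<Sum>i\<in>F. \<Sum>j\<in>G. <<f i, g j>>)"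
 unfolding cinner_sum_left by (simp add: cinner_sum_right)

lemma comp_id [simp]: "T oo \<one> = T" "\<one> oo T = T"
 by (auto intro: blinfun_eqI)

lemma apply_minus [simp]: "T $ (- x) = - (T $ x)"
 by (simp add: blinfun.minus_right)

text \<open>Polarization, by expanding the form at \<open>x + y\<close> and at
  \<open>x + \<i> *C y\<close>.\<close>

lemma quad_zero:
 fixes T :: "'a::chilbert_space op"
 assumes T: "clin T" and q: "!!x. <<x, T $ x>> = 0"
 shows "T = 0"
proof (rule blinfun_eqI, rule cinner_eqI)
 fix x y
 have 1: "<<x, T $ y>> + <<y, T $ x>> = 0"
  using q[of "x + y"] q[of x] q[of y] by (simp add: blinfun.add_right cinner_simps add.commute)
 have "\<i> * <<x, T $ y>> - \<i> * <<y, T $ x>> = 0"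
  using q[of "x + \<i> *C y"] q[of x] q[of y]
  by (simp add: blinfun.add_right cinner_simps clin_scaleC[OF T])
 hence "<<x, T $ y>> = <<y, T $ x>>" by (simp flip: right_diff_distrib)
 hence "<<y, T $ x>> = 0" using 1 by simp
 thus "<<y, T $ x>> = <<y, 0 $ x>>" by simp
qed

lemma quad_eq:
 fixes S T :: "'a::chilbert_space op"
 assumes "clin S" "clin T" "!!x. <<x, S $ x>> = <<x, T $ x>>"
 shows "S = T"
 using quad_zero[of "S - T"] assms by (simp add: cinner_simps)

text \<open>A condition on the real part only, hence accretivity: every skew-adjoint operator
  satisfies it. For selfadjoint operators it is positivity.\<close>

definition opos :: "'a::chilbert_space op => bool" where
 "opos T \<longleftrightarrow> (\<forall>x. 0 <= Re <<x, T $ x>>)"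

lemma herm_eqI:
 fixes S T :: "'a::chilbert_space op"
 assumes "clin S" "clin T" "hadj S = S" "hadj T = T" "opos (S - T)" "opos (T - S)"
 shows "S = T"
proof (rule quad_eq)
 fix x
 have "Re <<x, S $ x>> = Re <<x, T $ x>>"
  using assms(5,6)[unfolded opos_def, rule_format, of x] by (simp add: cinner_simps)
 moreover have "Im <<x, R $ x>> = 0" if "clin R" "hadj R = R" for R
 proof -
  have "<<x, R $ x>> = cnj <<x, R $ x>>"
   using hadj_left[OF that(1), of x x] that(2) by (metis cinner_commute)
  thus ?thesis by (metis Reals_cnj_iff complex_is_Real_iff)
 qed
 ultimately show "<<x, S $ x>> = <<x, T $ x>>" using assms by (simp add: complex_eq_iff)
qed (use assms in auto)

definition mform :: "'i set => ('i => 'i => 'a::chilbert_space op) => ('i => 'a) => complex" where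
 "mform I C xi = (\<Sum>i\<in>I. \<Sum>j\<in>I. <<xi i, C i j $ xi j>>)"

text \<open>Positivity is required only of real parts.  For a complex-linear map on a selfadjoint space,
  preserving such accretive matrices amounts to complete positivity and includes compatibility
  with adjoints.\<close>

definition acc :: "'i set => ('i => 'i => 'a::chilbert_space op) => bool" where
 "acc I C \<longleftrightarrow> (\<forall>xi. 0 <= Re (mform I C xi))"

text \<open>Completely positive contractions. The last clause says that the image of the unit is at
  most the unit, from which contractivity follows in \<open>cpc_norm\<close>. Preservation of the
  unit would be too much to ask, since the C*-algebras may act degenerately.\<close>

definition cpc :: "('a::chilbert_space op => 'b::chilbert_space op) => bool" where
 "cpc phi \<longleftrightarrow> (\<forall>T. clin T --> clin (phi T)) & clinear_on cops phi &
   (\<forall>n C. (\<forall>i<n. \<forall>j<n. clin (C i j)) & acc {..<n::nat} C --> acc {..<n} (%i j. phi (C i j))) &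
   (\<forall>x. Re <<x, phi \<one> $ x>> <= (norm x)^2)"

lemma mform_reindex:
 "bij_betw h J I ==> mform I C xi = mform J (%i j. C (h i) (h j)) (%i. xi (h i))"
 unfolding mform_def by (subst sum.reindex_bij_betw[symmetric], assumption)+ simp

lemma mform_cong: "(!!i. i \<in> I ==> xi i = xi' i) ==> mform I C xi = mform I C xi'"
 unfolding mform_def by (intro sum.cong) auto

lemma acc_reindex:
 assumes h: "bij_betw h J I"
 shows "acc I C \<longleftrightarrow> acc J (%i j. C (h i) (h j))"
proof
 assume a: "acc J (%i j. C (h i) (h j))"
 show "acc I C" unfolding acc_def
  using a unfolding acc_def by (subst mform_reindex[OF h]) blast
next
 assume a: "acc I C"
 show "acc J (%i j. C (h i) (h j))" unfolding acc_def
 proof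
  fix xi
  have "mform J (%i j. C (h i) (h j)) xi = mform I C (%i. xi (inv_into J h i))"
   unfolding mform_reindex[OF h]
   by (rule mform_cong) (use h in \<open>simp add: bij_betw_inv_into_left\<close>)
  thus "0 <= Re (mform J (%i j. C (h i) (h j)) xi)" using a by (simp add: acc_def)
 qed
qed

context
 fixes phi :: "'a::chilbert_space op => 'b::chilbert_space op"
 assumes phi: "cpc phi"
begin

lemma cpc_clin [simp]: "clin T ==> clin (phi T)"
 using phi by (simp add: cpc_def)

lemma cpc_add: "clin S ==> clin T ==> phi (S + T) = phi S + phi T"
 using phi by (simp add: cpc_def clinear_on_def cops_iff)

lemma cpc_scale: "clin T ==> phi (c *C T) = c *C phi T"
 using phi by (simp add: cpc_def clinear_on_def cops_iff)

lemma cpc_zero: "phi 0 = 0"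
 using cpc_scale[of 0 0] by simp

lemma cpc_minus: "clin T ==> phi (- T) = - phi T"
 using cpc_scale[of T "-1"] by simp

lemma cpc_diff: "clin S ==> clin T ==> phi (S - T) = phi S - phi T"
 using cpc_add[of S "- T"] cpc_minus[of T] by simp

lemma cpc_sum: "(!!i. i \<in> F ==> clin (T i)) ==> phi (\<Sum>i\<in>F. T i) = (\<Sum>i\<in>F. phi (T i))"
 by (induction F rule: infinite_finite_induct) (auto simp: cpc_zero cpc_add)

text \<open>Passes from the index sets \<open>{..<n}\<close> to arbitrary finite ones; sums and
  options of index sets occur below.\<close>

lemma cpc_acc:
 assumes "finite I" "!!i j. i \<in> I ==> j \<in> I ==> clin (C i j)" "acc I C"
 shows "acc I (%i j. phi (C i j))"
proof -
 obtain h where h: "bij_betw h {..<card I} I"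
  using ex_bij_betw_nat_finite[OF assms(1)] by (auto simp: atLeast0LessThan)
 have hI: "h i \<in> I" if "i < card I" for i using h that by (auto simp: bij_betw_def)
 have "acc {..<card I} (%i j. C (h i) (h j))" using assms(3) acc_reindex[OF h, of C] by simp
 hence "acc {..<card I} (%i j. phi (C (h i) (h j)))"
  using phi[unfolded cpc_def, THEN conjunct2, THEN conjunct2, THEN conjunct1, rule_format,
    of "card I" "%i j. C (h i) (h j)"] assms(2) hI by blast
 thus ?thesis using acc_reindex[OF h, of "%i j. phi (C i j)"] by simp
qed

lemma cpc_opos:
 assumes "clin T" "opos T" shows "opos (phi T)"
proof -
 have "acc {()} (%_ _. phi T)"
  using assms by (intro cpc_acc) (auto simp: acc_def mform_def opos_def)
 hence "0 <= Re (mform {()} (%_ _. phi T) (%_. x))" for x unfolding acc_def by blast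
 thus ?thesis by (simp add: opos_def mform_def)
qed

lemma cpc_mono: "clin S ==> clin T ==> opos (T - S) ==> opos (phi T - phi S)"
 using cpc_opos[of "T - S"] by (simp add: cpc_diff)

lemma cpc_id: "Re <<x, phi \<one> $ x>> <= (norm x)^2"
 using phi by (simp add: cpc_def)

text \<open>A skew-adjoint \<open>K\<close> and its negative are both accretive, so the form of
  \<open>phi K\<close> has zero real part. For \<open>K = T - hadj T\<close> this compares real
  parts, for \<open>K = \<i> *C (T + hadj T)\<close> imaginary parts.\<close>

lemma cpc_hadj:
 assumes T: "clin T" shows "phi (hadj T) = hadj (phi T)"
proof -
 have skew: "Re <<x, phi K $ x>> = 0" if K: "clin K" "hadj K = - K" for K x
 proof -
  have "Re <<y, K $ y>> = 0" for y
   using arg_cong[OF hadj_left[OF K(1), of y y], of Re] Re_cinner_commute[of "K $ y" y] K(2) by simp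
  hence "opos K" "opos (- K)" by (auto simp: opos_def)
  hence "opos (phi K)" "opos (- phi K)" using cpc_opos[of K] cpc_opos[of "- K"] K by (auto simp: cpc_minus)
  thus ?thesis unfolding opos_def by (metis add.inverse_inverse blinfun_simps(3) cinner_minus_right
     le_minus_iff neg_0_le_iff_le order_antisym uminus_complex.sel(1))
 qed
 have 1: "Re <<x, phi (T - hadj T) $ x>> = 0" for x using T by (intro skew) auto
 have 2: "Re <<x, phi (\<i> *C (T + hadj T)) $ x>> = 0" for x
  using T by (intro skew) (auto simp: scaleC_add_right)
 show ?thesis
 proof (rule quad_eq)
  fix x
  have "Re <<x, phi T $ x>> = Re <<x, phi (hadj T) $ x>>"
   using 1[of x] T by (simp add: cpc_diff cinner_simps)
  moreover have "Im <<x, phi T $ x>> = - Im <<x, phi (hadj T) $ x>>"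
   using 2[of x] T by (simp add: cpc_scale cpc_add cinner_simps)
  ultimately have "<<x, phi (hadj T) $ x>> = cnj <<x, phi T $ x>>" by (simp add: complex_eq_iff)
  thus "<<x, phi (hadj T) $ x>> = <<x, hadj (phi T) $ x>>"
   using T by (metis cinner_commute cpc_clin hadj_right)
 qed (use T in auto)
qed

text \<open>The Gram matrix of the unit and the \<open>a i\<close> is positive, and so is its image.
  Testing the image with a suitable vector in the slot of the unit, labelled \<open>None\<close>,
  leaves the Schwarz matrix, because \<open>phi \<one>\<close> is at most the unit.\<close>

lemma cpc_schwarz_mat:
 assumes I: "finite I" and a: "!!i. i \<in> I ==> clin (a i)"
 shows "acc I (%i j. phi (hadj (a i) oo a j) - (hadj (phi (a i)) oo phi (a j)))"
 unfolding acc_def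
proof
 fix xi
 define b where "b p = (case p of None => \<one> | Some i => a i)" for p
 define I' where "I' = insert None (Some ` I)"
 have b: "clin (b p)" if "p \<in> I'" for p using that a by (auto simp: b_def I'_def)
 have I': "finite I'" using I by (simp add: I'_def)
 have s: "(\<Sum>p\<in>I'. f p) = f None + (\<Sum>i\<in>I. f (Some i))" for f :: "_ => complex"
  unfolding I'_def using I by (subst sum.insert) (auto simp: sum.reindex)
 have "acc I' (%p q. hadj (b p) oo b q)"
  unfolding acc_def
 proof
  fix \<zeta>
  have "mform I' (%p q. hadj (b p) oo b q) \<zeta> = <<\<Sum>p\<in>I'. b p $ \<zeta> p, \<Sum>p\<in>I'. b p $ \<zeta> p>>"
   unfolding mform_def cinner_sum_sum'
   by (intro sum.cong refl) (simp add: hadj_right b)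
  thus "0 <= Re (mform I' (%p q. hadj (b p) oo b q) \<zeta>)" by (simp add: cinner_self)
 qed
 hence acc': "acc I' (%p q. phi (hadj (b p) oo b q))" using b I' by (intro cpc_acc) auto
 define u where "u = (\<Sum>j\<in>I. phi (a j) $ xi j)"
 \<comment> \<open>The slot of the unit receives \<open>- u\<close>, which completes the
   square.\<close>
 define \<zeta> where "\<zeta> p = (case p of None => - u | Some i => xi i)" for p
 have uu: "(\<Sum>j\<in>I. <<u, phi (a j) $ xi j>>) = <<u, u>>" by (simp add: u_def cinner_sum_right)
 have uu': "(\<Sum>i\<in>I. <<phi (a i) $ xi i, u>>) = <<u, u>>" by (simp add: u_def cinner_sum_left)
 have "0 <= Re (mform I' (%p q. phi (hadj (b p) oo b q)) \<zeta>)" using acc' by (simp add: acc_def)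
 also have "mform I' (%p q. phi (hadj (b p) oo b q)) \<zeta>
   = <<u, phi \<one> $ u>> - <<u, u>> + (- <<u, u>> + mform I (%i j. phi (hadj (a i) oo a j)) xi)"
 proof -
  have "(\<Sum>i\<in>I. <<xi i, phi (hadj (a i)) $ u>>) = <<u, u>>"
   unfolding uu'[symmetric] by (intro sum.cong refl) (simp add: a cpc_hadj hadj_right)
  thus ?thesis
   unfolding mform_def s \<zeta>_def b_def by (simp add: uu sum.distrib sum_negf sum_subtractf)
 qed
 also have "mform I (%i j. phi (hadj (a i) oo a j)) xi
  = mform I (%i j. phi (hadj (a i) oo a j) - (hadj (phi (a i)) oo phi (a j))) xi + <<u, u>>"
 proof -
  have "(\<Sum>i\<in>I. \<Sum>j\<in>I. <<xi i, (hadj (phi (a i)) oo phi (a j)) $ xi j>>) = <<u, u>>"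
   unfolding u_def cinner_sum_sum'
   by (intro sum.cong refl) (simp add: hadj_right a)
  thus ?thesis by (simp add: mform_def cinner_simps sum_subtractf)
 qed
 finally show "0 <= Re (mform I (%i j. phi (hadj (a i) oo a j) - (hadj (phi (a i)) oo phi (a j))) xi)"
  using cpc_id[of u] by (simp add: cinner_self)
qed

lemma cpc_schwarz:
 assumes T: "clin T"
 shows "opos (phi (hadj T oo T) - (hadj (phi T) oo phi T))"
  and "(norm (phi T $ x))^2 <= Re <<x, phi (hadj T oo T) $ x>>"
proof -
 have "acc {()} (%i j. phi (hadj T oo T) - (hadj (phi T) oo phi T))"
  using T by (intro cpc_schwarz_mat[of _ "%_. T"]) auto
 hence *: "0 <= Re (mform {()} (%i j. phi (hadj T oo T) - (hadj (phi T) oo phi T)) (%_. x))" for x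
  unfolding acc_def by blast
 thus 1: "opos (phi (hadj T oo T) - (hadj (phi T) oo phi T))" by (simp add: opos_def mform_def)
 show "(norm (phi T $ x))^2 <= Re <<x, phi (hadj T oo T) $ x>>"
  using 1[unfolded opos_def, rule_format, of x] T by (simp add: cinner_simps hadj_right cinner_self)
qed

text \<open>The operator \<open>hadj T oo T\<close> is at most \<open>(norm T)^2\<close> times the
  unit; apply \<open>phi\<close> and the Schwarz inequality.\<close>

lemma cpc_norm:
 assumes T: "clin T" shows "norm (phi T) <= norm T"
proof (rule norm_blinfun_bound)
 fix x
 have "opos ((complex_of_real ((norm T)^2) *C \<one>) - (hadj T oo T))"
  unfolding opos_def
 proof
  fix y
  have "(norm (T $ y))^2 <= (norm T * norm y)^2" by (intro power_mono norm_blinfun) auto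
  thus "0 <= Re <<y, ((complex_of_real ((norm T)^2) *C \<one>) - (hadj T oo T)) $ y>>"
   using T by (simp add: cinner_simps hadj_right cinner_self power_mult_distrib flip: of_real_power of_real_mult)
 qed
 hence "opos (phi (complex_of_real ((norm T)^2) *C \<one>) - phi (hadj T oo T))"
  using T by (intro cpc_mono) auto
 from this[unfolded opos_def, rule_format, of x]
 have "Re <<x, phi (hadj T oo T) $ x>> <= (norm T)^2 * Re <<x, phi \<one> $ x>>"
  by (simp add: cpc_scale cinner_simps flip: of_real_power)
 also have "... <= (norm T)^2 * (norm x)^2" by (intro mult_left_mono cpc_id) auto
 finally have "(norm (phi T $ x))^2 <= (norm T * norm x)^2"
  using cpc_schwarz(2)[OF T, of x] by (simp add: power_mult_distrib)
 thus "norm (phi T $ x) <= norm T * norm x" by (rule power2_le_imp_le) simp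
qed simp

lemma cpc_tendsto:
 assumes "(f ~~> T) F" "!!x. clin (f x)" "clin T"
 shows "((%x. phi (f x)) ~~> phi T) F"
proof (rule tendsto_norm_zero_cancel[THEN LIM_zero_cancel])
 show "((%x. norm (phi (f x) - phi T)) ~~> 0) F"
 proof (rule Lim_null_comparison)
  show "\<forall>\<^sub>F x in F. norm (norm (phi (f x) - phi T)) <= norm (f x - T)"
   using assms cpc_norm[of "f _ - T"] by (simp add: cpc_diff)
  show "((%x. norm (f x - T)) ~~> 0) F" using assms(1) by (simp add: tendsto_norm_zero LIM_zero)
 qed
qed

end

text \<open>A positive block matrix with a zero on the diagonal has zeros beside it: scaling
  \<open>y\<close> changes the off-diagonal term but not the term of \<open>p\<close>.\<close>

lemma cpc_acc_zero_corner:
 fixes q :: "'a::chilbert_space op"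
 assumes acc: "acc (UNIV :: bool set) (%i j. if i then (if j then z else hadj q) else (if j then q else p))"
  and q: "clin q" and z: "!!x. Re <<x, z $ x>> = 0"
 shows "q = 0"
proof -
 have main: "0 <= Re <<x, p $ x>> + 2 * Re <<x, q $ y>>" for x y
 proof -
  have "0 <= Re (mform UNIV (%i j. if i then (if j then z else hadj q) else (if j then q else p))
    (%i. if i then y else x))"
   using acc unfolding acc_def by blast
  thus ?thesis
   using z[of y] Re_cinner_commute[of "q $ y" x] by (simp add: mform_def UNIV_bool hadj_right q)
 qed
 have "Re <<x, q $ y>> = 0" for x y
 proof (rule ccontr)
  assume nz: "Re <<x, q $ y>> ~= 0"
  \<comment> \<open>Chosen so that the form takes the value \<open>-1\<close>.\<close>
  define t where "t = - (Re <<x, p $ x>> + 1) / (2 * Re <<x, q $ y>>)"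
  have "0 <= Re <<x, p $ x>> + 2 * Re <<x, q $ (complex_of_real t *C y)>>" by (rule main)
  also have "... = Re <<x, p $ x>> + t * (2 * Re <<x, q $ y>>)" by (simp add: clin_scaleC q cinner_simps)
  also have "... = -1" using nz by (simp add: t_def)
  finally show False by simp
 qed
 hence "(norm (q $ y))^2 = 0" for y using Re_cinner_self[of "q $ y"] by metis
 thus ?thesis by (intro blinfun_eqI) simp
qed

lemma cpc_comp:
 assumes "cpc phi" "cpc psi" shows "cpc (%T. psi (phi T))"
 unfolding cpc_def
proof (intro conjI allI impI)
 show "clinear_on cops (%T. psi (phi T))"
  using assms by (auto simp: clinear_on_def cops_iff cpc_add cpc_scale)
 show "acc {..<n} (%i j. psi (phi (C i j)))"
  if "(\<forall>i<n. \<forall>j<n. clin (C i j)) & acc {..<n::nat} C" for n C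
  using that assms by (intro cpc_acc[OF assms(2)] cpc_acc[OF assms(1)]) auto
 show "Re <<x, psi (phi \<one>) $ x>> <= (norm x)^2" for x
 proof -
  have "opos (\<one> - phi \<one>)"
   using cpc_id[OF assms(1)] by (simp add: opos_def cinner_simps Re_cinner_self)
  hence "opos (psi \<one> - psi (phi \<one>))" 
   by (intro cpc_mono[OF assms(2)] cpc_clin[OF assms(1)]) auto
  hence "0 <= Re <<x, (psi \<one> - psi (phi \<one>)) $ x>>" by (simp add: opos_def)
  thus ?thesis using cpc_id[OF assms(2), of x] by (simp add: cinner_simps)
 qed
qed (use assms in auto)

definition sand :: "('a::chilbert_space \<Rightarrow>\<^sub>L 'b::chilbert_space) => 'b op => 'a op" where
 "sand V T = hadj V oo T oo V"

lemma cinner_sand: "clin V ==> <<x, sand V T $ y>> = <<V $ x, T $ (V $ y)>>"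
 by (simp add: sand_def hadj_right)

lemma norm_apply_le: "norm T <= 1 ==> norm (T $ x) <= norm x"
 using norm_blinfun[of T x] mult_right_mono[of "norm T" 1 "norm x"] by simp

lemma cpc_sand:
 assumes V: "clin V" "norm V <= 1" shows "cpc (sand V)"
 unfolding cpc_def
proof (intro conjI allI impI)
 show "clin (sand V T)" if "clin T" for T using that V by (auto simp: sand_def)
 show "clinear_on cops (sand V)"
  unfolding clinear_on_def using V
  by (auto simp: cops_iff sand_def clin_scaleC blinfun.add_right intro!: blinfun_eqI)
 show "acc {..<n} (%i j. sand V (C i j))"
  if "(\<forall>i<n. \<forall>j<n. clin (C i j)) & acc {..<n::nat} C" for n C
  unfolding acc_def
 proof
  fix xi
  have "0 <= Re (mform {..<n} C (%i. V $ xi i))" using that by (simp add: acc_def)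
  thus "0 <= Re (mform {..<n} (%i j. sand V (C i j)) xi)"
   by (simp add: mform_def cinner_sand V)
 qed
 show "Re <<x, sand V \<one> $ x>> <= (norm x)^2" for x
  using norm_apply_le[OF V(2), of x] by (simp add: cinner_sand V Re_cinner_self)
qed

subsection \<open>Operators and completely positive maps from kernels\<close>

text \<open>The orthogonal projection of \<open>x\<close> to the closed span, obtained as the vector
  representing the family \<open><<v i, x>>\<close>.\<close>

lemma proj_ex:
 fixes v :: "'i => 'a::chilbert_space"
 shows "\<exists>z. z \<in> closure (cspan (v ` I)) & (\<forall>i\<in>I. <<v i, x - z>> = 0) & norm z <= norm x"
proof -
 have "cmod (\<Sum>i\<in>F. cnj (c i) * <<v i, x>>) <= norm x * norm (\<Sum>i\<in>F. c i *C v i)" for F c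
  using cauchy_schwarz[of "\<Sum>i\<in>F. c i *C v i" x]
  by (simp add: cinner_sum_left cinner_simps mult.commute)
 hence "\<exists>z. (\<forall>i\<in>I. <<v i, z>> = <<v i, x>>) & norm z <= norm x & z \<in> closure (cspan (v ` I))"
  by (intro riesz_family) auto
 thus ?thesis by (auto simp: cinner_simps)
qed

text \<open>The vanishing assumptions confine both operators and their adjoints to the closed span
  of the \<open>v i\<close>, where matrix coefficients determine an operator.\<close>

lemma op_eqI_family:
 fixes v :: "'i => 'a::chilbert_space" and S T :: "'a op"
 assumes "clin S" "clin T" "!!i j. i \<in> I ==> j \<in> I ==> <<v i, S $ v j>> = <<v i, T $ v j>>"
  and "!!x. (!!i. i \<in> I ==> <<v i, x>> = 0) ==> S $ x = 0 & hadj S $ x = 0"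
  and "!!x. (!!i. i \<in> I ==> <<v i, x>> = 0) ==> T $ x = 0 & hadj T $ x = 0"
 shows "S = T"
proof -
 define D where "D = S - T"
 have D: "clin D" using assms by (simp add: D_def)
 have D0: "<<v i, D $ v j>> = 0" if "i \<in> I" "j \<in> I" for i j
  using assms(3)[OF that] by (simp add: D_def cinner_simps)
 have Dx: "D $ x = 0" "hadj D $ x = 0" if "!!i. i \<in> I ==> <<v i, x>> = 0" for x
  using assms(4,5)[OF that] assms(1,2) by (auto simp: D_def)
 have Dv: "D $ v j = 0" if j: "j \<in> I" for j
 proof (rule cinner_eqI)
  fix y
  obtain z where z: "z \<in> closure (cspan (v ` I))" "!!i. i \<in> I ==> <<v i, y - z>> = 0"
   using proj_ex[of v I y] by blast
  have "<<D $ v j, z>> = 0"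
   by (rule orth_closure_cspan[OF z(1)]) (metis D0 j imageE orth_commute)
  hence "<<z, D $ v j>> = 0" using orth_commute by blast
  moreover have "<<y - z, D $ v j>> = 0"
   using Dx(2)[OF z(2)] hadj_left[OF D, of "y - z" "v j"] by simp
  ultimately show "<<y, D $ v j>> = <<y, 0>>" by (simp add: cinner_simps)
 qed
 have "D $ x = 0" for x
 proof -
  obtain z where z: "z \<in> closure (cspan (v ` I))" "!!i. i \<in> I ==> <<v i, x - z>> = 0"
   using proj_ex[of v I x] by blast
  have "D $ z = 0"
  proof (rule closure_cspan_induct[OF z(1)])
   show "closed {x. D $ x = 0}"
    by (intro closed_Collect_eq continuous_intros)
   show "csubspace {x. D $ x = 0}" by (simp add: csubspace_def blinfun.add_right clin_scaleC[OF D])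
  qed (use Dv in auto)
  thus ?thesis using Dx(1)[OF z(2)] by (simp add: blinfun.diff_right)
 qed
 hence "D = 0" by (intro blinfun_eqI) simp
 thus ?thesis by (simp add: D_def)
qed

text \<open>A bounded sesquilinear form given on generators only. The Riesz argument produces the
  column \<open>z j\<close> for each \<open>j\<close>, and \<open>family_op\<close> assembles the
  columns to an operator supported on the closed span.\<close>

lemma form_operator:
 fixes v :: "'i => 'a::chilbert_space"
 assumes bound: "!!F G c d. finite F ==> F <= I ==> finite G ==> G <= I ==>
   cmod (\<Sum>i\<in>F. \<Sum>j\<in>G. cnj (c i) * d j * k i j)
    <= M * norm (\<Sum>i\<in>F. c i *C v i) * norm (\<Sum>j\<in>G. d j *C v j)"
  and M: "0 <= M"
 shows "\<exists>T. clin T & (\<forall>i\<in>I. \<forall>j\<in>I. <<v i, T $ v j>> = k i j) & norm T <= M &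
  (\<forall>x. (\<forall>i\<in>I. <<v i, x>> = 0) --> T $ x = 0 & hadj T $ x = 0)"
proof -
 have "\<exists>z. (\<forall>i\<in>I. <<v i, z>> = k i j) & norm z <= M * norm (v j) & z \<in> closure (cspan (v ` I))"
  if j: "j \<in> I" for j
 proof (rule riesz_family)
  show "cmod (\<Sum>i\<in>F. cnj (c i) * k i j) <= (M * norm (v j)) * norm (\<Sum>i\<in>F. c i *C v i)"
   if "finite F" "F <= I" for F c
   using bound[OF that, of "{j}" c "%_. 1"] j by (simp add: ac_simps)
 qed (use M in simp)
 then obtain z where z: "!!i j. i \<in> I ==> j \<in> I ==> <<v i, z j>> = k i j"
  "!!j. j \<in> I ==> z j \<in> closure (cspan (v ` I))"
  by metis
 have zb: "norm (\<Sum>j\<in>G. d j *C z j) <= M * norm (\<Sum>j\<in>G. d j *C v j)" if G: "finite G" "G <= I" for G d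
 proof -
  define y where "y = (\<Sum>j\<in>G. d j *C z j)"
  define N where "N = M * norm (\<Sum>j\<in>G. d j *C v j)"
  have 1: "cmod <<x, y>> <= N * norm x" if "x \<in> cspan (v ` I)" for x
  proof -
   obtain F c where F: "finite F" "F <= I" and x: "x = (\<Sum>i\<in>F. c i *C v i)"
    using \<open>x \<in> cspan (v ` I)\<close> unfolding cspan_eq by auto
   have "<<x, y>> = (\<Sum>i\<in>F. \<Sum>j\<in>G. cnj (c i) * d j * k i j)"
    unfolding x y_def cinner_sum_sum using z F G by (intro sum.cong refl) (auto simp: subset_iff)
   thus ?thesis using bound[OF F G, of c d] by (simp add: x N_def ac_simps)
  qed
  have "y \<in> closure (cspan (v ` I))"
   unfolding y_def using z G
   by (auto intro!: csubspace_sum csubspaceD(3) csubspace_closure csubspace_cspan)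
  then obtain f where f: "!!n. f n \<in> cspan (v ` I)" "f ---> y" by (auto simp: closure_sequential)
  have "cmod <<y, y>> <= N * norm y"
  proof (rule LIMSEQ_le)
   show "(%n. cmod <<f n, y>>) ---> cmod <<y, y>>" "(%n. N * norm (f n)) ---> N * norm y"
    by (intro tendsto_intros f)+
  qed (use 1 f in auto)
  hence "norm y * norm y <= N * norm y" by (simp add: cinner_self power2_eq_square norm_mult)
  moreover have "0 <= N" using M by (simp add: N_def)
  ultimately show ?thesis unfolding y_def[symmetric] N_def[symmetric]
   by (cases "y = 0") (auto simp: mult_le_cancel_right)
 qed
 obtain T where T: "clin T" "!!i. i \<in> I ==> T $ v i = z i" "norm T <= M"
  "!!x. (!!i. i \<in> I ==> <<v i, x>> = 0) ==> T $ x = 0"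
  "!!x y. (!!i. i \<in> I ==> <<z i, y>> = 0) ==> <<y, T $ x>> = 0"
  using family_op[OF zb M] by blast
 have "hadj T $ y = 0" if y: "\<forall>i\<in>I. <<v i, y>> = 0" for y
 proof (rule cinner_eqI_left)
  fix x
  have "<<z i, y>> = 0" if "i \<in> I" for i
   using orth_closure_cspan[OF z(2)[OF that], of y] y by (metis imageE orth_commute)
  thus "<<hadj T $ y, x>> = <<0, x>>" using T(5) by (simp add: hadj_left T(1))
 qed
 thus ?thesis using T z by (intro exI[of _ T]) auto
qed

text \<open>The hypothesis optimized over \<open>r\<close>: the best value is \<open>W / U\<close>,
  and in the degenerate cases \<open>r\<close> is taken large enough (\<open>U = 0\<close>) or small
  enough (\<open>W = 0\<close>).\<close>

lemma le_of_quadratic: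
 fixes b N U W :: real
 assumes "!!r. 0 < r ==> 2 * r * b <= N * (r^2 * U^2 + W^2)" "0 <= N" "0 <= U" "0 <= W"
 shows "b <= N * U * W"
proof (rule ccontr)
 assume "\<not> b <= N * U * W"
 hence b: "N * U * W < b" by simp
 have b0: "0 < b" using b assms by (smt (verit) mult_nonneg_nonneg)
 consider "U = 0" | "W = 0" "U ~= 0" | "W ~= 0" "U ~= 0" by blast
 thus False
 proof cases
  case 1
  have "0 < (N * W^2 + 1) / b" using b0 assms by (simp add: add_nonneg_pos)
  from assms(1)[OF this] have "2 * (N * W^2 + 1) <= N * W^2" using 1 b0 by simp
  moreover have "0 <= N * W^2" using assms by simp
  ultimately show False by simp
 next
  case 2
  define r where "r = b / (N * U^2 + 1)"
  have p: "0 < N * U^2 + 1" using assms by (simp add: add_nonneg_pos)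
  have r: "0 < r" "r * (N * U^2 + 1) = b" using b0 p by (auto simp: r_def)
  have "r * (2 * b) <= r * (r * (N * U^2))"
   using assms(1)[OF r(1)] 2 by (simp add: power2_eq_square ac_simps)
  hence "2 * b <= r * (N * U^2)" using r(1) by simp
  also have "... <= b" unfolding r(2)[symmetric] using r(1) by simp
  finally show False using b0 by simp
 next
  case 3
  hence UW: "0 < U" "0 < W" using assms by auto
  have "2 * (W / U) * b <= N * ((W / U)^2 * U^2 + W^2)" using UW by (intro assms(1)) simp
  also have "... = 2 * (W / U) * (N * U * W)" using UW by (simp add: power2_eq_square)
  finally have "b <= N * U * W" using UW by (subst (asm) mult_le_cancel_left_pos) auto
  thus False using b by simp
 qed
qed

text \<open>Everything about the map is read off its coefficients
  \<open>ka T i j = <<v i, psi T $ v j>>\<close>: \<open>pos\<close> is complete positivity tested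
  at the generating vectors, with repetitions allowed, and \<open>one\<close> says that the unit
  goes to at most the unit. The boundedness of the forms, needed before any operator exists, is
  extracted from \<open>pos\<close> and \<open>one\<close> as well.\<close>

lemma kernel_cp:
 fixes ka :: "'a::chilbert_space op => 'i => 'i => complex" and v :: "'i => 'b::chilbert_space"
 assumes add: "!!S T i j. clin S ==> clin T ==> i \<in> I ==> j \<in> I ==> ka (S + T) i j = ka S i j + ka T i j"
  and scale: "!!c T i j. clin T ==> i \<in> I ==> j \<in> I ==> ka (c *C T) i j = c * ka T i j"
  and pos: "!!n C io. (!!a b. a < n ==> b < n ==> clin (C a b)) ==> acc {..<n::nat} C ==>
    (!!a. a < n ==> io a \<in> I) ==> 0 <= Re (\<Sum>a<n. \<Sum>b<n. ka (C a b) (io a) (io b))"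
  and one: "!!F c. finite F ==> F <= I ==>
    Re (\<Sum>i\<in>F. \<Sum>j\<in>F. cnj (c i) * c j * ka \<one> i j) <= (norm (\<Sum>i\<in>F. c i *C v i))^2"
 shows "\<exists>psi. cpc psi & (\<forall>T. clin T --> (\<forall>i\<in>I. \<forall>j\<in>I. <<v i, psi T $ v j>> = ka T i j) &
   (\<forall>x. (\<forall>i\<in>I. <<v i, x>> = 0) --> psi T $ x = 0 & hadj (psi T) $ x = 0))"
proof -
 have posG: "0 <= Re (\<Sum>a\<in>A. \<Sum>b\<in>A. ka (C a b) (io a) (io b))"
  if A: "finite A" "!!a b. a \<in> A ==> b \<in> A ==> clin (C a b)" "acc A C" "!!a. a \<in> A ==> io a \<in> I"
  for A :: "'z set" and C io
 proof -
  obtain h where h: "bij_betw h {..<card A} A"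
   using ex_bij_betw_nat_finite[OF A(1)] by (auto simp: atLeast0LessThan)
  have hA: "h i \<in> A" if "i < card A" for i using h that by (auto simp: bij_betw_def)
  have "0 <= Re (\<Sum>a<card A. \<Sum>b<card A. ka (C (h a) (h b)) (io (h a)) (io (h b)))"
   using A hA acc_reindex[OF h, of C] by (intro pos) auto
  also have "(\<Sum>a<card A. \<Sum>b<card A. ka (C (h a) (h b)) (io (h a)) (io (h b)))
    = (\<Sum>a\<in>A. \<Sum>b\<in>A. ka (C a b) (io a) (io b))"
   by (subst sum.reindex_bij_betw[OF h, symmetric])+ simp
  finally show ?thesis .
 qed
 have bound: "cmod (\<Sum>i\<in>F. \<Sum>j\<in>G. cnj (c i) * d j * ka T i j)
   <= norm T * norm (\<Sum>i\<in>F. c i *C v i) * norm (\<Sum>j\<in>G. d j *C v j)"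
  if F: "finite F" "F <= I" and G: "finite G" "G <= I" and T: "clin T" for F G c d T
 proof -
  define B where "B c = (\<Sum>i\<in>F. \<Sum>j\<in>G. cnj (c i) * d j * ka T i j)" for c
  define N where "N = norm T"
  define W where "W = norm (\<Sum>j\<in>G. d j *C v j)"
  have main: "2 * Re (B c) <= N * ((norm (\<Sum>i\<in>F. c i *C v i))^2 + W^2)" for c
  proof -
   \<comment> \<open>A block matrix with rank-one scalar diagonal blocks, weighted by
     \<open>N\<close>, and a multiple of \<open>T\<close> in one corner. As only the real part is
     tested, the opposite corner may be zero. It is accretive because \<open>N\<close> is the norm
     of \<open>T\<close>.\<close>
   define C where "C p q = (case p of
     Inl i => (case q of Inl i' => (of_real N * (cnj (c i) * c i')) *C \<one>
             | Inr j => (- (2 * (cnj (c i) * d j))) *C T)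
    | Inr j => (case q of Inl i => 0 | Inr j' => (of_real N * (cnj (d j) * d j')) *C \<one>))" for p q
   have sp: "(\<Sum>p\<in>F <+> G. f p) = (\<Sum>i\<in>F. f (Inl i)) + (\<Sum>j\<in>G. f (Inr j))" for f :: "_ => complex"
    using F G by (simp add: sum.Plus)
   have Cc: "clin (C p q)" for p q using T by (auto simp: C_def split: sum.splits)
   have "acc (F <+> G) C"
    unfolding acc_def
   proof
    fix xi :: "'i + 'i => 'a"
    define x where "x = (\<Sum>i\<in>F. c i *C xi (Inl i))"
    define y where "y = (\<Sum>j\<in>G. d j *C xi (Inr j))"
    have "mform (F <+> G) C xi = of_real N * <<x, x>> - 2 * <<x, T $ y>> + of_real N * <<y, y>>"
     unfolding x_def y_def clin_sum[OF T] cinner_sum_sum mform_def sp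
     by (simp add: C_def sum.distrib sum_subtractf cinner_simps sum_distrib_left sum_negf mult.assoc)
    hence "Re (mform (F <+> G) C xi) = N * (norm x)^2 - 2 * Re <<x, T $ y>> + N * (norm y)^2"
     by (simp add: Re_cinner_self)
    moreover have "Re <<x, T $ y>> <= norm x * (N * norm y)"
     using Re_cinner_le[of x "T $ y"] norm_blinfun[of T y] mult_left_mono[OF norm_blinfun[of T y], of "norm x"]
     by (simp add: N_def)
    moreover have "2 * (norm x * (N * norm y)) <= N * ((norm x)^2 + (norm y)^2)"
    proof -
     have "0 <= N * (norm x - norm y)^2" by (simp add: N_def)
     thus ?thesis by (simp add: power2_diff algebra_simps)
    qed
    ultimately show "0 <= Re (mform (F <+> G) C xi)" by (simp add: distrib_left)
   qed
   hence "0 <= Re (\<Sum>p\<in>F <+> G. \<Sum>q\<in>F <+> G. ka (C p q) (case_sum id id p) (case_sum id id q))"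
    using F G Cc by (intro posG) auto
   also have "(\<Sum>p\<in>F <+> G. \<Sum>q\<in>F <+> G. ka (C p q) (case_sum id id p) (case_sum id id q))
     = of_real N * (\<Sum>i\<in>F. \<Sum>j\<in>F. cnj (c i) * c j * ka \<one> i j) - 2 * B c
     + of_real N * (\<Sum>i\<in>G. \<Sum>j\<in>G. cnj (d i) * d j * ka \<one> i j)"
   proof -
    have z: "ka 0 i j = 0" if "i \<in> I" "j \<in> I" for i j using scale[of 0 i j 0] that by simp
    have e1: "(\<Sum>i\<in>F. \<Sum>i'\<in>F. ka (C (Inl i) (Inl i')) i i')
      = of_real N * (\<Sum>i\<in>F. \<Sum>j\<in>F. cnj (c i) * c j * ka \<one> i j)"
     unfolding sum_distrib_left using F scale[of \<one>] by (intro sum.cong refl) (auto simp: C_def subset_iff)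
    have e2: "(\<Sum>i\<in>F. \<Sum>j\<in>G. ka (C (Inl i) (Inr j)) i j) = - 2 * B c"
     unfolding sum_distrib_left B_def using F G scale[OF T]
     by (intro sum.cong refl) (auto simp: C_def subset_iff simp del: scaleC_minus_left)
    have e3: "(\<Sum>j\<in>G. \<Sum>i\<in>F. ka (C (Inr j) (Inl i)) j i) = 0"
     using F G z by (intro sum.neutral ballI) (auto simp: C_def subset_iff)
    have e4: "(\<Sum>i\<in>G. \<Sum>i'\<in>G. ka (C (Inr i) (Inr i')) i i')
      = of_real N * (\<Sum>i\<in>G. \<Sum>j\<in>G. cnj (d i) * d j * ka \<one> i j)"
     unfolding sum_distrib_left using G scale[of \<one>] by (intro sum.cong refl) (auto simp: C_def subset_iff)
    show ?thesis unfolding sp by (simp add: sum.distrib e1 e2 e3 e4)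
   qed
   finally have "2 * Re (B c) <= N * Re (\<Sum>i\<in>F. \<Sum>j\<in>F. cnj (c i) * c j * ka \<one> i j)
     + N * Re (\<Sum>i\<in>G. \<Sum>j\<in>G. cnj (d i) * d j * ka \<one> i j)"
    by (simp del: Re_sum)
   also have "... <= N * (norm (\<Sum>i\<in>F. c i *C v i))^2 + N * W^2"
    unfolding W_def by (intro add_mono mult_left_mono one F G) (auto simp: N_def)
   finally show ?thesis by (simp add: algebra_simps)
  qed
  have "cmod (B c) <= N * norm (\<Sum>i\<in>F. c i *C v i) * W"
  proof (rule le_of_quadratic)
   fix r :: real assume r: "0 < r"
   show "2 * r * cmod (B c) <= N * (r^2 * (norm (\<Sum>i\<in>F. c i *C v i))^2 + W^2)"
   proof (cases "B c = 0")
    case False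
    \<comment> \<open>Rotates the coefficients \<open>c\<close> so that the form becomes real and
      nonnegative, and scales them by \<open>r\<close>.\<close>
    define s where "s = of_real (r / cmod (B c)) * B c"
    have s: "cmod s = r" using False r by (simp add: s_def norm_mult norm_divide)
    have "B (%i. s * c i) = cnj s * B c" by (simp add: B_def sum_distrib_left ac_simps)
    also have "Re ... = r * cmod (B c)"
    proof -
     have "cnj (B c) * B c = of_real ((cmod (B c))^2)" by (metis complex_norm_square mult.commute)
     hence "cnj s * B c = of_real (r / cmod (B c) * (cmod (B c))^2)"
      by (simp add: s_def mult.assoc)
     thus ?thesis using False by (simp add: power2_eq_square del: of_real_mult of_real_divide)
    qed
    finally have "2 * (r * cmod (B c)) <= N * ((norm (\<Sum>i\<in>F. (s * c i) *C v i))^2 + W^2)"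
     using main[of "%i. s * c i"] by simp
    also have "(\<Sum>i\<in>F. (s * c i) *C v i) = s *C (\<Sum>i\<in>F. c i *C v i)"
     by (simp add: scaleC_sum_right scaleC_scaleC)
    finally show ?thesis by (simp add: norm_scaleC s power_mult_distrib)
   qed (simp add: N_def)
  qed (auto simp: N_def W_def)
  thus ?thesis by (simp add: B_def N_def W_def)
 qed
 have "\<exists>R. clin R & (\<forall>i\<in>I. \<forall>j\<in>I. <<v i, R $ v j>> = ka T i j) & norm R <= norm T &
   (\<forall>x. (\<forall>i\<in>I. <<v i, x>> = 0) --> R $ x = 0 & hadj R $ x = 0)" if "clin T" for T
  by (rule form_operator) (use bound that in auto)
 then obtain psi where psic: "!!T. clin T ==> clin (psi T)"
  and psi: "!!T i j. clin T ==> i \<in> I ==> j \<in> I ==> <<v i, psi T $ v j>> = ka T i j"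
  and psi0: "!!T x. clin T ==> (!!i. i \<in> I ==> <<v i, x>> = 0) ==> psi T $ x = 0 & hadj (psi T) $ x = 0"
  by metis
 have psi0': "<<x, psi T $ y>> = 0" if "clin T" "!!i. i \<in> I ==> <<v i, x>> = 0" for T x y
  using psi0[OF that] hadj_left[OF psic[OF that(1)], of x y] by simp
 obtain P where P: "!!x. P x \<in> closure (cspan (v ` I))" "!!x. norm (P x) <= norm x"
  "!!x i. i \<in> I ==> <<v i, x - P x>> = 0"
  using proj_ex[of v I] by metis
 \<comment> \<open>\<open>psi T\<close> is supported on the closed span, so testing it at any
   vectors amounts to testing it at their projections, which are limits of finite
   combinations.\<close>
 have Ppsi: "<<x, psi T $ y>> = <<P x, psi T $ P y>>" if "clin T" for x y T
  using psi0'[OF that P(3), of x y] psi0[OF that P(3), of y] by (simp add: cinner_simps blinfun.diff_right)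
 have "cpc psi"
  unfolding cpc_def
 proof (intro conjI allI impI)
  show "clinear_on cops psi"
   unfolding clinear_on_def cops_iff
  proof (intro conjI ballI allI)
   fix S T :: "'a op" assume "S \<in> cops" "T \<in> cops"
   hence *: "clin S" "clin T" by (auto simp: cops_iff)
   show "psi (S + T) = psi S + psi T"
    by (rule op_eqI_family[of _ _ I v]) (use * psic psi0 in \<open>auto simp: psi add cinner_simps\<close>)
  next
   fix c and T :: "'a op" assume "T \<in> cops"
   hence *: "clin T" by (auto simp: cops_iff)
   show "psi (c *C T) = c *C psi T"
    by (rule op_eqI_family[of _ _ I v]) (use * psic psi0 in \<open>auto simp: psi scale cinner_simps\<close>)
  qed
 next
  fix n :: nat and C :: "nat => nat => 'a op"
  assume "(\<forall>i<n. \<forall>j<n. clin (C i j)) & acc {..<n} C"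
  hence C: "!!a b. a < n ==> b < n ==> clin (C a b)" and acc: "acc {..<n} C" by auto
  have fin: "0 <= Re (mform {..<n} (%a b. psi (C a b)) eta)" if "!!a. eta a \<in> cspan (v ` I)" for eta
  proof -
   have "\<exists>F c. finite F & F <= I & eta a = (\<Sum>i\<in>F. c i *C v i)" for a
    using that[of a] unfolding cspan_eq by blast
   then obtain F c where F: "!!a. finite (F a)" "!!a. F a <= I"
    and eta: "!!a. eta a = (\<Sum>i\<in>F a. c a i *C v i)" by metis
   \<comment> \<open>Expanding each \<open>eta a\<close> in the \<open>v i\<close> replaces the
     index \<open>a\<close> by pairs \<open>(a, i)\<close> and reduces positivity of
     \<open>psi\<close> to positivity of the kernel.\<close>
   let ?A = "Sigma {..<n} F"
   let ?C = "%p q. (cnj (c (fst p) (snd p)) * c (fst q) (snd q)) *C C (fst p) (fst q)"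
   have s: "(\<Sum>p\<in>?A. f p) = (\<Sum>a<n. \<Sum>i\<in>F a. f (a, i))" for f :: "_ => complex"
    using F by (simp add: sum.Sigma)
   have "acc ?A ?C"
    unfolding acc_def
   proof
    fix xi :: "nat \<times> 'i => 'a"
    define x where "x a = (\<Sum>i\<in>F a. c a i *C xi (a, i))" for a
    have "mform ?A ?C xi = (\<Sum>a<n. \<Sum>i\<in>F a. \<Sum>b<n. \<Sum>j\<in>F b. cnj (c a i) * c b j * <<xi (a, i), C a b $ xi (b, j)>>)"
     unfolding mform_def s by (simp add: cinner_simps)
    also have "... = (\<Sum>a<n. \<Sum>b<n. \<Sum>i\<in>F a. \<Sum>j\<in>F b. cnj (c a i) * c b j * <<xi (a, i), C a b $ xi (b, j)>>)"
     by (intro sum.cong refl sum.swap)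
    also have "... = (\<Sum>a<n. \<Sum>b<n. <<x a, C a b $ x b>>)"
     unfolding x_def using C by (intro sum.cong refl) (simp add: clin_sum cinner_sum_sum)
    finally show "0 <= Re (mform ?A ?C xi)" using acc unfolding acc_def mform_def by simp
   qed
   hence "0 <= Re (\<Sum>p\<in>?A. \<Sum>q\<in>?A. ka (?C p q) (snd p) (snd q))"
    using F C by (intro posG) (auto intro!: finite_SigmaI simp: subset_iff)
   also have "(\<Sum>p\<in>?A. \<Sum>q\<in>?A. ka (?C p q) (snd p) (snd q))
     = (\<Sum>a<n. \<Sum>i\<in>F a. \<Sum>b<n. \<Sum>j\<in>F b. cnj (c a i) * c b j * ka (C a b) i j)"
    unfolding s using F(2) C by (intro sum.cong refl) (auto simp: scale subset_iff)
   also have "... = (\<Sum>a<n. \<Sum>b<n. \<Sum>i\<in>F a. \<Sum>j\<in>F b. cnj (c a i) * c b j * ka (C a b) i j)"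
    by (intro sum.cong refl sum.swap)
   also have "... = mform {..<n} (%a b. psi (C a b)) eta"
    unfolding mform_def eta
    by (intro sum.cong refl) (use F(2) C psi psic in \<open>auto simp: clin_sum cinner_sum_sum subset_iff intro!: sum.cong\<close>)
   finally show ?thesis .
  qed
  show "acc {..<n} (%a b. psi (C a b))"
   unfolding acc_def
  proof
   fix xi :: "nat => 'b"
   have "\<exists>f. (\<forall>m. f m \<in> cspan (v ` I)) & f ---> P (xi a)" for a
    using P(1)[of "xi a"] unfolding closure_sequential .
   then obtain f where f: "!!a m. f a m \<in> cspan (v ` I)" "!!a. f a ---> P (xi a)" by metis
   have "(%m. Re (mform {..<n} (%a b. psi (C a b)) (%a. f a m)))
     ---> Re (mform {..<n} (%a b. psi (C a b)) (%a. P (xi a)))"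
    unfolding mform_def by (intro tendsto_intros f)
   hence "0 <= Re (mform {..<n} (%a b. psi (C a b)) (%a. P (xi a)))"
    by (rule LIMSEQ_le_const) (use fin f in auto)
   also have "mform {..<n} (%a b. psi (C a b)) (%a. P (xi a)) = mform {..<n} (%a b. psi (C a b)) xi"
    unfolding mform_def by (intro sum.cong refl Ppsi[symmetric] C) auto
   finally show "0 <= Re (mform {..<n} (%a b. psi (C a b)) xi)" .
  qed
 next
  fix x
  obtain f where f: "!!m. f m \<in> cspan (v ` I)" "f ---> P x"
   using P(1)[of x] unfolding closure_sequential by blast
  have fb: "Re <<f m, psi \<one> $ f m>> <= (norm (f m))^2" for m
  proof -
   obtain F c where F: "finite F" "F <= I" and fm: "f m = (\<Sum>i\<in>F. c i *C v i)"
    using f(1)[of m] unfolding cspan_eq by auto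
   have "<<f m, psi \<one> $ f m>> = (\<Sum>i\<in>F. \<Sum>j\<in>F. cnj (c i) * c j * ka \<one> i j)"
    unfolding fm using F psi psic by (auto simp: clin_sum cinner_sum_sum subset_iff intro!: sum.cong)
   thus ?thesis using one[OF F, of c] by (simp add: fm del: Re_sum)
  qed
  have "Re <<P x, psi \<one> $ P x>> <= (norm (P x))^2"
   by (rule LIMSEQ_le[of "%m. Re <<f m, psi \<one> $ f m>>" _ "%m. (norm (f m))^2"])
    (auto intro!: tendsto_intros f fb)
  also have "... <= (norm x)^2" using P(2) by (intro power_mono) auto
  finally show "Re <<x, psi \<one> $ x>> <= (norm x)^2" by (subst Ppsi) auto
 qed (rule psic)
 thus ?thesis using psi psi0 by (intro exI[of _ psi]) blast
qed

subsection \<open>Matrix norms\<close>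

text \<open>A bound on the operator norm in quadratic form, for arbitrary index sets;
  \<open>mat_norm\<close> is the least nonnegative such bound on \<open>{..<n}\<close>.\<close>

definition mbound :: "'i set => ('i => 'i => 'a::chilbert_space op) => real => bool" where
 "mbound I T M \<longleftrightarrow> (\<forall>xi. (\<Sum>i\<in>I. (norm (\<Sum>j\<in>I. T i j $ xi j))^2) <= M^2 * (\<Sum>j\<in>I. (norm (xi j))^2))"

lemma mat_norm_bdd:
 fixes T :: "nat => nat => 'a::chilbert_space op"
 shows "bdd_above {sqrt (\<Sum>i<n. (norm (\<Sum>j<n. T i j $ xi j))^2) | xi. (\<Sum>j<n. (norm (xi j))^2) <= 1}"
proof (rule bdd_aboveI)
 fix y assume "y \<in> {sqrt (\<Sum>i<n. (norm (\<Sum>j<n. T i j $ xi j))^2) | xi. (\<Sum>j<n. (norm (xi j))^2) <= 1}"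
 then obtain xi where y: "y = sqrt (\<Sum>i<n. (norm (\<Sum>j<n. T i j $ xi j))^2)" and xi: "(\<Sum>j<n. (norm (xi j))^2) <= 1"
  by blast
 have n1: "norm (xi j) <= 1" if "j < n" for j
 proof -
  have "(norm (xi j))^2 <= (\<Sum>j<n. (norm (xi j))^2)" using that by (intro member_le_sum) auto
  hence "(norm (xi j))^2 <= 1^2" using xi by simp
  thus ?thesis by (rule power2_le_imp_le) simp
 qed
 have "y = L2_set (%i. norm (\<Sum>j<n. T i j $ xi j)) {..<n}" by (simp add: y L2_set_def)
 also have "... <= (\<Sum>i<n. norm (\<Sum>j<n. T i j $ xi j))" by (rule L2_set_le_sum) simp
 also have "... <= (\<Sum>i<n. \<Sum>j<n. norm (T i j))"
 proof (intro sum_mono order.trans[OF norm_sum])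
  fix i j assume "j \<in> {..<n}"
  thus "norm (T i j $ xi j) <= norm (T i j)"
   using norm_blinfun[of "T i j" "xi j"] n1[of j] mult_left_mono[of "norm (xi j)" 1 "norm (T i j)"] by auto
 qed
 finally show "y <= (\<Sum>i<n. \<Sum>j<n. norm (T i j))" .
qed

lemma mat_norm_nonneg: "0 <= mat_norm n T"
 unfolding mat_norm_def
 by (rule cSup_upper2[OF _ _ mat_norm_bdd, of 0]) (auto intro!: exI[of _ "%_. 0"])

lemma mbound_mat_norm: "mbound {..<n} T (mat_norm n T)"
 unfolding mbound_def
proof
 fix xi :: "nat => 'a"
 define s where "s = (\<Sum>j<n. (norm (xi j))^2)"
 have s0: "0 <= s" by (simp add: s_def sum_nonneg)
 show "(\<Sum>i<n. (norm (\<Sum>j<n. T i j $ xi j))^2) <= (mat_norm n T)^2 * (\<Sum>j<n. (norm (xi j))^2)"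
 proof (cases "s = 0")
  case True
  hence "xi j = 0" if "j < n" for j
   using that unfolding s_def by (subst (asm) sum_nonneg_eq_0_iff) auto
  thus ?thesis by simp
 next
  case False
  define r where "r = 1 / sqrt s"
  have r: "0 < r" "r^2 * s = 1" using False s0 by (auto simp: r_def power_divide)
  have sc: "(\<Sum>j<n. (norm (r *\<^sub>R xi j))^2) = r^2 * s"
   by (simp add: s_def power_mult_distrib sum_distrib_left)
  have "sqrt (\<Sum>i<n. (norm (\<Sum>j<n. T i j $ (r *\<^sub>R xi j)))^2) <= mat_norm n T"
   unfolding mat_norm_def
   by (rule cSup_upper[OF _ mat_norm_bdd]) (use sc r in \<open>auto intro!: exI[of _ "%j. r *\<^sub>R xi j"]\<close>)
  hence "(\<Sum>i<n. (norm (\<Sum>j<n. T i j $ (r *\<^sub>R xi j)))^2) <= (mat_norm n T)^2"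
   by (rule sqrt_le_D)
  hence "r^2 * (\<Sum>i<n. (norm (\<Sum>j<n. T i j $ xi j))^2) <= (mat_norm n T)^2"
   by (simp add: blinfun.scaleR_right power_mult_distrib sum_distrib_left flip: scaleR_right.sum)
  from mult_right_mono[OF this s0] have "r^2 * s * (\<Sum>i<n. (norm (\<Sum>j<n. T i j $ xi j))^2) <= (mat_norm n T)^2 * s"
   by (simp add: ac_simps)
  thus ?thesis using r by (simp add: s_def)
 qed
qed

lemma mat_norm_le: "0 <= M ==> mbound {..<n} T M ==> mat_norm n T <= M"
 unfolding mat_norm_def
proof (rule cSup_least)
 show "{sqrt (\<Sum>i<n. (norm (\<Sum>j<n. T i j $ xi j))^2) | xi. (\<Sum>j<n. (norm (xi j))^2) <= 1} ~= {}"
  by (auto intro!: exI[of _ "%_. 0"])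
 fix y assume M: "0 <= M" "mbound {..<n} T M"
  and "y \<in> {sqrt (\<Sum>i<n. (norm (\<Sum>j<n. T i j $ xi j))^2) | xi. (\<Sum>j<n. (norm (xi j))^2) <= 1}"
 then obtain xi where y: "y = sqrt (\<Sum>i<n. (norm (\<Sum>j<n. T i j $ xi j))^2)" and xi: "(\<Sum>j<n. (norm (xi j))^2) <= 1"
  by blast
 have "(\<Sum>i<n. (norm (\<Sum>j<n. T i j $ xi j))^2) <= M^2 * (\<Sum>j<n. (norm (xi j))^2)"
  using M(2) by (simp add: mbound_def)
 also have "... <= M^2" using xi by (simp add: mult_left_le)
 finally show "y <= M" unfolding y using M(1) by (simp add: real_le_lsqrt)
qed

lemma mbound_mono: "mbound I T M ==> 0 <= M ==> M <= M' ==> mbound I T M'"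
 unfolding mbound_def
 by (meson mult_right_mono order.trans power_mono sum_nonneg zero_le_power2)

text \<open>A norm bound is a positivity statement: \<open>M\<close> bounds \<open>T\<close> when
  the block matrix with \<open>M\<close> on the diagonal and \<open>2 T\<close> in one corner is
  accretive. Positivity passes to the image.\<close>

lemma cpc_mbound:
 fixes phi :: "'a::chilbert_space op => 'b::chilbert_space op"
 assumes phi: "cpc phi" and I: "finite I" and T: "!!i j. i \<in> I ==> j \<in> I ==> clin (T i j)"
  and M: "0 < M" "mbound I T M"
 shows "mbound I (%i j. phi (T i j)) M"
 unfolding mbound_def
proof
 fix eta
 define C where "C p q = (case p of
   Inl i => (case q of Inl i' => (if i = i' then of_real M *C \<one> else 0) | Inr j => 2 *C T i j)
  | Inr j => (case q of Inl i => 0 | Inr j' => (if j = j' then of_real M *C \<one> else 0)))" for p q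
 have sp: "(\<Sum>p\<in>I <+> I. f p) = (\<Sum>i\<in>I. f (Inl i)) + (\<Sum>j\<in>I. f (Inr j))" for f :: "_ => complex"
  using I by (simp add: sum.Plus)
 have Cc: "clin (C p q)" if "p \<in> I <+> I" "q \<in> I <+> I" for p q
  using T that by (auto simp: C_def split: sum.splits)
 have if0: "(if i = i' then A else 0) $ x = (if i = i' then A $ x else 0)" for i i' :: 'c and A :: "'z::chilbert_space op" and x
  by simp
 have "acc (I <+> I) C"
  unfolding acc_def
 proof
  fix xi :: "'c + 'c => 'a"
  define w where "w i = (\<Sum>j\<in>I. T i j $ xi (Inr j))" for i
  have "mform (I <+> I) C xi = (\<Sum>i\<in>I. of_real M * <<xi (Inl i), xi (Inl i)>>)
    + 2 * (\<Sum>i\<in>I. <<xi (Inl i), w i>>) + (\<Sum>i\<in>I. of_real M * <<xi (Inr i), xi (Inr i)>>)"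
   unfolding mform_def sp C_def w_def using I
   by (simp add: sum.distrib cinner_sum_right cinner_simps sum_distrib_left if0 if_distrib[of "cinner _"] sum.delta cong: if_cong)
  hence "Re (mform (I <+> I) C xi) = (\<Sum>i\<in>I. M * (norm (xi (Inl i)))^2 + 2 * Re <<xi (Inl i), w i>>)
    + M * (\<Sum>i\<in>I. (norm (xi (Inr i)))^2)"
   by (simp add: Re_cinner_self sum.distrib sum_distrib_left)
  also have "... \<ge> (\<Sum>i\<in>I. - ((norm (w i))^2 / M)) + M * (\<Sum>i\<in>I. (norm (xi (Inr i)))^2)"
  proof (intro add_mono sum_mono order.refl)
   fix i
   have "0 <= (norm (M *\<^sub>R xi (Inl i) + w i))^2 / M" using M by simp
   also have "... = M * (norm (xi (Inl i)))^2 + 2 * Re <<xi (Inl i), w i>> + (norm (w i))^2 / M"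
    unfolding norm_add_sq using M
    by (simp add: cinner_simps power_mult_distrib add_divide_distrib power2_eq_square)
   finally show "- ((norm (w i))^2 / M) <= M * (norm (xi (Inl i)))^2 + 2 * Re <<xi (Inl i), w i>>" by simp
  qed
  moreover have "(\<Sum>i\<in>I. (norm (w i))^2) / M <= M * (\<Sum>i\<in>I. (norm (xi (Inr i)))^2)"
   using M(2)[unfolded mbound_def, rule_format, of "%j. xi (Inr j)"] M(1)
   by (simp add: w_def divide_le_eq power2_eq_square mult.assoc mult.commute mult.left_commute)
  ultimately show "0 <= Re (mform (I <+> I) C xi)"
   by (simp add: sum_negf sum_divide_distrib)
 qed
 hence acc: "acc (I <+> I) (%p q. phi (C p q))" using I Cc by (intro cpc_acc[OF phi]) auto
 define w where "w i = (\<Sum>j\<in>I. phi (T i j) $ eta j)" for i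
 \<comment> \<open>The first block receives the minimizer of
   \<open>M * (norm x)^2 + 2 * Re <<x, w i>>\<close>.\<close>
 define \<zeta> where "\<zeta> p = (case p of Inl i => (- 1 / M) *\<^sub>R w i | Inr j => eta j)" for p
 have "0 <= Re (mform (I <+> I) (%p q. phi (C p q)) \<zeta>)" using acc by (simp add: acc_def)
 also have "mform (I <+> I) (%p q. phi (C p q)) \<zeta>
   = (\<Sum>i\<in>I. of_real M * <<\<zeta> (Inl i), phi \<one> $ \<zeta> (Inl i)>>)
    + 2 * (\<Sum>i\<in>I. <<\<zeta> (Inl i), w i>>) + (\<Sum>i\<in>I. of_real M * <<eta i, phi \<one> $ eta i>>)"
 proof -
  have "phi (if i = i' then of_real M *C \<one> else 0) = (if i = i' then of_real M *C phi \<one> else 0)"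
   for i i' :: 'c by (simp add: cpc_scale[OF phi] cpc_zero[OF phi])
  moreover have "\<zeta> (Inr j) = eta j" for j by (simp add: \<zeta>_def)
  ultimately show ?thesis
   unfolding mform_def sp C_def w_def using I T
   by (simp add: sum.distrib cinner_sum_right cinner_simps sum_distrib_left if0 if_distrib[of "cinner _"] sum.delta cong: if_cong)
    (simp add: cpc_scale[OF phi] cpc_zero[OF phi] cinner_simps)
 qed
 also have "Re ... = M * (\<Sum>i\<in>I. Re <<\<zeta> (Inl i), phi \<one> $ \<zeta> (Inl i)>>)
   + 2 * (\<Sum>i\<in>I. Re <<\<zeta> (Inl i), w i>>) + M * (\<Sum>i\<in>I. Re <<eta i, phi \<one> $ eta i>>)"
  by (simp add: sum_distrib_left)
 also have "... <= M * (\<Sum>i\<in>I. (norm (\<zeta> (Inl i)))^2)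
   + 2 * (\<Sum>i\<in>I. Re <<\<zeta> (Inl i), w i>>) + M * (\<Sum>i\<in>I. (norm (eta i))^2)"
  using M(1) by (intro add_mono mult_left_mono sum_mono cpc_id[OF phi] order.refl) auto
 also have "... = - (\<Sum>i\<in>I. (norm (w i))^2) / M + M * (\<Sum>i\<in>I. (norm (eta i))^2)"
  using M(1)
  by (simp add: \<zeta>_def power_divide cinner_simps Re_cinner_self sum_negf power2_eq_square
    flip: sum_divide_distrib)
 finally show "(\<Sum>i\<in>I. (norm (\<Sum>j\<in>I. phi (T i j) $ eta j))^2) <= M^2 * (\<Sum>j\<in>I. (norm (eta j))^2)"
  using M(1) by (simp add: w_def[symmetric] field_simps power2_eq_square)
qed

lemma cpc_mat_norm:
 assumes phi: "cpc phi" and T: "!!i j. i < n ==> j < n ==> clin (T i j)"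
 shows "mat_norm n (%i j. phi (T i j)) <= mat_norm n T"
proof (rule field_le_epsilon)
 \<comment> \<open>\<open>cpc_mbound\<close> asks for a strictly positive bound.\<close>
 fix e :: real assume "0 < e"
 hence "0 < mat_norm n T + e" using mat_norm_nonneg[of n T] by simp
 moreover have "mbound {..<n} T (mat_norm n T + e)"
  using \<open>0 < e\<close> by (intro mbound_mono[OF mbound_mat_norm mat_norm_nonneg]) simp
 ultimately show "mat_norm n (%i j. phi (T i j)) <= mat_norm n T + e"
  using T by (intro mat_norm_le cpc_mbound[OF phi]) auto
qed

subsection \<open>Multiplicative domains\<close>

text \<open>Choi's multiplicative domain, described by its bimodule property; equality in the
  Schwarz inequality for \<open>z\<close> and \<open>hadj z\<close> is the criterion in
  \<open>mdI\<close>.\<close>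

definition md :: "('a::chilbert_space op => 'b::chilbert_space op) => 'a op set" where
 "md phi = {z. clin z & (\<forall>w. clin w --> phi (w oo z) = phi w oo phi z & phi (z oo w) = phi z oo phi w)}"

lemma comp_assoc: "(A oo B) oo C = A oo (B oo C)"
 by (rule blinfun_eqI) simp

lemma comp_simps:
 "(A + B) oo C = (A oo C) + (B oo C)" "C' oo (A + B) = (C' oo A) + (C' oo B)"
 "(A - B) oo C = (A oo C) - (B oo C)" "C' oo (A - B) = (C' oo A) - (C' oo B)"
 "(c *C A) oo C = c *C (A oo C)" "clin C' ==> C' oo (c *C A) = c *C (C' oo A)"
 for A B :: "'a::chilbert_space \<Rightarrow>\<^sub>L 'b::chilbert_space" and C :: "'c::chilbert_space \<Rightarrow>\<^sub>L 'a"
  and C' :: "'b \<Rightarrow>\<^sub>L 'd::chilbert_space"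
 by (auto intro!: blinfun_eqI simp: blinfun.add_right blinfun.diff_right clin_scaleC)

text \<open>Choi's argument: equality in the Schwarz inequality puts a zero into a corner of the
  Schwarz matrix of \<open>z\<close> and \<open>hadj w\<close>, and then the entry beside it
  vanishes as well.\<close>

lemma md_half:
 assumes phi: "cpc phi" and z: "clin z" "phi (hadj z oo z) = hadj (phi z) oo phi z" and w: "clin w"
 shows "phi (w oo z) = phi w oo phi z"
proof -
 define a where "a i = (if i then z else hadj w)" for i
 let ?D = "%i j. phi (hadj (a i) oo a j) - (hadj (phi (a i)) oo phi (a j))"
 have "acc UNIV ?D" using z w by (intro cpc_schwarz_mat[OF phi]) (auto simp: a_def)
 also have "?D = (%i j. if i then (if j then 0 else hadj (phi (w oo z) - (phi w oo phi z)))
   else (if j then phi (w oo z) - (phi w oo phi z) else ?D False False))"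
  using z w cpc_hadj[OF phi, of w] cpc_hadj[OF phi, of "w oo z"]
  by (auto simp: fun_eq_iff a_def cpc_clin[OF phi])
 finally have "phi (w oo z) - (phi w oo phi z) = 0"
  by (rule cpc_acc_zero_corner) (use z w phi in auto)
 thus ?thesis by simp
qed

lemma mdI:
 assumes phi: "cpc phi" and z: "clin z" "phi (hadj z oo z) = hadj (phi z) oo phi z"
  "phi (z oo hadj z) = phi z oo hadj (phi z)"
 shows "z \<in> md phi"
proof -
 have "phi (z oo w) = phi z oo phi w" if w: "clin w" for w
 proof -
  have "phi (hadj w oo hadj z) = phi (hadj w) oo phi (hadj z)"
   using z w by (intro md_half[OF phi]) (auto simp: cpc_hadj[OF phi] cpc_clin[OF phi])
  hence "hadj (phi (hadj (z oo w))) = hadj (phi (hadj w) oo phi (hadj z))" using z w by simp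
  thus ?thesis using z w by (simp add: cpc_hadj[OF phi] cpc_clin[OF phi] del: hadj_simps(7)) (simp add: cpc_clin[OF phi])
 qed
 thus ?thesis using md_half[OF phi z(1,2)] z(1) by (simp add: md_def)
qed

lemma mdD:
 "z \<in> md phi ==> clin w ==> phi (w oo z) = phi w oo phi z"
 "z \<in> md phi ==> clin w ==> phi (z oo w) = phi z oo phi w" "z \<in> md phi ==> clin z"
 by (auto simp: md_def)

lemma closed_clin: "closed {T :: 'a::chilbert_space \<Rightarrow>\<^sub>L 'b::chilbert_space. clin T}"
proof -
 have "{T :: 'a \<Rightarrow>\<^sub>L 'b. clin T} = (\<Inter>c. \<Inter>x. {T. T $ (c *C x) = c *C T $ x})" by (auto simp: clin_def)
 moreover have "closed {T :: 'a \<Rightarrow>\<^sub>L 'b. T $ (c *C x) = c *C T $ x}" for c x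
  by (intro closed_Collect_eq continuous_at_imp_continuous_on ballI)
   (auto simp: continuous_at intro!: tendsto_intros)
 ultimately show ?thesis by (simp only:) (intro closed_INT ballI)
qed

lemma closed_seqI:
 "(!!f x. (!!n. f n \<in> S) ==> f ---> x ==> x \<in> S) ==> closed (S :: 'a::metric_space set)"
 unfolding closed_sequential_limits by blast

lemma clin_lim: "(!!n. clin (f n)) ==> f ---> T ==> clin T"
 for T :: "'a::chilbert_space \<Rightarrow>\<^sub>L 'b::chilbert_space"
 using closed_clin[where 'a = 'a and 'b = 'b] unfolding closed_sequential_limits by auto

lemma tendsto_comp [tendsto_intros]:
 "(f ~~> S) F ==> (g ~~> T) F ==> ((%x. f x oo g x) ~~> (S oo T)) F"
 by (rule bounded_bilinear.tendsto[OF bounded_bilinear_blinfun_compose])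

lemma tendsto_hadj:
 fixes T :: "'a::chilbert_space \<Rightarrow>\<^sub>L 'b::chilbert_space"
 assumes "(f ~~> T) F" "!!x. clin (f x)" "clin T"
 shows "((%x. hadj (f x)) ~~> hadj T) F"
proof (rule tendsto_norm_zero_cancel[THEN LIM_zero_cancel])
 have "norm (hadj (f x) - hadj T) = norm (f x - T)" for x
  using norm_hadj[of "f x - T"] assms by simp
 thus "((%x. norm (hadj (f x) - hadj T)) ~~> 0) F"
  using assms(1) by (simp add: tendsto_norm_zero LIM_zero)
qed

lemma cstar_algebraI:
 assumes "!!T. T \<in> C ==> clin T" "0 \<in> C" "!!S T. S \<in> C ==> T \<in> C ==> S + T \<in> C"
  "!!c T. T \<in> C ==> c *C T \<in> C" "!!f T. (!!n. f n \<in> C) ==> f ---> T ==> clin T ==> T \<in> C"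
  "!!S T. S \<in> C ==> T \<in> C ==> S oo T \<in> C" "!!T. T \<in> C ==> hadj T \<in> C"
 shows "cstar_algebra C"
proof -
 have "closed C" using assms(1,5) by (intro closed_seqI) (metis clin_lim)
 thus ?thesis
  using assms by (auto simp: cstar_algebra_def cops_iff csubspace_def adj_hadj)
qed

lemma cstar_algebraD:
 assumes "cstar_algebra C"
 shows "T \<in> C ==> clin T" "csubspace C" "closed C" "S \<in> C ==> T \<in> C ==> S oo T \<in> C" "T \<in> C ==> hadj T \<in> C"
 using assms by (auto simp: cstar_algebra_def cops_iff adj_hadj subset_iff)

lemma cstar_md:
 assumes phi: "cpc phi" shows "cstar_algebra (md phi)"
proof (rule cstar_algebraI)
 note [simp] = cpc_clin[OF phi] cpc_add[OF phi] cpc_scale[OF phi] cpc_zero[OF phi] cpc_hadj[OF phi]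
 show "clin T" if "T \<in> md phi" for T using that by (simp add: md_def)
 show "0 \<in> md phi" by (simp add: md_def)
 show "S + T \<in> md phi" if "S \<in> md phi" "T \<in> md phi" for S T
  using that by (auto simp: md_def comp_simps)
 show "c *C T \<in> md phi" if "T \<in> md phi" for T c
  using that by (auto simp: md_def comp_simps)
 show "S oo T \<in> md phi" if S: "S \<in> md phi" and T: "T \<in> md phi" for S T
 proof -
  have c: "clin S" "clin T" using S T by (auto dest: mdD)
  have "phi (w oo (S oo T)) = phi w oo phi (S oo T)" if "clin w" for w
   using mdD(1)[OF T, of "w oo S"] mdD(1)[OF T, of S] mdD(1)[OF S that] c that
   by (simp add: comp_assoc)
  moreover have "phi ((S oo T) oo w) = phi (S oo T) oo phi w" if "clin w" for w
   using mdD(2)[OF S, of "T oo w"] mdD(2)[OF S, of T] mdD(2)[OF T that] c that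
   by (simp add: comp_assoc)
  ultimately show ?thesis using c by (simp add: md_def)
 qed
 show "hadj T \<in> md phi" if T: "T \<in> md phi" for T
 proof -
  have c: "clin T" using T by (auto dest: mdD)
  have "phi (w oo hadj T) = phi w oo phi (hadj T)" if "clin w" for w
  proof -
   have "hadj (phi (T oo hadj w)) = hadj (phi T oo phi (hadj w))" using mdD(2)[OF T, of "hadj w"] that by simp
   thus ?thesis using c that cpc_hadj[OF phi, of "T oo hadj w"] by simp
  qed
  moreover have "phi (hadj T oo w) = phi (hadj T) oo phi w" if "clin w" for w
  proof -
   have "hadj (phi (hadj w oo T)) = hadj (phi (hadj w) oo phi T)" using mdD(1)[OF T, of "hadj w"] that by simp
   thus ?thesis using c that cpc_hadj[OF phi, of "hadj w oo T"] by simp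
  qed
  ultimately show ?thesis using c by (simp add: md_def)
 qed
 show "T \<in> md phi" if f: "!!n. f n \<in> md phi" "f ---> T" "clin T" for f T
 proof -
  have c: "clin (f n)" for n using f(1) by (auto dest: mdD)
  have phiT: "(%n. phi (f n)) ---> phi T" by (rule cpc_tendsto[OF phi f(2) c f(3)])
  have "phi (w oo T) = phi w oo phi T" if w: "clin w" for w
  proof (rule LIMSEQ_unique)
   show "(%n. phi (w oo f n)) ---> phi (w oo T)"
    by (rule cpc_tendsto[OF phi]) (use w c f in \<open>auto intro!: tendsto_intros\<close>)
   show "(%n. phi (w oo f n)) ---> (phi w oo phi T)"
    unfolding mdD(1)[OF f(1) w] by (intro tendsto_intros phiT)
  qed
  moreover have "phi (T oo w) = phi T oo phi w" if w: "clin w" for w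
  proof (rule LIMSEQ_unique)
   show "(%n. phi (f n oo w)) ---> phi (T oo w)"
    by (rule cpc_tendsto[OF phi]) (use w c f in \<open>auto intro!: tendsto_intros\<close>)
   show "(%n. phi (f n oo w)) ---> (phi T oo phi w)"
    unfolding mdD(2)[OF f(1) w] by (intro tendsto_intros phiT)
  qed
  ultimately show ?thesis using f(3) by (simp add: md_def)
 qed
qed

section \<open>Arveson's extension theorem\<close>

text \<open>Zorn's lemma is applied to graphs; positivity alone makes them single-valued, as \<open>0 \<in> K\<close>.\<close>

lemma positive_extension:
 fixes K W M :: "'v::real_vector set" and f :: "'v => real"
 assumes K_add: "!!x y. x \<in> K ==> y \<in> K ==> x + y \<in> K" and K_scale: "!!r x. 0 <= r ==> x \<in> K ==> r *\<^sub>R x \<in> K"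
  and W: "subspace W" and M: "subspace M" "M <= W"
  and f_add: "!!x y. x \<in> M ==> y \<in> M ==> f (x + y) = f x + f y"
  and f_scale: "!!r x. x \<in> M ==> f (r *\<^sub>R x) = r * f x"
  and f_pos: "!!x. x \<in> M ==> x \<in> K ==> 0 <= f x"
  and cof: "!!w. w \<in> W ==> \<exists>m\<in>M. m - w \<in> K"
 shows "\<exists>g. (\<forall>x\<in>W. \<forall>y\<in>W. g (x + y) = g x + g y) & (\<forall>r. \<forall>x\<in>W. g (r *\<^sub>R x) = r * g x) &
  (\<forall>x\<in>M. g x = f x) & (\<forall>x\<in>W. x \<in> K --> 0 <= (g x :: real))"
proof -
 define G0 where "G0 = (%x. (x, f x)) ` M"
 define A where "A = {G :: ('v \<times> real) set. subspace G & G0 <= G & fst ` G <= W & (\<forall>(v, r)\<in>G. v \<in> K --> 0 <= r)}"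
 have G0A: "G0 \<in> A"
 proof -
  have f0: "f 0 = 0" using f_scale[of 0 0] M by (simp add: subspace_0)
  have "subspace G0"
   unfolding subspace_def G0_def
  proof (intro conjI ballI allI)
   show "0 \<in> (%x. (x, f x)) ` M" using f0 M by (auto simp: subspace_0 zero_prod_def intro!: image_eqI[of _ _ 0])
   fix x y assume "x \<in> (%x. (x, f x)) ` M" "y \<in> (%x. (x, f x)) ` M"
   thus "x + y \<in> (%x. (x, f x)) ` M" using f_add M by (auto simp: subspace_add image_iff)
  next
   fix c x assume "x \<in> (%x. (x, f x)) ` M"
   thus "c *\<^sub>R x \<in> (%x. (x, f x)) ` M" using f_scale M by (auto simp: subspace_scale image_iff)
  qed
  thus ?thesis using M f_pos by (auto simp: A_def G0_def)
 qed
 have "\<exists>G\<in>A. \<forall>X\<in>A. G <= X --> X = G"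
 proof (rule subset_Zorn_nonempty)
  show "A ~= {}" using G0A by blast
  fix \<C> assume C: "\<C> ~= {}" "subset.chain A \<C>"
  have CA: "X \<in> A" if "X \<in> \<C>" for X using C that by (auto simp: subset_chain_def)
  have "subspace (\<Union>\<C>)"
   unfolding subspace_def
  proof (intro conjI ballI allI)
   obtain X where "X \<in> \<C>" using C by blast
   thus "0 \<in> \<Union>\<C>" using CA[of X] subspace_0 by (auto simp: A_def)
   fix x y assume "x \<in> \<Union>\<C>" "y \<in> \<Union>\<C>"
   then obtain X Y where XY: "X \<in> \<C>" "x \<in> X" "Y \<in> \<C>" "y \<in> Y" by blast
   then obtain Z where "Z \<in> \<C>" "x \<in> Z" "y \<in> Z"
    using C by (metis (no_types, lifting) subset_chain_def subsetD)
   thus "x + y \<in> \<Union>\<C>" using CA[of Z] by (auto simp: A_def intro: subspace_add)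
  next
   fix c x assume "x \<in> \<Union>\<C>"
   then obtain X where "X \<in> \<C>" "x \<in> X" by blast
   thus "c *\<^sub>R x \<in> \<Union>\<C>" using CA[of X] by (auto simp: A_def intro: subspace_scale)
  qed
  moreover have "G0 <= \<Union>\<C>"
  proof -
   obtain X where "X \<in> \<C>" using C by blast
   thus ?thesis using CA[of X] by (auto simp: A_def)
  qed
  moreover have "fst p \<in> W" if "p \<in> \<Union>\<C>" for p using CA that unfolding A_def by blast
  hence "fst ` \<Union>\<C> <= W" by blast
  moreover have "\<forall>(v, r)\<in>\<Union>\<C>. v \<in> K --> 0 <= r" using CA unfolding A_def by blast
  ultimately show "\<Union>\<C> \<in> A" unfolding A_def by blast
 qed
 then obtain G where GA: "G \<in> A" and max: "!!X. X \<in> A ==> G <= X ==> X = G" by blast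
 have G: "subspace G" "G0 <= G" "fst ` G <= W" and Gpos: "!!v r. (v, r) \<in> G ==> v \<in> K ==> 0 <= r"
  using GA by (auto simp: A_def)
 have "0 \<in> W" using W by (rule subspace_0)
 hence K0: "0 \<in> K" using cof[of 0] K_scale[of 0] by fastforce
 have Gz: "r = 0" if "(0, r) \<in> G" for r
  using Gpos[OF that K0] Gpos[of 0 "- r"] subspace_scale[OF G(1) that, of "-1"] K0 by auto
 have dom: "\<exists>r. (w, r) \<in> G" if w: "w \<in> W" for w
 proof (rule ccontr)
  assume nw: "\<nexists>r. (w, r) \<in> G"
  \<comment> \<open>Lower bounds for the value at \<open>w\<close>: each expresses positivity at
    some \<open>m + w\<close>. Cofinality at \<open>- w\<close> makes the set nonempty, and
    cofinality at \<open>w\<close> bounds it from above.\<close>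
  define U where "U = {- r | m r. (m, r) \<in> G & m + w \<in> K}"
  have up: "u <= r" if u: "u \<in> U" and r: "(m, r) \<in> G" "m - w \<in> K" for u m r
  proof -
   obtain m' r' where m': "u = - r'" "(m', r') \<in> G" "m' + w \<in> K" using u by (auto simp: U_def)
   have "(m' + m, r' + r) \<in> G" using subspace_add[OF G(1) m'(2) r(1)] by simp
   moreover have "m' + m \<in> K" using K_add[OF m'(3) r(2)] by simp
   ultimately show ?thesis using Gpos m'(1) by fastforce
  qed
  obtain m1 where m1: "m1 \<in> M" "m1 - w \<in> K" using cof[OF w] by blast
  have m1G: "(m1, f m1) \<in> G" using m1 G(2) by (auto simp: G0_def)
  obtain m2 where m2: "m2 \<in> M" "m2 - (- w) \<in> K" using cof[OF subspace_neg[OF W w]] by blast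
  have m2U: "- f m2 \<in> U" using m2 G(2) by (auto simp: U_def G0_def)
  define c where "c = Sup U"
  have bdd: "bdd_above U" using up[OF _ m1G m1(2)] by (meson bdd_aboveI)
  have c1: "- r <= c" if "(m, r) \<in> G" "m + w \<in> K" for m r
   unfolding c_def using that bdd by (intro cSup_upper) (auto simp: U_def)
  have c2: "c <= r" if "(m, r) \<in> G" "m - w \<in> K" for m r
   unfolding c_def using m2U up that by (intro cSup_least) auto
  define G' where "G' = {(m + t *\<^sub>R w, r + t * c) | m r t. (m, r) \<in> G}"
  have "subspace G'"
   unfolding subspace_def
  proof (intro conjI ballI allI)
   have "(0, 0) \<in> G" using subspace_0[OF G(1)] by (simp add: zero_prod_def)
   thus "0 \<in> G'" unfolding G'_def
    by (intro CollectI exI[of _ "0::'v"] exI[of _ "0::real"]) (auto simp: zero_prod_def)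
   fix x y assume "x \<in> G'" "y \<in> G'"
   then obtain m r t m' r' t' where x: "x = (m + t *\<^sub>R w, r + t * c)" "(m, r) \<in> G"
    and y: "y = (m' + t' *\<^sub>R w, r' + t' * c)" "(m', r') \<in> G"
    by (auto simp: G'_def)
   have "(m + m', r + r') \<in> G" using subspace_add[OF G(1) x(2) y(2)] by simp
   thus "x + y \<in> G'" unfolding G'_def x y
    by (intro CollectI exI[of _ "m + m'"] exI[of _ "r + r'"] exI[of _ "t + t'"]) (simp add: algebra_simps)
  next
   fix a x assume "x \<in> G'"
   then obtain m r t where x: "x = (m + t *\<^sub>R w, r + t * c)" "(m, r) \<in> G"
    by (auto simp: G'_def)
   have "(a *\<^sub>R m, a * r) \<in> G" using subspace_scale[OF G(1) x(2), of a] by simp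
   thus "a *\<^sub>R x \<in> G'" unfolding G'_def x
    by (intro CollectI exI[of _ "a *\<^sub>R m"] exI[of _ "a * r"] exI[of _ "a * t"]) (simp add: algebra_simps)
  qed
  moreover have GG': "G <= G'"
  proof
   fix p assume "p \<in> G"
   thus "p \<in> G'" unfolding G'_def
    by (intro CollectI exI[of _ "fst p"] exI[of _ "snd p"] exI[of _ 0]) simp
  qed
  moreover have "fst ` G' <= W"
   using G(3) w W by (auto simp: G'_def intro!: subspace_add subspace_scale)
  moreover have "0 <= r" if "(v, r) \<in> G'" "v \<in> K" for v r
  proof -
   obtain m r' t where v: "v = m + t *\<^sub>R w" "r = r' + t * c" "(m, r') \<in> G" using \<open>(v, r) \<in> G'\<close> by (auto simp: G'_def)
   consider "t = 0" | "0 < t" | "t < 0" by linarith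
   thus ?thesis
   proof cases
    case 1
    thus ?thesis using v that Gpos by simp
   next
    case 2
    have "((1 / t) *\<^sub>R m, r' / t) \<in> G" using subspace_scale[OF G(1) v(3), of "1 / t"] by simp
    moreover have "(1 / t) *\<^sub>R m + w \<in> K"
     using K_scale[of "1 / t" v] that 2 by (simp add: v scaleR_add_right)
    ultimately have "- (r' / t) <= c" by (rule c1)
    thus ?thesis using 2 v by (simp add: field_simps)
   next
    case 3
    have "((1 / - t) *\<^sub>R m, r' / - t) \<in> G" using subspace_scale[OF G(1) v(3), of "1 / - t"] by simp
    moreover have "(1 / - t) *\<^sub>R m - w \<in> K"
     using K_scale[of "1 / - t" v] that 3 by (simp add: v scaleR_add_right)
    ultimately have "c <= r' / - t" by (rule c2)
    thus ?thesis using 3 v by (simp add: field_simps)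
   qed
  qed
  ultimately have "G' \<in> A" using G(2) by (auto simp: A_def)
  hence "G' = G" using GG' by (rule max)
  moreover have "(w, c) \<in> G'"
   using subspace_0[OF G(1)] unfolding G'_def
   by (intro CollectI exI[of _ 0] exI[of _ 1]) (auto simp: zero_prod_def)
  ultimately show False using nw by blast
 qed
 define g where "g w = (SOME r. (w, r) \<in> G)" for w
 have gG: "(w, g w) \<in> G" if "w \<in> W" for w unfolding g_def using dom[OF that] by (rule someI_ex)
 have guniq: "g w = r" if "(w, r) \<in> G" for w r
 proof -
  have "w \<in> W" using G(3) that by force
  hence "(w, g w) \<in> G" by (rule gG)
  thus ?thesis using Gz[of "g w - r"] subspace_diff[OF G(1) _ that, of "(w, g w)"] by simp
 qed
 show ?thesis
 proof (intro exI[of _ g] conjI ballI allI impI)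
  show "g (x + y) = g x + g y" if "x \<in> W" "y \<in> W" for x y
   using subspace_add[OF G(1) gG[OF that(1)] gG[OF that(2)]] by (intro guniq) simp
  show "g (r *\<^sub>R x) = r * g x" if "x \<in> W" for r x
   using subspace_scale[OF G(1) gG[OF that], of r] by (intro guniq) simp
  show "g x = f x" if "x \<in> M" for x using that G(2) by (intro guniq) (auto simp: G0_def)
  show "0 <= g x" if "x \<in> W" "x \<in> K" for x using Gpos[OF gG] that by blast
 qed
qed

text \<open>Makes the finitely supported operator-valued functions a real vector space to which
  \<open>positive_extension\<close> applies.\<close>

instantiation "fun" :: (type, real_vector) real_vector
begin

definition "scaleR_fun r f = (%x. r *\<^sub>R f x)"

instance
 by standard (auto simp: scaleR_fun_def fun_eq_iff scaleR_add_right scaleR_add_left)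

end

lemma scaleR_fun_apply [simp]: "(r *\<^sub>R f) x = r *\<^sub>R f x" for f :: "'a => 'b::real_vector"
 by (simp add: scaleR_fun_def)

text \<open>A finitely supported \<open>v\<close> stands for a formal sum of operators placed at
  positions \<open>p\<close>; this is the functional that applies \<open>h p\<close> to the operator
  at position \<open>p\<close>.\<close>

definition fs :: "('p => 'v::zero => complex) => ('p => 'v) => complex" where
 "fs h v = (\<Sum>p | v p ~= 0. h p (v p))"

lemma fs_eq: "finite F ==> {p. v p ~= 0} <= F ==> (!!p. h p 0 = 0) ==> fs h v = (\<Sum>p\<in>F. h p (v p))"
 unfolding fs_def by (intro sum.mono_neutral_left) auto

lemma fs_add:
 fixes v w :: "'p => 'v::real_vector"
 assumes "finite {p. v p ~= 0}" "finite {p. w p ~= 0}" "!!p. h p 0 = 0" "!!p. h p (v p + w p) = h p (v p) + h p (w p)"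
 shows "fs h (v + w) = fs h v + fs h w"
proof -
 let ?F = "{p. v p ~= 0} \<union> {p. w p ~= 0}"
 have "fs h (v + w) = (\<Sum>p\<in>?F. h p ((v + w) p))" using assms by (intro fs_eq) auto
 moreover have "fs h v = (\<Sum>p\<in>?F. h p (v p))" "fs h w = (\<Sum>p\<in>?F. h p (w p))"
  using assms by (intro fs_eq; auto)+
 ultimately show ?thesis by (simp add: assms sum.distrib)
qed

lemma fs_scale:
 fixes v :: "'p => 'v::real_vector"
 assumes "finite {p. v p ~= 0}" "!!p. h p 0 = 0" "!!p. h p (r *\<^sub>R v p) = of_real r * h p (v p)"
 shows "fs h (r *\<^sub>R v) = of_real r * fs h v"
proof -
 have "fs h (r *\<^sub>R v) = (\<Sum>p | v p ~= 0. h p ((r *\<^sub>R v) p))" using assms by (intro fs_eq) auto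
 thus ?thesis by (simp add: fs_def assms sum_distrib_left)
qed

lemma fs_sum:
 fixes v :: "'i => 'p => 'v::real_vector"
 assumes "finite A" "!!a. a \<in> A ==> finite {p. v a p ~= 0}" "!!p. h p 0 = 0"
  "!!p S T. h p (S + T) = h p S + h p T"
 shows "finite {p. (\<Sum>a\<in>A. v a) p ~= 0} & fs h (\<Sum>a\<in>A. v a) = (\<Sum>a\<in>A. fs h (v a))"
 using assms(1,2)
proof (induction A rule: finite_induct)
 case (insert a A)
 have "{p. (v a + sum v A) p ~= 0} <= {p. v a p ~= 0} \<union> {p. (sum v A) p ~= 0}" by auto
 hence 1: "finite {p. (v a + sum v A) p ~= 0}" using insert by (auto intro: finite_subset)
 have 2: "fs h (v a + sum v A) = fs h (v a) + fs h (sum v A)"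
  using insert assms by (intro fs_add) auto
 have 3: "fs h (sum v A) = (\<Sum>a\<in>A. fs h (v a))" using insert by blast
 show ?case unfolding sum.insert[OF insert(1,2)] 2 3 using 1 by blast
qed (simp add: fs_def)

definition acc_pres :: "'a::chilbert_space op set => ('a op => 'b::chilbert_space op) => bool" where
 "acc_pres R phi \<longleftrightarrow> (\<forall>n C. (\<forall>i<n. \<forall>j<n. C i j \<in> R) & acc {..<n::nat} C --> acc {..<n} (%i j. phi (C i j)))"

lemma acc_presD:
 assumes "acc_pres R phi" "finite I" "!!i j. i \<in> I ==> j \<in> I ==> C i j \<in> R" "acc I C"
 shows "acc I (%i j. phi (C i j))"
proof -
 obtain h where h: "bij_betw h {..<card I} I"
  using ex_bij_betw_nat_finite[OF assms(2)] by (auto simp: atLeast0LessThan)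
 have hI: "h i \<in> I" if "i < card I" for i using h that by (auto simp: bij_betw_def)
 have "acc {..<card I} (%i j. C (h i) (h j))" using assms(4) acc_reindex[OF h, of C] by simp
 hence "acc {..<card I} (%i j. phi (C (h i) (h j)))"
  using assms(1)[unfolded acc_pres_def, rule_format, of "card I" "%i j. C (h i) (h j)"] assms(3) hI by blast
 thus ?thesis using acc_reindex[OF h, of "%i j. phi (C i j)"] by simp
qed

text \<open>A map into the operators on a space with orthonormal basis \<open>E\<close> amounts to a
  functional on matrices over its domain indexed by \<open>E\<close>, and complete positivity
  becomes positivity of the functional. The functional is extended by
  \<open>positive_extension\<close>, and \<open>kernel_cp\<close> turns the extension back into a
  map. The unit of \<open>R\<close> may be a proper projection \<open>P\<close>.\<close>

lemma arveson_extension: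
 fixes phi :: "'a::chilbert_space op => 'b::chilbert_space op"
 assumes R: "csubspace R" "!!T. T \<in> R ==> clin T"
  and P: "P \<in> R" "hadj P = P" "P oo P = P" "!!T. T \<in> R ==> P oo T = T & T oo P = T"
  and phi: "clinear_on R phi" "!!T. T \<in> R ==> clin (phi T)" "acc_pres R phi"
  and phiP: "!!x. Re <<x, phi P $ x>> <= (norm x)^2"
 shows "\<exists>psi. cpc psi & (\<forall>T\<in>R. psi T = phi T)"
proof -
 obtain E :: "'b set" where E: "ortho E" "!!x. (!!e. e \<in> E ==> <<e, x>> = 0) ==> x = 0" using onb_ex by metis
 have Pc: "clin P" using R P by blast
 have phi_add: "phi (S + T) = phi S + phi T" if "S \<in> R" "T \<in> R" for S T
  using phi(1) that by (simp add: clinear_on_def)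
 have phi_scale: "phi (c *C T) = c *C phi T" if "T \<in> R" for c T
  using phi(1) that by (simp add: clinear_on_def)
 have phi0: "phi 0 = 0" using phi_scale[OF P(1), of 0] by simp
 define W where "W = {v :: 'b \<times> 'b => 'a op. finite {p. v p ~= 0} & {p. v p ~= 0} <= E \<times> E & (\<forall>p. clin (v p))}"
 define M where "M = {v\<in>W. \<forall>p. v p \<in> R}"
 \<comment> \<open>The cone tests vectors in the range of \<open>P\<close> only. On \<open>R\<close>
   this changes nothing, but it makes the multiples of \<open>P\<close> on the diagonal cofinal and
   lets \<open>P\<close> take the part of \<open>\<one>\<close>.\<close>
 define q where "q xi = (%p (T :: 'a op). <<P $ xi (fst p), T $ (P $ xi (snd p))>>)" for xi :: "'b => 'a"
 define K where "K = {v :: 'b \<times> 'b => 'a op. finite {p. v p ~= 0} & (\<forall>xi. 0 <= Re (fs (q xi) v))}"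
 define h where "h = (%p T. <<fst p, phi T $ snd p>>)"
 define f where "f v = Re (fs h v)" for v
 have q: "q xi p 0 = 0" "q xi p (S + T) = q xi p S + q xi p T" "q xi p (r *\<^sub>R T) = of_real r * q xi p T" for xi p S T r
  by (simp_all add: q_def cinner_simps blinfun.scaleR_left)
 have h0: "h p 0 = 0" for p by (simp add: h_def phi0)
 have supp_add: "finite {p. (v + w) p ~= 0}" if "finite {p. v p ~= 0}" "finite {p. w p ~= 0}"
  for v w :: "'b \<times> 'b => 'a op"
  by (rule finite_subset[OF _ finite_UnI[OF that]]) auto
 have supp_scale: "finite {p. (r *\<^sub>R v) p ~= 0}" if "finite {p. v p ~= 0}"
  for v :: "'b \<times> 'b => 'a op" and r
  by (rule finite_subset[OF _ that]) auto
 have W: "subspace W"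
  unfolding subspace_def
 proof (intro conjI ballI allI)
  show "0 \<in> W" by (simp add: W_def)
  show "v + w \<in> W" if "v \<in> W" "w \<in> W" for v w
  proof -
   have "{p. (v + w) p ~= 0} <= {p. v p ~= 0} \<union> {p. w p ~= 0}" by auto
   hence "{p. (v + w) p ~= 0} <= E \<times> E" using that unfolding W_def by blast
   thus ?thesis using that supp_add[of v w] unfolding W_def by simp
  qed
  show "r *\<^sub>R v \<in> W" if "v \<in> W" for r v
  proof -
   have "{p. (r *\<^sub>R v) p ~= 0} <= {p. v p ~= 0}" by auto
   hence "{p. (r *\<^sub>R v) p ~= 0} <= E \<times> E" using that unfolding W_def by blast
   thus ?thesis using that supp_scale[of v r] unfolding W_def by simp
  qed
 qed
 have Rs: "r *\<^sub>R T \<in> R" if "T \<in> R" for r T using csubspaceD(3)[OF R(1) that] by (simp add: scaleR_scaleC)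
 have MR: "v + w \<in> M" "r *\<^sub>R v \<in> M" if "v \<in> M" "w \<in> M" for v w r
  using that subspace_add[OF W] subspace_scale[OF W] Rs csubspaceD(2)[OF R(1)] unfolding M_def by auto
 have M: "subspace M" "M <= W"
  using MR subspace_0[OF W] csubspaceD(1)[OF R(1)] by (auto simp: subspace_def M_def)
 have boxed: "\<exists>F. finite F & F <= E & {p. v p ~= 0} <= F \<times> F" if "v \<in> W" for v
 proof (intro exI conjI)
  let ?F = "fst ` {p. v p ~= 0} \<union> snd ` {p. v p ~= 0}"
  show "finite ?F" "?F <= E" using that by (auto simp: W_def)
  show "{p. v p ~= 0} <= ?F \<times> ?F" by force
 qed
 have "\<exists>g. (\<forall>x\<in>W. \<forall>y\<in>W. g (x + y) = g x + g y) & (\<forall>r. \<forall>x\<in>W. g (r *\<^sub>R x) = r * g x) &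
  (\<forall>x\<in>M. g x = f x) & (\<forall>x\<in>W. x \<in> K --> 0 <= (g x :: real))"
 proof (rule positive_extension[OF _ _ W M])
  show "v + w \<in> K" if "v \<in> K" "w \<in> K" for v w
   using that supp_add[of v w] fs_add[of v w "q _"] by (auto simp: K_def q)
  show "r *\<^sub>R v \<in> K" if "0 <= r" "v \<in> K" for v r
   using that supp_scale[of v r] fs_scale[of v "q _" r] by (auto simp: K_def q)
  show "f (v + w) = f v + f w" if "v \<in> M" "w \<in> M" for v w
   unfolding f_def using that
   by (subst fs_add) (auto simp: phi0 M_def W_def h_def phi_add cinner_simps)
  show "f (r *\<^sub>R v) = r * f v" if "v \<in> M" for r v
  proof -
   have "h p (r *\<^sub>R v p) = of_real r * h p (v p)" for p
   proof -
    have "v p \<in> R" using that unfolding M_def by blast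
    thus ?thesis by (simp add: h_def phi_scale scaleR_scaleC cinner_simps)
   qed
   hence "fs h (r *\<^sub>R v) = of_real r * fs h v"
    using that by (intro fs_scale) (auto simp: h0 M_def W_def)
   thus ?thesis by (simp add: f_def)
  qed
  show "0 <= f v" if v: "v \<in> M" "v \<in> K" for v
  proof -
   obtain F where F: "finite F" "F <= E" "{p. v p ~= 0} <= F \<times> F" using boxed[OF subsetD[OF M(2) v(1)]] by metis
   have vR: "v p \<in> R" for p using v unfolding M_def by blast
   have "acc F (%i j. v (i, j))"
    unfolding acc_def
   proof
    fix xi
    have "0 <= Re (fs (q xi) v)" using v by (simp add: K_def)
    also have "fs (q xi) v = (\<Sum>p\<in>F\<times>F. q xi p (v p))" using F by (intro fs_eq) (auto simp: q)
    also have "... = (\<Sum>i\<in>F. \<Sum>j\<in>F. q xi (i, j) (v (i, j)))" by (simp add: sum.cartesian_product)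
    also have "... = mform F (%i j. v (i, j)) xi"
    proof -
     have "q xi (i, j) (v (i, j)) = <<xi i, v (i, j) $ xi j>>" for i j
     proof -
      have "q xi (i, j) (v (i, j)) = <<xi i, (P oo (v (i, j) oo P)) $ xi j>>"
       using hadj_left[OF Pc, of "xi i"] P(2) by (simp add: q_def)
      thus ?thesis using P(4)[OF vR, of "(i, j)"] by simp
     qed
     thus ?thesis by (simp add: mform_def)
    qed
    finally show "0 <= Re (mform F (%i j. v (i, j)) xi)" .
   qed
   hence "acc F (%i j. phi (v (i, j)))" using F(1) vR by (intro acc_presD[OF phi(3)]) auto
   hence "0 <= Re (mform F (%i j. phi (v (i, j))) (%i. i))" unfolding acc_def by blast
   also have "mform F (%i j. phi (v (i, j))) (%i. i) = (\<Sum>p\<in>F\<times>F. h p (v p))"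
    by (simp add: mform_def h_def sum.cartesian_product split_def)
   also have "... = fs h v" using F by (intro fs_eq[symmetric]) (auto simp: h0)
   finally show ?thesis by (simp add: f_def)
  qed
  show "\<exists>m\<in>M. m - w \<in> K" if w: "w \<in> W" for w
  proof -
   obtain F where F: "finite F" "F <= E" "{p. w p ~= 0} <= F \<times> F" using boxed[OF w] by metis
   \<comment> \<open>Large enough for \<open>c\<close> times \<open>P\<close> on the diagonal of
     \<open>F\<close> to dominate \<open>w\<close>.\<close>
   define c where "c = (\<Sum>i\<in>F. \<Sum>j\<in>F. norm (w (i, j)))"
   define m where "m p = (if fst p = snd p & fst p \<in> F then c *\<^sub>R P else 0)" for p :: "'b \<times> 'b"
   have msupp: "{p. m p ~= 0} <= F \<times> F" by (auto simp: m_def split: if_splits)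
   hence mf: "finite {p. m p ~= 0}" using F(1) by (meson finite_SigmaI finite_subset)
   have mR: "m p \<in> R" for p using Rs[OF P(1)] csubspaceD(1)[OF R(1)] by (simp add: m_def)
   have "m \<in> W" using mf msupp F(2) R(2)[OF mR] unfolding W_def by blast
   hence mM: "m \<in> M" using mR by (simp add: M_def)
   have "m - w \<in> K"
    unfolding K_def
   proof (intro CollectI conjI allI)
    have sub: "{p. (m - w) p ~= 0} <= F \<times> F"
    proof -
     have "{p. (m - w) p ~= 0} <= {p. m p ~= 0} \<union> {p. w p ~= 0}" by (auto simp: fun_diff_def)
     thus ?thesis using msupp F(3) by blast
    qed
    thus "finite {p. (m - w) p ~= 0}" using F(1) by (meson finite_SigmaI finite_subset)
    fix xi :: "'b => 'a"
    define S where "S = (\<Sum>i\<in>F. (norm (P $ xi i))^2)"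
    have "fs (q xi) (m - w) = (\<Sum>p\<in>F\<times>F. q xi p ((m - w) p))" using F sub by (intro fs_eq) (auto simp: q)
    also have "... = (\<Sum>i\<in>F. \<Sum>j\<in>F. q xi (i, j) (m (i, j)) - q xi (i, j) (w (i, j)))"
     by (simp add: sum.cartesian_product q_def cinner_simps fun_diff_def split_def)
    also have "... = (\<Sum>i\<in>F. \<Sum>j\<in>F. q xi (i, j) (m (i, j))) - (\<Sum>i\<in>F. \<Sum>j\<in>F. q xi (i, j) (w (i, j)))"
     by (simp add: sum_subtractf)
    also have "(\<Sum>i\<in>F. \<Sum>j\<in>F. q xi (i, j) (m (i, j))) = of_real (c * S)"
    proof -
     have "(\<Sum>j\<in>F. q xi (i, j) (m (i, j))) = of_real (c * (norm (P $ xi i))^2)" if "i \<in> F" for i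
     proof -
      have "q xi (i, j) (m (i, j)) = (if i = j then of_real (c * (norm (P $ xi i))^2) else 0)" for j
      proof -
       have "P $ (P $ x) = P $ x" for x using P(3) by (metis blinfun_compose.rep_eq comp_apply)
       thus ?thesis using that
        by (auto simp: q_def m_def blinfun.scaleR_left cinner_simps cinner_self)
      qed
      thus ?thesis using that F(1) by simp
     qed
     thus ?thesis by (simp add: S_def sum_distrib_left)
    qed
    finally have eq: "fs (q xi) (m - w) = of_real (c * S) - (\<Sum>i\<in>F. \<Sum>j\<in>F. q xi (i, j) (w (i, j)))" .
    have "Re (fs (q xi) (m - w)) = c * S - Re (\<Sum>i\<in>F. \<Sum>j\<in>F. q xi (i, j) (w (i, j)))"
     unfolding eq by simp
    moreover have "Re (\<Sum>i\<in>F. \<Sum>j\<in>F. q xi (i, j) (w (i, j))) <= c * S"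
     unfolding c_def sum_distrib_right Re_sum
    proof (intro sum_mono)
     fix i j assume ij: "i \<in> F" "j \<in> F"
     have n: "(norm (P $ xi i))^2 <= S" if "i \<in> F" for i
      unfolding S_def using F(1) that by (intro member_le_sum) auto
     have "Re (q xi (i, j) (w (i, j))) <= norm (P $ xi i) * norm (w (i, j) $ (P $ xi j))"
      unfolding q_def using Re_cinner_le[of "P $ xi i" "w (i, j) $ (P $ xi j)"] by simp
     also have "... <= norm (P $ xi i) * (norm (w (i, j)) * norm (P $ xi j))"
      by (intro mult_left_mono norm_blinfun) auto
     also have "... = norm (w (i, j)) * (norm (P $ xi i) * norm (P $ xi j))" by simp
     also have "... <= norm (w (i, j)) * S"
     proof (intro mult_left_mono)
      have "0 <= (norm (P $ xi i) - norm (P $ xi j))^2" by simp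
      thus "norm (P $ xi i) * norm (P $ xi j) <= S"
       using n[OF ij(1)] n[OF ij(2)] unfolding power2_diff by linarith
     qed simp
     finally show "Re (q xi (i, j) (w (i, j))) <= norm (w (i, j)) * S" .
    qed
    ultimately show "0 <= Re (fs (q xi) (m - w))" by simp
   qed
   thus ?thesis using mM by blast
  qed
 qed
 then obtain L where L_add: "!!x y. x \<in> W ==> y \<in> W ==> L (x + y) = L x + L y"
  and L_scale: "!!r x. x \<in> W ==> L (r *\<^sub>R x) = r * L x" and Lf: "!!x. x \<in> M ==> L x = f x"
  and L_pos: "!!x. x \<in> W ==> x \<in> K ==> 0 <= (L x :: real)" by blast
 have L_sum: "(\<Sum>a\<in>A. v a) \<in> W & L (\<Sum>a\<in>A. v a) = (\<Sum>a\<in>A. L (v a))"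
  if "!!a. a \<in> A ==> v a \<in> W" for A :: "'z set" and v
  using that
 proof (induction A rule: infinite_finite_induct)
  case (insert a A)
  hence 1: "v a \<in> W" "sum v A \<in> W" "L (sum v A) = (\<Sum>a\<in>A. L (v a))" by auto
  show ?case unfolding sum.insert[OF insert(1,2)] L_add[OF 1(1,2)] 1(3)
   by (intro conjI refl subspace_add[OF W 1(1,2)])
 qed (use subspace_0[OF W] L_scale[of 0 0] in auto)
 define sg where "sg i j T = (%p. if p = (i, j) then T else 0)" for i j :: 'b and T :: "'a op"
 have sgsupp: "{p. sg i j T p ~= 0} <= {(i, j)}" for i j T by (auto simp: sg_def)
 hence sgfin: "finite {p. sg i j T p ~= 0}" for i j T by (rule finite_subset) simp
 have sgW: "sg i j T \<in> W" if "i \<in> E" "j \<in> E" "clin T" for i j T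
  using that sgfin[of i j T] by (auto simp: W_def sg_def split: if_splits)
 have sgM: "sg i j T \<in> M" if "i \<in> E" "j \<in> E" "T \<in> R" for i j T
  using sgW[OF that(1,2) R(2)[OF that(3)]] that csubspaceD(1)[OF R(1)] by (auto simp: M_def sg_def)
 have sgadd: "sg i j (S + T) = sg i j S + sg i j T" for i j S T by (auto simp: sg_def fun_eq_iff)
 have sgscale: "sg i j (r *\<^sub>R T) = r *\<^sub>R sg i j T" for i j r T by (auto simp: sg_def fun_eq_iff)
 have sgfs: "fs g (sg i j T) = g (i, j) T" if "!!p. g p 0 = 0" for g i j T
  using fs_eq[of "{(i, j)}" "sg i j T" g] sgsupp[of i j T] that by (simp add: sg_def)
 \<comment> \<open>A complex functional is recovered from its real part by
   \<open>f T = Re (f T) - \<i> * Re (f (\<i> *C T))\<close>.\<close>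
 define ka where "ka T i j = of_real (L (sg i j T)) - \<i> * of_real (L (sg i j (\<i> *C T)))" for T i j
 have Lc: "L (sg i j (c *C T)) = Re c * L (sg i j T) + Im c * L (sg i j (\<i> *C T))"
  if "i \<in> E" "j \<in> E" "clin T" for i j T c
 proof -
  have "c *C T = Re c *\<^sub>R T + Im c *\<^sub>R (\<i> *C T)"
   unfolding scaleR_scaleC scaleC_scaleC scaleC_add_left[symmetric]
   by (subst complex_eq) (simp add: mult.commute)
  thus ?thesis using that sgW by (simp add: sgadd sgscale L_add L_scale subspace_scale[OF W])
 qed
 have Reka: "Re (c * ka T i j) = L (sg i j (c *C T))" if "i \<in> E" "j \<in> E" "clin T" for i j T c
  using Lc[OF that, of c] by (simp add: ka_def)
 have "\<exists>psi. cpc psi & (\<forall>T. clin T --> (\<forall>i\<in>E. \<forall>j\<in>E. <<i, psi T $ j>> = ka T i j) &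
   (\<forall>x. (\<forall>i\<in>E. <<i, x>> = 0) --> psi T $ x = 0 & hadj (psi T) $ x = 0))"
 proof (rule kernel_cp)
  show "ka (S + T) i j = ka S i j + ka T i j" if "clin S" "clin T" "i \<in> E" "j \<in> E" for S T i j
   using that sgW by (simp add: ka_def scaleC_add_right sgadd L_add algebra_simps)
  show "ka (c *C T) i j = c * ka T i j" if "clin T" "i \<in> E" "j \<in> E" for c T i j
   using Lc[OF that(2,3,1), of c] Lc[OF that(2,3,1), of "\<i> * c"]
   by (simp add: ka_def scaleC_scaleC complex_eq_iff)
  show "0 <= Re (\<Sum>a<n. \<Sum>b<n. ka (C a b) (io a) (io b))"
   if C: "!!a b. a < n ==> b < n ==> clin (C a b)" "acc {..<n::nat} C" "!!a. a < n ==> io a \<in> E" for n C io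
  proof -
   let ?v = "%p. sg (io (fst p)) (io (snd p)) (C (fst p) (snd p))"
   have vW: "?v p \<in> W" if "p \<in> {..<n} \<times> {..<n}" for p using that C by (auto intro!: sgW)
   have "Re (\<Sum>a<n. \<Sum>b<n. ka (C a b) (io a) (io b)) = (\<Sum>a<n. \<Sum>b<n. L (sg (io a) (io b) (C a b)))"
    unfolding Re_sum using Reka[of _ _ _ 1] C by (intro sum.cong refl) simp
   also have "... = (\<Sum>p\<in>{..<n} \<times> {..<n}. L (?v p))"
    by (simp add: sum.cartesian_product split_def)
   also have "... = L (\<Sum>p\<in>{..<n} \<times> {..<n}. ?v p)" by (rule conjunct2[OF L_sum, symmetric]) (rule vW)
   finally have 1: "Re (\<Sum>a<n. \<Sum>b<n. ka (C a b) (io a) (io b)) = L (\<Sum>p\<in>{..<n} \<times> {..<n}. ?v p)" .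
   have "(\<Sum>p\<in>{..<n} \<times> {..<n}. ?v p) \<in> K"
    unfolding K_def
   proof (intro CollectI conjI allI)
    have fsum: "finite {p. (\<Sum>p\<in>{..<n} \<times> {..<n}. ?v p) p ~= 0} &
      fs (q xi) (\<Sum>p\<in>{..<n} \<times> {..<n}. ?v p) = (\<Sum>p\<in>{..<n} \<times> {..<n}. fs (q xi) (?v p))" for xi
     using sgfin by (intro fs_sum) (auto simp: q)
    thus "finite {p. (\<Sum>p\<in>{..<n} \<times> {..<n}. ?v p) p ~= 0}" by blast
    fix xi
    have "fs (q xi) (\<Sum>p\<in>{..<n} \<times> {..<n}. ?v p) = (\<Sum>p\<in>{..<n} \<times> {..<n}. fs (q xi) (?v p))"
     using fsum by blast
    also have "... = (\<Sum>a<n. \<Sum>b<n. q xi (io a, io b) (C a b))"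
     by (simp add: sgfs q sum.cartesian_product split_def)
    also have "... = mform {..<n} C (%a. P $ xi (io a))" by (simp add: q_def mform_def)
    finally show "0 <= Re (fs (q xi) (\<Sum>p\<in>{..<n} \<times> {..<n}. ?v p))" using C(2) by (simp add: acc_def)
   qed
   moreover have "(\<Sum>p\<in>{..<n} \<times> {..<n}. ?v p) \<in> W" by (rule conjunct1[OF L_sum]) (rule vW)
   ultimately show ?thesis unfolding 1 by (intro L_pos)
  qed
  show "Re (\<Sum>i\<in>F. \<Sum>j\<in>F. cnj (c i) * c j * ka \<one> i j) <= (norm (\<Sum>i\<in>F. c i *C i))^2"
   if F: "finite F" "F <= E" for F c
  proof -
   define cc where "cc p = cnj (c (fst p)) * c (snd p)" for p
   let ?v = "%T p. sg (fst p) (snd p) (cc p *C T)"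
   have vW: "?v T p \<in> W" if "p \<in> F \<times> F" "clin T" for p T using that F by (auto intro!: sgW)
   have "Re (\<Sum>i\<in>F. \<Sum>j\<in>F. cnj (c i) * c j * ka \<one> i j)
     = (\<Sum>i\<in>F. \<Sum>j\<in>F. L (sg i j ((cnj (c i) * c j) *C \<one>)))"
    unfolding Re_sum using F by (intro sum.cong refl Reka) auto
   also have "... = (\<Sum>p\<in>F\<times>F. L (?v \<one> p))" by (simp add: sum.cartesian_product split_def cc_def)
   \<comment> \<open>The cone cannot tell \<open>\<one>\<close> from \<open>P\<close>: the matrix
     built from \<open>P - \<one>\<close> lies in it, so replacing \<open>\<one>\<close> by
     \<open>P\<close> does not decrease the functional, and for \<open>P\<close> the assumption
     \<open>phiP\<close> gives the bound.\<close>
   also have "... = (\<Sum>p\<in>F\<times>F. L (?v P p)) - L (\<Sum>p\<in>F\<times>F. ?v (P - \<one>) p)"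
   proof -
    have "L (?v P p) = L (?v \<one> p) + L (?v (P - \<one>) p)" if "p \<in> F \<times> F" for p
     using vW[OF that, of \<one>] vW[OF that, of "P - \<one>"] Pc
     by (subst L_add[symmetric]) (simp_all flip: sgadd scaleC_add_right)
    moreover have "L (\<Sum>p\<in>F\<times>F. ?v (P - \<one>) p) = (\<Sum>p\<in>F\<times>F. L (?v (P - \<one>) p))"
     by (rule conjunct2[OF L_sum]) (use Pc in \<open>auto intro!: vW\<close>)
    ultimately show ?thesis by (simp add: sum.distrib)
   qed
   also have "... <= (\<Sum>p\<in>F\<times>F. L (?v P p))"
   proof -
    have "(\<Sum>p\<in>F\<times>F. ?v (P - \<one>) p) \<in> K"
     unfolding K_def
    proof (intro CollectI conjI allI)
     have fsum: "finite {p. (\<Sum>p\<in>F\<times>F. ?v (P - \<one>) p) p ~= 0} &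
       fs (q xi) (\<Sum>p\<in>F\<times>F. ?v (P - \<one>) p) = (\<Sum>p\<in>F\<times>F. fs (q xi) (?v (P - \<one>) p))" for xi
      using sgfin F by (intro fs_sum) (auto simp: q)
     thus "finite {p. (\<Sum>p\<in>F\<times>F. ?v (P - \<one>) p) p ~= 0}" by blast
     fix xi
     have PP: "P $ (P $ x) = P $ x" for x using P(3) by (metis blinfun_compose.rep_eq comp_apply)
     have "fs (q xi) (?v (P - \<one>) p) = 0" for p
      by (simp add: sgfs q) (simp add: q_def PP)
     thus "0 <= Re (fs (q xi) (\<Sum>p\<in>F\<times>F. ?v (P - \<one>) p))" using fsum by simp
    qed
    moreover have "(\<Sum>p\<in>F\<times>F. ?v (P - \<one>) p) \<in> W"
     by (rule conjunct1[OF L_sum]) (use Pc in \<open>auto intro!: vW\<close>)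
    ultimately show ?thesis using L_pos by simp
   qed
   also have "... = (\<Sum>p\<in>F\<times>F. Re <<fst p, phi (cc p *C P) $ snd p>>)"
   proof (intro sum.cong refl)
    fix p assume "p \<in> F \<times> F"
    hence "?v P p \<in> M" using F P(1) csubspaceD(3)[OF R(1)] by (auto intro!: sgM)
    thus "L (?v P p) = Re <<fst p, phi (cc p *C P) $ snd p>>"
     by (simp add: Lf f_def sgfs h0) (simp add: h_def)
   qed
   also have "... = Re <<\<Sum>i\<in>F. c i *C i, phi P $ (\<Sum>i\<in>F. c i *C i)>>"
    unfolding clin_sum[OF phi(2)[OF P(1)]] cinner_sum_sum
    by (simp add: sum.cartesian_product split_def phi_scale[OF P(1)] cinner_simps cc_def)
   also have "... <= (norm (\<Sum>i\<in>F. c i *C i))^2" by (rule phiP)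
   finally show ?thesis .
  qed
 qed
 then obtain psi where psi: "cpc psi" "!!T i j. clin T ==> i \<in> E ==> j \<in> E ==> <<i, psi T $ j>> = ka T i j" by blast
 have "psi T = phi T" if T: "T \<in> R" for T
 proof (rule op_eqI_family[of _ _ E "%e. e"])
  show "clin (psi T)" "clin (phi T)" using R(2)[OF T] psi(1) phi(2)[OF T] by auto
  show "<<i, psi T $ j>> = <<i, phi T $ j>>" if "i \<in> E" "j \<in> E" for i j
  proof -
   have "L (sg i j (c *C T)) = Re (c * <<i, phi T $ j>>)" for c
    using sgM[OF that csubspaceD(3)[OF R(1) T, of c]]
    by (simp add: Lf f_def sgfs h0) (simp add: h_def phi_scale[OF T] cinner_simps)
   from this[of 1] this[of \<i>] have "ka T i j = <<i, phi T $ j>>" by (simp add: ka_def complex_eq_iff)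
   thus ?thesis using psi(2)[OF R(2)[OF T] that] by simp
  qed
 next
  fix x assume "!!i. i \<in> E ==> <<i, x>> = 0"
  hence "x = 0" by (rule E(2))
  thus "psi T $ x = 0 & hadj (psi T) $ x = 0" "phi T $ x = 0 & hadj (phi T) $ x = 0" by simp_all
 qed
 thus ?thesis using psi(1) by blast
qed

text \<open>The reason is that \<open>\<parallel>P - t C\<parallel>\<^sup>2 \<le> 1 + O(t\<^sup>2)\<close> as \<open>t \<rightarrow> 0\<^sup>+\<close> for accretive \<open>C\<close>.\<close>

lemma completely_isometric_acc_pres:
 fixes phi :: "'a::chilbert_space op => 'b::chilbert_space op"
 assumes R: "csubspace R" "!!T. T \<in> R ==> clin T"
  and P: "P \<in> R" "hadj P = P" "P oo P = P" "!!T. T \<in> R ==> P oo T = T & T oo P = T"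
  and phi: "completely_isometric R phi" "!!T. T \<in> R ==> clin (phi T)"
  and Q: "hadj (phi P) = phi P" "phi P oo phi P = phi P"
   "!!T. T \<in> R ==> phi P oo phi T = phi T & phi T oo phi P = phi T"
 shows "acc_pres R phi"
 unfolding acc_pres_def
proof (intro allI impI)
 fix n C assume "(\<forall>i<n. \<forall>j<n. C i j \<in> R) & acc {..<n::nat} C"
 hence C: "!!i j. i < n ==> j < n ==> C i j \<in> R" and acc: "acc {..<n} C" by auto
 have Pc: "clin P" using R P by blast
 have lin: "phi (S - T) = phi S - phi T" "phi (r *\<^sub>R S) = r *\<^sub>R phi S" "phi 0 = 0" if "S \<in> R" "T \<in> R" for S T r
 proof -
  have a: "!!S T. S \<in> R ==> T \<in> R ==> phi (S + T) = phi S + phi T" "!!c T. T \<in> R ==> phi (c *C T) = c *C phi T"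
   using phi(1) by (auto simp: completely_isometric_def clinear_on_def)
  show "phi (r *\<^sub>R S) = r *\<^sub>R phi S" "phi 0 = 0" using a(2)[OF that(1)] a(2)[OF that(1), of 0] by (simp_all add: scaleR_scaleC)
  show "phi (S - T) = phi S - phi T"
   using a(1)[OF that(1) csubspaceD(4)[OF R(1) that(2)]] a(2)[OF that(2), of "-1"] by simp
 qed
 have phiij: "phi (C i j) $ (phi P $ x) = phi (C i j) $ x" "<<phi P $ y, phi (C i j) $ x>> = <<y, phi (C i j) $ x>>"
  if "i < n" "j < n" for i j x y
 proof -
  note * = Q(3)[OF C[OF that]]
  show "phi (C i j) $ (phi P $ x) = phi (C i j) $ x" using * by (metis blinfun_compose.rep_eq comp_apply)
  have "<<phi P $ y, phi (C i j) $ x>> = <<y, phi P $ (phi (C i j) $ x)>>"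
   using hadj_left[OF phi(2)[OF P(1)], of y] Q(1) by simp
  thus "<<phi P $ y, phi (C i j) $ x>> = <<y, phi (C i j) $ x>>"
   using * by (metis blinfun_compose.rep_eq comp_apply)
 qed
 have Cij: "<<P $ y, C i j $ x>> = <<y, C i j $ x>>" if "i < n" "j < n" for i j x y
  using hadj_left[OF Pc, of y "C i j $ x"] P(2) P(4)[OF C[OF that]]
  by (metis blinfun_compose.rep_eq comp_apply)
 define c where "c = mat_norm n C"
 define D where "D t i j = (if i = j then P else 0) - t *\<^sub>R C i j" for t :: real and i j
 have DR: "D t i j \<in> R" if "i < n" "j < n" for t i j
  using C[OF that] P(1) csubspaceD(1)[OF R(1)] csubspaceD(3)[OF R(1) C[OF that], of "of_real t"]
  by (auto simp: D_def scaleR_scaleC intro!: csubspaceD(4,5)[OF R(1)])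
 have Dapp: "(\<Sum>j<n. D t i j $ xi j) = P $ xi i - t *\<^sub>R (\<Sum>j<n. C i j $ xi j)" if "i < n" for t i xi
 proof -
  have "(\<Sum>j<n. D t i j $ xi j) = (\<Sum>j<n. if i = j then P $ xi j else 0) - (\<Sum>j<n. t *\<^sub>R C i j $ xi j)"
   unfolding sum_subtractf[symmetric]
   by (intro sum.cong refl) (simp add: D_def blinfun.scaleR_left)
  thus ?thesis using that by (simp add: scaleR_sum_right)
 qed
 have phiDapp: "(\<Sum>j<n. phi (D t i j) $ xi j) = phi P $ xi i - t *\<^sub>R (\<Sum>j<n. phi (C i j) $ xi j)" if "i < n" for t i xi
 proof -
  have "phi (D t i j) = (if i = j then phi P else 0) - t *\<^sub>R phi (C i j)" if "j < n" for j
  proof -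
   note Cij = C[OF \<open>i < n\<close> that]
   have tC: "t *\<^sub>R C i j \<in> R" using csubspaceD(3)[OF R(1) Cij, of "of_real t"] by (simp add: scaleR_scaleC)
   show ?thesis using lin(1)[OF _ tC] lin(2)[OF Cij Cij] lin(3)[OF Cij Cij] P(1) csubspaceD(1)[OF R(1)]
    by (simp add: D_def)
  qed
  hence "(\<Sum>j<n. phi (D t i j) $ xi j) = (\<Sum>j<n. if i = j then phi P $ xi j else 0) - (\<Sum>j<n. t *\<^sub>R phi (C i j) $ xi j)"
   unfolding sum_subtractf[symmetric]
   by (intro sum.cong refl) (simp add: blinfun.scaleR_left)
  thus ?thesis using that by (simp add: scaleR_sum_right)
 qed
 have Db: "mat_norm n (D t) <= sqrt (1 + t^2 * c^2)" if t: "0 < t" for t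
 proof (rule mat_norm_le)
  show "mbound {..<n} (D t) (sqrt (1 + t^2 * c^2))"
   unfolding mbound_def
  proof
   fix xi :: "nat => 'a"
   define w where "w i = (\<Sum>j<n. C i j $ xi j)" for i
   have m: "(\<Sum>i<n. <<P $ xi i, w i>>) = mform {..<n} C xi"
    unfolding w_def mform_def cinner_sum_right by (intro sum.cong refl Cij) auto
   have "(\<Sum>i<n. (norm (\<Sum>j<n. D t i j $ xi j))^2)
     = (\<Sum>i<n. (norm (P $ xi i))^2 - 2 * t * Re <<P $ xi i, w i>> + t^2 * (norm (w i))^2)"
    by (intro sum.cong refl) (simp add: Dapp w_def[symmetric] norm_diff_sq cinner_simps power_mult_distrib)
   also have "... = (\<Sum>i<n. (norm (P $ xi i))^2) - 2 * t * Re (mform {..<n} C xi) + t^2 * (\<Sum>i<n. (norm (w i))^2)"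
    unfolding m[symmetric] by (simp add: sum.distrib sum_subtractf sum_distrib_left)
   also have "... <= (\<Sum>i<n. (norm (xi i))^2) - 0 + t^2 * (c^2 * (\<Sum>i<n. (norm (xi i))^2))"
   proof (intro add_mono diff_mono sum_mono mult_left_mono)
    fix i
    have "(norm (P $ xi i))^2 = Re <<xi i, P $ xi i>>"
     unfolding Re_cinner_self[symmetric] using hadj_left[OF Pc, of "xi i" "P $ xi i"] P(2,3)
     by (metis blinfun_compose.rep_eq comp_apply)
    also have "... <= norm (xi i) * norm (P $ xi i)" using Re_cinner_le[of "xi i" "P $ xi i"] by simp
    finally have "norm (P $ xi i) * norm (P $ xi i) <= norm (xi i) * norm (P $ xi i)"
     by (simp add: power2_eq_square)
    hence "norm (P $ xi i) <= norm (xi i)" by (cases "P $ xi i = 0") (auto simp: mult_le_cancel_right)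
    thus "(norm (P $ xi i))^2 <= (norm (xi i))^2" by (intro power_mono) auto
   next
    show "0 <= 2 * t * Re (mform {..<n} C xi)" using t acc unfolding acc_def by simp
    show "(\<Sum>i<n. (norm (w i))^2) <= c^2 * (\<Sum>i<n. (norm (xi i))^2)"
     using mbound_mat_norm[of n C] unfolding mbound_def w_def c_def by blast
   qed auto
   also have "... = (sqrt (1 + t^2 * c^2))^2 * (\<Sum>i<n. (norm (xi i))^2)"
    by (simp add: add_nonneg_nonneg algebra_simps)
   finally show "(\<Sum>i<n. (norm (\<Sum>j<n. D t i j $ xi j))^2) <= (sqrt (1 + t^2 * c^2))^2 * (\<Sum>i<n. (norm (xi i))^2)" .
  qed
 qed simp
 show "acc {..<n} (%i j. phi (C i j))"
  unfolding acc_def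
 proof
  fix eta :: "nat => 'b"
  define m where "m = Re (mform {..<n} (%i j. phi (C i j)) eta)"
  define S where "S = (\<Sum>i<n. (norm (phi P $ eta i))^2)"
  have S0: "0 <= S" by (simp add: S_def sum_nonneg)
  \<comment> \<open>The transferred norm bound is tested at the vectors
    \<open>phi P $ eta i\<close>; the zeroth-order terms \<open>S\<close> cancel, and what remains
    is divided by \<open>t\<close>.\<close>
  have *: "- 2 * m <= t * (c^2 * S)" if t: "0 < t" for t
  proof -
   define w where "w i = (\<Sum>j<n. phi (C i j) $ eta j)" for i
   have w': "(\<Sum>j<n. phi (C i j) $ (phi P $ eta j)) = w i" if "i < n" for i
    unfolding w_def using that phiij(1) by (intro sum.cong refl) auto
   have mm: "m = (\<Sum>i<n. Re <<phi P $ eta i, w i>>)"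
    unfolding m_def mform_def w_def cinner_sum_right Re_sum using phiij(2) by (intro sum.cong refl) auto
   have PP: "phi P $ (phi P $ x) = phi P $ x" for x using Q(2) by (metis blinfun_compose.rep_eq comp_apply)
   have "mat_norm n (%i j. phi (D t i j)) = mat_norm n (D t)"
    using phi(1) DR unfolding completely_isometric_def by blast
   hence "mbound {..<n} (%i j. phi (D t i j)) (sqrt (1 + t^2 * c^2))"
    using mbound_mono[OF mbound_mat_norm mat_norm_nonneg, of n "%i j. phi (D t i j)"] Db[OF t] by simp
   hence "(\<Sum>i<n. (norm (\<Sum>j<n. phi (D t i j) $ (phi P $ eta j)))^2) <= (1 + t^2 * c^2) * S"
    unfolding mbound_def S_def by (simp add: add_nonneg_nonneg)
   also have "(\<Sum>i<n. (norm (\<Sum>j<n. phi (D t i j) $ (phi P $ eta j)))^2)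
     = (\<Sum>i<n. (norm (phi P $ eta i))^2 - 2 * t * Re <<phi P $ eta i, w i>> + t^2 * (norm (w i))^2)"
    by (intro sum.cong refl) (simp add: phiDapp w' PP norm_diff_sq cinner_simps power_mult_distrib)
   also have "... = S - 2 * t * m + t^2 * (\<Sum>i<n. (norm (w i))^2)"
    unfolding mm S_def by (simp add: sum.distrib sum_subtractf sum_distrib_left)
   finally have "- 2 * t * m + t^2 * (\<Sum>i<n. (norm (w i))^2) <= t^2 * (c^2 * S)"
    by (simp add: algebra_simps)
   moreover have "0 <= t^2 * (\<Sum>i<n. (norm (w i))^2)" by (simp add: sum_nonneg)
   ultimately have "t * (- 2 * m) <= t * (t * (c^2 * S))" by (simp add: power2_eq_square algebra_simps)
   thus ?thesis using t by (subst (asm) mult_le_cancel_left_pos)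
  qed
  have "- 2 * m <= 0"
  proof (rule field_le_epsilon)
   fix e :: real assume e: "0 < e"
   have p: "0 < c^2 * S + 1" using S0 by (simp add: add_nonneg_pos)
   have "- 2 * m <= (e / (c^2 * S + 1)) * (c^2 * S)" using e p by (intro *) simp
   also have "... <= (e / (c^2 * S + 1)) * (c^2 * S + 1)" using e p by (intro mult_left_mono) auto
   also have "... = e" using p by simp
   finally show "- 2 * m <= 0 + e" by simp
  qed
  thus "0 <= Re (mform {..<n} (%i j. phi (C i j)) eta)" by (simp add: m_def)
 qed
qed

section \<open>Rigid completely positive idempotents\<close>

lemma compact_Pi_UNIV:
 fixes K :: "'i => 'b::topological_space set"
 assumes "!!i. compact (K i)"
 shows "compact {f. \<forall>i. f i \<in> K i}"
proof -
 have "compactin (product_topology (%i. euclidean) UNIV) (PiE UNIV K)"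
  unfolding compactin_PiE using assms by simp
 moreover have "PiE UNIV K = {f. \<forall>i. f i \<in> K i}" by auto
 ultimately show ?thesis by (simp add: euclidean_product_topology)
qed

text \<open>A convergent subnet in a compact set, expressed by a finer filter.\<close>

lemma cluster_filter:
 fixes f :: "'a => 'b::topological_space"
 assumes "compact U" "F ~= bot" "\<forall>\<^sub>F x in F. f x \<in> U"
 obtains y H where "y \<in> U" "H ~= bot" "H <= F" "(f ~~> y) H"
proof -
 have "filtermap f F ~= bot" "eventually (%x. x \<in> U) (filtermap f F)"
  using assms by (auto simp: filtermap_bot_iff eventually_filtermap)
 then obtain y where y: "y \<in> U" "inf (nhds y) (filtermap f F) ~= bot"
  using assms(1) unfolding compact_filter by blast
 define H where "H = inf F (filtercomap f (nhds y))"
 have "H ~= bot"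
 proof
  assume "H = bot"
  hence "eventually (%_. False) H" by simp
  then obtain P Q where P: "eventually P F" and Q: "eventually Q (filtercomap f (nhds y))"
   and PQ: "!!x. P x ==> Q x ==> False"
   unfolding H_def eventually_inf by blast
  obtain R where R: "eventually R (nhds y)" "!!x. R (f x) ==> Q x" using Q unfolding eventually_filtercomap by blast
  have "eventually (%y. \<not> R y) (filtermap f F)"
   unfolding eventually_filtermap using P by (rule eventually_mono) (use PQ R(2) in blast)
  hence "eventually (%_. False) (inf (nhds y) (filtermap f F))"
   unfolding eventually_inf using R(1) by blast
  thus False using y(2) by (simp add: eventually_False)
 qed
 moreover have "H <= F" by (simp add: H_def)
 moreover have "(f ~~> y) H"
  by (rule filterlim_mono[OF filterlim_filtercomap order.refl]) (simp add: H_def)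
 ultimately show ?thesis using y(1) that by blast
qed

text \<open>All matrix coefficients of a contraction lie in fixed discs, so Tychonoff's theorem
  gives a cluster point of coefficient families. Positivity survives the limit, and
  \<open>kernel_cp\<close> turns the limiting coefficients into a map.\<close>

lemma cpc_cluster:
 fixes \<G> :: "('a::chilbert_space op => 'b::chilbert_space op) filter"
 assumes "\<G> ~= bot" and cpc: "\<forall>\<^sub>F phi in \<G>. cpc phi"
 shows "\<exists>psi \<H>. cpc psi & \<H> ~= bot & \<H> <= \<G> &
  (\<forall>T x y. clin T --> ((%phi. <<x, phi T $ y>>) ~~> <<x, psi T $ y>>) \<H>)"
proof -
 \<comment> \<open>Off the complex-linear operators the coordinate is set to \<open>0\<close>, so
   that every coordinate stays in its disc.\<close>
 define f :: "('a op => 'b op) => 'a op \<times> 'b \<times> 'b => complex"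
  where "f phi = (%(T, x, y). if clin T then <<x, phi T $ y>> else 0)" for phi
 define K where "K = (%(T::'a op, x::'b, y::'b). cball (0::complex) (norm x * (norm T * norm y)))"
 have "compact {g. \<forall>i. g i \<in> K i}" by (rule compact_Pi_UNIV) (auto simp: K_def)
 moreover have "\<forall>\<^sub>F phi in \<G>. f phi \<in> {g. \<forall>i. g i \<in> K i}"
  using cpc
 proof (rule eventually_mono)
  fix phi :: "'a op => 'b op" assume phi: "cpc phi"
  have "cmod <<x, phi T $ y>> <= norm x * (norm T * norm y)" if "clin T" for T x y
  proof -
   have "cmod <<x, phi T $ y>> <= norm x * norm (phi T $ y)" by (rule cauchy_schwarz)
   also have "norm (phi T $ y) <= norm T * norm y"
    using norm_blinfun[of "phi T" y] mult_right_mono[OF cpc_norm[OF phi that], of "norm y"] by simp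
   finally show ?thesis by (simp add: mult_left_mono)
  qed
  thus "f phi \<in> {g. \<forall>i. g i \<in> K i}" by (auto simp: f_def K_def)
 qed
 ultimately obtain g \<H> where \<H>: "\<H> ~= bot" "\<H> <= \<G>" "(f ~~> g) \<H>"
  by (rule cluster_filter[OF _ assms(1)])
 define ka where "ka T x y = g (T, x, y)" for T x y
 have coord: "((%phi. f phi i) ~~> g i) \<H>" for i
 proof -
  have "continuous_on UNIV (%h::'a op \<times> 'b \<times> 'b => complex. h i)" by simp
  hence "((%h. h i) ~~> g i) (nhds g)"
   unfolding continuous_on_def using tendsto_at_iff_tendsto_nhds[of "%h. h i" g] by simp
  thus ?thesis by (rule filterlim_compose[OF _ \<H>(3)])
 qed
 have lim: "((%phi. <<x, phi T $ y>>) ~~> ka T x y) \<H>" if "clin T" for T x y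
  using coord[of "(T, x, y)"] that by (simp add: f_def ka_def)
 have ev: "\<forall>\<^sub>F phi in \<H>. cpc phi" using cpc \<H>(2) by (simp add: filter_leD)
 have "\<exists>psi. cpc psi & (\<forall>T. clin T --> (\<forall>x\<in>UNIV. \<forall>y\<in>UNIV. <<x, psi T $ y>> = ka T x y) &
   (\<forall>x. (\<forall>i\<in>UNIV. <<i, x>> = 0) --> psi T $ x = 0 & hadj (psi T) $ x = 0))"
 proof (rule kernel_cp)
  show "ka (S + T) x y = ka S x y + ka T x y" if "clin S" "clin T" for S T x y
  proof (rule tendsto_unique[OF \<H>(1)])
   show "((%phi. <<x, phi (S + T) $ y>>) ~~> ka (S + T) x y) \<H>" using that by (intro lim) auto
   have "\<forall>\<^sub>F phi in \<H>. <<x, phi S $ y>> + <<x, phi T $ y>> = <<x, phi (S + T) $ y>>"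
    using ev by (rule eventually_mono) (simp add: cpc_add that cinner_simps)
   thus "((%phi. <<x, phi (S + T) $ y>>) ~~> ka S x y + ka T x y) \<H>"
    by (rule Lim_transform_eventually[rotated]) (intro tendsto_intros lim that)
  qed
  show "ka (c *C T) x y = c * ka T x y" if "clin T" for c T x y
  proof (rule tendsto_unique[OF \<H>(1)])
   show "((%phi. <<x, phi (c *C T) $ y>>) ~~> ka (c *C T) x y) \<H>" using that by (intro lim) auto
   have "\<forall>\<^sub>F phi in \<H>. c * <<x, phi T $ y>> = <<x, phi (c *C T) $ y>>"
    using ev by (rule eventually_mono) (simp add: cpc_scale that cinner_simps)
   thus "((%phi. <<x, phi (c *C T) $ y>>) ~~> c * ka T x y) \<H>"
    by (rule Lim_transform_eventually[rotated]) (intro tendsto_intros lim that)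
  qed
  show "0 <= Re (\<Sum>a<n. \<Sum>b<n. ka (C a b) (io a) (io b))"
   if C: "!!a b. a < n ==> b < n ==> clin (C a b)" "acc {..<n::nat} C" for n C and io :: "nat => 'b"
  proof (rule tendsto_lowerbound[OF _ _ \<H>(1)])
   show "((%phi. Re (\<Sum>a<n. \<Sum>b<n. <<io a, phi (C a b) $ io b>>))
     ~~> Re (\<Sum>a<n. \<Sum>b<n. ka (C a b) (io a) (io b))) \<H>"
    using C by (intro tendsto_intros lim) auto
   show "\<forall>\<^sub>F phi in \<H>. 0 <= Re (\<Sum>a<n. \<Sum>b<n. <<io a, phi (C a b) $ io b>>)"
    using ev
   proof (rule eventually_mono)
    fix phi :: "'a op => 'b op" assume phi: "cpc phi"
    have "acc {..<n} (%i j. phi (C i j))" using C by (intro cpc_acc[OF phi]) auto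
    thus "0 <= Re (\<Sum>a<n. \<Sum>b<n. <<io a, phi (C a b) $ io b>>)" unfolding acc_def mform_def by blast
   qed
  qed
  show "Re (\<Sum>i\<in>F. \<Sum>j\<in>F. cnj (c i) * c j * ka \<one> i j) <= (norm (\<Sum>i\<in>F. c i *C i))^2" for F c
  proof (rule tendsto_upperbound[OF _ _ \<H>(1)])
   show "((%phi. Re (\<Sum>i\<in>F. \<Sum>j\<in>F. cnj (c i) * c j * <<i, phi \<one> $ j>>))
     ~~> Re (\<Sum>i\<in>F. \<Sum>j\<in>F. cnj (c i) * c j * ka \<one> i j)) \<H>"
    by (intro tendsto_intros lim) auto
   show "\<forall>\<^sub>F phi in \<H>. Re (\<Sum>i\<in>F. \<Sum>j\<in>F. cnj (c i) * c j * <<i, phi \<one> $ j>>) <= (norm (\<Sum>i\<in>F. c i *C i))^2"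
    using ev
   proof (rule eventually_mono)
    fix phi :: "'a op => 'b op" assume phi: "cpc phi"
    have "(\<Sum>i\<in>F. \<Sum>j\<in>F. cnj (c i) * c j * <<i, phi \<one> $ j>>)
      = <<\<Sum>i\<in>F. c i *C i, phi \<one> $ (\<Sum>i\<in>F. c i *C i)>>"
     using cpc_clin[OF phi, of \<one>] by (simp add: clin_sum cinner_sum_sum)
    thus "Re (\<Sum>i\<in>F. \<Sum>j\<in>F. cnj (c i) * c j * <<i, phi \<one> $ j>>) <= (norm (\<Sum>i\<in>F. c i *C i))^2"
     using cpc_id[OF phi] by (simp del: Re_sum)
   qed
  qed
 qed
 then obtain psi where "cpc psi" "!!T x y. clin T ==> <<x, psi T $ y>> = ka T x y" by auto
 thus ?thesis using \<H>(1,2) lim by (intro exI[of _ psi] exI[of _ \<H>]) simp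
qed

lemma weak_limit_eq:
 fixes psi :: "'a::chilbert_space op" and \<H> :: "('c => 'a op) filter"
 assumes "\<H> ~= bot" "!!x y. ((%phi. <<x, phi T $ y>>) ~~> <<x, psi $ y>>) \<H>" "\<forall>\<^sub>F phi in \<H>. phi T = S"
 shows "psi = S"
proof (rule blinfun_eqI, rule cinner_eqI)
 fix x y
 have "\<forall>\<^sub>F phi in \<H>. <<x, phi T $ y>> = <<x, S $ y>>" using assms(3) by (rule eventually_mono) simp
 hence "((%phi. <<x, phi T $ y>>) ~~> <<x, S $ y>>) \<H>" by (rule tendsto_eventually)
 thus "<<x, psi $ y>> = <<x, S $ y>>" using tendsto_unique[OF assms(1,2)] by blast
qed

lemma weak_limit_norm:
 fixes psi :: "'a::chilbert_space op" and \<H> :: "('c => 'a op) filter"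
 assumes "\<H> ~= bot" "!!x y. ((%phi. <<x, phi T $ y>>) ~~> <<x, psi $ y>>) \<H>" "\<forall>\<^sub>F phi in \<H>. norm (phi T) <= r"
 shows "norm psi <= r"
proof -
 obtain phi :: "'c => 'a op" where "norm (phi T) <= r" using eventually_happens'[OF assms(1,3)] by blast
 hence r: "0 <= r" using norm_ge_zero order.trans by blast
 show ?thesis
 proof (rule norm_blinfun_bound[OF r], rule norm_leI_cinner)
  fix x y
  show "cmod <<x, psi $ y>> <= r * norm y * norm x"
  proof (rule tendsto_upperbound[OF tendsto_norm[OF assms(2)] _ assms(1)])
   show "\<forall>\<^sub>F phi in \<H>. cmod <<x, phi T $ y>> <= r * norm y * norm x"
    using assms(3)
   proof (rule eventually_mono)
    fix phi :: "'c => 'a op" assume "norm (phi T) <= r"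
    hence "norm (phi T $ y) <= r * norm y"
     using norm_blinfun[of "phi T" y] mult_right_mono[of "norm (phi T)" r "norm y"] by simp
    thus "cmod <<x, phi T $ y>> <= r * norm y * norm x"
     using cauchy_schwarz[of x "phi T $ y"] mult_left_mono[of "norm (phi T $ y)" "r * norm y" "norm x"]
     by (simp add: mult.commute)
   qed
  qed
 qed (use r in simp)
qed

lemma cpc_avg:
 fixes psi :: "nat => 'a::chilbert_space op => 'b::chilbert_space op"
 assumes psi: "!!k. cpc (psi k)"
 shows "cpc (%T. (1 / real (Suc m)) *\<^sub>R (\<Sum>k\<le>m. psi k T))"
 unfolding cpc_def
proof (intro conjI allI impI)
 fix n :: nat and C :: "nat => nat => 'a op"
 assume C: "(\<forall>i<n. \<forall>j<n. clin (C i j)) & acc {..<n} C"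
 have a: "acc {..<n} (%i j. psi k (C i j))" for k using C by (intro cpc_acc[OF psi]) auto
 show "acc {..<n} (%i j. (1 / real (Suc m)) *\<^sub>R (\<Sum>k\<le>m. psi k (C i j)))"
  unfolding acc_def
 proof
  fix xi
  have "mform {..<n} (%i j. (1 / real (Suc m)) *\<^sub>R (\<Sum>k\<le>m. psi k (C i j))) xi
   = of_real (1 / real (Suc m)) * (\<Sum>i<n. \<Sum>j<n. \<Sum>k\<le>m. <<xi i, psi k (C i j) $ xi j>>)"
   unfolding mform_def
   by (simp only: blinfun.scaleR_left blinfun.sum_left cinner_simps cinner_sum_right sum_distrib_left)
  also have "(\<Sum>i<n. \<Sum>j<n. \<Sum>k\<le>m. <<xi i, psi k (C i j) $ xi j>>) = (\<Sum>k\<le>m. mform {..<n} (%i j. psi k (C i j)) xi)"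
  proof -
   have "(\<Sum>i<n. \<Sum>j<n. \<Sum>k\<le>m. <<xi i, psi k (C i j) $ xi j>>) = (\<Sum>i<n. \<Sum>k\<le>m. \<Sum>j<n. <<xi i, psi k (C i j) $ xi j>>)"
    by (intro sum.cong refl sum.swap)
   thus ?thesis unfolding mform_def by (simp only: sum.swap[of _ "{..m}"])
  qed
  finally show "0 <= Re (mform {..<n} (%i j. (1 / real (Suc m)) *\<^sub>R (\<Sum>k\<le>m. psi k (C i j))) xi)"
   using a unfolding acc_def by (simp add: sum_nonneg del: of_nat_Suc)
 qed
next
 show "clinear_on cops (%T. (1 / real (Suc m)) *\<^sub>R (\<Sum>k\<le>m. psi k T))"
  by (auto simp: clinear_on_def cops_iff cpc_add[OF psi] cpc_scale[OF psi] sum.distrib scaleR_add_right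
    scaleR_scaleC scaleC_scaleC scaleC_add_right mult.commute simp flip: scaleC_sum_right simp del: of_nat_Suc)
 fix x
 have "(\<Sum>k\<le>m. Re <<x, psi k \<one> $ x>>) <= (\<Sum>k\<le>m. (norm x)^2)" by (intro sum_mono cpc_id[OF psi])
 hence "(1 / real (Suc m)) * (\<Sum>k\<le>m. Re <<x, psi k \<one> $ x>>) <= (1 / real (Suc m)) * (real (Suc m) * (norm x)^2)"
  by (intro mult_left_mono) auto
 thus "Re <<x, ((1 / real (Suc m)) *\<^sub>R (\<Sum>k\<le>m. psi k \<one>)) $ x>> <= (norm x)^2"
  by (simp add: blinfun.scaleR_left blinfun.sum_left cinner_simps cinner_sum_right del: of_nat_Suc)
qed (use psi in auto)

lemma cpc_ident: "cpc (%T. T)"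
 by (auto simp: cpc_def clinear_on_def Re_cinner_self)

text \<open>The idempotents among these maps are the \<open>R\<close>-projections in Hamana's
  sense.\<close>

definition fixers :: "'a::chilbert_space op set => ('a op => 'a op) set" where
 "fixers R = {phi. cpc phi & (\<forall>r\<in>R. phi r = r)}"

text \<open>Zorn's lemma on the seminorms \<open>norm (\<sigma> T)\<close>. They enter as epigraphs,
  so that a smaller seminorm is a larger set; a chain is bounded by a point-weak cluster point,
  under which norms can only drop.\<close>

lemma minimal_fixer:
 fixes R :: "'a::chilbert_space op set"
 assumes R: "!!r. r \<in> R ==> clin r"
 obtains phi where "phi \<in> fixers R"
  "!!\<sigma> T. \<sigma> \<in> fixers R ==> (!!T. clin T ==> norm (\<sigma> T) <= norm (phi T)) ==> clin T ==> norm (\<sigma> T) = norm (phi T)"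
proof -
 define N where "N \<sigma> = {(T, r). clin T & norm (\<sigma> T) <= r}" for \<sigma> :: "'a op => 'a op"
 have "\<exists>M\<in>N ` fixers R. \<forall>X\<in>N ` fixers R. M <= X --> X = M"
 proof (rule subset_Zorn)
  fix \<C> assume C: "subset.chain (N ` fixers R) \<C>"
  show "\<exists>U\<in>N ` fixers R. \<forall>X\<in>\<C>. X <= U"
  proof (cases "\<C> = {}")
   case True
   have "(%T. T) \<in> fixers R" by (simp add: fixers_def cpc_ident)
   thus ?thesis using True by blast
  next
   case False
   \<comment> \<open>The filter of tails of the chain: eventually the seminorm is below each member
     of it.\<close>
   define \<G> where "\<G> = (INF X\<in>\<C>. principal {\<sigma> \<in> fixers R. X <= N \<sigma>})"
   have "eventually P \<G> \<longleftrightarrow> (\<exists>X\<in>\<C>. eventually P (principal {\<sigma> \<in> fixers R. X <= N \<sigma>}))" for P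
    unfolding \<G>_def
   proof (rule eventually_INF_base[OF False])
    fix X Y assume "X \<in> \<C>" "Y \<in> \<C>"
    hence "X <= Y \<or> Y <= X" using C by (auto simp: subset_chain_def)
    thus "\<exists>Z\<in>\<C>. principal {\<sigma> \<in> fixers R. Z <= N \<sigma>}
      <= inf (principal {\<sigma> \<in> fixers R. X <= N \<sigma>}) (principal {\<sigma> \<in> fixers R. Y <= N \<sigma>})"
     using \<open>X \<in> \<C>\<close> \<open>Y \<in> \<C>\<close> by (auto intro: bexI[of _ X] bexI[of _ Y])
   qed
   hence ev: "eventually P \<G> \<longleftrightarrow> (\<exists>X\<in>\<C>. \<forall>\<sigma>\<in>{\<sigma> \<in> fixers R. X <= N \<sigma>}. P \<sigma>)" for P
    unfolding eventually_principal by simp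
   have "\<G> ~= bot"
   proof
    assume "\<G> = bot"
    hence "eventually (%_. False) \<G>" by simp
    then obtain X where "X \<in> \<C>" "\<forall>\<sigma>\<in>fixers R. \<not> X <= N \<sigma>" unfolding ev by auto
    thus False using C by (auto simp: subset_chain_def)
   qed
   moreover have "\<forall>\<^sub>F phi in \<G>. cpc phi" unfolding ev using False by (auto simp: fixers_def)
   ultimately obtain psi \<H> where psi: "cpc psi" "\<H> ~= bot" "\<H> <= \<G>"
    "!!T x y. clin T ==> ((%phi. <<x, phi T $ y>>) ~~> <<x, psi T $ y>>) \<H>"
    using cpc_cluster[of \<G>] by blast
   have "psi r = r" if r: "r \<in> R" for r
   proof (rule weak_limit_eq[OF psi(2) psi(4)[OF R[OF r]]])
    have "\<forall>\<^sub>F phi in \<G>. phi r = r" unfolding ev using False r by (auto simp: fixers_def)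
    thus "\<forall>\<^sub>F phi in \<H>. phi r = r" using psi(3) by (simp add: filter_leD)
   qed
   hence "psi \<in> fixers R" using psi(1) by (simp add: fixers_def)
   moreover have "X <= N psi" if X: "X \<in> \<C>" for X
   proof
    fix p assume p: "p \<in> X"
    obtain T r where Tr: "p = (T, r)" by fastforce
    have T: "clin T" using X p C Tr by (auto simp: subset_chain_def N_def)
    have "\<forall>\<^sub>F phi in \<G>. norm (phi T) <= r" unfolding ev using X p Tr by (auto simp: N_def)
    hence "\<forall>\<^sub>F phi in \<H>. norm (phi T) <= r" using psi(3) by (simp add: filter_leD)
    hence "norm (psi T) <= r" by (rule weak_limit_norm[OF psi(2) psi(4)[OF T]])
    thus "p \<in> N psi" using T Tr by (simp add: N_def)
   qed
   ultimately show ?thesis by blast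
  qed
 qed
 then obtain phi where phi: "phi \<in> fixers R" "!!\<sigma>. \<sigma> \<in> fixers R ==> N phi <= N \<sigma> ==> N \<sigma> = N phi" by blast
 have "norm (\<sigma> T) = norm (phi T)"
  if \<sigma>: "\<sigma> \<in> fixers R" "!!T. clin T ==> norm (\<sigma> T) <= norm (phi T)" "clin T" for \<sigma> T
 proof -
  have "N phi <= N \<sigma>" using \<sigma>(2) unfolding N_def by (auto intro: order.trans)
  hence "N \<sigma> = N phi" using phi(2) \<sigma>(1) by blast
  hence "(T, norm (\<sigma> T)) \<in> N phi" using \<sigma>(3) by (auto simp: N_def)
  thus ?thesis using \<sigma>(2,3) by (auto simp: N_def intro: antisym)
 qed
 thus ?thesis using phi(1) that by blast
qed

text \<open>Hamana's argument: a minimal seminorm \<open>T \<mapsto> \<parallel>\<phi> T\<parallel>\<close> cannot be decreased by passing to a limit of the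
  Cesaro means of \<open>\<theta>\<^sup>k \<circ> \<phi>\<close>.\<close>

lemma rigid_idempotent:
 fixes R :: "'a::chilbert_space op set"
 assumes R: "!!r. r \<in> R ==> clin r"
 obtains phi where "phi \<in> fixers R" "!!T. clin T ==> phi (phi T) = phi T"
  "!!psi T. psi \<in> fixers R ==> clin T ==> phi (psi (phi T)) = phi T"
proof -
 obtain phi where phi: "phi \<in> fixers R"
  and min: "!!\<sigma> T. \<sigma> \<in> fixers R ==> (!!T. clin T ==> norm (\<sigma> T) <= norm (phi T)) ==> clin T ==> norm (\<sigma> T) = norm (phi T)"
  using minimal_fixer[OF R] by blast
 have phic: "cpc phi" and phiR: "!!r. r \<in> R ==> phi r = r" using phi by (auto simp: fixers_def)
 \<comment> \<open>If a map fixing \<open>R\<close> sends an element of the range of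
   \<open>phi\<close> into that range, it fixes the element. Idempotence and rigidity are both
   instances.\<close>
 have main: "phi T = phi U" if \<theta>: "\<theta> \<in> fixers R" and TU: "clin T" "clin U" "phi U = \<theta> (phi T)" for \<theta> T U
 proof -
  have \<theta>c: "cpc \<theta>" and \<theta>R: "!!r. r \<in> R ==> \<theta> r = r" using \<theta> by (auto simp: fixers_def)
  have pow: "cpc (%V. (\<theta> ^^ k) (phi V))" for k
   by (induction k) (auto simp: phic intro: cpc_comp[OF _ \<theta>c])
  have powR: "(\<theta> ^^ k) (phi r) = r" if "r \<in> R" for k r
   by (induction k) (auto simp: phiR \<theta>R that)
  have powc: "clin ((\<theta> ^^ k) (phi V))" if "clin V" for k V by (rule cpc_clin[OF pow that])
  have pown: "norm ((\<theta> ^^ k) (phi V)) <= norm (phi V)" if "clin V" for k V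
  proof (induction k)
   case (Suc k)
   thus ?case using cpc_norm[OF \<theta>c powc[OF that, of k]] by simp
  qed simp
  define L where "L m V = (1 / real (Suc m)) *\<^sub>R (\<Sum>k\<le>m. (\<theta> ^^ k) (phi V))" for m V
  have Lc: "cpc (L m)" for m unfolding L_def by (rule cpc_avg[OF pow])
  have LR: "L m r = r" if "r \<in> R" for m r
   by (simp add: L_def powR that del: of_nat_Suc) (simp add: sum_constant_scaleR del: of_nat_Suc)
  have Ln: "norm (L m V) <= norm (phi V)" if "clin V" for m V
  proof -
   have "norm (\<Sum>k\<le>m. (\<theta> ^^ k) (phi V)) <= (\<Sum>k\<le>m. norm (phi V))"
    by (rule order.trans[OF norm_sum]) (intro sum_mono pown that)
   thus ?thesis by (simp add: L_def field_simps)
  qed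
  have "filtermap L sequentially ~= bot" by (simp add: filtermap_bot_iff)
  moreover have "\<forall>\<^sub>F phi in filtermap L sequentially. cpc phi" by (simp add: eventually_filtermap Lc)
  ultimately obtain psi \<H> where psi: "cpc psi" "\<H> ~= bot" "\<H> <= filtermap L sequentially"
   "!!T x y. clin T ==> ((%phi. <<x, phi T $ y>>) ~~> <<x, psi T $ y>>) \<H>"
   using cpc_cluster[of "filtermap L sequentially"] by blast
  have ev: "eventually Q \<H>" if "\<forall>\<^sub>F m in sequentially. Q (L m)" for Q
   using psi(3) that by (auto simp: le_filter_def eventually_filtermap)
  have "psi r = r" if r: "r \<in> R" for r
   by (rule weak_limit_eq[OF psi(2) psi(4)[OF R[OF r]]]) (intro ev, simp add: LR r)
  hence psiS: "psi \<in> fixers R" using psi(1) by (simp add: fixers_def)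
  have "norm (psi V) <= norm (phi V)" if "clin V" for V
   by (rule weak_limit_norm[OF psi(2) psi(4)[OF that]]) (intro ev, simp add: Ln that)
  \<comment> \<open>The limit of the means has a seminorm at most that of \<open>phi\<close>, so
    minimality forces equality; at \<open>T - U\<close> the means telescope and tend to
    zero.\<close>
  hence eq: "norm (psi (T - U)) = norm (phi (T - U))" using min[OF psiS] TU by simp
  have "norm (psi (T - U)) <= 0 + e" if e: "0 < e" for e
  proof (rule weak_limit_norm[OF psi(2) psi(4)])
   have tele: "L m (T - U) = (1 / real (Suc m)) *\<^sub>R (phi T - (\<theta> ^^ Suc m) (phi T))" for m
   proof -
    have "(\<theta> ^^ k) (phi (T - U)) = (\<theta> ^^ k) (phi T) - (\<theta> ^^ Suc k) (phi T)" for k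
     using cpc_diff[OF pow TU(1,2), of k] TU(3) by (simp add: funpow_swap1)
    thus ?thesis unfolding L_def
     using sum_telescope[of "%k. (\<theta> ^^ k) (phi T)" m] by simp
   qed
   have bd: "norm (L m (T - U)) <= (2 * norm (phi T)) * (1 / real (Suc m))" for m
   proof -
    have "norm (phi T - (\<theta> ^^ Suc m) (phi T)) <= 2 * norm (phi T)"
     using norm_triangle_ineq4[of "phi T" "(\<theta> ^^ Suc m) (phi T)"] pown[OF TU(1), of "Suc m"] by linarith
    thus ?thesis unfolding tele by (simp add: divide_right_mono del: funpow.simps of_nat_Suc)
   qed
   have "(%m. (2 * norm (phi T)) * (1 / real (Suc m))) ---> (2 * norm (phi T)) * 0"
    using LIMSEQ_inverse_real_of_nat by (intro tendsto_intros) (simp add: inverse_eq_divide)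
   hence "\<forall>\<^sub>F m in sequentially. (2 * norm (phi T)) * (1 / real (Suc m)) < e"
    using e by (intro order_tendstoD(2)) auto
   hence "\<forall>\<^sub>F m in sequentially. norm (L m (T - U)) <= 0 + e"
    
   proof (rule eventually_mono)
    fix m assume "(2 * norm (phi T)) * (1 / real (Suc m)) < e"
    thus "norm (L m (T - U)) <= 0 + e" using bd[of m] by linarith
   qed
   thus "\<forall>\<^sub>F phi in \<H>. norm (phi (T - U)) <= 0 + e" by (rule ev)
  qed (use TU in auto)
  hence "norm (psi (T - U)) <= 0" by (rule field_le_epsilon)
  hence "phi (T - U) = 0" using eq by simp
  thus ?thesis using TU by (simp add: cpc_diff[OF phic])
 qed
 have idem: "phi (phi T) = phi T" if "clin T" for T
  using main[OF phi that, of "phi T"] that phic by simp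
 moreover have "phi (psi (phi T)) = phi T" if psi: "psi \<in> fixers R" and T: "clin T" for psi T
 proof -
  have psic: "cpc psi" using psi by (simp add: fixers_def)
  have "(%V. phi (psi V)) \<in> fixers R"
   using phi psi cpc_comp[OF psic phic] by (simp add: fixers_def)
  note comp = this
  have 1: "phi (phi (psi (phi T))) = phi (psi (phi T))" using T phic psic by (simp add: idem)
  have "phi T = phi (phi (psi (phi T)))"
   by (rule main[OF comp]) (simp_all add: T phic psic 1)
  thus ?thesis using 1 by simp
 qed
 ultimately show ?thesis using phi that by blast
qed

text \<open>The source of associativity of the Choi--Effros product. Applying \<open>phi\<close>
  once more to the Schwarz matrix of \<open>phi a\<close> and \<open>hadj b\<close> annihilates a
  diagonal corner by idempotence, and with it the off-diagonal entry.\<close>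

lemma ce_left:
 assumes phi: "cpc phi" and idem: "!!T. clin T ==> phi (phi T) = phi T" and ab: "clin a" "clin b"
 shows "phi (b oo phi a) = phi (phi b oo phi a)"
proof -
 note [simp] = cpc_clin[OF phi] cpc_hadj[OF phi] cpc_diff[OF phi] idem
 define s where "s i = (if i then phi a else hadj b)" for i
 let ?D = "%i j. phi (hadj (s i) oo s j) - (hadj (phi (s i)) oo phi (s j))"
 have s: "clin (s i)" for i using ab by (simp add: s_def)
 have "acc UNIV ?D" by (intro cpc_schwarz_mat[OF phi] s) simp
 hence "acc UNIV (%i j. phi (?D i j))" using s by (intro cpc_acc[OF phi]) auto
 also have "(%i j. phi (?D i j)) = (%i j. if i then (if j then 0 else hadj (phi (b oo phi a) - phi (phi b oo phi a)))
   else (if j then phi (b oo phi a) - phi (phi b oo phi a) else phi (?D False False)))"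
 proof (intro ext)
  fix i j
  have "phi (phi (hadj (phi a) oo hadj b) - (hadj (phi a) oo hadj (phi b))) = hadj (phi (b oo phi a) - phi (phi b oo phi a))"
   using ab cpc_hadj[OF phi, of "b oo phi a"] cpc_hadj[OF phi, of "phi b oo phi a"] by simp
  thus "phi (?D i j) = (if i then (if j then 0 else hadj (phi (b oo phi a) - phi (phi b oo phi a)))
    else (if j then phi (b oo phi a) - phi (phi b oo phi a) else phi (?D False False)))"
   using ab by (cases i; cases j) (simp_all add: s_def)
 qed
 finally have "phi (b oo phi a) - phi (phi b oo phi a) = 0"
  by (rule cpc_acc_zero_corner) (use ab in auto)
 thus ?thesis by simp
qed

lemma ce_right:
 assumes phi: "cpc phi" and idem: "!!T. clin T ==> phi (phi T) = phi T" and ab: "clin a" "clin b"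
 shows "phi (phi a oo b) = phi (phi a oo phi b)"
proof -
 note [simp] = cpc_clin[OF phi]
 have "phi (hadj b oo phi (hadj a)) = phi (phi (hadj b) oo phi (hadj a))"
  using ab by (intro ce_left[OF phi idem]) auto
 hence "phi (hadj (phi a oo b)) = phi (hadj (phi a oo phi b))" using ab by (simp add: cpc_hadj[OF phi])
 hence "hadj (hadj (phi (phi a oo b))) = hadj (hadj (phi (phi a oo phi b)))"
  using cpc_hadj[OF phi, of "phi a oo b"] cpc_hadj[OF phi, of "phi a oo phi b"] ab by simp
 thus ?thesis using ab by simp
qed

section \<open>Generated C*-algebras and the representation of the Choi--Effros algebra\<close>

abbreviation cstar_gen :: "'a::chilbert_space op set => 'a op set" where
 "cstar_gen S \<equiv> cstar_algebra hull S"

lemma cstar_Inter: "\<S> ~= {} ==> (!!C. C \<in> \<S> ==> cstar_algebra C) ==> cstar_algebra (\<Inter>\<S>)"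
 by (rule cstar_algebraI)
  (auto dest: cstar_algebraD(1,4,5) csubspaceD(1-3)[OF cstar_algebraD(2)],
   meson cstar_algebraD(3) closed_sequentially)

lemma cstar_clin: "cstar_algebra {T. clin T}"
 by (rule cstar_algebraI) auto

lemma cstar_gen:
 assumes "!!T. T \<in> S ==> clin T"
 shows "cstar_algebra (cstar_gen S)"
 unfolding hull_def using assms cstar_clin by (intro cstar_Inter) auto

lemma cstar_gen_subset: "cstar_algebra C ==> S <= C ==> cstar_gen S <= C"
 by (rule hull_minimal)

lemma cstar_agree:
 fixes phi psi :: "'a::chilbert_space op => 'b::chilbert_space op"
 assumes "cpc phi" "cpc psi" "S <= md phi" "S <= md psi" "!!s. s \<in> S ==> phi s = psi s" "a \<in> cstar_gen S"
 shows "phi a = psi a"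
proof -
 have C: "cstar_algebra (md phi)" "cstar_algebra (md psi)" using assms(1,2) by (auto intro: cstar_md)
 have "cstar_algebra {a \<in> md phi \<inter> md psi. phi a = psi a}"
 proof (rule cstar_algebraI)
  fix f T assume f: "!!n. f n \<in> {a \<in> md phi \<inter> md psi. phi a = psi a}" "f ---> T" "clin T"
  have "T \<in> md phi" "T \<in> md psi"
   using closed_sequentially[OF cstar_algebraD(3)[OF C(1)] _ f(2)]
    closed_sequentially[OF cstar_algebraD(3)[OF C(2)] _ f(2)] f(1) by auto
  moreover have c: "clin (f n)" for n using f(1)[of n] by (auto dest: mdD)
  have "(%n. phi (f n)) ---> phi T" "(%n. psi (f n)) ---> psi T"
   by (rule cpc_tendsto[OF assms(1) f(2) c f(3)], rule cpc_tendsto[OF assms(2) f(2) c f(3)])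
  hence "phi T = psi T" using f(1) LIMSEQ_unique[of "%n. phi (f n)" "phi T" "psi T"] by simp
  ultimately show "T \<in> {a \<in> md phi \<inter> md psi. phi a = psi a}" by simp
 qed (use cstar_algebraD[OF C(1)] cstar_algebraD[OF C(2)] csubspaceD(1-3)[OF cstar_algebraD(2)[OF C(1)]]
   csubspaceD(1-3)[OF cstar_algebraD(2)[OF C(2)]] assms(1,2)
   in \<open>auto simp: cpc_add cpc_scale cpc_zero cpc_hadj mdD\<close>)
 hence "cstar_gen S <= {a \<in> md phi \<inter> md psi. phi a = psi a}"
  using assms by (intro cstar_gen_subset) auto
 thus ?thesis using assms(6) by blast
qed

text \<open>The image of a rigid idempotent \<open>\<phi>\<close> is a C*-algebra for the Choi--Effros product
  \<open>a \<circ> b = \<phi> (a b)\<close>; the map \<open>\<phi>'\<close> below is \<open>\<phi>\<close> followed by the representation of that algebra on the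
  Hilbert space with kernel \<open>\<langle>\<xi>, \<phi> (S\<^sup>* R) \<eta>\<rangle>\<close>.\<close>

lemma envelope_map:
 fixes R :: "'a::chilbert_space op set" and g :: "'a op \<times> 'a => 'i"
 assumes R: "!!r. r \<in> R ==> clin r" and g: "inj g"
 shows "\<exists>(phi' :: 'a op => ('i ell2 \<Rightarrow>\<^sub>L 'i ell2)) \<alpha>. cpc phi' & cpc \<alpha> & (\<forall>r\<in>R. \<alpha> (phi' r) = r) &
  cstar_gen R <= md phi' & (\<forall>Phi\<in>fixers R. \<forall>a\<in>cstar_gen R. phi' (Phi a) = phi' a)"
proof -
 obtain phi where phif: "phi \<in> fixers R" and idem: "!!T. clin T ==> phi (phi T) = phi T"
  and rigid: "!!psi T. psi \<in> fixers R ==> clin T ==> phi (psi (phi T)) = phi T"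
  using rigid_idempotent[OF R] by blast
 have phi: "cpc phi" and phiR: "!!r. r \<in> R ==> phi r = r" using phif by (auto simp: fixers_def)
 note [simp] = cpc_clin[OF phi] cpc_add[OF phi] cpc_scale[OF phi] idem
 note ceL = ce_left[OF phi idem] and ceR = ce_right[OF phi idem]
 \<comment> \<open>Pairs of a range element of \<open>phi\<close> and a vector label the generators
   of the induced representation space.\<close>
 define I where "I = {(S, xi::'a). clin S & phi S = S}"
 define ka where "ka T i j = <<snd i, phi (hadj (fst i) oo (T oo fst j)) $ snd j>>" for T and i j :: "'a op \<times> 'a"
 have Ic: "clin (fst i)" "phi (fst i) = fst i" "phi (hadj (fst i)) = hadj (fst i)" if "i \<in> I" for i
  using that cpc_hadj[OF phi, of "fst i"] by (auto simp: I_def)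
 \<comment> \<open>The injection \<open>g\<close> relabels the generators by elements of
   \<open>'i\<close>, so that the space produced by \<open>kolmogorov\<close> is
   \<open>'i ell2\<close>.\<close>
 define h where "h = inv_into I g"
 have hg: "h (g i) = i" if "i \<in> I" for i
  using that g unfolding h_def by (meson inj_on_subset inv_into_f_f subset_UNIV)
 have hI: "h x \<in> I" if "x \<in> g ` I" for x using that unfolding h_def by (rule inv_into_into)
 have "psd_kernel (g ` I) (%x y. ka \<one> (h x) (h y))"
  unfolding psd_kernel_def
 proof (intro conjI ballI allI impI)
  fix x y assume "x \<in> g ` I" "y \<in> g ` I"
  hence i: "clin (fst (h x))" "clin (fst (h y))" using hI Ic by auto
  have "hadj (phi (hadj (fst (h y)) oo fst (h x))) = phi (hadj (fst (h x)) oo fst (h y))"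
   using i by (subst cpc_hadj[OF phi, symmetric]) auto
  thus "ka \<one> (h x) (h y) = cnj (ka \<one> (h y) (h x))"
   using i unfolding ka_def comp_id
   by (metis cinner_commute clin_intros(7,9) cpc_clin[OF phi] hadj_right)
 next
  fix F c assume F: "finite F & F <= g ` I"
  have Fc: "clin (fst (h x))" if "x \<in> F" for x using hI[of x] Ic(1)[of "h x"] that F by blast
  have "acc F (%x y. hadj (fst (h x)) oo fst (h y))"
   unfolding acc_def
  proof
   fix xi
   have "mform F (%x y. hadj (fst (h x)) oo fst (h y)) xi = <<\<Sum>x\<in>F. fst (h x) $ xi x, \<Sum>x\<in>F. fst (h x) $ xi x>>"
    unfolding mform_def cinner_sum_sum' by (intro sum.cong refl) (simp add: hadj_right Fc)
   thus "0 <= Re (mform F (%x y. hadj (fst (h x)) oo fst (h y)) xi)" by (simp add: cinner_self)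
  qed
  hence "acc F (%x y. phi (hadj (fst (h x)) oo fst (h y)))" using F Fc by (intro cpc_acc[OF phi]) auto
  hence "0 <= Re (mform F (%x y. phi (hadj (fst (h x)) oo fst (h y))) (%x. c x *C snd (h x)))"
   by (simp add: acc_def)
  also have "mform F (%x y. phi (hadj (fst (h x)) oo fst (h y))) (%x. c x *C snd (h x))
    = (\<Sum>i\<in>F. \<Sum>j\<in>F. cnj (c i) * c j * ka \<one> (h i) (h j))"
   unfolding mform_def by (intro sum.cong refl) (simp add: ka_def clin_scaleC Fc cinner_simps)
  finally show "0 <= Re (\<Sum>i\<in>F. \<Sum>j\<in>F. cnj (c i) * c j * ka \<one> (h i) (h j))" .
 qed
 then obtain u :: "'i => 'i ell2" where u: "!!x y. x \<in> g ` I ==> y \<in> g ` I ==> <<u x, u y>> = ka \<one> (h x) (h y)"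
  using kolmogorov by blast
 define v where "v i = u (g i)" for i
 have vv: "<<v i, v j>> = ka \<one> i j" if "i \<in> I" "j \<in> I" for i j
  using u[of "g i" "g j"] that by (simp add: v_def hg)
 have "\<exists>\<gamma>. cpc \<gamma> & (\<forall>T. clin T --> (\<forall>i\<in>I. \<forall>j\<in>I. <<v i, \<gamma> T $ v j>> = ka T i j) &
   (\<forall>x. (\<forall>i\<in>I. <<v i, x>> = 0) --> \<gamma> T $ x = 0 & hadj (\<gamma> T) $ x = 0))"
 proof (rule kernel_cp)
  show "ka (S + T) i j = ka S i j + ka T i j" if "clin S" "clin T" "i \<in> I" "j \<in> I" for S T i j
   using that Ic by (simp add: ka_def comp_simps cinner_simps)
  show "ka (c *C T) i j = c * ka T i j" if "clin T" "i \<in> I" "j \<in> I" for c T i j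
   using that Ic by (simp add: ka_def comp_simps cinner_simps)
  show "0 <= Re (\<Sum>a<n. \<Sum>b<n. ka (C a b) (io a) (io b))"
   if C: "!!a b. a < n ==> b < n ==> clin (C a b)" "acc {..<n::nat} C" "!!a. a < n ==> io a \<in> I" for n C io
  proof -
   have "acc {..<n} (%a b. hadj (fst (io a)) oo (C a b oo fst (io b)))"
    unfolding acc_def
   proof
    fix xi
    have "mform {..<n} (%a b. hadj (fst (io a)) oo (C a b oo fst (io b))) xi = mform {..<n} C (%a. fst (io a) $ xi a)"
     unfolding mform_def using C Ic by (intro sum.cong refl) (simp add: hadj_right)
    thus "0 <= Re (mform {..<n} (%a b. hadj (fst (io a)) oo (C a b oo fst (io b))) xi)"
     using C(2) by (simp add: acc_def)
   qed
   hence "acc {..<n} (%a b. phi (hadj (fst (io a)) oo (C a b oo fst (io b))))"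
    using C Ic by (intro cpc_acc[OF phi]) auto
   hence "0 <= Re (mform {..<n} (%a b. phi (hadj (fst (io a)) oo (C a b oo fst (io b)))) (%a. snd (io a)))"
    unfolding acc_def by blast
   thus ?thesis by (simp add: mform_def ka_def)
  qed
  show "Re (\<Sum>i\<in>F. \<Sum>j\<in>F. cnj (c i) * c j * ka \<one> i j) <= (norm (\<Sum>i\<in>F. c i *C v i))^2"
   if "finite F" "F <= I" for F c
  proof -
   have "(\<Sum>i\<in>F. \<Sum>j\<in>F. cnj (c i) * c j * ka \<one> i j) = <<\<Sum>i\<in>F. c i *C v i, \<Sum>i\<in>F. c i *C v i>>"
    unfolding cinner_sum_sum using that vv by (intro sum.cong refl) (auto simp: subset_iff)
   thus ?thesis by (simp add: Re_cinner_self del: Re_sum)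
  qed
 qed
 then obtain \<gamma> where \<gamma>: "cpc \<gamma>" and \<gamma>v: "!!T i j. clin T ==> i \<in> I ==> j \<in> I ==> <<v i, \<gamma> T $ v j>> = ka T i j"
  and \<gamma>0: "!!T x. clin T ==> (!!i. i \<in> I ==> <<v i, x>> = 0) ==> \<gamma> T $ x = 0 & hadj (\<gamma> T) $ x = 0"
  by metis
 note [simp] = cpc_clin[OF \<gamma>]
 define phi' where "phi' T = \<gamma> (phi T)" for T
 have phi': "cpc phi'" unfolding phi'_def by (rule cpc_comp[OF phi \<gamma>])
 \<comment> \<open>\<open>\<gamma>\<close> is known only through its coefficients. On the range of
   \<open>phi\<close> it acts by left multiplication for the Choi--Effros product: both vectors have
   the same coefficients and lie in the closed span.\<close>
 have act: "\<gamma> a $ v (S, xi) = v (phi (a oo S), xi)" if a: "clin a" "phi a = a" and S: "clin S" "phi S = S" for a S xi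
 proof -
  let ?x = "\<gamma> a $ v (S, xi)" and ?y = "v (phi (a oo S), xi)"
  have i: "(S, xi) \<in> I" "(phi (a oo S), xi) \<in> I" using a S by (auto simp: I_def)
  have 0: "<<v j, ?x>> = <<v j, ?y>>" if j: "j \<in> I" for j
   using \<gamma>v[OF a(1) j i(1)] vv[OF j i(2)] ceR[of "hadj (fst j)" "a oo S"] Ic[OF j] a S
   by (simp add: ka_def)
  obtain z where z: "z \<in> closure (cspan (v ` I))" "!!j. j \<in> I ==> <<v j, ?x - z>> = 0"
   using proj_ex[of v I ?x] by blast
  have "<<?x - z, ?x>> = 0"
   using \<gamma>0[OF a(1) z(2)] hadj_left[of "\<gamma> a" "?x - z" "v (S, xi)"] a by simp
  moreover have "<<?x - z, z>> = 0"
   using orth_closure_cspan[OF z(1), of "?x - z"] z(2) by (metis imageE orth_commute)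
  ultimately have "<<?x - z, ?x - z>> = 0" by (simp add: cinner_simps)
  hence xz: "?x \<in> closure (cspan (v ` I))" using z(1) by (simp add: cinner_self)
  have "?y \<in> closure (cspan (v ` I))" using i(2) by (meson closure_subset hull_inc imageI subsetD)
  thus ?thesis using 0 by (intro orth_closure_cspan_eq[OF xz]) auto
 qed
 have mult: "\<gamma> (phi (hadj a oo a)) = hadj (\<gamma> a) oo \<gamma> a" if a: "clin a" "phi a = a" for a
 proof (rule op_eqI_family[of _ _ I v])
  fix i j assume ij: "i \<in> I" "j \<in> I"
  obtain S xi where i: "i = (S, xi)" by fastforce
  obtain T eta where j: "j = (T, eta)" by fastforce
  have S: "clin S" "phi S = S" and T: "clin T" "phi T = T" using ij by (auto simp: I_def i j)
  have ha: "phi (hadj a) = hadj a" "phi (hadj S) = hadj S" using a S by (simp_all add: cpc_hadj[OF phi])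
  have "phi (hadj S oo (phi (hadj a oo a) oo T)) = phi (hadj S oo phi (phi (hadj a oo a) oo T))"
   using ceR[of "hadj S" "phi (hadj a oo a) oo T"] S T a ha by simp
  also have "phi (phi (hadj a oo a) oo T) = phi ((hadj a oo a) oo T)"
   using ceL[of T "hadj a oo a"] T a by simp
  also have "(hadj a oo a) oo T = hadj a oo (a oo T)" by (rule comp_assoc)
  also have "phi (hadj a oo (a oo T)) = phi (hadj a oo phi (a oo T))"
   using ceR[of "hadj a" "a oo T"] a T ha by simp
  also have "phi (hadj S oo phi (hadj a oo phi (a oo T))) = phi (hadj S oo (hadj a oo phi (a oo T)))"
   using ceR[of "hadj S" "hadj a oo phi (a oo T)"] a S T ha by simp
  also have "... = phi ((hadj S oo hadj a) oo phi (a oo T))" by (simp add: comp_assoc)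
  also have "... = phi (phi (hadj S oo hadj a) oo phi (a oo T))"
   using ceL[of "a oo T" "hadj S oo hadj a"] a S T by simp
  also have "phi (hadj S oo hadj a) = hadj (phi (a oo S))" using a S cpc_hadj[OF phi, of "a oo S"] by simp
  finally have e: "phi (hadj S oo (phi (hadj a oo a) oo T)) = phi (hadj (phi (a oo S)) oo phi (a oo T))" .
  have "<<v i, (hadj (\<gamma> a) oo \<gamma> a) $ v j>> = <<v (phi (a oo S), xi), v (phi (a oo T), eta)>>"
   using a by (simp add: hadj_right i j act S T)
  also have "... = ka \<one> (phi (a oo S), xi) (phi (a oo T), eta)"
   using a S T by (intro vv) (auto simp: I_def)
  also have "... = ka (phi (hadj a oo a)) i j" by (simp add: ka_def i j e)
  finally show "<<v i, \<gamma> (phi (hadj a oo a)) $ v j>> = <<v i, (hadj (\<gamma> a) oo \<gamma> a) $ v j>>"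
   using \<gamma>v[OF _ ij, of "phi (hadj a oo a)"] a by simp
 next
  fix x assume x: "!!i. i \<in> I ==> <<v i, x>> = 0"
  show "\<gamma> (phi (hadj a oo a)) $ x = 0 & hadj (\<gamma> (phi (hadj a oo a))) $ x = 0" using \<gamma>0[OF _ x] a by simp
  show "(hadj (\<gamma> a) oo \<gamma> a) $ x = 0 & hadj (hadj (\<gamma> a) oo \<gamma> a) $ x = 0"
   using \<gamma>0[OF a(1) x] a by simp
 qed (use a in auto)
 have hR: "clin (hadj r)" "phi (hadj r) = hadj r" if "r \<in> R" for r
  using R[OF that] phiR[OF that] by (simp_all add: cpc_hadj[OF phi])
 have Rmd: "r \<in> md phi'" if r: "r \<in> R" for r
 proof (rule mdI[OF phi'])
  show "phi' (hadj r oo r) = hadj (phi' r) oo phi' r"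
   using mult[OF R[OF r] phiR[OF r]] by (simp add: phi'_def phiR r)
  show "phi' (r oo hadj r) = phi' r oo hadj (phi' r)"
   using mult[OF hR[OF r]] R[OF r] hR[OF r] cpc_hadj[OF \<gamma> R[OF r]] by (simp add: phi'_def phiR r)
 qed (rule R[OF r])
 hence gen: "cstar_gen R <= md phi'" by (intro cstar_gen_subset cstar_md[OF phi']) blast
 have "phi' (Phi a) = phi' a" if Phif: "Phi \<in> fixers R" and a: "a \<in> cstar_gen R" for Phi a
 proof -
  have Phi: "cpc Phi" and PhiR: "!!r. r \<in> R ==> Phi r = r" using Phif by (auto simp: fixers_def)
  note [simp] = cpc_clin[OF Phi]
  have Phi': "cpc (%T. phi' (Phi T))" by (rule cpc_comp[OF Phi phi'])
  \<comment> \<open>A squeeze. The Schwarz inequality for \<open>phi\<close>, followed by rigidity,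
    bounds \<open>phi' (Phi (hadj r oo r))\<close> from above by \<open>phi' (hadj r oo r)\<close>;
    the Schwarz inequality for the composite of \<open>Phi\<close> and \<open>phi'\<close> gives the
    reverse bound.\<close>
  have sq: "phi' (Phi (hadj r oo r)) = hadj (phi' (Phi r)) oo phi' (Phi r)"
   if r: "clin r" "phi r = r" "Phi r = r" for r
  proof -
   have m: "hadj (phi' (Phi r)) oo phi' (Phi r) = phi' (hadj r oo r)" using mult[OF r(1,2)] r by (simp add: phi'_def)
   have "opos (phi (hadj r oo r) - (hadj r oo r))" using cpc_schwarz(1)[OF phi r(1)] r by simp
   hence "opos (Phi (phi (hadj r oo r)) - Phi (hadj r oo r))"
    using r by (intro cpc_mono[OF Phi]) auto
   hence "opos (phi (Phi (phi (hadj r oo r))) - phi (Phi (hadj r oo r)))"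
    using r by (intro cpc_mono[OF phi]) auto
   hence "opos (phi (hadj r oo r) - phi (Phi (hadj r oo r)))" using rigid[OF Phif, of "hadj r oo r"] r by simp
   hence 1: "opos (phi' (hadj r oo r) - phi' (Phi (hadj r oo r)))"
    unfolding phi'_def using r by (intro cpc_mono[OF \<gamma>]) auto
   have 2: "opos (phi' (Phi (hadj r oo r)) - phi' (hadj r oo r))"
    using cpc_schwarz(1)[OF Phi' r(1)] m by simp
   have h: "hadj (phi' (hadj r oo r)) = phi' (hadj r oo r)"
    "hadj (phi' (Phi (hadj r oo r))) = phi' (Phi (hadj r oo r))"
    using cpc_hadj[OF phi', of "hadj r oo r"] cpc_hadj[OF Phi', of "hadj r oo r"] r by auto
   show ?thesis unfolding m
    by (rule herm_eqI) (use r h 1 2 phi' in auto)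
  qed
  have "r \<in> md (%T. phi' (Phi T))" if r: "r \<in> R" for r
  proof (rule mdI[OF Phi' R[OF r]])
   show "phi' (Phi (hadj r oo r)) = hadj (phi' (Phi r)) oo phi' (Phi r)"
    using R r phiR PhiR by (intro sq) auto
   have "Phi (hadj r) = hadj r" using R[OF r] PhiR[OF r] by (simp add: cpc_hadj[OF Phi])
   thus "phi' (Phi (r oo hadj r)) = phi' (Phi r) oo hadj (phi' (Phi r))"
    using sq[OF hR[OF r]] R[OF r] PhiR[OF r] cpc_hadj[OF phi' R[OF r]] phi' by simp
  qed
  thus ?thesis
   by (intro cstar_agree[OF Phi' phi' _ _ _ a]) (use Rmd PhiR in auto)
 qed
 moreover obtain \<alpha> :: "('i ell2 \<Rightarrow>\<^sub>L 'i ell2) => 'a op" where "cpc \<alpha>" "!!r. r \<in> R ==> \<alpha> (phi' r) = r"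
 proof -
  \<comment> \<open>The unit of the Choi--Effros algebra. The map from \<open>xi\<close> to
    \<open>v (e, xi)\<close> carries the original space into the new one, and compressing
    \<open>phi' r\<close> along it returns \<open>r\<close>.\<close>
  define e where "e = phi \<one>"
  have e: "clin e" "phi e = e" "hadj e = e" by (simp_all add: e_def cpc_hadj[OF phi, symmetric])
  have eI: "(e, xi) \<in> I" for xi using e by (simp add: I_def)
  have ne: "norm (phi (hadj e oo e)) <= 1"
  proof -
   have n1: "norm e <= 1"
    using cpc_norm[OF phi, of \<one>] norm_blinfun_id_le[where 'a = 'a] by (simp add: e_def)
   have "norm (phi (hadj e oo e)) <= norm (hadj e oo e)" using e by (intro cpc_norm[OF phi]) auto
   also have "... <= norm (hadj e) * norm e" by (rule norm_blinfun_compose)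
   also have "... <= 1 * 1" using n1 e by (intro mult_mono) auto
   finally show ?thesis by simp
  qed
  have "norm (\<Sum>xi\<in>F. c xi *C v (e, xi)) <= 1 * norm (\<Sum>xi\<in>F. c xi *C xi)" for F c
  proof -
   let ?x = "\<Sum>xi\<in>F. c xi *C xi"
   have "<<\<Sum>xi\<in>F. c xi *C v (e, xi), \<Sum>xi\<in>F. c xi *C v (e, xi)>> = <<?x, phi (hadj e oo e) $ ?x>>"
    using e by (subst clin_sum) (simp_all add: cinner_sum_sum vv[OF eI eI] ka_def)
   hence "(norm (\<Sum>xi\<in>F. c xi *C v (e, xi)))^2 = Re <<?x, phi (hadj e oo e) $ ?x>>"
    by (simp add: Re_cinner_self[symmetric])
   also have "... <= norm ?x * norm (phi (hadj e oo e) $ ?x)" using Re_cinner_le abs_le_D1 by blast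
   also have "... <= norm ?x * norm ?x" by (intro mult_left_mono norm_apply_le ne) auto
   finally have "(norm (\<Sum>xi\<in>F. c xi *C v (e, xi)))^2 <= (norm ?x)^2" by (simp only: power2_eq_square)
   thus ?thesis unfolding mult_1 by (rule power2_le_imp_le) simp
  qed
  hence "\<exists>V. clin V & (\<forall>xi. V $ xi = v (e, xi)) & norm V <= 1"
   by (rule family_op[of UNIV "%xi. v (e, xi)" 1 "%xi. xi"]) auto
  then obtain V where V: "clin V" "!!xi. V $ xi = v (e, xi)" "norm V <= 1" by blast
  have "sand V (phi' r) = r" if r: "r \<in> R" for r
  proof (rule blinfun_eqI, rule cinner_eqI)
   fix xi eta
   have "<<xi, sand V (phi' r) $ eta>> = <<v (e, xi), \<gamma> r $ v (e, eta)>>"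
    by (simp add: cinner_sand V phi'_def phiR r)
   also have "... = <<xi, phi (e oo (r oo e)) $ eta>>"
    using \<gamma>v[OF R[OF r] eI eI] by (simp add: ka_def e)
   also have "phi (e oo (r oo e)) = phi (e oo phi (r oo e))"
    using ceR[of \<one> "r oo e"] R[OF r] e by (simp add: e_def)
   also have "... = phi (r oo e)"
    using ceL[of "r oo e" \<one>] R[OF r] e by (simp add: e_def)
   also have "... = r" using ceR[of r \<one>] R[OF r] by (simp add: e_def phiR r)
   finally show "<<xi, sand V (phi' r) $ eta>> = <<xi, r $ eta>>" .
  qed
  thus ?thesis using that cpc_sand[OF V(1,3)] by blast
 qed
 ultimately show ?thesis using phi' gen by (intro exI[of _ phi'] exI[of _ \<alpha>]) blast
qed

section \<open>Homomorphisms of C*-algebras\<close>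

instance chilbert_space \<subseteq> banach ..

lemma cstar_add: "cstar_algebra C ==> S \<in> C ==> T \<in> C ==> S + T \<in> C"
 and cstar_diff: "cstar_algebra C ==> S \<in> C ==> T \<in> C ==> S - T \<in> C"
 and cstar_scaleC: "cstar_algebra C ==> S \<in> C ==> c *C S \<in> C"
 and cstar_zero: "cstar_algebra C ==> 0 \<in> C"
 and cstar_comp: "cstar_algebra C ==> S \<in> C ==> T \<in> C ==> S oo T \<in> C"
 and cstar_hadj: "cstar_algebra C ==> S \<in> C ==> hadj S \<in> C"
 using csubspaceD(2)[OF cstar_algebraD(2), of C S T] csubspaceD(5)[OF cstar_algebraD(2), of C S T]
  csubspaceD(3)[OF cstar_algebraD(2), of C S c] csubspaceD(1)[OF cstar_algebraD(2), of C]
  cstar_algebraD(4)[of C S T] cstar_algebraD(5)[of C S] by auto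

lemma cstar_scaleR: "cstar_algebra C ==> S \<in> C ==> r *\<^sub>R S \<in> C"
 by (simp add: scaleR_scaleC cstar_scaleC)

lemma cstar_complete: "cstar_algebra C ==> complete C"
 using cstar_algebraD(3) complete_eq_closed by blast

lemma norm_star_square: "clin x ==> norm (hadj x oo x) <= (norm x)^2"
 using norm_blinfun_compose[of "hadj x" x] by (simp add: norm_hadj power2_eq_square)

text \<open>The element \<open>z = x (1 + x\<^sup>* x)\<^sup>-\<^sup>1\<close> is obtained as the fixed point of a contraction.\<close>

lemma resolvent_ex:
 assumes C: "cstar_algebra C" and x: "x \<in> C"
 obtains z where "z \<in> C" "z + (z oo (hadj x oo x)) = x"
proof -
 define h where "h = hadj x oo x"
 define m where "m = (norm x)^2"
 have xc: "clin x" and h: "h \<in> C" using C x by (auto simp: h_def cstar_comp cstar_hadj cstar_algebraD(1))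
 have m: "0 <= m" by (simp add: m_def)
 \<comment> \<open>The error operator of the relaxed iteration \<open>G\<close> below. As
   \<open>h\<close> is positive of norm at most \<open>m\<close>, \<open>m - h\<close> has norm at
   most \<open>m\<close>, so \<open>G\<close> contracts with ratio
   \<open>m / (1 + m)\<close>.\<close>
 define A where "A = (1 / (1 + m)) *\<^sub>R (m *\<^sub>R \<one> - h)"
 have A: "norm A <= m / (1 + m)"
 proof -
  have "norm (m *\<^sub>R \<one> - h) <= m"
  proof (rule norm_blinfun_bound[OF m])
   fix xi
   have hxi: "h $ xi = hadj x $ (x $ xi)" by (simp add: h_def)
   have "norm (h $ xi) <= norm x * norm (x $ xi)"
    using norm_blinfun[of "hadj x" "x $ xi"] by (simp add: hxi norm_hadj xc)
   hence "(norm (h $ xi))^2 <= m * (norm (x $ xi))^2"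
    using power_mono[of "norm (h $ xi)" "norm x * norm (x $ xi)" 2] by (simp add: m_def power_mult_distrib)
   also have "(norm (x $ xi))^2 = Re <<xi, h $ xi>>" by (simp add: hxi hadj_right xc Re_cinner_self)
   finally have 1: "(norm (h $ xi))^2 <= m * Re <<xi, h $ xi>>" .
   have "0 <= m * Re <<xi, h $ xi>>" using 1 by (meson order.trans zero_le_power2)
   hence "(norm ((m *\<^sub>R \<one> - h) $ xi))^2 <= (m * norm xi)^2"
    using 1 by (simp add: norm_diff_sq blinfun.scaleR_left cinner_simps power_mult_distrib)
   thus "norm ((m *\<^sub>R \<one> - h) $ xi) <= m * norm xi"
    by (rule power2_le_imp_le) (use m in simp)
  qed
  thus ?thesis using m by (simp add: A_def divide_right_mono)
 qed
 define G where "G z = z + (1 / (1 + m)) *\<^sub>R (x - z - (z oo h))" for z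
 have "\<exists>!z\<in>C. G z = z"
 proof (rule Banach_fix[of C "m / (1 + m)"])
  show "complete C" "C ~= {}" using C cstar_complete cstar_zero by blast+
  show "0 <= m / (1 + m)" "m / (1 + m) < 1" using m by auto
  show "G ` C <= C"
   using C x h by (auto simp: G_def intro!: cstar_add cstar_scaleR cstar_diff cstar_comp)
  have "dist (G z) (G w) <= m / (1 + m) * dist z w" for z w
  proof -
   have "G z - G w = (z - w) oo A"
   proof (rule blinfun_eqI)
    fix xi
    have "(1 / (1 + m)) *\<^sub>R (m *\<^sub>R u) = u - (1 / (1 + m)) *\<^sub>R u" for u :: 'a
    proof -
     have "m / (1 + m) = 1 - 1 / (1 + m)" using m by (simp add: field_simps)
     thus ?thesis by (simp add: scaleR_diff_left)
    qed
    thus "(G z - G w) $ xi = ((z - w) oo A) $ xi"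
     by (simp add: G_def A_def blinfun.scaleR_left blinfun.scaleR_right blinfun.diff_right
       scaleR_diff_right algebra_simps del: scaleR_scaleR)
   qed
   hence "norm (G z - G w) <= norm (z - w) * norm A" using norm_blinfun_compose[of "z - w" A] by simp
   also have "... <= norm (z - w) * (m / (1 + m))" by (intro mult_left_mono A) auto
   finally show ?thesis by (simp add: dist_norm mult.commute)
  qed
  thus "!!z w. z \<in> C ==> w \<in> C ==> dist (G z) (G w) <= m / (1 + m) * dist z w" by blast
 qed
 then obtain z where z: "z \<in> C" "G z = z" by blast
 have "x - z - (z oo h) = 0" using z(2) m by (simp add: G_def)
 thus ?thesis using z(1) that[of z] by (simp add: h_def algebra_simps)
qed

text \<open>In terms of functional calculus, \<open>t / (1 + t^2)\<close> is at most
  \<open>1/2\<close>, and so is \<open>t - t / (1 + t^2)\<close> for \<open>t\<close> between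
  \<open>0\<close> and \<open>1\<close>. The adjoint of the equation, tested at one vector, gives
  both bounds without spectral theory.\<close>

lemma resolvent_bounds:
 assumes c: "clin z" "clin y" and eq: "z + (z oo (hadj y oo y)) = y"
 shows "norm z <= 1 / 2" and "norm y <= 1 ==> norm (y - z) <= 1 / 2"
proof -
 have main: "norm (hadj z $ xi) <= norm xi / 2 & (norm y <= 1 --> norm (hadj (y - z) $ xi) <= norm xi / 2)" for xi
 proof -
  define eta where "eta = hadj z $ xi"
  define a where "a = norm (y $ eta)"
  define b where "b = norm xi"
  have "hadj y = hadj (z + (z oo (hadj y oo y)))" by (simp add: eq)
  also have "... = hadj z + ((hadj y oo y) oo hadj z)" using c by simp
  finally have "hadj y $ xi = (hadj z + ((hadj y oo y) oo hadj z)) $ xi" by simp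
  hence e: "hadj y $ xi = eta + hadj y $ (y $ eta)" by (simp add: eta_def del: hadj_simps)
  have "(norm eta)^2 + a^2 = Re <<eta, hadj y $ xi>>"
   unfolding e by (simp add: cinner_simps hadj_right c Re_cinner_self a_def)
  also have "... = Re <<y $ eta, xi>>" by (simp add: hadj_right c)
  also have "... <= a * b" using Re_cinner_le[of "y $ eta" xi] by (simp add: a_def b_def)
  finally have 1: "(norm eta)^2 + a^2 <= a * b" .
  have "(a - b / 2)^2 = a^2 - a * b + (b / 2)^2" by (simp add: power2_diff)
  hence "0 <= a^2 - a * b + (b / 2)^2" by (metis zero_le_power2)
  hence "(norm eta)^2 <= (b / 2)^2" using 1 by linarith
  hence neta: "norm eta <= b / 2" by (rule power2_le_imp_le) (simp add: b_def)
  moreover have "norm (hadj (y - z) $ xi) <= b / 2" if y1: "norm y <= 1"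
  proof -
   have "hadj (y - z) $ xi = hadj y $ (y $ eta)" using c e by (simp add: eta_def)
   hence "norm (hadj (y - z) $ xi) <= a"
    using norm_apply_le[of "hadj y" "y $ eta"] y1 by (simp add: a_def norm_hadj c)
   moreover have "a <= norm eta" unfolding a_def by (rule norm_apply_le[OF y1])
   ultimately show ?thesis using neta by linarith
  qed
  ultimately show ?thesis by (simp add: eta_def b_def)
 qed
 have "norm (hadj z) <= 1 / 2"
  by (rule norm_blinfun_bound) (use main in auto)
 thus "norm z <= 1 / 2" by (simp add: norm_hadj c)
 assume y1: "norm y <= 1"
 have "norm (hadj (y - z)) <= 1 / 2"
  by (rule norm_blinfun_bound) (use main y1 in auto)
 thus "norm (y - z) <= 1 / 2" using c norm_hadj[of "y - z"] by simp
qed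

text \<open>A truncation: \<open>x\<close> is divided by \<open>norm (psi x)\<close> and passed
  through \<open>t / (1 + t^2)\<close>. This bounds the norm of the new element independently of
  \<open>norm x\<close>, while the same equation in the image keeps the error below half of
  \<open>norm (psi x)\<close>.\<close>

lemma approx_preimage:
 assumes psi: "cpc psi" and C: "cstar_algebra C" "C <= md psi" and x: "x \<in> C"
 obtains z where "z \<in> C" "norm z <= norm (psi x)" "norm (psi x - psi z) <= norm (psi x) / 2"
proof (cases "psi x = 0")
 case True
 thus ?thesis using that[of 0] cstar_zero[OF C(1)] cpc_zero[OF psi] by simp
next
 case False
 define r where "r = norm (psi x)"
 have r: "0 < r" using False by (simp add: r_def)
 define x' where "x' = (1 / r) *\<^sub>R x"
 have x': "x' \<in> C" using x C by (simp add: x'_def cstar_scaleR)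
 obtain z where z: "z \<in> C" "z + (z oo (hadj x' oo x')) = x'" using resolvent_ex[OF C(1) x'] by blast
 have c: "clin x" "clin x'" "clin z" using C z x x' cstar_algebraD(1) by blast+
 have sc: "psi (s *\<^sub>R T) = s *\<^sub>R psi T" if "clin T" for s T using cpc_scale[OF psi that] by (simp add: scaleR_scaleC)
 have y': "norm (psi x') <= 1" using r by (simp add: x'_def sc c r_def)
 have "psi z + (psi z oo (hadj (psi x') oo psi x')) = psi (z + (z oo (hadj x' oo x')))"
  using mdD(1)[OF subsetD[OF C(2) x'], of "hadj x'"] mdD(2)[OF subsetD[OF C(2) z(1)], of "hadj x' oo x'"] c
  by (simp add: cpc_add[OF psi] cpc_hadj[OF psi])
 hence eq: "psi z + (psi z oo (hadj (psi x') oo psi x')) = psi x'" by (simp add: z)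
 note b1 = resolvent_bounds(1)[OF c(3,2) z(2)]
 have b2: "norm (psi x' - psi z) <= 1 / 2" using c psi by (intro resolvent_bounds(2)[OF _ _ eq y']) auto
 show ?thesis
 proof (rule that[of "r *\<^sub>R z"])
  show "r *\<^sub>R z \<in> C" using z C by (simp add: cstar_scaleR)
  show "norm (r *\<^sub>R z) <= norm (psi x)" using b1 r mult_left_mono[OF b1, of r] by (simp add: r_def)
  have "psi x = r *\<^sub>R psi x'" using r by (simp add: x'_def sc c)
  hence "psi x - psi (r *\<^sub>R z) = r *\<^sub>R (psi x' - psi z)" by (simp add: sc c scaleR_diff_right)
  thus "norm (psi x - psi (r *\<^sub>R z)) <= norm (psi x) / 2"
   using mult_left_mono[OF b2, of r] r by (simp add: r_def)
 qed
qed

text \<open>The content is closedness. As in the open mapping theorem, a point of the closure is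
  approximated by images of elements of controlled norm, with errors that shrink geometrically, and
  the corrections are summed.\<close>

lemma cstar_image:
 assumes psi: "cpc psi" and C: "cstar_algebra C" "C <= md psi"
 shows "cstar_algebra (psi ` C)"
proof (rule cstar_algebraI)
 have cC: "clin x" if "x \<in> C" for x using that C cstar_algebraD(1) by blast
 show "clin T" if "T \<in> psi ` C" for T using that cC psi by auto
 show "0 \<in> psi ` C" using cpc_zero[OF psi] cstar_zero[OF C(1)] by (metis imageI)
 show "S + T \<in> psi ` C" if "S \<in> psi ` C" "T \<in> psi ` C" for S T
  using that cC by (auto simp: cpc_add[OF psi, symmetric] intro!: imageI cstar_add[OF C(1)])
 show "c *C T \<in> psi ` C" if "T \<in> psi ` C" for T c
  using that cC by (auto simp: cpc_scale[OF psi, symmetric] intro!: imageI cstar_scaleC[OF C(1)])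
 show "S oo T \<in> psi ` C" if "S \<in> psi ` C" "T \<in> psi ` C" for S T
 proof -
  obtain x y where xy: "x \<in> C" "y \<in> C" "S = psi x" "T = psi y" using \<open>S \<in> psi ` C\<close> \<open>T \<in> psi ` C\<close> by blast
  have "S oo T = psi (x oo y)" using mdD(1)[of y psi x] C(2) xy cC by auto
  thus ?thesis using xy cstar_comp[OF C(1)] by blast
 qed
 show "hadj T \<in> psi ` C" if "T \<in> psi ` C" for T
  using that cC by (auto simp: cpc_hadj[OF psi, symmetric] intro!: imageI cstar_hadj[OF C(1)])
 fix f T assume f: "!!n. f n \<in> psi ` C" "f ---> T"
 \<comment> \<open>The image of the starting element \<open>x\<close> is within
   \<open>norm y / 8\<close> of \<open>y\<close>, so \<open>z\<close> has norm at most
   \<open>9/8\<close> of \<open>norm y\<close> and the error is at most \<open>1/8 + 9/16\<close> of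
   it; \<open>2\<close> and \<open>3/4\<close> are these numbers rounded up.\<close>
 have D: "\<exists>z\<in>C. norm z <= 2 * norm y & norm (y - psi z) <= (3/4) * norm y" if y: "y \<in> closure (psi ` C)" for y
 proof (cases "y = 0")
  case True
  thus ?thesis using cstar_zero[OF C(1)] cpc_zero[OF psi] by (intro bexI[of _ 0]) auto
 next
  case False
  then obtain x where x: "x \<in> C" "dist (psi x) y < norm y / 8"
   using y unfolding closure_approachable by (metis (no_types, lifting) divide_pos_pos imageE zero_less_norm_iff zero_less_numeral)
  obtain z where z: "z \<in> C" "norm z <= norm (psi x)" "norm (psi x - psi z) <= norm (psi x) / 2"
   using approx_preimage[OF psi C x(1)] by blast
  have xy: "norm (psi x - y) <= norm y / 8" using x(2) by (simp add: dist_norm)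
  hence nx: "norm (psi x) <= norm y + norm y / 8" using norm_triangle_ineq2[of "psi x" y] by linarith
  have "norm (y - psi z) <= norm (psi x - y) + norm (psi x - psi z)"
   using norm_triangle_ineq[of "y - psi x" "psi x - psi z"] by (simp add: norm_minus_commute)
  hence "norm z <= 2 * norm y" "norm (y - psi z) <= (3/4) * norm y"
   using z(2,3) nx xy norm_ge_zero[of y] by linarith+
  thus ?thesis using z(1) by blast
 qed
 then obtain Z where Z: "!!y. y \<in> closure (psi ` C) ==> Z y \<in> C" "!!y. y \<in> closure (psi ` C) ==> norm (Z y) <= 2 * norm y"
  "!!y. y \<in> closure (psi ` C) ==> norm (y - psi (Z y)) <= (3/4) * norm y"
  by metis
 have "csubspace (psi ` C)"
  unfolding csubspace_def using \<open>0 \<in> psi ` C\<close> \<open>!!S T. S \<in> psi ` C ==> T \<in> psi ` C ==> S + T \<in> psi ` C\<close>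
   \<open>!!T c. T \<in> psi ` C ==> c *C T \<in> psi ` C\<close> by blast
 hence sub: "csubspace (closure (psi ` C))" by (rule csubspace_closure)
 define y where "y = rec_nat T (%_ v. v - psi (Z v))"
 have y0: "y 0 = T" and yS: "y (Suc n) = y n - psi (Z (y n))" for n by (simp_all add: y_def)
 have yD: "y n \<in> closure (psi ` C)" for n
 proof (induction n)
  case 0
  thus ?case using f unfolding y0 closure_sequential by blast
 next
  case (Suc n)
  thus ?case unfolding yS using Z(1)[OF Suc] subsetD[OF closure_subset, of _ "psi ` C"]
   by (intro csubspaceD(5)[OF sub]) auto
 qed
 have yn: "norm (y n) <= (3/4) ^ n * norm T" for n
 proof (induction n)
  case (Suc n)
  have "norm (y (Suc n)) <= (3/4) * norm (y n)" unfolding yS by (rule Z(3)[OF yD])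
  thus ?case using Suc by simp
 qed (simp add: y0)
 have zn: "norm (Z (y n)) <= 2 * norm T * (3/4) ^ n" for n
  using Z(2)[OF yD, of n] yn[of n] by (simp add: ac_simps)
 have "summable (%n. 2 * norm T * (3/4) ^ n)" by (intro summable_mult summable_geometric) simp
 hence "summable (%n. Z (y n))" by (rule summable_comparison_test'[where N = 0]) (use zn in simp)
 then obtain z where "(%n. Z (y n)) sums z" by blast
 hence zl: "(%n. \<Sum>k<n. Z (y k)) ---> z" by (simp add: sums_def)
 have sC: "(\<Sum>k<n. Z (y k)) \<in> C" for n
  using Z(1)[OF yD] by (intro csubspace_sum cstar_algebraD(2)[OF C(1)]) auto
 hence zC: "z \<in> C" using closed_sequentially[OF cstar_algebraD(3)[OF C(1)] _ zl] by blast
 have "(%n. psi (\<Sum>k<n. Z (y k))) ---> psi z"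
  by (rule cpc_tendsto[OF psi zl]) (use cC sC zC in auto)
 moreover have "psi (\<Sum>k<n. Z (y k)) = T - y n" for n
 proof -
  have "psi (\<Sum>k<n. Z (y k)) = (\<Sum>k<n. psi (Z (y k)))" using Z(1)[OF yD] cC by (intro cpc_sum[OF psi]) auto
  also have "... = (\<Sum>k<n. y k - y (Suc k))" by (simp add: yS)
  also have "... = T - y n" using sum_lessThan_telescope'[of y n] by (simp add: y0)
  finally show ?thesis .
 qed
 moreover have "(%n. T - y n) ---> T - 0"
 proof (intro tendsto_intros)
  have "(%n. (3/4::real) ^ n * norm T) ---> 0 * norm T"
   by (intro tendsto_intros LIMSEQ_realpow_zero) auto
  thus "y ---> 0" by (intro Lim_null_comparison[of y "%n. (3/4) ^ n * norm T"]) (use yn in auto)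
 qed
 ultimately have "psi z = T" using LIMSEQ_unique by fastforce
 thus "T \<in> psi ` C" using zC by blast
qed

lemma cstar_preimage:
 assumes psi: "cpc psi" and C: "cstar_algebra C" "C <= md psi" and D: "cstar_algebra D"
 shows "cstar_algebra {a \<in> C. psi a \<in> D}"
proof (rule cstar_algebraI)
 have cC: "clin x" if "x \<in> C" for x using that C cstar_algebraD(1) by blast
 show "S oo T \<in> {a \<in> C. psi a \<in> D}" if "S \<in> {a \<in> C. psi a \<in> D}" "T \<in> {a \<in> C. psi a \<in> D}" for S T
  using that mdD(1)[of T psi S] C cC by (auto simp: cstar_comp D)
 show "T \<in> {a \<in> C. psi a \<in> D}" if f: "!!n. f n \<in> {a \<in> C. psi a \<in> D}" "f ---> T" "clin T" for f T
 proof -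
  have "T \<in> C" using closed_sequentially[OF cstar_algebraD(3)[OF C(1)] _ f(2)] f(1) by auto
  moreover have "(%n. psi (f n)) ---> psi T" by (rule cpc_tendsto[OF psi f(2)]) (use f cC in auto)
  hence "psi T \<in> D"
   by (rule closed_sequentially[OF cstar_algebraD(3)[OF D], rotated]) (use f(1) in auto)
  ultimately show ?thesis by simp
 qed
qed (use cstar_algebraD(1)[OF C(1)] in \<open>auto simp: cpc_zero[OF psi] cpc_add[OF psi] cpc_scale[OF psi] cpc_hadj[OF psi]
   cstar_zero[OF D] cstar_zero[OF C(1)] cstar_add[OF C(1)] cstar_add[OF D] cstar_scaleC[OF C(1)] cstar_scaleC[OF D]
   cstar_hadj[OF C(1)] cstar_hadj[OF D]\<close>)

text \<open>No spectra are involved. Were \<open>p\<close> to increase a norm, then after scaling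
  \<open>norm z < 1 = norm (p z)\<close>. With \<open>h = hadj z oo z\<close>, the Neumann series of
  \<open>h\<close> has a sum \<open>k\<close> in \<open>C\<close>, found as a fixed point; its image
  makes the unit minus the image \<open>Y\<close> of \<open>h\<close> invertible, and this keeps
  \<open>norm (p z)\<close> strictly below one.\<close>

lemma star_hom_norm:
 assumes C: "cstar_algebra C" and D: "cstar_algebra D" and p: "star_hom C D p" and x: "x \<in> C"
 shows "norm (p x) <= norm x"
proof (rule ccontr)
 have pD: "!!a. a \<in> C ==> p a \<in> D" and padd: "!!a b. a \<in> C ==> b \<in> C ==> p (a + b) = p a + p b"
  and pscale: "!!c a. a \<in> C ==> p (c *C a) = c *C p a"
  and pmult: "!!a b. a \<in> C ==> b \<in> C ==> p (a oo b) = p a oo p b"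
  and phadj: "!!a. a \<in> C ==> p (hadj a) = hadj (p a)"
  using p by (auto simp: star_hom_def clinear_on_def adj_hadj)
 assume "\<not> norm (p x) <= norm x"
 hence r: "norm x < norm (p x)" "0 < norm (p x)" using norm_ge_zero[of x] by linarith+
 define z where "z = of_real (1 / norm (p x)) *C x"
 have z: "z \<in> C" "norm z < 1" "norm (p z) = 1"
  using r x C by (auto simp: z_def pscale norm_scaleC norm_divide cstar_scaleC)
 define h where "h = hadj z oo z"
 have zc: "clin z" "clin (p z)" using C D pD z cstar_algebraD(1) by blast+
 have hC: "h \<in> C" using C z by (simp add: h_def cstar_comp cstar_hadj)
 have "norm h <= (norm z)^2" unfolding h_def by (rule norm_star_square[OF zc(1)])
 also have "... < 1" using z by (simp add: abs_square_less_1)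
 finally have nh: "norm h < 1" .
 have "\<exists>!k\<in>C. h + (h oo k) = k"
 proof (rule Banach_fix[of C "norm h"])
  show "complete C" using cstar_algebraD(3)[OF C] by (simp add: complete_eq_closed)
  show "C ~= {}" "(%k. h + (h oo k)) ` C <= C" using hC C by (auto intro: cstar_add cstar_comp)
  show "dist (h + (h oo k)) (h + (h oo l)) <= norm h * dist k l" for k l
   using norm_blinfun_compose[of h "k - l"]
   by (simp add: dist_norm bounded_bilinear.diff_right[OF bounded_bilinear_blinfun_compose])
 qed (use nh in auto)
 then obtain k where k: "k \<in> C" "h + (h oo k) = k" by blast
 define y where "y = p z"
 define Y where "Y = hadj y oo y"
 define q where "q = hadj (p k)"
 define M where "M = 1 + norm q"
 have kc: "clin (p k)" using k pD D cstar_algebraD(1) by blast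
 have "p k = Y + (Y oo p k)"
  using arg_cong[OF k(2), of p] k(1) hC z C by (simp add: padd pmult phadj cstar_comp cstar_hadj h_def Y_def y_def)
 from arg_cong[OF this, of hadj] have qY: "q = Y + (q oo Y)"
  using zc kc by (simp add: q_def Y_def y_def)
 \<comment> \<open>The unit plus \<open>q\<close> is a left inverse of the unit minus
   \<open>Y\<close>.\<close>
 have inv: "xi = (xi - Y $ xi) + q $ (xi - Y $ xi)" for xi
  using arg_cong[OF qY, of "%T. T $ xi"] by (simp add: blinfun.diff_right)
 have Y1: "norm Y <= 1" using norm_star_square[OF zc(2)] z(3) by (simp add: Y_def y_def)
 have "norm (y $ xi) <= sqrt (1 - 1 / (2 * M^2)) * norm xi" for xi
 proof -
  define eta where "eta = xi - Y $ xi"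
  have M: "0 < M" by (simp add: M_def add_pos_nonneg)
  have "norm xi <= norm eta + norm (q $ eta)"
   using norm_triangle_ineq[of eta "q $ eta"] inv[of xi] by (simp add: eta_def)
  also have "... <= M * norm eta" using norm_blinfun[of q eta] by (simp add: M_def algebra_simps)
  finally have "(norm xi)^2 <= M^2 * (norm eta)^2"
   using power_mono[of "norm xi" "M * norm eta" 2] by (simp add: power_mult_distrib)
  moreover have "(norm eta)^2 <= 2 * ((norm xi)^2 - (norm (y $ xi))^2)"
  proof -
   have "norm (Y $ xi) <= norm xi"
    using norm_blinfun[of Y xi] mult_right_mono[OF Y1, of "norm xi"] by simp
   moreover have "Re <<xi, Y $ xi>> = (norm (y $ xi))^2"
    using zc(2) by (simp add: Y_def y_def hadj_right Re_cinner_self)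
   ultimately show ?thesis unfolding eta_def norm_diff_sq using power_mono[of "norm (Y $ xi)" "norm xi" 2] by simp
  qed
  ultimately have "(norm xi)^2 <= M^2 * (2 * ((norm xi)^2 - (norm (y $ xi))^2))"
   by (meson mult_left_mono order_trans zero_le_power2)
  hence "(norm (y $ xi))^2 <= (1 - 1 / (2 * M^2)) * (norm xi)^2"
   using M by (simp add: field_simps)
  from real_sqrt_le_mono[OF this] show ?thesis by (simp add: real_sqrt_mult)
 qed
 moreover define c where "c = 1 / (2 * M^2)"
 moreover have "1 <= M^2" by (rule one_le_power) (simp add: M_def)
 hence c: "0 < c" "c <= 1" unfolding c_def by (intro divide_pos_pos divide_le_eq_1[THEN iffD2] disjI1 conjI; linarith)+
 ultimately have "norm y <= sqrt (1 - c)" by (intro norm_blinfun_bound) auto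
 moreover have "sqrt (1 - c) < sqrt 1" using c by (subst real_sqrt_less_iff) simp
 ultimately show False using z(3) by (simp add: y_def)
qed

text \<open>The homomorphism is \<open>Om\<close> followed by the inverse of \<open>Lam\<close>. The
  images of the two generated algebras are C*-algebras with the common generators
  \<open>Om (i x) = Lam (j x)\<close>, so each contains the other, and \<open>inj\<close> makes
  \<open>Lam\<close> invertible there.\<close>

lemma maps_onto_intro:
 fixes Lam :: "'a::chilbert_space op => 'b::chilbert_space op"
  and Om :: "'m::chilbert_space op => 'b op"
 assumes Lam: "cpc Lam" "j ` X <= md Lam" and inj: "!!u. u \<in> cstar_gen (j ` X) ==> Lam u = 0 ==> u = 0"
  and Om: "cpc Om" "i ` X <= md Om" and ij: "!!x. x \<in> X ==> Om (i x) = Lam (j x)"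
 shows "maps_onto X (cstar_gen (i ` X)) i (cstar_gen (j ` X)) j"
proof -
 define F where "F = cstar_gen (i ` X)"
 define E where "E = cstar_gen (j ` X)"
 have c: "clin (i x)" "clin (j x)" if "x \<in> X" for x using that Lam(2) Om(2) by (auto dest: mdD)
 have F: "cstar_algebra F" and E: "cstar_algebra E" unfolding F_def E_def using c by (auto intro!: cstar_gen)
 have Fm: "F <= md Om" and Em: "E <= md Lam"
  unfolding F_def E_def by (intro cstar_gen_subset cstar_md Lam Om)+
 have iF: "i x \<in> F" and jE: "j x \<in> E" if "x \<in> X" for x
  using that unfolding F_def E_def by (auto intro: hull_inc)
 have "F <= {a \<in> F. Om a \<in> Lam ` E}"
  unfolding F_def
  by (rule cstar_gen_subset, fold F_def, rule cstar_preimage[OF Om(1) F Fm cstar_image[OF Lam(1) E Em]])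
   (use iF jE ij in auto)
 hence FE: "\<exists>u. u \<in> E & Lam u = Om a" if "a \<in> F" for a using that by fastforce
 have "E <= {a \<in> E. Lam a \<in> Om ` F}"
  unfolding E_def
  by (rule cstar_gen_subset, fold E_def, rule cstar_preimage[OF Lam(1) E Em cstar_image[OF Om(1) F Fm]])
   (use iF jE ij in \<open>auto simp: ij[symmetric]\<close>)
 hence EF: "\<exists>a\<in>F. Om a = Lam u" if "u \<in> E" for u using that by fastforce
 obtain p where p: "!!a. a \<in> F ==> p a \<in> E" "!!a. a \<in> F ==> Lam (p a) = Om a" using FE by metis
 have cE: "clin u" if "u \<in> E" for u using that cstar_algebraD(1)[OF E] by blast
 have cF: "clin u" if "u \<in> F" for u using that cstar_algebraD(1)[OF F] by blast
 have uniq: "u = w" if "u \<in> E" "w \<in> E" "Lam u = Lam w" for u w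
 proof -
  have "u - w \<in> E" using that E by (simp add: cstar_diff)
  moreover have "Lam (u - w) = 0" using that cE by (simp add: cpc_diff[OF Lam(1)])
  ultimately show ?thesis using inj[of "u - w"] by (simp add: E_def)
 qed
 have "star_hom F E p"
  unfolding star_hom_def clinear_on_def adj_hadj
 proof (intro conjI ballI allI)
  show "p ` F <= E" using p by blast
  show "p (x + y) = p x + p y" if "x \<in> F" "y \<in> F" for x y
   using that by (intro uniq)
    (simp_all add: p F E cstar_add cpc_add[OF Lam(1)] cpc_add[OF Om(1)] cE cF)
  show "p (c *C x) = c *C p x" if "x \<in> F" for c x
   using that by (intro uniq)
    (simp_all add: p F E cstar_scaleC cpc_scale[OF Lam(1)] cpc_scale[OF Om(1)] cE cF)
  show "p (hadj x) = hadj (p x)" if "x \<in> F" for x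
   using that by (intro uniq)
    (simp_all add: p F E cstar_hadj cpc_hadj[OF Lam(1)] cpc_hadj[OF Om(1)] cE cF)
  show "p (S oo T) = p S oo p T" if "S \<in> F" "T \<in> F" for S T
   using that mdD(1)[OF subsetD[OF Fm], of T S] mdD(1)[OF subsetD[OF Em], of "p T" "p S"]
   by (intro uniq) (simp_all add: p F E cstar_comp cE cF)
 qed
 moreover have "p ` F = E"
 proof
  show "E <= p ` F"
  proof
   fix u assume u: "u \<in> E"
   then obtain a where a: "a \<in> F" "Om a = Lam u" using EF by blast
   hence "p a = u" using u p by (intro uniq) auto
   thus "u \<in> p ` F" using a by blast
  qed
 qed (use p in blast)
 moreover have "p (i x) = j x" if "x \<in> X" for x
  using that p iF jE ij by (intro uniq) auto
 ultimately show ?thesis unfolding maps_onto_def F_def E_def by blast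
qed

section \<open>Tensor products\<close>

text \<open>Unlike \<^const>\<open>hilbert_tensor\<close>, this allows the elementary tensors to span a proper
  subspace of the target space.\<close>

definition wtensor :: "('h::chilbert_space => 'k::chilbert_space => 'l::chilbert_space) => bool" where
 "wtensor t \<longleftrightarrow> (\<forall>y. clinear_on UNIV (%x. t x y)) & (\<forall>x. clinear_on UNIV (t x)) &
   (\<forall>x y x' y'. <<t x y, t x' y'>> = <<x, x'>> * <<y, y'>>)"

definition torth :: "('h => 'k => 'l::chilbert_space) => 'l set" where
 "torth t = {z. \<forall>x y. <<t x y, z>> = 0}"

lemma hilbert_wtensor: "hilbert_tensor t ==> wtensor t"
 by (simp add: hilbert_tensor_def wtensor_def)

lemma hilbert_torth:
 assumes "hilbert_tensor t" "z \<in> torth t" shows "z = 0"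
proof -
 have "z \<in> closure (cspan {t x y | x y. True})" using assms(1) by (simp add: hilbert_tensor_def)
 hence "<<z, z>> = 0"
 proof (rule orth_closure_cspan)
  fix s assume "s \<in> {t x y | x y. True}"
  hence "<<s, z>> = 0" using assms(2) by (auto simp: torth_def)
  thus "<<z, s>> = 0" using orth_commute by blast
 qed
 thus ?thesis by (simp add: cinner_self)
qed

lemma wtensor_simps:
 assumes "wtensor t"
 shows "t (x + x') y = t x y + t x' y" "t x (y + y') = t x y + t x y'"
  "t (c *C x) y = c *C t x y" "t x (c *C y) = c *C t x y"
  "<<t x y, t x' y'>> = <<x, x'>> * <<y, y'>>"
 using assms by (auto simp: wtensor_def clinear_on_def)

lemma wtensor_norm: "wtensor t ==> norm (t x y) = norm x * norm y"
proof -
 assume t: "wtensor t"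
 have "(norm (t x y))^2 = (norm x * norm y)^2"
  using wtensor_simps(5)[OF t, of x y x y]
  by (simp add: cinner_self power_mult_distrib flip: of_real_mult of_real_power)
 thus ?thesis by (simp add: power2_eq_iff_nonneg)
qed

lemma wtensor_flip: "wtensor t ==> wtensor (%y x. t x y)"
 by (simp add: wtensor_def)

lemma torth_flip: "torth (%y x. t x y) = torth t"
 by (auto simp: torth_def)

section \<open>Gram sums and tensor products of operators\<close>

lemma has_sum_finite_sum:
 fixes f :: "'a => 'i => 'b::topological_comm_monoid_add"
 assumes "!!a. a \<in> F ==> (f a has_sum s a) A"
 shows "((%i. \<Sum>a\<in>F. f a i) has_sum (\<Sum>a\<in>F. s a)) A"
 using assms
 by (induction F rule: infinite_finite_induct) (auto simp: has_sum_0 intro: has_sum_add)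

lemma ell2_embedding: "\<exists>u :: 'k::chilbert_space => 'k ell2. \<forall>y y'. <<u y, u y'>> = <<y, y'>>"
proof -
 have "psd_kernel UNIV (cinner :: 'k => 'k => complex)"
  unfolding psd_kernel_def
 proof (intro conjI ballI allI impI)
  show "<<i, j>> = cnj <<j, i>>" for i j :: 'k by (rule cinner_commute)
  fix F and c :: "'k => complex"
  have "(\<Sum>i\<in>F. \<Sum>j\<in>F. cnj (c i) * c j * <<i, j>>) = <<\<Sum>i\<in>F. c i *C i, \<Sum>i\<in>F. c i *C i>>"
   by (simp add: cinner_sum_sum)
  thus "0 <= Re (\<Sum>i\<in>F. \<Sum>j\<in>F. cnj (c i) * c j * <<i, j>>)" by (simp add: Re_cinner_self del: Re_sum)
 qed
 thus ?thesis using kolmogorov[of UNIV "cinner :: 'k => 'k => complex"] by (metis UNIV_I)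
qed

text \<open>Writing each \<open>y a\<close> in coordinates turns the Gram sum of elementary tensors
  into a sum, over the coordinates, of squared norms in the first factor. Positivity and the
  boundedness of \<open>S \<otimes> 1\<close> can then be checked coordinate by coordinate.\<close>

lemma gram_has_sum:
 fixes x :: "'c => 'h::chilbert_space" and y :: "'c => 'k::chilbert_space" and u :: "'k => 'i ell2"
 assumes u: "!!y y'. <<u y, u y'>> = <<y, y'>>"
 shows "((%i. (norm (\<Sum>a\<in>F. ell2_coord (u (y a)) i *C x a))^2)
    has_sum Re (\<Sum>a\<in>F. \<Sum>b\<in>F. <<x a, x b>> * <<y a, y b>>)) UNIV"
proof -
 have "((%i. cnj (ell2_coord (u (y a)) i) * ell2_coord (u (y b)) i) has_sum <<y a, y b>>) UNIV" for a b
  unfolding u[symmetric] cinner_ell2_def by (intro has_sum_infsum ell2_cinner_summable)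
 hence "((%i. \<Sum>a\<in>F. \<Sum>b\<in>F. <<x a, x b>> * (cnj (ell2_coord (u (y a)) i) * ell2_coord (u (y b)) i))
   has_sum (\<Sum>a\<in>F. \<Sum>b\<in>F. <<x a, x b>> * <<y a, y b>>)) UNIV"
  by (intro has_sum_finite_sum has_sum_cmult_right)
 hence "((%i. Re (\<Sum>a\<in>F. \<Sum>b\<in>F. <<x a, x b>> * (cnj (ell2_coord (u (y a)) i) * ell2_coord (u (y b)) i)))
   has_sum Re (\<Sum>a\<in>F. \<Sum>b\<in>F. <<x a, x b>> * <<y a, y b>>)) UNIV"
  by (rule has_sum_Re)
 moreover have "(\<Sum>a\<in>F. \<Sum>b\<in>F. <<x a, x b>> * (cnj (ell2_coord (u (y a)) i) * ell2_coord (u (y b)) i))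
   = <<\<Sum>a\<in>F. ell2_coord (u (y a)) i *C x a, \<Sum>a\<in>F. ell2_coord (u (y a)) i *C x a>>" for i
  unfolding cinner_sum_sum by (simp add: ac_simps)
 ultimately show ?thesis by (simp add: Re_cinner_self del: Re_sum)
qed

lemma norm_sum_wtensor:
 assumes t: "wtensor t"
 shows "(norm (\<Sum>a\<in>F. t (x a) (y a)))^2 = Re (\<Sum>a\<in>F. \<Sum>b\<in>F. <<x a, x b>> * <<y a, y b>>)"
 unfolding Re_cinner_self[symmetric] cinner_sum_sum' by (simp add: wtensor_simps[OF t])

lemma gram_nonneg: "0 <= Re (\<Sum>a\<in>F. \<Sum>b\<in>F. <<x a, x b>> * <<y a, y b>>)"
 for x :: "_ => 'h::chilbert_space" and y :: "_ => 'k::chilbert_space"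
proof -
 obtain u :: "'k => 'k ell2" where u: "!!y y'. <<u y, u y'>> = <<y, y'>>" using ell2_embedding by blast
 show ?thesis by (rule has_sum_nonneg[OF gram_has_sum[OF u]]) simp
qed

lemma gram_bound:
 fixes x :: "_ => 'h::chilbert_space" and y :: "_ => 'k::chilbert_space"
  and S :: "'h \<Rightarrow>\<^sub>L 'p::chilbert_space"
 assumes S: "clin S"
 shows "Re (\<Sum>a\<in>F. \<Sum>b\<in>F. <<S $ x a, S $ x b>> * <<y a, y b>>)
  <= (norm S)^2 * Re (\<Sum>a\<in>F. \<Sum>b\<in>F. <<x a, x b>> * <<y a, y b>>)"
proof -
 obtain u :: "'k => 'k ell2" where u: "!!y y'. <<u y, u y'>> = <<y, y'>>" using ell2_embedding by blast
 show ?thesis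
 proof (rule has_sum_mono[OF gram_has_sum[OF u] has_sum_cmult_right[OF gram_has_sum[OF u]]])
  fix i
  let ?w = "\<Sum>a\<in>F. ell2_coord (u (y a)) i *C x a"
  have "(norm (S $ ?w))^2 <= (norm S * norm ?w)^2" by (intro power_mono norm_blinfun) simp
  thus "(norm (\<Sum>a\<in>F. ell2_coord (u (y a)) i *C S $ x a))^2 <= (norm S)^2 * (norm ?w)^2"
   by (simp add: clin_sum[OF S] power_mult_distrib)
 qed
qed

text \<open>Gram vectors of the product kernel. Bilinearity is automatic, since the difference of
  the two sides has norm zero by the inner products alone.\<close>

lemma wtensor_ex: "\<exists>w :: 'p::chilbert_space => 'k::chilbert_space => ('p \<times> 'k) ell2. wtensor w"
proof -
 define K where "K i j = <<fst i, fst j>> * <<snd i, snd j>>" for i j :: "'p \<times> 'k"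
 have "psd_kernel UNIV K"
  unfolding psd_kernel_def
 proof (intro conjI ballI allI impI)
  show "K i j = cnj (K j i)" for i j by (simp add: K_def cinner_commute[symmetric])
  fix F c
  have "(\<Sum>i\<in>F. \<Sum>j\<in>F. cnj (c i) * c j * K i j)
    = (\<Sum>i\<in>F. \<Sum>j\<in>F. <<c i *C fst i, c j *C fst j>> * <<snd i, snd j>>)"
   by (simp add: K_def cinner_simps ac_simps)
  thus "0 <= Re (\<Sum>i\<in>F. \<Sum>j\<in>F. cnj (c i) * c j * K i j)"
   using gram_nonneg[of "%i. c i *C fst i" snd F] by (simp del: Re_sum)
 qed
 then obtain v :: "'p \<times> 'k => ('p \<times> 'k) ell2" where v: "!!i j. <<v i, v j>> = K i j"
  using kolmogorov[of UNIV K] by auto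
 have eqI: "x = y" if "<<x, x>> = <<x, y>>" "<<y, x>> = <<y, y>>" for x y :: "('p \<times> 'k) ell2"
 proof -
  have "<<x - y, x - y>> = 0" using that by (simp add: cinner_simps)
  thus ?thesis by (simp add: cinner_self)
 qed
 have "wtensor (%x y. v (x, y))"
  unfolding wtensor_def clinear_on_def
  by (intro conjI allI ballI; (rule eqI)?) (simp_all add: cinner_simps v K_def algebra_simps)
 thus ?thesis by blast
qed

lemma op_eq_on_family:
 fixes S T :: "'a::chilbert_space \<Rightarrow>\<^sub>L 'b::chilbert_space" and v :: "'i => 'a"
 assumes "clin S" "clin T" "!!i. i \<in> I ==> S $ v i = T $ v i"
  and "!!x. (!!i. i \<in> I ==> <<v i, x>> = 0) ==> S $ x = T $ x"
 shows "S = T"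
proof (rule blinfun_eqI)
 fix x
 obtain z where z: "z \<in> closure (cspan (v ` I))" "!!i. i \<in> I ==> <<v i, x - z>> = 0"
  using proj_ex[of v I x] by blast
 have "S $ z = T $ z"
 proof (rule closure_cspan_induct[OF z(1)])
  show "closed {x. S $ x = T $ x}" by (intro closed_Collect_eq continuous_intros)
  show "csubspace {x. S $ x = T $ x}"
   using assms(1,2) by (simp add: csubspace_def blinfun.add_right clin_scaleC)
 qed (use assms(3) in auto)
 thus "S $ x = T $ x" using assms(4)[OF z(2)] by (simp add: blinfun.diff_right)
qed

lemma op_image_eqI:
 fixes t :: "'h => 'k => 'l::chilbert_space"
 assumes "!!x y. <<t x y, u>> = <<t x y, v>>" "!!z. z \<in> torth t ==> <<z, u>> = <<z, v>>"
 shows "u = v"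
proof -
 have "u - v \<in> torth t" using assms(1) by (simp add: torth_def cinner_simps)
 hence "<<u - v, u>> = <<u - v, v>>" by (rule assms(2))
 hence "<<u - v, u - v>> = 0" by (subst cinner_diff_right) simp
 thus ?thesis by (simp add: cinner_self)
qed

text \<open>Vanishing on \<open>torth t\<close> pins the operator down even where the elementary
  tensors do not span; for a Hilbert space tensor product it agrees with
  \<open>op_tensor\<close>.\<close>

definition otimes :: "('h::chilbert_space => 'k::chilbert_space => 'l::chilbert_space)
  => 'h op => 'k op => 'l op" where
 "otimes t S T = (THE R. clin R & (\<forall>x y. R $ t x y = t (S $ x) (T $ y)) & (\<forall>z\<in>torth t. R $ z = 0))"

lemma op_eq_on_tensors:
 fixes t :: "'h => 'k => 'l::chilbert_space" and R R' :: "'l \<Rightarrow>\<^sub>L 'b::chilbert_space"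
 assumes "clin R" "clin R'" "!!x y. R $ t x y = R' $ t x y" "!!z. z \<in> torth t ==> R $ z = R' $ z"
 shows "R = R'"
 using assms by (intro op_eq_on_family[of R R' UNIV "%(x, y). t x y"]) (auto simp: torth_def)

lemma left_tensor_ex:
 fixes t :: "'h::chilbert_space => 'k::chilbert_space => 'l::chilbert_space"
 assumes t: "wtensor t" and S: "clin S"
 shows "\<exists>R. clin R & (\<forall>x y. R $ t x y = t (S $ x) y) & norm R <= norm S & (\<forall>z\<in>torth t. R $ z = 0 & hadj R $ z = 0)"
proof -
 have "norm (\<Sum>i\<in>F. c i *C t (S $ fst i) (snd i)) <= norm S * norm (\<Sum>i\<in>F. c i *C t (fst i) (snd i))" for F c
 proof -
  define x where "x i = c i *C fst i" for i
  have e: "(\<Sum>i\<in>F. c i *C t (S $ fst i) (snd i)) = (\<Sum>i\<in>F. t (S $ x i) (snd i))"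
   "(\<Sum>i\<in>F. c i *C t (fst i) (snd i)) = (\<Sum>i\<in>F. t (x i) (snd i))"
   by (simp_all add: x_def wtensor_simps[OF t] clin_scaleC[OF S])
  have "(norm (\<Sum>i\<in>F. t (S $ x i) (snd i)))^2 <= (norm S * norm (\<Sum>i\<in>F. t (x i) (snd i)))^2"
   using gram_bound[OF S, of x snd F] by (simp add: norm_sum_wtensor[OF t] power_mult_distrib del: Re_sum)
  thus ?thesis unfolding e by (rule power2_le_imp_le) simp
 qed
 then obtain R where R: "clin R" "!!i. i \<in> UNIV ==> R $ (t (fst i) (snd i)) = t (S $ fst i) (snd i)" "norm R <= norm S"
  "!!x. (!!i. i \<in> UNIV ==> <<t (fst i) (snd i), x>> = 0) ==> R $ x = 0"
  "!!x y. (!!i. i \<in> UNIV ==> <<t (S $ fst i) (snd i), y>> = 0) ==> <<y, R $ x>> = 0"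
  using family_op[of UNIV "%i. t (S $ fst i) (snd i)" "norm S" "%i. t (fst i) (snd i)"] by (smt (verit) norm_ge_zero)
 have "hadj R $ z = 0" if "z \<in> torth t" for z
 proof (rule cinner_eqI_left)
  fix w
  have "<<z, R $ w>> = 0" using that by (intro R(5)) (auto simp: torth_def)
  thus "<<hadj R $ z, w>> = <<0, w>>" by (simp add: hadj_left R(1))
 qed
 thus ?thesis using R(1,3,4) R(2)[of "(_, _)"] by (intro exI[of _ R]) (auto simp: torth_def)
qed

lemma otimes_ex:
 fixes t :: "'h::chilbert_space => 'k::chilbert_space => 'l::chilbert_space"
 assumes t: "wtensor t" and S: "clin S" and T: "clin T"
 shows "\<exists>R. clin R & (\<forall>x y. R $ t x y = t (S $ x) (T $ y)) & norm R <= norm S * norm T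
  & (\<forall>z\<in>torth t. R $ z = 0 & hadj R $ z = 0)"
proof -
 obtain A where A: "clin A" "!!x y. A $ t x y = t (S $ x) y" "norm A <= norm S" "!!z. z \<in> torth t ==> A $ z = 0 & hadj A $ z = 0"
  using left_tensor_ex[OF t S] by blast
 obtain B where B: "clin B" "!!x y. B $ t x y = t x (T $ y)" "norm B <= norm T" "!!z. z \<in> torth t ==> B $ z = 0 & hadj B $ z = 0"
  using left_tensor_ex[OF wtensor_flip[OF t] T, unfolded torth_flip[of t]] by blast
 have "norm (A oo B) <= norm S * norm T"
  by (rule order.trans[OF norm_blinfun_compose]) (intro mult_mono A B, auto)
 thus ?thesis using A B by (intro exI[of _ "A oo B"]) auto
qed

context
 fixes t :: "'h::chilbert_space => 'k::chilbert_space => 'l::chilbert_space"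
 assumes t: "wtensor t"
begin

lemma otimes_all:
 assumes "clin S" "clin T"
 shows "clin (otimes t S T) & (\<forall>x y. otimes t S T $ t x y = t (S $ x) (T $ y)) & norm (otimes t S T) <= norm S * norm T
  & (\<forall>z\<in>torth t. otimes t S T $ z = 0 & hadj (otimes t S T) $ z = 0)"
proof -
 obtain R where R: "clin R" "!!x y. R $ t x y = t (S $ x) (T $ y)" "norm R <= norm S * norm T"
  "!!z. z \<in> torth t ==> R $ z = 0 & hadj R $ z = 0"
  using otimes_ex[OF t assms] by metis
 have "otimes t S T = R"
  unfolding otimes_def
  by (rule the_equality) (use R in \<open>auto intro!: op_eq_on_tensors[where t = t]\<close>)
 thus ?thesis using R by blast
qed

lemma clin_otimes [simp]: "clin S ==> clin T ==> clin (otimes t S T)"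
 and otimes_apply [simp]: "clin S ==> clin T ==> otimes t S T $ t x y = t (S $ x) (T $ y)"
 and norm_otimes: "clin S ==> clin T ==> norm (otimes t S T) <= norm S * norm T"
 and otimes_torth [simp]: "clin S ==> clin T ==> z \<in> torth t ==> otimes t S T $ z = 0"
 and otimes_torth_hadj [simp]: "clin S ==> clin T ==> z \<in> torth t ==> hadj (otimes t S T) $ z = 0"
 using otimes_all[of S T] by auto

lemma otimes_eqI:
 assumes "clin R" "!!x y. R $ t x y = t (S $ x) (T $ y)" "!!z. z \<in> torth t ==> R $ z = 0" "clin S" "clin T"
 shows "R = otimes t S T"
 using assms by (intro op_eq_on_tensors[where t = t]) auto

lemma otimes_add_left: "clin S ==> clin S' ==> clin T ==> otimes t (S + S') T = otimes t S T + otimes t S' T"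
 and otimes_add_right: "clin S ==> clin T ==> clin T' ==> otimes t S (T + T') = otimes t S T + otimes t S T'"
 and otimes_scale_left: "clin S ==> clin T ==> otimes t (c *C S) T = c *C otimes t S T"
 and otimes_scale_right: "clin S ==> clin T ==> otimes t S (c *C T) = c *C otimes t S T"
 and otimes_comp: "clin S ==> clin S' ==> clin T ==> clin T' ==>
  otimes t S T oo otimes t S' T' = otimes t (S oo S') (T oo T')"
 by (rule otimes_eqI[symmetric] otimes_eqI; simp add: wtensor_simps[OF t])+

lemma otimes_hadj:
 assumes S: "clin S" and T: "clin T"
 shows "hadj (otimes t S T) = otimes t (hadj S) (hadj T)"
proof (rule otimes_eqI)
 fix x y
 show "hadj (otimes t S T) $ t x y = t (hadj S $ x) (hadj T $ y)"
 proof (rule op_image_eqI)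
  fix x' y'
  show "<<t x' y', hadj (otimes t S T) $ t x y>> = <<t x' y', t (hadj S $ x) (hadj T $ y)>>"
   using S T by (simp add: hadj_right wtensor_simps[OF t])
 next
  fix z assume "z \<in> torth t"
  moreover from this have "<<t u v, z>> = 0" "<<z, t u v>> = 0" for u v
   using orth_commute[of z "t u v"] by (auto simp: torth_def)
  ultimately show "<<z, hadj (otimes t S T) $ t x y>> = <<z, t (hadj S $ x) (hadj T $ y)>>"
   using S T by (simp add: hadj_right)
 qed
qed (use S T in auto)

end

section \<open>Slices and tensor products of completely positive maps\<close>

definition sliceL :: "('h::chilbert_space => 'k::chilbert_space => 'l::chilbert_space) => 'k => 'h \<Rightarrow>\<^sub>L 'l" where
 "sliceL t y = Blinfun (%x. t x y)"

definition sliceR :: "('h::chilbert_space => 'k::chilbert_space => 'l::chilbert_space) => 'h => 'k \<Rightarrow>\<^sub>L 'l" where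
 "sliceR t x = sliceL (%y x. t x y) x"

context
 fixes t :: "'h::chilbert_space => 'k::chilbert_space => 'l::chilbert_space"
 assumes t: "wtensor t"
begin

lemma sliceL: "clin (sliceL t y)" "sliceL t y $ x = t x y" "norm (sliceL t y) <= norm y"
proof -
 obtain T where T: "clin T" "!!x. T $ x = t x y" "norm T <= norm y"
  using mk_op[of "%x. t x y" "norm y"] wtensor_simps[OF t] wtensor_norm[OF t] by (metis mult.commute norm_ge_zero order_refl)
 hence "sliceL t y = T" unfolding sliceL_def using blinfun_apply_inverse[of T] by (simp flip: T(2))
 thus "clin (sliceL t y)" "sliceL t y $ x = t x y" "norm (sliceL t y) <= norm y" using T by auto
qed

end

text \<open>The slice of \<open>T\<close> by the functional on the second factor that sends
  \<open>R\<close> to \<open><<y', R $ y>>\<close>.\<close>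

definition slice1 :: "('h::chilbert_space => 'k::chilbert_space => 'l::chilbert_space) => 'k => 'k => 'l op => 'h op" where
 "slice1 t y' y T = hadj (sliceL t y') oo (T oo sliceL t y)"

definition slice2 :: "('h::chilbert_space => 'k::chilbert_space => 'l::chilbert_space) => 'h => 'h => 'l op => 'k op" where
 "slice2 t x' x T = hadj (sliceR t x') oo (T oo sliceR t x)"

lemma sliceR:
 assumes "wtensor t"
 shows "clin (sliceR t x)" "sliceR t x $ y = t x y" "norm (sliceR t x) <= norm x"
 unfolding sliceR_def using sliceL[OF wtensor_flip[OF assms]] by auto

lemma slice2_flip: "slice2 t = slice1 (%y x. t x y)"
 by (simp add: fun_eq_iff slice1_def slice2_def sliceR_def)

lemma slice1_simps:
 assumes "wtensor t"
 shows "clin T ==> clin (slice1 t y' y T)"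
  "<<x', slice1 t y' y T $ x>> = <<t x' y', T $ t x y>>"
  "slice1 t y' y (S + T) = slice1 t y' y S + slice1 t y' y T"
  "slice1 t y' y (c *C T) = c *C slice1 t y' y T"
  "norm (slice1 t y' y T) <= norm y' * norm T * norm y"
proof -
 note s = sliceL[OF assms]
 show "clin T ==> clin (slice1 t y' y T)" by (simp add: slice1_def s)
 show i: "<<x', slice1 t y' y T $ x>> = <<t x' y', T $ t x y>>" for T x x' by (simp add: slice1_def s hadj_right)
 show "slice1 t y' y (S + T) = slice1 t y' y S + slice1 t y' y T"
  "slice1 t y' y (c *C T) = c *C slice1 t y' y T"
  by (intro blinfun_eqI cinner_eqI; simp add: i cinner_simps)+
 have "norm (slice1 t y' y T) <= norm (hadj (sliceL t y')) * norm (T oo sliceL t y)"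
  unfolding slice1_def by (rule norm_blinfun_compose)
 also have "... <= norm y' * (norm T * norm y)"
 proof (intro mult_mono)
  show "norm (hadj (sliceL t y')) <= norm y'" using s by (simp add: norm_hadj)
  show "norm (T oo sliceL t y) <= norm T * norm y"
   using norm_blinfun_compose[of T "sliceL t y"] mult_left_mono[OF s(3)[of y], of "norm T"] by simp
 qed auto
 finally show "norm (slice1 t y' y T) <= norm y' * norm T * norm y" by (simp add: mult.assoc)
qed

lemma slice1_otimes:
 assumes t: "wtensor t" and "clin S" "clin T"
 shows "slice1 t y' y (otimes t S T) = <<y', T $ y>> *C S"
 by (intro blinfun_eqI cinner_eqI)
  (simp add: slice1_simps[OF t] assms wtensor_simps[OF t] cinner_simps)

lemma slice1_cpc: "wtensor t ==> norm y <= 1 ==> cpc (slice1 t y y)"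
proof -
 assume t: "wtensor t" and y: "norm y <= 1"
 have "slice1 t y y = sand (sliceL t y)" by (auto simp: fun_eq_iff slice1_def sand_def comp_assoc)
 thus ?thesis using sliceL[OF t, of y] y cpc_sand[of "sliceL t y"] by simp
qed

text \<open>This is \<open>\<alpha> \<otimes> id\<close> on all bounded operators. Since
  \<open>\<alpha>\<close> need not be normal, values on elementary tensors do not settle it; it is
  defined by applying \<open>\<alpha>\<close> to slices.\<close>

lemma amplification:
 fixes \<alpha> :: "'h::chilbert_space op => 'p::chilbert_space op"
  and t :: "'h => 'k::chilbert_space => 'l::chilbert_space" and w :: "'p => 'k => 'r::chilbert_space"
 assumes \<alpha>: "cpc \<alpha>" and t: "wtensor t" and w: "wtensor w"
 shows "\<exists>A. cpc A & (\<forall>T. clin T --> (\<forall>x' x y' y. <<w x' y', A T $ w x y>> = <<x', \<alpha> (slice1 t y' y T) $ x>>) &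
  (\<forall>z\<in>torth w. A T $ z = 0 & hadj (A T) $ z = 0))"
proof -
 define ka where "ka T i j = <<fst i, \<alpha> (slice1 t (snd i) (snd j) T) $ fst j>>" for T i j
 note s = slice1_simps[OF t]
 have "\<exists>A. cpc A & (\<forall>T. clin T --> (\<forall>i\<in>UNIV. \<forall>j\<in>UNIV. <<w (fst i) (snd i), A T $ w (fst j) (snd j)>> = ka T i j) &
   (\<forall>x. (\<forall>i\<in>UNIV. <<w (fst i) (snd i), x>> = 0) --> A T $ x = 0 & hadj (A T) $ x = 0))"
 proof (rule kernel_cp)
  show "ka (S + T) i j = ka S i j + ka T i j" if "clin S" "clin T" for S T i j
   using that by (simp add: ka_def s cpc_add[OF \<alpha>] cinner_simps)
  show "ka (c *C T) i j = c * ka T i j" if "clin T" for c T i j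
   using that by (simp add: ka_def s cpc_scale[OF \<alpha>] cinner_simps)
  show "0 <= Re (\<Sum>a<n. \<Sum>b<n. ka (C a b) (io a) (io b))"
   if C: "!!a b. a < n ==> b < n ==> clin (C a b)" "acc {..<n::nat} C" for n C io
  proof -
   have "acc {..<n} (%a b. slice1 t (snd (io a)) (snd (io b)) (C a b))"
    unfolding acc_def
   proof
    fix xi
    have "mform {..<n} (%a b. slice1 t (snd (io a)) (snd (io b)) (C a b)) xi = mform {..<n} C (%a. t (xi a) (snd (io a)))"
     by (simp add: mform_def s)
    thus "0 <= Re (mform {..<n} (%a b. slice1 t (snd (io a)) (snd (io b)) (C a b)) xi)"
     using C(2) by (simp add: acc_def)
   qed
   hence "acc {..<n} (%a b. \<alpha> (slice1 t (snd (io a)) (snd (io b)) (C a b)))"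
    using C by (intro cpc_acc[OF \<alpha>]) (auto simp: s)
   hence "0 <= Re (mform {..<n} (%a b. \<alpha> (slice1 t (snd (io a)) (snd (io b)) (C a b))) (%a. fst (io a)))"
    unfolding acc_def by blast
   thus ?thesis by (simp add: mform_def ka_def)
  qed
  show "Re (\<Sum>i\<in>F. \<Sum>j\<in>F. cnj (c i) * c j * ka \<one> i j) <= (norm (\<Sum>i\<in>F. c i *C w (fst i) (snd i)))^2" for F c
  proof -
   let ?u = "\<Sum>i\<in>F. c i *C w (fst i) (snd i)" and ?R = "otimes w (\<alpha> \<one>) \<one>"
   have \<alpha>1: "clin (\<alpha> \<one>)" using \<alpha> by simp
   have R: "clin ?R" using \<alpha>1 by (simp add: clin_otimes[OF w])
   have "slice1 t y' y \<one> = <<y', y>> *C \<one>" for y' y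
    by (intro blinfun_eqI cinner_eqI) (simp add: s wtensor_simps[OF t] cinner_simps)
   hence "ka \<one> i j = <<w (fst i) (snd i), ?R $ w (fst j) (snd j)>>" for i j
    using \<alpha>1 by (simp add: ka_def cpc_scale[OF \<alpha>] cinner_simps otimes_apply[OF w] wtensor_simps[OF w])
   hence "(\<Sum>i\<in>F. \<Sum>j\<in>F. cnj (c i) * c j * ka \<one> i j) = <<?u, ?R $ ?u>>"
    by (simp add: clin_sum[OF R] cinner_sum_sum)
   moreover have "norm ?R <= 1"
   proof -
    have n: "norm (\<one> :: 'k op) <= 1" "norm (\<one> :: 'h op) <= 1" by (rule norm_blinfun_id_le)+
    have "norm ?R <= norm (\<alpha> \<one>) * norm (\<one> :: 'k op)" using \<alpha>1 by (intro norm_otimes[OF w]) auto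
    also have "... <= 1 * 1" using n cpc_norm[OF \<alpha>, of \<one>] by (intro mult_mono) auto
    finally show ?thesis by simp
   qed
   hence "norm ?u * norm (?R $ ?u) <= norm ?u * norm ?u" by (intro mult_left_mono norm_apply_le) auto
   hence "Re <<?u, ?R $ ?u>> <= (norm ?u)^2"
    using Re_cinner_le[of ?u "?R $ ?u"] by (simp add: power2_eq_square)
   ultimately show ?thesis by simp
  qed
 qed
 then obtain A where A: "cpc A" "!!T i j. clin T ==> <<w (fst i) (snd i), A T $ w (fst j) (snd j)>> = ka T i j"
   "!!T x. clin T ==> (!!i. <<w (fst i) (snd i), x>> = 0) ==> A T $ x = 0 & hadj (A T) $ x = 0" by auto
 show ?thesis
 proof (intro exI[of _ A] conjI allI impI ballI)
  fix T :: "'l op" assume T: "clin T"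
  show "<<w x' y', A T $ w x y>> = <<x', \<alpha> (slice1 t y' y T) $ x>>" for x' x y' y
   using A(2)[OF T, of "(x', y')" "(x, y)"] by (simp add: ka_def)
  fix z assume "z \<in> torth w"
  hence "<<w (fst i) (snd i), z>> = 0" for i by (simp add: torth_def)
  thus "A T $ z = 0" "hadj (A T) $ z = 0" using A(3)[OF T] by blast+
 qed (rule A(1))
qed

text \<open>\<open>\<sigma> x' x T\<close> is the slice \<open>\<langle>x', (\<alpha> \<otimes> id) T x\<rangle>\<close> in the first tensor factor.  Since \<open>\<alpha>\<close> and \<open>\<beta>\<close> need not be
  normal, the order of the two amplifications matters outside the minimal tensor product.\<close>

lemma tensor_cp:
 fixes \<alpha> :: "'h::chilbert_space op => 'p::chilbert_space op"
  and \<beta> :: "'k::chilbert_space op => 'q::chilbert_space op"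
  and t :: "'h => 'k => 'l::chilbert_space" and s :: "'p => 'q => 'r::chilbert_space"
 assumes \<alpha>: "cpc \<alpha>" and \<beta>: "cpc \<beta>" and t: "wtensor t" and s: "wtensor s"
 shows "\<exists>Lam \<sigma>. cpc Lam & (\<forall>x. norm x <= 1 --> cpc (\<sigma> x x)) &
  (\<forall>S T. clin S --> clin T --> Lam (otimes t S T) = otimes s (\<alpha> S) (\<beta> T)) &
  (\<forall>T. clin T --> (\<forall>x' x. clin (\<sigma> x' x T)) & (\<forall>x' x y' y. <<s x' y', Lam T $ s x y>> = <<y', \<beta> (\<sigma> x' x T) $ y>>) &
   (\<forall>x' x y' y. <<y', \<sigma> x' x T $ y>> = <<x', \<alpha> (slice1 t y' y T) $ x>>) &
   (\<forall>z\<in>torth s. Lam T $ z = 0 & hadj (Lam T) $ z = 0))"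
proof -
 \<comment> \<open>The intermediate space between the two amplifications: \<open>\<alpha>\<close> is
   applied in the first factor, then \<open>\<beta>\<close> in the second.\<close>
 obtain w :: "'p => 'k => ('p \<times> 'k) ell2" where w: "wtensor w" using wtensor_ex by blast
 obtain A where A: "cpc A" "!!T x' x y' y. clin T ==> <<w x' y', A T $ w x y>> = <<x', \<alpha> (slice1 t y' y T) $ x>>"
  using amplification[OF \<alpha> t w] by (elim exE conjE) (rule that, assumption, simp_all)
 obtain B where B: "cpc B" "!!T x' x y' y. clin T ==> <<s x' y', B T $ s x y>> = <<y', \<beta> (slice2 w x' x T) $ y>>"
  "!!T z. clin T ==> z \<in> torth s ==> B T $ z = 0 & hadj (B T) $ z = 0"
  using amplification[OF \<beta> wtensor_flip[OF w] wtensor_flip[OF s], unfolded torth_flip[of s], folded slice2_flip]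
  by (elim exE conjE) (rule that, assumption, simp_all)
 define Lam where "Lam T = B (A T)" for T
 define \<sigma> where "\<sigma> x' x T = slice2 w x' x (A T)" for x' x T
 note sl = slice1_simps[OF wtensor_flip[OF w], folded slice2_flip]
 have Lam: "cpc Lam" unfolding Lam_def by (rule cpc_comp[OF A(1) B(1)])
 have 1: "clin (\<sigma> x' x T)" if "clin T" for x' x T using that A(1) by (simp add: \<sigma>_def sl)
 have 2: "<<s x' y', Lam T $ s x y>> = <<y', \<beta> (\<sigma> x' x T) $ y>>" if "clin T" for T x' x y' y
  using that A(1) by (simp add: Lam_def \<sigma>_def B(2))
 have 3: "<<y', \<sigma> x' x T $ y>> = <<x', \<alpha> (slice1 t y' y T) $ x>>" if "clin T" for T x' x y' y
  using that A(1) by (simp add: \<sigma>_def sl A(2))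
 have 4: "Lam T $ z = 0 & hadj (Lam T) $ z = 0" if "clin T" "z \<in> torth s" for T z
  using that A(1) B(3) by (simp add: Lam_def)
 have 5: "cpc (\<sigma> x x)" if "norm x <= 1" for x
  unfolding \<sigma>_def slice2_flip by (rule cpc_comp[OF A(1) slice1_cpc[OF wtensor_flip[OF w] that]])
 have 6: "Lam (otimes t S T) = otimes s (\<alpha> S) (\<beta> T)" if S: "clin S" and T: "clin T" for S T
 proof -
  have st: "clin (otimes t S T)" using S T by (simp add: clin_otimes[OF t])
  have c: "clin (\<alpha> S)" "clin (\<beta> T)" using S T \<alpha> \<beta> by auto
  have "\<sigma> x' x (otimes t S T) = <<x', \<alpha> S $ x>> *C T" for x' x
   by (intro blinfun_eqI cinner_eqI)
    (simp add: 3[OF st] slice1_otimes[OF t S T] cpc_scale[OF \<alpha> S] cinner_simps)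
  hence e: "<<s x' y', Lam (otimes t S T) $ s x y>> = <<s x' y', otimes s (\<alpha> S) (\<beta> T) $ s x y>>" for x' x y' y
   by (simp add: 2[OF st] cpc_scale[OF \<beta> T] otimes_apply[OF s c] wtensor_simps[OF s] cinner_simps)
  show ?thesis
  proof (rule op_eqI_family[of _ _ UNIV "%(x, y). s x y"])
   fix z assume "!!i. i \<in> UNIV ==> <<case i of (x, y) => s x y, z>> = 0"
   hence z: "z \<in> torth s" by (auto simp: torth_def)
   show "Lam (otimes t S T) $ z = 0 & hadj (Lam (otimes t S T)) $ z = 0" by (rule 4[OF st z])
   show "otimes s (\<alpha> S) (\<beta> T) $ z = 0 & hadj (otimes s (\<alpha> S) (\<beta> T)) $ z = 0"
    using otimes_torth[OF s c z] otimes_torth_hadj[OF s c z] by blast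
  qed (use e cpc_clin[OF Lam st] clin_otimes[OF s c] in auto)
 qed
 show ?thesis using Lam 1 2 3 4 5 6 by (intro exI[of _ Lam] exI[of _ \<sigma>]) auto
qed

lemma op_tensor_otimes:
 assumes t: "hilbert_tensor t" and S: "clin S" and T: "clin T"
 shows "op_tensor t S T = otimes t S T"
 unfolding op_tensor_def cops_iff
proof (rule the_equality)
 have w: "wtensor t" by (rule hilbert_wtensor[OF t])
 show "clin (otimes t S T) & (\<forall>x y. otimes t S T $ t x y = t (S $ x) (T $ y))"
  using S T by (simp add: clin_otimes[OF w] otimes_apply[OF w])
 fix R assume "clin R & (\<forall>x y. R $ t x y = t (S $ x) (T $ y))"
 thus "R = otimes t S T"
  using S T by (intro op_eq_on_tensors[where t = t])
   (auto simp: clin_otimes[OF w] otimes_apply[OF w] dest: hilbert_torth[OF t])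
qed

section \<open>Contractive approximate identities\<close>

text \<open>\<open>P\<close> is the projection onto the closed span of the ranges of the elements of \<open>X\<close>.\<close>

definition cai :: "'a::chilbert_space op set => 'a op => 'a op filter => bool" where
 "cai X P \<F> \<longleftrightarrow> csubspace X & (\<forall>x\<in>X. clin x & P oo x = x & x oo P = x) &
   clin P & hadj P = P & P oo P = P & \<F> ~= bot &
   (\<forall>\<^sub>F e in \<F>. e \<in> X & norm e <= 1 & (\<forall>x\<in>X. x oo e \<in> X)) &
   (\<forall>xi. ((%e. e $ xi) ~~> P $ xi) \<F>) &
   (\<forall>x\<in>X. ((%e. x oo e) ~~> x) \<F> & ((%e. e oo x) ~~> x) \<F>)"

lemma caiD:
 assumes "cai X P \<F>"
 shows "csubspace X" "x \<in> X ==> clin x" "x \<in> X ==> P oo x = x" "x \<in> X ==> x oo P = x"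
  "clin P" "hadj P = P" "P oo P = P" "\<F> ~= bot"
  "\<forall>\<^sub>F e in \<F>. e \<in> X & norm e <= 1 & (\<forall>x\<in>X. x oo e \<in> X)"
  "((%e. e $ xi) ~~> P $ xi) \<F>"
  "x \<in> X ==> ((%e. x oo e) ~~> x) \<F>" "x \<in> X ==> ((%e. e oo x) ~~> x) \<F>"
 using assms by (auto simp: cai_def)

lemma cai_unit:
 assumes "csubspace X" "!!x. x \<in> X ==> clin x" "e \<in> X" "hadj e = e" "norm e <= 1"
  "!!x. x \<in> X ==> e oo x = x & x oo e = x"
 shows "cai X e (principal {e})"
proof -
 have [simp]: "(f ~~> f e) (principal {e})" for f :: "_ => 'z::topological_space"
  by (rule tendsto_eventually) (simp add: eventually_principal)
 show ?thesis
  using assms unfolding cai_def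
  by (auto simp: eventually_principal principal_eq_bot_iff intro!: tendsto_eventually)
qed

lemma comp_eq_apply: "A oo B = C ==> A $ (B $ x) = C $ x"
 by auto

text \<open>A contraction that almost fixes \<open>xi\<close> has \<open>Re <<xi, e $ xi>>\<close>
  close to \<open>(norm xi)^2\<close>, and this number is the same for \<open>e\<close> and
  \<open>hadj e\<close>.\<close>

lemma contraction_hadj_approx:
 assumes e: "clin e" "norm e <= 1"
 shows "(norm (hadj e $ xi - xi))^2 <= 2 * norm xi * norm (xi - e $ xi)"
proof -
 have "norm (hadj e $ xi) <= norm xi" using e by (intro norm_apply_le) (simp add: norm_hadj)
 hence n: "(norm (hadj e $ xi))^2 <= (norm xi)^2" by (intro power_mono) auto
 have "(norm (hadj e $ xi - xi))^2 = (norm (hadj e $ xi))^2 + (norm xi)^2 - 2 * Re <<xi, e $ xi>>"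
  by (simp add: norm_diff_sq hadj_left e)
 also have "... <= 2 * (norm xi)^2 - 2 * Re <<xi, e $ xi>>" using n by simp
 also have "... = 2 * Re <<xi, xi - e $ xi>>" by (simp add: cinner_simps Re_cinner_self)
 also have "... <= 2 * (norm xi * norm (xi - e $ xi))" using Re_cinner_le[of xi "xi - e $ xi"] by simp
 finally show ?thesis by simp
qed

lemma contraction_hadj_approx_op:
 assumes e: "clin e" "norm e <= 1"
 shows "norm ((hadj e oo x) - x) <= sqrt (2 * norm x * norm (x - (e oo x)))"
proof (rule norm_blinfun_bound)
 fix xi
 have "(norm (((hadj e oo x) - x) $ xi))^2 <= 2 * norm (x $ xi) * norm ((x - (e oo x)) $ xi)"
  using contraction_hadj_approx[OF e, of "x $ xi"] by simp
 also have "... <= 2 * (norm x * norm xi) * (norm (x - (e oo x)) * norm xi)"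
  by (intro mult_mono norm_blinfun) auto
 also have "... = (sqrt (2 * norm x * norm (x - (e oo x))) * norm xi)^2"
  by (simp add: power_mult_distrib) (simp add: power2_eq_square)
 finally show "norm (((hadj e oo x) - x) $ xi) <= sqrt (2 * norm x * norm (x - (e oo x))) * norm xi"
  by (rule power2_le_imp_le) simp
qed simp

lemma hadj_approx_tendsto:
 assumes "((%e. e oo x) ~~> x) \<F>" and ev: "\<forall>\<^sub>F e in \<F>. clin e & norm e <= 1"
 shows "((%e. hadj e oo x) ~~> x) \<F>"
proof (rule Lim_null[THEN iffD2], rule Lim_null_comparison)
 show "\<forall>\<^sub>F e in \<F>. norm ((hadj e oo x) - x) <= sqrt (2 * norm x * norm (x - (e oo x)))"
  using ev by eventually_elim (simp add: contraction_hadj_approx_op)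
 have "((%e. sqrt (2 * norm x * norm (x - (e oo x)))) ~~> sqrt (2 * norm x * norm (x - x))) \<F>"
  using assms(1) by (intro tendsto_intros)
 thus "((%e. sqrt (2 * norm x * norm (x - (e oo x)))) ~~> 0) \<F>" by simp
qed

text \<open>The uniform Lipschitz bound carries convergence to limit points, by the usual splitting
  into thirds.\<close>

lemma closed_pointwise_limit:
 fixes L :: "'e => 'v::real_normed_vector => 'w::real_normed_vector"
 assumes ev: "\<forall>\<^sub>F e in \<F>. \<forall>v w. norm (L e v - L e w) <= K * norm (v - w)"
  and L0: "!!v w. norm (L0 v - L0 w) <= K * norm (v - w)" and K: "0 < K"
 shows "closed {v. ((%e. L e v) ~~> L0 v) \<F>}"
proof (rule closed_seqI)
 fix f x assume f: "!!n. f n \<in> {v. ((%e. L e v) ~~> L0 v) \<F>}" "f ---> x"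
 show "x \<in> {v. ((%e. L e v) ~~> L0 v) \<F>}"
 proof (clarify, rule tendstoI)
  fix \<epsilon> :: real assume "0 < \<epsilon>"
  hence "0 < \<epsilon> / (3 * K)" using K by simp
  then obtain n where n: "norm (f n - x) < \<epsilon> / (3 * K)" using f(2) unfolding LIMSEQ_iff by blast
  hence n': "K * norm (f n - x) < \<epsilon> / 3" using K by (simp add: field_simps)
  have "\<forall>\<^sub>F e in \<F>. dist (L e (f n)) (L0 (f n)) < \<epsilon> / 3" using f(1)[of n] \<open>0 < \<epsilon>\<close> by (auto dest!: tendstoD[of _ _ _ "\<epsilon> / 3"])
  thus "\<forall>\<^sub>F e in \<F>. dist (L e x) (L0 x) < \<epsilon>"
   using ev
  proof eventually_elim
   case (elim e)
   have "norm (L e x - L e (f n)) < \<epsilon> / 3"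
    using elim(2) n' by (metis norm_minus_commute order_le_less_trans)
   moreover have "norm (L0 (f n) - L0 x) < \<epsilon> / 3" using L0[of "f n" x] n' by simp
   ultimately show ?case
    using elim(1) norm_triangle_ineq[of "L e x - L e (f n)" "L e (f n) - L0 (f n)"]
     norm_triangle_ineq[of "L e x - L0 (f n)" "L0 (f n) - L0 x"] by (simp add: dist_norm)
  qed
 qed
qed

lemma closed_strong_limit:
 fixes L :: "'e => 'a::chilbert_space \<Rightarrow>\<^sub>L 'b::chilbert_space"
 assumes "\<forall>\<^sub>F e in \<F>. norm (L e) <= 1"
 shows "closed {v. ((%e. L e $ v) ~~> L0 $ v) \<F>}"
proof (rule closed_pointwise_limit)
 let ?K = "1 + norm L0"
 show "norm (L0 $ v - L0 $ w) <= ?K * norm (v - w)" for v w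
  using norm_blinfun[of L0 "v - w"] norm_ge_zero[of "v - w"] unfolding blinfun.diff_right distrib_right
  by linarith
 show "\<forall>\<^sub>F e in \<F>. \<forall>v w. norm (L e $ v - L e $ w) <= ?K * norm (v - w)"
  using assms
 proof eventually_elim
  case (elim e)
  have "norm (L e $ v - L e $ w) <= norm (v - w)" for v w
   using norm_apply_le[OF elim, of "v - w"] by (simp add: blinfun.diff_right)
  moreover have "norm (v - w) <= ?K * norm (v - w)" for v w :: 'a by (simp add: distrib_right)
  ultimately show ?case using order_trans by blast
 qed
qed (simp add: add_pos_nonneg)

lemma csubspace_strong_limit:
 fixes L :: "'e => 'a::chilbert_space \<Rightarrow>\<^sub>L 'b::chilbert_space"
 assumes ev: "\<forall>\<^sub>F e in \<F>. clin (L e)" and L0: "clin L0"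
 shows "csubspace {v. ((%e. L e $ v) ~~> L0 $ v) \<F>}"
proof -
 have "((%e. L e $ (c *C v)) ~~> L0 $ (c *C v)) \<F>" if "((%e. L e $ v) ~~> L0 $ v) \<F>" for c v
 proof (rule Lim_transform_eventually)
  show "((%e. c *C L e $ v) ~~> L0 $ (c *C v)) \<F>" unfolding clin_scaleC[OF L0] by (rule tendsto_scaleC[OF that])
  show "\<forall>\<^sub>F e in \<F>. c *C L e $ v = L e $ (c *C v)" using ev by eventually_elim (simp add: clin_scaleC)
 qed
 thus ?thesis by (auto simp: csubspace_def blinfun.add_right intro: tendsto_add)
qed

lemma approx_right_closed:
 fixes f :: "'e => 'a::chilbert_space op"
 assumes "\<forall>\<^sub>F e in \<F>. clin (f e) & norm (f e) <= 1"
 shows "closed {x :: 'a op. ((%e. f e oo x) ~~> x) \<F>}" "csubspace {x :: 'a op. clin x & ((%e. f e oo x) ~~> x) \<F>}"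
  "closed {x :: 'a op. ((%e. x oo f e) ~~> x) \<F>}" "csubspace {x :: 'a op. clin x & ((%e. x oo f e) ~~> x) \<F>}"
proof -
 show "closed {x :: 'a op. ((%e. f e oo x) ~~> x) \<F>}"
  by (rule closed_pointwise_limit[where K = 1])
   (use assms in \<open>auto elim!: eventually_mono simp: comp_simps(4)[symmetric]
    intro!: order_trans[OF norm_blinfun_compose] mult_left_le_one_le\<close>)
 show "closed {x :: 'a op. ((%e. x oo f e) ~~> x) \<F>}"
  by (rule closed_pointwise_limit[where K = 1])
   (use assms in \<open>auto elim!: eventually_mono simp: comp_simps(3)[symmetric]
    intro!: order_trans[OF norm_blinfun_compose] mult_left_le\<close>)
 have "((%e. f e oo (c *C x)) ~~> c *C x) \<F>" if "((%e. f e oo x) ~~> x) \<F>" for c and x :: "'a op"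
  by (rule Lim_transform_eventually[OF tendsto_scaleC[OF that]])
   (use assms in eventually_elim, simp add: comp_simps)
 thus "csubspace {x :: 'a op. clin x & ((%e. f e oo x) ~~> x) \<F>}"
  by (auto simp: csubspace_def comp_simps(2) intro: tendsto_add)
 show "csubspace {x :: 'a op. clin x & ((%e. x oo f e) ~~> x) \<F>}"
  by (auto simp: csubspace_def comp_simps(1,5) intro: tendsto_add tendsto_scaleC)
qed

text \<open>The elements on which \<open>e\<close> and \<open>hadj e\<close> both act as approximate
  units from the left, also after taking adjoints, form a C*-algebra. For contractions all these
  limits on \<open>X\<close> reduce to the ones contained in \<open>cai\<close>.\<close>

lemma cai_cstar:
 assumes c: "cai X P \<F>" and x: "x \<in> cstar_gen X"
 shows "((%e. e oo x) ~~> x) \<F>" "((%e. hadj e oo x) ~~> x) \<F>"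
  "((%e. x oo e) ~~> x) \<F>" "((%e. x oo hadj e) ~~> x) \<F>" "P oo x = x" "x oo P = x"
proof -
 define D where "D = {x. clin x & ((%e. e oo x) ~~> x) \<F> & ((%e. hadj e oo x) ~~> x) \<F> &
  ((%e. e oo hadj x) ~~> hadj x) \<F> & ((%e. hadj e oo hadj x) ~~> hadj x) \<F> & P oo x = x & P oo hadj x = hadj x}"
 have ev: "\<forall>\<^sub>F e in \<F>. clin e & norm e <= 1" using caiD(9)[OF c] by eventually_elim (simp add: caiD(2)[OF c])
 have ev': "\<forall>\<^sub>F e in \<F>. clin (hadj e) & norm (hadj e) <= 1" using ev by eventually_elim (simp add: norm_hadj)
 have adj: "((%e. x oo hadj (f e)) ~~> x) \<F>"
  if "((%e. f e oo hadj x) ~~> hadj x) \<F>" "\<forall>\<^sub>F e in \<F>. clin (f e)" "clin x" for x f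
 proof -
  have "((%e. norm ((f e oo hadj x) - hadj x)) ~~> 0) \<F>" using that(1) by (simp add: tendsto_norm_zero_iff flip: Lim_null)
  hence "((%e. norm ((x oo hadj (f e)) - x)) ~~> 0) \<F>"
  proof (rule Lim_transform_eventually)
   show "\<forall>\<^sub>F e in \<F>. norm ((f e oo hadj x) - hadj x) = norm ((x oo hadj (f e)) - x)"
    using that(2)
   proof eventually_elim
    case (elim e)
    thus ?case using that(3) norm_hadj[of "(x oo hadj (f e)) - x"] by simp
   qed
  qed
  thus ?thesis by (simp add: tendsto_norm_zero_iff flip: Lim_null)
 qed
 note cl = approx_right_closed[of "%e. e", OF ev] approx_right_closed[of hadj, OF ev']
 have "cstar_algebra D"
 proof (rule cstar_algebraI)
  show "S + T \<in> D" if "S \<in> D" "T \<in> D" for S T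
   using that unfolding D_def by (auto simp: comp_simps intro!: tendsto_add)
  show "a *C T \<in> D" if "T \<in> D" for a T
   using that csubspaceD(3)[OF cl(2), of _ a] csubspaceD(3)[OF cl(6), of _ a] csubspaceD(3)[OF cl(2), of _ "cnj a"] csubspaceD(3)[OF cl(6), of _ "cnj a"]
    caiD(5)[OF c] unfolding D_def by (auto simp: comp_simps)
  show "hadj T \<in> D" if "T \<in> D" for T using that unfolding D_def by auto
  show "S oo T \<in> D" if S: "S \<in> D" and T: "T \<in> D" for S T
  proof -
   have m: "((%e. f e oo (S oo T)) ~~> S oo T) \<F>" if "((%e. f e oo S) ~~> S) \<F>" for S T and f :: "_ => 'a op"
    using tendsto_comp[OF that tendsto_const[of T]] by (simp add: comp_assoc)
   have "P oo (S oo T) = S oo T" "P oo (hadj T oo hadj S) = hadj T oo hadj S"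
    using S T unfolding D_def by (simp_all flip: comp_assoc)
   thus ?thesis using S T unfolding D_def by (auto intro!: m)
  qed
  show "T \<in> D" if f: "!!n. f n \<in> D" "f ---> T" "clin T" for f T
  proof -
   have f': "(%n. hadj (f n)) ---> hadj T" using f by (intro tendsto_hadj) (auto simp: D_def)
   have "P oo T = T" "P oo hadj T = hadj T"
    using LIMSEQ_unique[OF tendsto_comp[OF tendsto_const[of P] f(2)]] f(1,2)
     LIMSEQ_unique[OF tendsto_comp[OF tendsto_const[of P] f']] f'
    unfolding D_def by auto
   thus ?thesis
    using f closed_sequentially[OF cl(1), of f T] closed_sequentially[OF cl(5), of f T]
     closed_sequentially[OF cl(1), of "%n. hadj (f n)" "hadj T"] closed_sequentially[OF cl(5), of "%n. hadj (f n)" "hadj T"] f'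
    unfolding D_def by auto
  qed
 qed (auto simp: D_def)
 moreover have "X <= D"
 proof
  fix x assume x: "x \<in> X"
  note l = caiD(2)[OF c x]
  have 1: "((%e. e oo x) ~~> x) \<F>" by (rule caiD(12)[OF c x])
  have xe: "((%e. x oo e) ~~> x) \<F>" by (rule caiD(11)[OF c x])
  have 4: "((%e. hadj e oo hadj x) ~~> hadj x) \<F>"
  proof -
   have n: "((%e. norm ((x oo e) - x)) ~~> 0) \<F>" using xe by (simp add: tendsto_norm_zero_iff flip: Lim_null)
   have "((%e. norm ((hadj e oo hadj x) - hadj x)) ~~> 0) \<F>"
   proof (rule Lim_transform_eventually[OF n])
    show "\<forall>\<^sub>F e in \<F>. norm ((x oo e) - x) = norm ((hadj e oo hadj x) - hadj x)"
     using ev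
    proof eventually_elim
     case (elim e)
     thus ?case using l norm_hadj[of "(x oo e) - x"] by simp
    qed
   qed
   thus ?thesis by (simp add: tendsto_norm_zero_iff flip: Lim_null)
  qed
  \<comment> \<open>\<open>hadj_approx_tendsto\<close> along the net of adjoints leads from
    \<open>hadj e\<close> back to \<open>e\<close>.\<close>
  have 3: "((%e. e oo hadj x) ~~> hadj x) \<F>"
  proof -
   have "((%e. hadj (hadj e) oo hadj x) ~~> hadj x) \<F>"
    using hadj_approx_tendsto[of "hadj x" "filtermap hadj \<F>"] 4 ev'
    by (simp add: filterlim_filtermap eventually_filtermap)
   thus ?thesis by (rule Lim_transform_eventually) (use ev in eventually_elim, simp)
  qed
  have "P oo hadj x = hadj x"
   using arg_cong[OF caiD(4)[OF c x], of hadj] caiD(5,6)[OF c] l by simp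
  thus "x \<in> D" using 1 3 4 l hadj_approx_tendsto[OF 1 ev] caiD(3)[OF c x] by (simp add: D_def)
 qed
 ultimately have "x \<in> D" using x cstar_gen_subset by blast
 moreover from this have "x oo P = x"
  using arg_cong[of "P oo hadj x" "hadj x" hadj] hadj_simps(7)[OF caiD(5)[OF c], of "hadj x"] caiD(6)[OF c]
  by (simp add: D_def)
 moreover have "((%e. x oo hadj (hadj e)) ~~> x) \<F>"
  using \<open>x \<in> D\<close> ev' by (intro adj) (auto simp: D_def elim: eventually_mono)
 hence "((%e. x oo e) ~~> x) \<F>" by (rule Lim_transform_eventually) (use ev in eventually_elim, simp)
 ultimately show "((%e. e oo x) ~~> x) \<F>" "((%e. hadj e oo x) ~~> x) \<F>"
  "((%e. x oo e) ~~> x) \<F>" "((%e. x oo hadj e) ~~> x) \<F>" "P oo x = x" "x oo P = x"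
  using adj[of "%e. e" x] eventually_conj_iff[of clin "%e. norm e <= 1" \<F>] ev by (auto simp: D_def)
qed

text \<open>The delicate point is \<open>x oo P = x\<close>, a statement about the ranges of
  adjoints. Contractivity makes \<open>hadj e\<close> converge on the range of \<open>P\<close>
  along with \<open>e\<close>, which is enough.\<close>

lemma cai_algebra:
 fixes X :: "'a::chilbert_space op set"
 assumes X: "csubspace X" "!!x. x \<in> X ==> clin x" "!!x y. x \<in> X ==> y \<in> X ==> x oo y \<in> X"
  and \<F>: "\<F> ~= bot" "\<forall>\<^sub>F e in \<F>. e \<in> X & norm e <= 1"
  and lim: "!!x. x \<in> X ==> ((%e. e oo x) ~~> x) \<F>" "!!x. x \<in> X ==> ((%e. x oo e) ~~> x) \<F>"
 shows "\<exists>P. cai X P \<F>"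
proof -
 define v :: "'a op \<times> 'a => 'a" where "v = (%i. fst i $ snd i)"
 define I where "I = X \<times> (UNIV :: 'a set)"
 obtain P where P: "clin P" "!!i. i \<in> I ==> P $ v i = v i" "norm P <= 1"
  "!!x. (!!i. i \<in> I ==> <<v i, x>> = 0) ==> P $ x = 0"
  "!!x y. (!!i. i \<in> I ==> <<v i, y>> = 0) ==> <<y, P $ x>> = 0"
  by (rule family_op[of I v 1 v]) auto
 have h0: "hadj P $ x = 0" if "!!i. i \<in> I ==> <<v i, x>> = 0" for x
  by (rule cinner_eqI_left) (simp add: hadj_left P(1) P(5)[OF that])
 have PP: "P oo P = P" by (rule op_eq_on_family[of _ _ I v]) (auto simp: P)
 have hP: "hadj P = P"
  by (rule op_eqI_family[of _ _ I v]) (auto simp: P h0 hadj_right)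
 have Px: "P oo x = x" if "x \<in> X" for x
  by (rule blinfun_eqI) (use P(2)[of "(x, _)"] that in \<open>simp add: v_def I_def\<close>)
 have ev: "\<forall>\<^sub>F e in \<F>. clin e & norm e <= 1" using \<F>(2) by eventually_elim (simp add: X)
 have onM: "((%e. e $ m) ~~> \<one> $ m) \<F>" if "P $ m = m" for m
 proof -
  obtain z where z: "z \<in> closure (cspan (v ` I))" "!!i. i \<in> I ==> <<v i, m - z>> = 0"
   using proj_ex[of v I m] by blast
  have "P $ z = z"
  proof (rule closure_cspan_induct[OF z(1)])
   show "closed {x. P $ x = x}" by (intro closed_Collect_eq continuous_intros)
   show "csubspace {x. P $ x = x}" using P(1) by (simp add: csubspace_def blinfun.add_right clin_scaleC)
  qed (use P(2) in auto)
  hence "m = z" using P(4)[of "m - z"] z(2) that by (simp add: blinfun.diff_right)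
  show ?thesis unfolding \<open>m = z\<close>
  proof (rule closure_cspan_induct[OF z(1)])
   show "closed {x. ((%e. e $ x) ~~> \<one> $ x) \<F>}"
    using ev by (intro closed_strong_limit) (auto elim: eventually_mono)
   show "csubspace {x. ((%e. e $ x) ~~> \<one> $ x) \<F>}"
    using ev by (intro csubspace_strong_limit) (auto elim: eventually_mono)
   fix y assume "y \<in> v ` I"
   then obtain x h where x: "x \<in> X" "y = x $ h" by (auto simp: v_def I_def)
   have "((%e. (e oo x) $ h) ~~> x $ h) \<F>" using lim(1)[OF x(1)] by (intro blinfun.tendsto tendsto_const)
   thus "((%e. e $ y) ~~> \<one> $ y) \<F>" using x by simp
  qed
 qed
 have xP: "x oo P = x" if x: "x \<in> X" for x
 proof -
  have "x $ \<zeta> = 0" if \<zeta>: "P $ \<zeta> = 0" for \<zeta>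
  proof (rule cinner_eqI)
   fix k
   \<comment> \<open>\<open><<k, (x oo e) $ \<zeta>>>\<close> equals
     \<open><<hadj e $ m, \<zeta>>>\<close>, which tends to \<open><<m, \<zeta>>>\<close>; and this
     is zero because \<open>P $ \<zeta> = 0\<close>.\<close>
   define m where "m = P $ (hadj x $ k)"
   have Pm: "P $ m = m" by (simp add: m_def comp_eq_apply[OF PP])
   have "((%e. norm (hadj e $ m - m)) ~~> 0) \<F>"
   proof (rule Lim_null_comparison)
    show "\<forall>\<^sub>F e in \<F>. norm (norm (hadj e $ m - m)) <= sqrt (2 * norm m * norm (m - e $ m))"
     using ev by eventually_elim (auto intro: real_le_rsqrt contraction_hadj_approx)
    have "((%e. sqrt (2 * norm m * norm (m - e $ m))) ~~> sqrt (2 * norm m * norm (m - m))) \<F>"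
     using onM[OF Pm] by (intro tendsto_intros) simp
    thus "((%e. sqrt (2 * norm m * norm (m - e $ m))) ~~> 0) \<F>" by simp
   qed
   hence "((%e. hadj e $ m) ~~> m) \<F>" by (simp add: tendsto_norm_zero_iff flip: Lim_null)
   hence "((%e. <<hadj e $ m, \<zeta>>>) ~~> <<m, \<zeta>>>) \<F>" by (intro tendsto_cinner tendsto_const)
   moreover have "<<m, \<zeta>>> = 0"
    using hadj_left[OF P(1), of "hadj x $ k" \<zeta>] \<zeta> by (simp add: m_def hP)
   ultimately have 1: "((%e. <<hadj e $ m, \<zeta>>>) ~~> 0) \<F>" by simp
   have "((%e. <<k, (x oo e) $ \<zeta>>>) ~~> 0) \<F>"
   proof (rule Lim_transform_eventually[OF 1])
    show "\<forall>\<^sub>F e in \<F>. <<hadj e $ m, \<zeta>>> = <<k, (x oo e) $ \<zeta>>>"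
     using \<F>(2)
    proof eventually_elim
     case (elim e)
     hence e: "clin e" "P $ (e $ \<zeta>) = e $ \<zeta>" using X(2) comp_eq_apply[OF Px[of e]] by auto
     have "<<hadj e $ m, \<zeta>>> = <<m, e $ \<zeta>>>" using e by (simp add: hadj_left)
     also have "... = <<hadj x $ k, P $ (e $ \<zeta>)>>" using hadj_left[OF P(1), of "hadj x $ k" "e $ \<zeta>"] by (simp add: m_def hP)
     also have "... = <<k, (x oo e) $ \<zeta>>>" using e X(2)[OF x] by (simp add: hadj_left)
     finally show ?case .
    qed
   qed
   moreover have "((%e. <<k, (x oo e) $ \<zeta>>>) ~~> <<k, x $ \<zeta>>>) \<F>"
    using lim(2)[OF x] by (intro tendsto_cinner blinfun.tendsto tendsto_const)
   ultimately show "<<k, x $ \<zeta>>> = <<k, 0>>" using tendsto_unique[OF \<F>(1)] by fastforce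
  qed
  moreover have "P $ (xi - P $ xi) = 0" for xi by (simp only: blinfun.diff_right comp_eq_apply[OF PP] diff_self)
  ultimately have "x $ (xi - P $ xi) = 0" for xi by blast
  thus ?thesis by (intro blinfun_eqI) (simp add: blinfun.diff_right)
 qed
 have strong: "((%e. e $ xi) ~~> P $ xi) \<F>" for xi
 proof (rule Lim_transform_eventually)
  show "((%e. e $ (P $ xi)) ~~> P $ xi) \<F>" using onM[of "P $ xi"] comp_eq_apply[OF PP] by simp
  show "\<forall>\<^sub>F e in \<F>. e $ (P $ xi) = e $ xi"
   using \<F>(2)
  proof eventually_elim
   case (elim e)
   thus ?case using comp_eq_apply[OF xP[of e]] by simp
  qed
 qed
 have "\<forall>\<^sub>F e in \<F>. e \<in> X & norm e <= 1 & (\<forall>x\<in>X. x oo e \<in> X)"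
  using \<F>(2) by eventually_elim (simp add: X(3))
 hence "cai X P \<F>"
  unfolding cai_def by (intro conjI ballI allI X P(1) Px xP hP PP \<F> strong lim)
 thus ?thesis by blast
qed

section \<open>Adjoining the unit to a space with an approximate identity\<close>

lemma mat_norm_single: "mat_norm (Suc 0) (%_ _. T) = norm T"
proof (rule antisym)
 have "(norm (T $ xi))^2 <= (norm T)^2 * (norm xi)^2" for xi
  using power_mono[OF norm_blinfun[of T xi], of 2] by (simp add: power_mult_distrib)
 thus "mat_norm (Suc 0) (%_ _. T) <= norm T" by (intro mat_norm_le) (auto simp: mbound_def)
 show "norm T <= mat_norm (Suc 0) (%_ _. T)"
 proof (rule norm_blinfun_bound[OF mat_norm_nonneg])
  fix xi
  have "(norm (T $ xi))^2 <= (mat_norm (Suc 0) (%_ _. T) * norm xi)^2"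
   using mbound_mat_norm[of "Suc 0" "%_ _. T", unfolded mbound_def, rule_format, of "%_. xi"]
   by (simp add: power_mult_distrib)
  thus "norm (T $ xi) <= mat_norm (Suc 0) (%_ _. T) * norm xi"
   by (rule power2_le_imp_le) (simp add: mat_norm_nonneg)
 qed
qed

lemma completely_isometric_norm:
 assumes "completely_isometric X i" "x \<in> X" shows "norm (i x) = norm x"
 using conjunct2[OF assms(1)[unfolded completely_isometric_def], rule_format, of "Suc 0" "%_ _. x"] assms(2)
 by (simp add: mat_norm_single)

lemma mat_norm_comp_le:
 assumes "norm e <= 1" shows "mat_norm n (%k l. T k l oo e) <= mat_norm n T"
proof (rule mat_norm_le[OF mat_norm_nonneg], unfold mbound_def, rule)
 fix xi
 have "(\<Sum>k<n. (norm (\<Sum>l<n. T k l $ (e $ xi l)))^2) <= (mat_norm n T)^2 * (\<Sum>l<n. (norm (e $ xi l))^2)"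
  by (rule mbound_mat_norm[unfolded mbound_def, rule_format])
 also have "... <= (mat_norm n T)^2 * (\<Sum>l<n. (norm (xi l))^2)"
  by (intro mult_left_mono sum_mono power_mono norm_apply_le assms) auto
 finally show "(\<Sum>k<n. (norm (\<Sum>l<n. (T k l oo e) $ xi l))^2) <= (mat_norm n T)^2 * (\<Sum>l<n. (norm (xi l))^2)" by simp
qed

text \<open>Lower semicontinuity of matrix norms when the right factor converges strongly.\<close>

lemma mat_norm_strong_limit:
 assumes "\<F> ~= bot" "!!xi. ((%e. e $ xi) ~~> P $ xi) \<F>" and T: "!!k l. k < n ==> l < n ==> T k l oo P = T k l"
  and K: "\<forall>\<^sub>F e in \<F>. mat_norm n (%k l. T k l oo e) <= K" "0 <= K"
 shows "mat_norm n T <= K"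
proof (rule mat_norm_le[OF K(2)], unfold mbound_def, rule, rule tendsto_upperbound[OF _ _ assms(1)])
 fix xi
 have "((%e. \<Sum>k<n. (norm (\<Sum>l<n. T k l $ (e $ xi l)))^2) ~~> (\<Sum>k<n. (norm (\<Sum>l<n. T k l $ (P $ xi l)))^2)) \<F>"
  by (intro tendsto_intros assms(2))
 thus "((%e. \<Sum>k<n. (norm (\<Sum>l<n. (T k l oo e) $ xi l))^2) ~~> (\<Sum>k<n. (norm (\<Sum>l<n. T k l $ xi l))^2)) \<F>"
  by (simp add: comp_eq_apply[OF T])
 show "\<forall>\<^sub>F e in \<F>. (\<Sum>k<n. (norm (\<Sum>l<n. (T k l oo e) $ xi l))^2) <= K^2 * (\<Sum>l<n. (norm (xi l))^2)"
  using K(1)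
 proof eventually_elim
  case (elim e)
  thus ?case using mbound_mono[OF mbound_mat_norm mat_norm_nonneg elim] unfolding mbound_def by blast
 qed
qed

text \<open>Although \<open>P\<close> may lie outside \<open>X\<close>, the operators
  \<open>(x + a *C P) oo e\<close> lie in \<open>X\<close>, and \<open>e\<close> tends to
  \<open>P\<close> strongly. Matrix norms over \<open>X + \<complex> P\<close> are therefore
  determined by norms that \<open>i\<close> preserves.\<close>

lemma cai_extension_norm:
 fixes i :: "'a::chilbert_space op => 'b::chilbert_space op"
 assumes c: "cai X P \<F>" and ci: "completely_isometric X i" and c': "cai (i ` X) P' (filtermap i \<F>)"
  and mult: "\<forall>\<^sub>F e in \<F>. \<forall>x\<in>X. i (x oo e) = i x oo i e" and x: "!!k l. k < n ==> l < n ==> x k l \<in> X"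
 shows "mat_norm n (%k l. i (x k l) + a k l *C P') = mat_norm n (%k l. x k l + a k l *C P)"
proof -
 let ?T = "%k l. x k l + a k l *C P" and ?T' = "%k l. i (x k l) + a k l *C P'"
 have lin: "i (x + y) = i x + i y" "i (b *C x) = b *C i x" if "x \<in> X" "y \<in> X" for x y b
  using ci that by (auto simp: completely_isometric_def clinear_on_def)
 have ev: "\<forall>\<^sub>F e in \<F>. norm e <= 1 & norm (i e) <= 1 &
   mat_norm n (%k l. ?T' k l oo i e) = mat_norm n (%k l. ?T k l oo e)"
  using caiD(9)[OF c] mult
 proof eventually_elim
  case (elim e)
  have X: "csubspace X" by (rule caiD(1)[OF c])
  have e: "x k l oo e \<in> X" "a k l *C e \<in> X" "(x k l oo e) + a k l *C e \<in> X" if "k < n" "l < n" for k l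
   using elim x[OF that] csubspaceD(2,3)[OF X] by auto
  have 1: "?T k l oo e = (x k l oo e) + a k l *C e" for k l
   using caiD(3)[OF c] elim by (simp add: comp_simps(1,5))
  have 2: "?T' k l oo i e = i ((x k l oo e) + a k l *C e)" if "k < n" "l < n" for k l
   using caiD(3)[OF c', of "i e"] elim lin e[OF that] x[OF that] by (simp add: comp_simps(1,5))
  have "mat_norm n (%k l. ?T' k l oo i e) = mat_norm n (%k l. i ((x k l oo e) + a k l *C e))"
   unfolding mat_norm_def by (simp add: 2)
  also have "... = mat_norm n (%k l. ?T k l oo e)"
   unfolding 1 using ci e(3) by (auto simp: completely_isometric_def)
  finally show ?case using elim completely_isometric_norm[OF ci] by auto
 qed
 show ?thesis
 proof (rule antisym)
  show "mat_norm n ?T' <= mat_norm n ?T"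
  proof (rule mat_norm_strong_limit[OF caiD(8)[OF c'] caiD(10)[OF c'] _ _ mat_norm_nonneg])
   show "?T' k l oo P' = ?T' k l" if "k < n" "l < n" for k l
    using caiD(4)[OF c'] caiD(7)[OF c'] x[OF that] by (simp add: comp_simps(1,5))
   show "\<forall>\<^sub>F e in filtermap i \<F>. mat_norm n (%k l. ?T' k l oo e) <= mat_norm n ?T"
    unfolding eventually_filtermap using ev by eventually_elim (simp add: mat_norm_comp_le)
  qed
  show "mat_norm n ?T <= mat_norm n ?T'"
  proof (rule mat_norm_strong_limit[OF caiD(8)[OF c] caiD(10)[OF c] _ _ mat_norm_nonneg])
   show "?T k l oo P = ?T k l" if "k < n" "l < n" for k l
    using caiD(4)[OF c] caiD(7)[OF c] x[OF that] by (simp add: comp_simps(1,5))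
   show "\<forall>\<^sub>F e in \<F>. mat_norm n (%k l. ?T k l oo e) <= mat_norm n ?T'"
    using ev by eventually_elim (use mat_norm_comp_le[of "i _" n ?T'] in fastforce)
  qed
 qed
qed

lemma projection_le:
 assumes P: "clin P" "hadj P = P" "P oo P = P"
 shows "norm (P $ xi) <= norm xi" "Re <<xi, P $ xi>> = (norm (P $ xi))^2"
proof -
 have "<<xi, P $ xi>> = <<P $ xi, P $ xi>>"
  using hadj_left[OF P(1), of xi "P $ xi"] comp_eq_apply[OF P(3)] by (simp add: P(2))
 thus 1: "Re <<xi, P $ xi>> = (norm (P $ xi))^2" by (simp add: Re_cinner_self)
 have "Re <<xi, P $ xi>> <= norm xi * norm (P $ xi)" using Re_cinner_le[of xi "P $ xi"] by simp
 thus "norm (P $ xi) <= norm xi"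
  unfolding 1 power2_eq_square by (metis mult_right_le_imp_le norm_ge_zero order_le_less)
qed

text \<open>\<open>i\<close> is first extended to \<open>X + \<complex> P\<close> by sending
  \<open>P\<close> to \<open>P'\<close>. On a space containing its unit a complete isometry that
  respects the units is completely positive, and Arveson's theorem applies.\<close>

lemma cai_extension:
 fixes i :: "'a::chilbert_space op => 'b::chilbert_space op"
 assumes c: "cai X P \<F>" and ci: "completely_isometric X i" and c': "cai (i ` X) P' (filtermap i \<F>)"
  and mult: "\<forall>\<^sub>F e in \<F>. \<forall>x\<in>X. i (x oo e) = i x oo i e"
 shows "\<exists>\<alpha>. cpc \<alpha> & (\<forall>x\<in>X. \<alpha> x = i x) & \<alpha> P = P'"
proof -
 note X = caiD(1)[OF c] and ext = cai_extension_norm[OF c ci c' mult]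
 define R where "R = {x + a *C P | x a. x \<in> X}"
 have "\<forall>T\<in>R. \<exists>x a. x \<in> X & T = x + a *C P" by (auto simp: R_def)
 then obtain f g where fg: "!!T. T \<in> R ==> f T \<in> X & T = f T + g T *C P" by metis
 define phi where "phi T = i (f T) + g T *C P'" for T
 have lin: "i (x + y) = i x + i y" "i (b *C x) = b *C i x" "i (x - y) = i x - i y" if "x \<in> X" "y \<in> X" for x y b
 proof -
  have l: "i (x + y) = i x + i y" "i (b *C x) = b *C i x" if "x \<in> X" "y \<in> X" for x y b
   using ci that by (auto simp: completely_isometric_def clinear_on_def)
  thus "i (x + y) = i x + i y" "i (b *C x) = b *C i x" using that by auto
  show "i (x - y) = i x - i y" using l(1)[of "x - y" y] csubspaceD(5)[OF X] that by (simp add: algebra_simps)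
 qed
 \<comment> \<open>\<open>P\<close> may belong to \<open>X\<close>, so the decomposition picked by
   \<open>f\<close> and \<open>g\<close> need not be the given one; the norm equality shows that
   \<open>phi\<close> does not depend on it.\<close>
 have phi: "phi (x + a *C P) = i x + a *C P'" if x: "x \<in> X" for x a
 proof -
  let ?T = "x + a *C P"
  have T: "f ?T \<in> X" "?T = f ?T + g ?T *C P" using fg[of ?T] x by (auto simp: R_def)
  have "mat_norm (Suc 0) (%_ _. i (f ?T - x) + (g ?T - a) *C P') = mat_norm (Suc 0) (%_ _. (f ?T - x) + (g ?T - a) *C P)"
   by (rule ext) (use T x csubspaceD(5)[OF X] in auto)
  hence "norm (i (f ?T - x) + (g ?T - a) *C P') = norm ((f ?T - x) + (g ?T - a) *C P)" unfolding mat_norm_single .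
  also have "(f ?T - x) + (g ?T - a) *C P = 0" using T(2) by (simp add: scaleC_diff_left algebra_simps)
  finally have "i (f ?T) - i x + (g ?T - a) *C P' = 0" using lin(3) T x by simp
  thus ?thesis by (simp add: phi_def scaleC_diff_left algebra_simps)
 qed
 have 0: "0 \<in> X" "i 0 = 0" using csubspaceD(1)[OF X] lin(3)[of 0 0] by auto
 have phiP: "phi P = P'" using phi[OF 0(1), of 1] 0 by simp
 have Xphi: "x \<in> R" "phi x = i x" if "x \<in> X" for x
 proof -
  have "x + 0 *C P \<in> R" unfolding R_def using that by blast
  thus "x \<in> R" "phi x = i x" using phi[OF that, of 0] by auto
 qed
 have Rc: "csubspace R"
 proof -
  have "0 \<in> R" using Xphi 0 by blast
  moreover have "S + T \<in> R" if ST: "S \<in> R" "T \<in> R" for S T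
  proof -
   obtain x a y b where "x \<in> X" "S = x + a *C P" "y \<in> X" "T = y + b *C P" using ST by (auto simp: R_def)
   hence "x + y \<in> X" "S + T = (x + y) + (a + b) *C P" using csubspaceD(2)[OF X] by (auto simp: scaleC_add_left)
   thus ?thesis unfolding R_def by blast
  qed
  moreover have "b *C T \<in> R" if T: "T \<in> R" for b T
  proof -
   obtain x a where "x \<in> X" "T = x + a *C P" using T by (auto simp: R_def)
   hence "b *C x \<in> X" "b *C T = b *C x + (b * a) *C P"
    using csubspaceD(3)[OF X] by (auto simp: scaleC_add_right scaleC_scaleC)
   thus ?thesis unfolding R_def by blast
  qed
  ultimately show ?thesis by (simp add: csubspace_def)
 qed
 have Rl: "clin T" "clin (phi T)" if "T \<in> R" for T
  using that caiD(2,5)[OF c] caiD(2,5)[OF c'] by (auto simp: R_def phi)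
 have PR: "P \<in> R" unfolding R_def using 0(1) by (auto intro!: exI[of _ 0] exI[of _ 1])
 have Pu: "P oo T = T & T oo P = T" if "T \<in> R" for T
  using that caiD(3,4,5,7)[OF c] by (auto simp: R_def comp_simps)
 have Pu': "phi P oo phi T = phi T & phi T oo phi P = phi T" if "T \<in> R" for T
  using that caiD(3,4,5,7)[OF c'] by (auto simp: R_def phi phiP comp_simps)
 have philin: "clinear_on R phi"
  unfolding clinear_on_def
 proof (intro conjI ballI allI)
  fix S T assume ST: "S \<in> R" "T \<in> R"
  then obtain x a y b where xy: "x \<in> X" "S = x + a *C P" "y \<in> X" "T = y + b *C P" by (auto simp: R_def)
  hence e: "x + y \<in> X" "S + T = (x + y) + (a + b) *C P" using csubspaceD(2)[OF X] by (auto simp: scaleC_add_left)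
  show "phi (S + T) = phi S + phi T"
   unfolding e(2) phi[OF e(1)] lin(1)[OF xy(1,3)] unfolding xy(2,4) phi[OF xy(1)] phi[OF xy(3)]
   by (simp add: scaleC_add_left)
 next
  fix b T assume "T \<in> R"
  then obtain x a where x: "x \<in> X" "T = x + a *C P" by (auto simp: R_def)
  hence e: "b *C x \<in> X" "b *C T = b *C x + (b * a) *C P"
   using csubspaceD(3)[OF X] by (auto simp: scaleC_add_right scaleC_scaleC)
  show "phi (b *C T) = b *C phi T"
   unfolding e(2) phi[OF e(1)] lin(2)[OF x(1,1)] unfolding x(2) phi[OF x(1)]
   by (simp add: scaleC_add_right scaleC_scaleC)
 qed
 have "mat_norm n (%k l. phi (T k l)) = mat_norm n T" if "!!k l. k < n ==> l < n ==> T k l \<in> R" for n T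
 proof -
  have "mat_norm n (%k l. phi (T k l)) = mat_norm n (%k l. f (T k l) + g (T k l) *C P)"
   unfolding phi_def using fg that by (intro ext) auto
  also have "... = mat_norm n T" unfolding mat_norm_def using fg that by (simp flip: fg)
  finally show ?thesis .
 qed
 hence "completely_isometric R phi" using philin by (simp add: completely_isometric_def)
 hence "acc_pres R phi"
  using caiD(6,7)[OF c'] Pu'
  by (intro completely_isometric_acc_pres[OF Rc Rl(1) PR caiD(6,7)[OF c] Pu]) (auto simp: phiP Rl)
 moreover have "Re <<xi, phi P $ xi>> <= (norm xi)^2" for xi
  using projection_le[OF caiD(5,6,7)[OF c'], of xi] by (simp add: phiP power_mono)
 ultimately obtain \<alpha> where "cpc \<alpha>" "\<forall>T\<in>R. \<alpha> T = phi T"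
  using arveson_extension[OF Rc Rl(1) PR caiD(6,7)[OF c] Pu philin Rl(2)] by blast
 thus ?thesis using Xphi PR phiP by (intro exI[of _ \<alpha>]) auto
qed

lemma cai_extension_inverse:
 fixes i :: "'a::chilbert_space op => 'b::chilbert_space op"
 assumes c: "cai X P \<F>" and ci: "completely_isometric X i" and c': "cai (i ` X) P' (filtermap i \<F>)"
  and mult: "\<forall>\<^sub>F e in \<F>. \<forall>x\<in>X. i (x oo e) = i x oo i e"
 shows "\<exists>\<alpha> \<beta>. cpc \<alpha> & cpc \<beta> & (\<forall>x\<in>X. \<alpha> x = i x & \<beta> (i x) = x) & \<alpha> P = P' & \<beta> P' = P"
proof -
 note X = caiD(1)[OF c]
 define g where "g = inv_into X i"
 have lin: "i (x + y) = i x + i y" "i (b *C x) = b *C i x" if "x \<in> X" "y \<in> X" for x y b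
  using ci that by (auto simp: completely_isometric_def clinear_on_def)
 have "inj_on i X"
 proof (rule inj_onI)
  fix x y assume xy: "x \<in> X" "y \<in> X" "i x = i y"
  hence d: "x - y \<in> X" using csubspaceD(5)[OF X] by blast
  have "i x = i (x - y) + i y" using lin(1)[of "x - y" y] d xy by simp
  thus "x = y" using completely_isometric_norm[OF ci d] xy by simp
 qed
 hence g: "g (i x) = x" if "x \<in> X" for x using that by (simp add: g_def)
 have "completely_isometric (i ` X) g"
  unfolding completely_isometric_def clinear_on_def
 proof (intro conjI ballI allI impI)
  show "g (x + y) = g x + g y" if "x \<in> i ` X" "y \<in> i ` X" for x y
   using that csubspaceD(2)[OF X] by (auto simp: g simp flip: lin)
  show "g (a *C x) = a *C g x" if "x \<in> i ` X" for a x
   using that csubspaceD(3)[OF X] by (auto simp: g simp flip: lin(2))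
  fix n :: nat and T assume T: "\<forall>k<n. \<forall>l<n. T k l \<in> i ` X"
  have gT: "\<forall>k<n. \<forall>l<n. g (T k l) \<in> X & i (g (T k l)) = T k l"
  proof (intro allI impI)
   fix k l assume "k < n" "l < n"
   then obtain x where "x \<in> X" "T k l = i x" using T by blast
   thus "g (T k l) \<in> X & i (g (T k l)) = T k l" using g by simp
  qed
  hence "mat_norm n (%k l. i (g (T k l))) = mat_norm n (%k l. g (T k l))"
   using ci by (simp add: completely_isometric_def)
  thus "mat_norm n (%k l. g (T k l)) = mat_norm n T" using gT by (simp add: mat_norm_def)
 qed
 moreover have "cai (g ` i ` X) P (filtermap g (filtermap i \<F>))"
 proof -
  have "\<forall>\<^sub>F e in \<F>. g (i e) = e" using caiD(9)[OF c] by eventually_elim (simp add: g)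
  hence "eventually Q (filtermap g (filtermap i \<F>)) = eventually Q \<F>" for Q
   unfolding eventually_filtermap by (intro eventually_subst) (auto elim: eventually_mono)
  hence "filtermap g (filtermap i \<F>) = \<F>" by (simp add: filter_eq_iff)
  moreover have "g ` i ` X = X" using g by (auto simp: image_image)
  ultimately show ?thesis using c by simp
 qed
 moreover have "\<forall>\<^sub>F e in filtermap i \<F>. \<forall>x\<in>i ` X. g (x oo e) = g x oo g e"
  unfolding eventually_filtermap using mult caiD(9)[OF c]
 proof eventually_elim
  case (elim e)
  hence "g (i x oo i e) = x oo e" if "x \<in> X" for x using g[of "x oo e"] that by auto
  thus ?case using elim by (simp add: g)
 qed
 ultimately obtain \<beta> where "cpc \<beta>" "\<forall>x\<in>i ` X. \<beta> x = g x" "\<beta> P' = P"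
  using cai_extension[OF c'] by blast
 moreover obtain \<alpha> where "cpc \<alpha>" "\<forall>x\<in>X. \<alpha> x = i x" "\<alpha> P = P'" using cai_extension[OF assms] by blast
 ultimately show ?thesis using g by (intro exI[of _ \<alpha>] exI[of _ \<beta>]) auto
qed

text \<open>The Schwarz inequality for \<open>d = (z oo u e) - z\<close>, where
  \<open>hadj d oo d\<close> is at most \<open>(norm z)^2\<close> times
  \<open>2 - u e - hadj (u e)\<close>. The image of the latter, tested at \<open>eta\<close>, tends
  to zero by \<open>lim\<close>.\<close>

lemma cpc_strong_limit:
 fixes Psi :: "'a::chilbert_space op => 'b::chilbert_space op"
 assumes Psi: "cpc Psi" and u: "\<forall>\<^sub>F e in \<F>. clin (u e) & norm (u e) <= 1"
  and lim: "((%e. Psi (u e) $ eta) ~~> eta) \<F>" and z: "clin z"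
 shows "((%e. Psi (z oo u e) $ eta) ~~> Psi z $ eta) \<F>"
proof (rule Lim_null[THEN iffD2], rule Lim_null_comparison)
 show "\<forall>\<^sub>F e in \<F>. norm (Psi (z oo u e) $ eta - Psi z $ eta) <= sqrt ((norm z)^2 * (2 * ((norm eta)^2 - Re <<eta, Psi (u e) $ eta>>)))"
  using u
 proof eventually_elim
  case (elim e)
  let ?e = "u e" and ?n = "complex_of_real ((norm z)^2)"
  let ?d = "(z oo u e) - z"
  let ?T = "?n *C (2 *C \<one> - (?e + hadj ?e))"
  have c: "clin ?d" "clin ?T" "clin ?e" using elim z by auto
  have "opos (?T - (hadj ?d oo ?d))"
   unfolding opos_def
  proof
   fix xi
   have "(norm (?d $ xi))^2 <= (norm z * norm (?e $ xi - xi))^2"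
    using norm_blinfun[of z "?e $ xi - xi"] by (intro power_mono) (auto simp: blinfun.diff_right)
   also have "... = (norm z)^2 * ((norm (?e $ xi))^2 + (norm xi)^2 - 2 * Re <<?e $ xi, xi>>)"
    by (simp add: power_mult_distrib norm_diff_sq)
   also have "... <= (norm z)^2 * (2 * (norm xi)^2 - 2 * Re <<?e $ xi, xi>>)"
    using power_mono[OF norm_apply_le[of ?e xi], of 2] elim by (intro mult_left_mono) auto
   also have "... = Re <<xi, ?T $ xi>>"
   proof -
    have "Re <<xi, ?e $ xi>> = Re <<?e $ xi, xi>>" by (metis cinner_commute complex_cnj(1) complex.collapse cnj.simps(1))
    thus ?thesis using c(3) by (simp add: cinner_simps hadj_right cinner_self flip: of_real_power)
   qed
   finally have "(norm (?d $ xi))^2 <= Re <<xi, ?T $ xi>>" .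
   moreover have "Re <<xi, (hadj ?d oo ?d) $ xi>> = (norm (?d $ xi))^2"
    unfolding blinfun_apply_blinfun_compose hadj_right[OF c(1)] by (rule Re_cinner_self)
   ultimately show "0 <= Re <<xi, (?T - (hadj ?d oo ?d)) $ xi>>"
    unfolding blinfun.diff_left cinner_diff_right minus_complex.simps by linarith
  qed
  hence m: "opos (Psi ?T - Psi (hadj ?d oo ?d))" using c by (intro cpc_mono[OF Psi]) auto
  have "(norm (Psi ?d $ eta))^2 <= Re <<eta, Psi (hadj ?d oo ?d) $ eta>>" by (rule cpc_schwarz(2)[OF Psi c(1)])
  also have "... <= Re <<eta, Psi ?T $ eta>>" using m by (simp add: opos_def cinner_simps)
  also have "Psi ?T = ?n *C (2 *C Psi \<one> - (Psi ?e + hadj (Psi ?e)))"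
   using c(3) by (simp add: cpc_scale[OF Psi] cpc_diff[OF Psi] cpc_add[OF Psi] cpc_hadj[OF Psi])
  also have "Re <<eta, ... $ eta>> = (norm z)^2 * (2 * Re <<eta, Psi \<one> $ eta>> - 2 * Re <<eta, Psi ?e $ eta>>)"
  proof -
   have "Re <<eta, Psi ?e $ eta>> = Re <<Psi ?e $ eta, eta>>" by (metis cinner_commute cnj.simps(1))
   thus ?thesis using cpc_clin[OF Psi c(3)] by (simp add: cinner_simps hadj_right flip: of_real_power)
  qed
  also have "... <= (norm z)^2 * (2 * ((norm eta)^2 - Re <<eta, Psi ?e $ eta>>))"
   using cpc_id[OF Psi, of eta] by (intro mult_left_mono) auto
  finally show ?case using c z by (intro real_le_rsqrt) (simp add: cpc_diff[OF Psi])
 qed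
 have "((%e. sqrt ((norm z)^2 * (2 * ((norm eta)^2 - Re <<eta, Psi (u e) $ eta>>)))) ~~> sqrt ((norm z)^2 * (2 * ((norm eta)^2 - Re <<eta, eta>>)))) \<F>"
  using lim by (intro tendsto_intros tendsto_cinner)
 thus "((%e. sqrt ((norm z)^2 * (2 * ((norm eta)^2 - Re <<eta, Psi (u e) $ eta>>)))) ~~> 0) \<F>"
  by (simp add: Re_cinner_self)
qed

text \<open>A map with \<open>Psi (u e)\<close> tending strongly to \<open>P\<close> is known at
  \<open>z\<close> from its values at \<open>z oo u e\<close>. This reaches elements such as
  \<open>b \<otimes> Q\<close> that lie outside the space on which the map is prescribed.\<close>

lemma cpc_determined:
 fixes Psi :: "'a::chilbert_space op => 'b::chilbert_space op"
 assumes Psi: "cpc Psi" and \<F>: "\<F> ~= bot" and u: "\<forall>\<^sub>F e in \<F>. clin (u e) & norm (u e) <= 1"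
  and lim: "!!xi. ((%e. Psi (u e) $ xi) ~~> P $ xi) \<F>" and P: "P oo P = P"
  and z: "clin z" "!!xi. ((%e. Psi (z oo u e) $ xi) ~~> S $ xi) \<F>"
  and unit: "Psi z oo P = Psi z" "S oo P = S"
 shows "Psi z = S"
proof (rule blinfun_eqI)
 fix xi
 have "((%e. Psi (u e) $ (P $ xi)) ~~> P $ xi) \<F>" using lim[of "P $ xi"] by (simp add: comp_eq_apply[OF P])
 from tendsto_unique[OF \<F> cpc_strong_limit[OF Psi u this z(1)] z(2)]
 show "Psi z $ xi = S $ xi" by (simp add: comp_eq_apply[OF unit(1)] comp_eq_apply[OF unit(2)])
qed

section \<open>Rigidity of the envelope of one factor\<close>

text \<open>Rank-one operators embed the space into its operators, and an infinite set absorbs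
  products with smaller sets. The injection lets \<open>envelope_map\<close> work on
  \<open>'p op ell2\<close>, the space for which the minimality of the factor is assumed.\<close>

lemma operator_pair_injection:
 "\<exists>g :: 'p::chilbert_space op \<times> 'p => 'p op. inj g"
 including cardinal_syntax
proof (cases "\<exists>x :: 'p. x ~= 0")
 case False
 hence "p = q" for p q :: "'p op \<times> 'p"
  by (cases p; cases q) (metis blinfun_eqI)
 hence "inj (%p :: 'p op \<times> 'p. fst p)" by (intro injI)
 thus ?thesis by blast
next
 case True
 then obtain e :: 'p where e: "e ~= 0" by blast
 let ?O = "UNIV :: 'p op set"
 have "\<exists>T :: 'p op. \<forall>y. T $ y = <<e, y>> *C x" for x
 proof -
  have "norm (<<e, y>> *C x) <= (norm e * norm x) * norm y" for y
   using mult_right_mono[OF cauchy_schwarz[of e y] norm_ge_zero[of x]] by (simp add: norm_scaleC ac_simps)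
  thus ?thesis
   using mk_op[of "%y. <<e, y>> *C x" "norm e * norm x"]
   by (metis (no_types, lifting) cinner_add_right cinner_scaleC_right mult_nonneg_nonneg norm_ge_zero
     scaleC_add_left scaleC_scaleC)
 qed
 then obtain T :: "'p => 'p op" where T: "!!x y. T x $ y = <<e, y>> *C x" by metis
 have "inj T"
 proof (rule injI)
  fix x x' assume "T x = T x'"
  hence "<<e, e>> *C x = <<e, e>> *C x'" by (simp flip: T)
  hence "inverse <<e, e>> *C <<e, e>> *C x = inverse <<e, e>> *C <<e, e>> *C x'" by simp
  thus "x = x'" using e by (simp add: scaleC_scaleC cinner_self)
 qed
 hence "|UNIV :: 'p set| <=o |?O|" by (intro card_of_ordLeqI[of T]) auto
 moreover have inf: "infinite ?O"
 proof
  assume "finite ?O"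
  moreover have "inj (%n :: nat. real n *\<^sub>R T e)"
  proof (rule injI)
   fix m n :: nat assume "real m *\<^sub>R T e = real n *\<^sub>R T e"
   moreover have "T e ~= 0" using T[of e e] e by (metis blinfun.zero_left scaleC_scaleC[of "inverse <<e, e>>"] cinner_self norm_eq_zero norm_scaleC mult_eq_0_iff norm_of_real abs_power2 power_eq_0_iff abs_eq_0)
   ultimately show "m = n" by simp
  qed
  ultimately show False by (meson finite_imageD finite_subset infinite_UNIV_nat subset_UNIV)
 qed
 ultimately have "|?O \<times> (UNIV :: 'p set)| =o |?O|" by (intro card_of_Times_infinite[of ?O UNIV, THEN conjunct1]) auto
 then obtain g where "bij_betw g (?O \<times> (UNIV :: 'p set)) ?O" using card_of_ordIso by blast
 hence "inj g" by (simp add: bij_betw_def)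
 thus ?thesis by blast
qed

text \<open>Minimality is what makes \<open>phi\<close> injective on the envelope: composed with
  \<open>j\<close> it gives a competing cover, so there is a homomorphism \<open>p\<close> with
  \<open>p (phi (j x)) = j x\<close>, and \<open>p\<close> then inverts \<open>phi\<close> on the
  whole generated algebra.\<close>

lemma rigid_factor:
 fixes X :: "'h::chilbert_space op set" and j :: "'h op => 'p::chilbert_space op"
 assumes ci: "completely_isometric X j" and jl: "!!x. x \<in> X ==> clin (j x)" and P: "clin P"
  and minimal: "!!phi :: 'p op => ('p op ell2 \<Rightarrow>\<^sub>L 'p op ell2). cpc phi ==> cstar_gen (j ` X) <= md phi ==>
   completely_isometric X (%x. phi (j x)) ==>
   maps_onto X (cstar_gen ((%x. phi (j x)) ` X)) (%x. phi (j x)) (cstar_gen (j ` X)) j"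
 shows "\<exists>phi :: 'p op => ('p op ell2 \<Rightarrow>\<^sub>L 'p op ell2). cpc phi & cstar_gen (insert P (j ` X)) <= md phi &
  (\<forall>Phi\<in>fixers (insert P (j ` X)). \<forall>a\<in>cstar_gen (insert P (j ` X)). phi (Phi a) = phi a) &
  (\<forall>a\<in>cstar_gen (j ` X). phi a = 0 --> a = 0)"
proof -
 let ?R = "insert P (j ` X)"
 define E where "E = cstar_gen (j ` X)"
 obtain g :: "'p op \<times> 'p => 'p op" where g: "inj g" using operator_pair_injection by blast
 have Rl: "clin r" if "r \<in> ?R" for r using jl P that by auto
 obtain phi \<alpha> where phi: "cpc phi" "cstar_gen ?R <= md phi"
  and \<alpha>: "cpc \<alpha>" "!!r. r \<in> ?R ==> \<alpha> (phi r) = r"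
  and rigid: "\<forall>Phi\<in>fixers ?R. \<forall>a\<in>cstar_gen ?R. (phi :: _ => ('p op ell2 \<Rightarrow>\<^sub>L 'p op ell2)) (Phi a) = phi a"
  by (rule exE[OF envelope_map[of ?R g]], erule Rl, rule g, elim exE conjE, rule that, assumption+, auto)
 have E: "cstar_algebra E" unfolding E_def by (rule cstar_gen) (use jl in auto)
 have jE: "j x \<in> E" if "x \<in> X" for x using that by (auto simp: E_def intro: hull_inc)
 have Em: "E <= md phi" using phi(2) hull_mono[of "j ` X" ?R cstar_algebra] by (auto simp: E_def)
 define i where "i x = phi (j x)" for x
 have ici: "completely_isometric X i"
  unfolding completely_isometric_def clinear_on_def
 proof (intro conjI ballI allI impI)
  show "i (x + y) = i x + i y" if "x \<in> X" "y \<in> X" for x y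
   using that ci jl by (simp add: i_def completely_isometric_def clinear_on_def cpc_add[OF phi(1)])
  show "i (c *C x) = c *C i x" if "x \<in> X" for c x
   using that ci jl by (simp add: i_def completely_isometric_def clinear_on_def cpc_scale[OF phi(1)])
  fix n :: nat and T assume T: "\<forall>k<n. \<forall>l<n. T k l \<in> X"
  have "mat_norm n (%k l. i (T k l)) <= mat_norm n (%k l. j (T k l))"
   unfolding i_def using T jl by (intro cpc_mat_norm[OF phi(1)]) auto
  moreover have "mat_norm n (%k l. \<alpha> (i (T k l))) <= mat_norm n (%k l. i (T k l))"
   using T jl phi(1) by (intro cpc_mat_norm[OF \<alpha>(1)]) (auto simp: i_def)
  moreover have "mat_norm n (%k l. \<alpha> (i (T k l))) = mat_norm n (%k l. j (T k l))"
   using T by (simp add: mat_norm_def i_def \<alpha>(2))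
  ultimately show "mat_norm n (%k l. i (T k l)) = mat_norm n T" using T ci by (simp add: completely_isometric_def)
 qed
 define F where "F = cstar_gen (i ` X)"
 have F: "cstar_algebra F" unfolding F_def i_def by (rule cstar_gen) (use jl phi(1) in auto)
 have i: "i = (%x. phi (j x))" by (simp add: i_def fun_eq_iff)
 have "maps_onto X F i E j" unfolding F_def E_def i
  by (rule minimal[OF phi(1)]) (use Em ici in \<open>simp_all add: E_def i\<close>)
 then obtain p where p: "star_hom F E p" "!!x. x \<in> X ==> p (i x) = j x" by (auto simp: maps_onto_def)
 have "E <= {a \<in> E. phi a \<in> F}"
  unfolding E_def by (rule cstar_gen_subset, fold E_def, rule cstar_preimage[OF phi(1) E Em F])
   (use jE in \<open>auto simp: F_def i_def intro: hull_inc\<close>)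
 hence EF: "phi a \<in> F" if "a \<in> E" for a using that by blast
 have El: "clin a" if "a \<in> E" for a using cstar_algebraD(1)[OF E that] .
 have lin: "p (a + b) = p a + p b" "p (c *C a) = c *C p a" "p (a oo b) = p a oo p b" "p (hadj a) = hadj (p a)"
  if "a \<in> F" "b \<in> F" for a b c
  using p(1) that by (auto simp: star_hom_def clinear_on_def adj_hadj)
 have "cstar_algebra {a \<in> E. p (phi a) = a}"
 proof (rule cstar_algebraI)
  show "0 \<in> {a \<in> E. p (phi a) = a}"
   using lin(2)[of 0 0 0] cstar_zero[OF E] cstar_zero[OF F] by (simp add: cpc_zero[OF phi(1)])
  show "S oo T \<in> {a \<in> E. p (phi a) = a}" if "S \<in> {a \<in> E. p (phi a) = a}" "T \<in> {a \<in> E. p (phi a) = a}" for S T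
  proof -
   have "phi (S oo T) = phi S oo phi T" using mdD(1)[of T phi S] Em El that by blast
   thus ?thesis using that by (simp add: lin(3) EF cstar_comp[OF E])
  qed
  show "T \<in> {a \<in> E. p (phi a) = a}" if f: "!!n. f n \<in> {a \<in> E. p (phi a) = a}" "f ---> T" "clin T" for f T
  proof -
   have T: "T \<in> E" using f closed_sequentially[OF cstar_algebraD(3)[OF E]] by blast
   have d: "norm (f n - p (phi T)) <= norm (f n - T)" for n
   proof -
    have fn: "f n \<in> E" "p (phi (f n)) = f n" using f(1) by auto
    have "p (phi (f n - T)) = p (phi (f n)) - p (phi T)"
     using lin(1)[OF EF[OF cstar_diff[OF E fn(1) T]] EF[OF T]] fn T El by (simp add: cpc_diff[OF phi(1)] eq_diff_eq)
    hence "norm (f n - p (phi T)) <= norm (phi (f n - T))"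
     using star_hom_norm[OF F E p(1) EF[OF cstar_diff[OF E fn(1) T]]] fn by simp
    also have "... <= norm (f n - T)" using fn T El by (intro cpc_norm[OF phi(1)]) auto
    finally show ?thesis .
   qed
   have "(%n. norm (f n - T)) ---> 0" using f(2) by (simp add: tendsto_norm_zero_iff flip: Lim_null)
   hence "(%n. f n - p (phi T)) ---> 0" by (rule Lim_null_comparison[rotated]) (simp add: d)
   hence "f ---> p (phi T)" by (rule Lim_null[THEN iffD2])
   from LIMSEQ_unique[OF f(2) this] show ?thesis using T by simp
  qed
  show "clin T" if "T \<in> {a \<in> E. p (phi a) = a}" for T using that El by blast
  show "S + T \<in> {a \<in> E. p (phi a) = a}" if "S \<in> {a \<in> E. p (phi a) = a}" "T \<in> {a \<in> E. p (phi a) = a}" for S T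
   using that lin(1)[of "phi S" "phi T"] EF by (simp add: cpc_add[OF phi(1)] El cstar_add[OF E])
  show "c *C T \<in> {a \<in> E. p (phi a) = a}" if "T \<in> {a \<in> E. p (phi a) = a}" for c T
   using that lin(2)[of "phi T" "phi T" c] EF by (simp add: cpc_scale[OF phi(1)] El cstar_scaleC[OF E])
  show "hadj T \<in> {a \<in> E. p (phi a) = a}" if "T \<in> {a \<in> E. p (phi a) = a}" for T
   using that lin(4)[of "phi T" "phi T"] EF by (simp add: cpc_hadj[OF phi(1)] El cstar_hadj[OF E])
 qed
 hence "E <= {a \<in> E. p (phi a) = a}"
  unfolding E_def by (rule cstar_gen_subset, fold E_def) (use p(2) jE in \<open>auto simp: i_def\<close>)
 hence pid: "p (phi a) = a" if "a \<in> E" for a using that by blast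
 have "a = 0" if "a \<in> E" "phi a = 0" for a
  using pid[OF that(1)] pid[OF cstar_zero[OF E]] that by (simp add: cpc_zero[OF phi(1)])
 thus ?thesis using phi rigid by (intro exI[of _ phi]) (auto simp: E_def)
qed

section \<open>The minimal tensor product\<close>

lemma wtensor_bounded_bilinear: "wtensor s ==> bounded_bilinear s"
 by unfold_locales
  (auto simp: wtensor_simps scaleR_scaleC wtensor_norm intro!: exI[of _ 1])

lemma otimes_diff:
 assumes s: "wtensor s" and c: "clin S" "clin S'" "clin T" "clin T'"
 shows "otimes s S T - otimes s S' T' = otimes s (S - S') T + otimes s S' (T - T')"
 using otimes_add_left[OF s, of "S - S'" S' T] otimes_add_right[OF s, of S' "T - T'" T'] c by simp

lemma otimes_tendsto:
 assumes s: "wtensor s" and f: "(f ~~> S) \<F>" "\<forall>\<^sub>F x in \<F>. clin (f x)" "clin S"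
  and g: "(g ~~> T) \<F>" "\<forall>\<^sub>F x in \<F>. clin (g x)" "clin T"
 shows "((%x. otimes s (f x) (g x)) ~~> otimes s S T) \<F>"
proof (rule Lim_null[THEN iffD2], rule Lim_null_comparison)
 show "\<forall>\<^sub>F x in \<F>. norm (otimes s (f x) (g x) - otimes s S T) <= norm (f x - S) * norm (g x) + norm S * norm (g x - T)"
  using f(2) g(2)
 proof eventually_elim
  case (elim x)
  thus ?case
   using norm_otimes[OF s, of "f x - S" "g x"] norm_otimes[OF s, of S "g x - T"] f(3) g(3)
    norm_triangle_ineq[of "otimes s (f x - S) (g x)" "otimes s S (g x - T)"]
   by (simp add: otimes_diff[OF s])
 qed
 have "((%x. norm (f x - S) * norm (g x) + norm S * norm (g x - T)) ~~> norm (S - S) * norm T + norm S * norm (T - T)) \<F>"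
  by (intro tendsto_intros f g)
 thus "((%x. norm (f x - S) * norm (g x) + norm S * norm (g x - T)) ~~> 0) \<F>" by simp
qed

lemma min_tensor_eq:
 assumes "hilbert_tensor s" "M <= Collect clin" "N <= Collect clin"
 shows "min_tensor s M N = closure (cspan {otimes s b a | b a. b \<in> M & a \<in> N})"
proof -
 have "{op_tensor s b a | b a. b \<in> M & a \<in> N} = {otimes s b a | b a. b \<in> M & a \<in> N}"
  using op_tensor_otimes[OF assms(1)] assms(2,3) by (metis (no_types, lifting) mem_Collect_eq subsetD)
 thus ?thesis by (simp add: min_tensor_def)
qed

lemma min_tensor_csubspace: "csubspace (min_tensor s M N)" and min_tensor_closed: "closed (min_tensor s M N)"
 unfolding min_tensor_def by (auto intro: csubspace_closure csubspace_cspan)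

lemma closed_comp_eq: "closed {x. A oo x = x}" "closed {x. x oo A = x}"
 for A :: "'a::chilbert_space op"
 by (rule closed_seqI, use LIMSEQ_unique[OF tendsto_comp[OF tendsto_const[of A]]] in fastforce)
  (rule closed_seqI, use LIMSEQ_unique[OF tendsto_comp[OF _ tendsto_const[of A]]] in fastforce)

lemma closed_comp_mem:
 fixes A :: "'a::chilbert_space op"
 assumes "closed S"
 shows "closed {x. x oo A \<in> S}" "closed {x. A oo x \<in> S}"
proof -
 show "closed {x. x oo A \<in> S}"
 proof (rule closed_seqI)
  fix f x assume "!!n. f n \<in> {x. x oo A \<in> S}" "f ---> x"
  thus "x \<in> {x. x oo A \<in> S}"
   using closed_sequentially[OF assms, of "%n. f n oo A"] tendsto_comp[of f x _ "%_. A" A] by simp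
 qed
 show "closed {x. A oo x \<in> S}"
 proof (rule closed_seqI)
  fix f x assume "!!n. f n \<in> {x. A oo x \<in> S}" "f ---> x"
  thus "x \<in> {x. A oo x \<in> S}"
   using closed_sequentially[OF assms, of "%n. A oo f n"] tendsto_comp[of "%_. A" A _ f x] by simp
 qed
qed

context
 fixes s :: "'p::chilbert_space => 'q::chilbert_space => 'r::chilbert_space"
  and M :: "'p op set" and N :: "'q op set"
 assumes s: "hilbert_tensor s" and M: "M <= Collect clin" and N: "N <= Collect clin"
begin

lemma min_tensor_induct:
 assumes "u \<in> min_tensor s M N" "closed {x. Q x}" "csubspace {x. Q x}"
  and "!!b a. b \<in> M ==> a \<in> N ==> Q (otimes s b a)"
 shows "Q u"
 using assms(1) unfolding min_tensor_eq[OF s M N]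
 by (rule closure_cspan_induct) (use assms(2-4) in auto)

lemma otimes_min_tensor: "b \<in> M ==> a \<in> N ==> otimes s b a \<in> min_tensor s M N"
 unfolding min_tensor_eq[OF s M N] by (intro subsetD[OF closure_subset] hull_inc) auto

lemma clin_min_tensor: "u \<in> min_tensor s M N ==> clin u"
 by (erule min_tensor_induct)
  (auto simp: closed_clin csubspace_def clin_otimes[OF hilbert_wtensor[OF s]] subsetD[OF M, simplified] subsetD[OF N, simplified])

end

text \<open>Contractivity of the product net reduces all limits to elementary tensors, where they
  are limits in each factor.\<close>

lemma cai_tensor:
 fixes s :: "'p::chilbert_space => 'q::chilbert_space => 'r::chilbert_space"
 assumes s: "hilbert_tensor s" and M: "cai M P \<F>" and N: "cai N Q \<G>"
 shows "cai (min_tensor s M N) (otimes s P Q) (filtermap (%p. otimes s (fst p) (snd p)) (\<F> \<times>\<^sub>F \<G>))"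
proof -
 let ?J = "min_tensor s M N" and ?R = "otimes s P Q" and ?T = "%p. otimes s (fst p) (snd p)"
 note w = hilbert_wtensor[OF s]
 note Ml = caiD(2)[OF M] and Nl = caiD(2)[OF N]
 have Ms: "M <= Collect clin" and Ns: "N <= Collect clin" using Ml Nl by auto
 note ind = min_tensor_induct[OF s Ms Ns]
 have Jl: "clin x" if "x \<in> ?J" for x using that by (rule clin_min_tensor[OF s Ms Ns])
 have R: "clin ?R" "hadj ?R = ?R" "?R oo ?R = ?R"
  using caiD(5,6,7)[OF M] caiD(5,6,7)[OF N] by (simp_all add: clin_otimes[OF w] otimes_hadj[OF w] otimes_comp[OF w])
 have cs: "csubspace {x :: 'r op. ?R oo x = x}" "csubspace {x :: 'r op. x oo ?R = x}"
  using R(1) by (auto simp: csubspace_def comp_simps)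
 have Rx: "?R oo x = x" "x oo ?R = x" if "x \<in> ?J" for x
  using that caiD(2-5)[OF M] caiD(2-5)[OF N]
  by (auto elim!: ind[OF _ closed_comp_eq(1) cs(1)] ind[OF _ closed_comp_eq(2) cs(2)] simp: otimes_comp[OF w])
 have ev: "\<forall>\<^sub>F p in \<F> \<times>\<^sub>F \<G>. fst p \<in> M & snd p \<in> N & norm (fst p) <= 1 & norm (snd p) <= 1 &
   (\<forall>x\<in>M. x oo fst p \<in> M) & (\<forall>x\<in>N. x oo snd p \<in> N)"
  using eventually_prodI[OF caiD(9)[OF M] caiD(9)[OF N]] by eventually_elim auto
 have nT: "norm (?T p) <= 1" if "fst p \<in> M" "snd p \<in> N" "norm (fst p) <= 1" "norm (snd p) <= 1" for p
  using norm_otimes[OF w Ml[OF that(1)] Nl[OF that(2)]] mult_mono[OF that(3,4)] by simp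
 have ev1: "\<forall>\<^sub>F p in \<F> \<times>\<^sub>F \<G>. ?T p \<in> ?J & norm (?T p) <= 1 & (\<forall>x\<in>?J. x oo ?T p \<in> ?J)"
  using ev
 proof eventually_elim
  case (elim p)
  have J: "otimes s b a \<in> ?J" if "b \<in> M" "a \<in> N" for b a using that by (rule otimes_min_tensor[OF s Ms Ns])
  have "x oo ?T p \<in> ?J" if "x \<in> ?J" for x
  proof (rule ind[OF that])
   show "closed {x. x oo ?T p \<in> ?J}" by (rule closed_comp_mem(1)[OF min_tensor_closed])
   show "csubspace {x. x oo ?T p \<in> ?J}"
    using csubspaceD(1,2,3)[OF min_tensor_csubspace[of s M N]] by (auto simp: csubspace_def comp_simps)
  qed (use elim Ml Nl J in \<open>auto simp: otimes_comp[OF w]\<close>)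
  thus ?case using elim J nT by auto
 qed
 have evl: "\<forall>\<^sub>F p in \<F> \<times>\<^sub>F \<G>. clin (?T p) & norm (?T p) <= 1" using ev1 by eventually_elim (simp add: Jl)
 note cl = approx_right_closed[OF evl]
 have fs: "((%p. f (fst p)) ~~> x) (\<F> \<times>\<^sub>F \<G>)" if "(f ~~> x) \<F>" for f and x :: "'z::topological_space"
  by (rule filterlim_compose[OF that filterlim_fst])
 have sn: "((%p. f (snd p)) ~~> x) (\<F> \<times>\<^sub>F \<G>)" if "(f ~~> x) \<G>" for f and x :: "'z::topological_space"
  by (rule filterlim_compose[OF that filterlim_snd])
 have strong: "((%p. ?T p $ xi) ~~> ?R $ xi) (\<F> \<times>\<^sub>F \<G>)" for xi
 proof -
  have "xi \<in> closure (cspan {s x y | x y. True})" using s by (simp add: hilbert_tensor_def)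
  thus ?thesis
  proof (rule closure_cspan_induct)
   show "closed {xi. ((%p. ?T p $ xi) ~~> ?R $ xi) (\<F> \<times>\<^sub>F \<G>)}"
    using evl by (intro closed_strong_limit) (auto elim: eventually_mono)
   show "csubspace {xi. ((%p. ?T p $ xi) ~~> ?R $ xi) (\<F> \<times>\<^sub>F \<G>)}"
    using evl R(1) by (intro csubspace_strong_limit) (auto elim: eventually_mono)
   fix z assume "z \<in> {s x y | x y. True}"
   then obtain x y where z: "z = s x y" by blast
   have "((%p. s (fst p $ x) (snd p $ y)) ~~> s (P $ x) (Q $ y)) (\<F> \<times>\<^sub>F \<G>)"
    by (intro bounded_bilinear.tendsto[OF wtensor_bounded_bilinear[OF w]] fs[of "%e. e $ x"] sn[of "%e. e $ y"] caiD(10)[OF M] caiD(10)[OF N])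
   thus "((%p. ?T p $ z) ~~> ?R $ z) (\<F> \<times>\<^sub>F \<G>)"
    unfolding z otimes_apply[OF w caiD(5)[OF M] caiD(5)[OF N]]
    by (rule Lim_transform_eventually) (use ev in eventually_elim, simp add: otimes_apply[OF w] Ml Nl)
  qed
 qed
 have lim: "((%p. x oo ?T p) ~~> x) (\<F> \<times>\<^sub>F \<G>) & ((%p. ?T p oo x) ~~> x) (\<F> \<times>\<^sub>F \<G>)" if x: "x \<in> ?J" for x
 proof -
  have "(clin x & ((%p. x oo ?T p) ~~> x) (\<F> \<times>\<^sub>F \<G>)) & (clin x & ((%p. ?T p oo x) ~~> x) (\<F> \<times>\<^sub>F \<G>))"
  proof (rule ind[OF x])
   show "closed {x. (clin x & ((%p. x oo ?T p) ~~> x) (\<F> \<times>\<^sub>F \<G>)) & (clin x & ((%p. ?T p oo x) ~~> x) (\<F> \<times>\<^sub>F \<G>))}"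
    by (intro closed_Collect_conj closed_clin cl)
   show "csubspace {x. (clin x & ((%p. x oo ?T p) ~~> x) (\<F> \<times>\<^sub>F \<G>)) & (clin x & ((%p. ?T p oo x) ~~> x) (\<F> \<times>\<^sub>F \<G>))}"
    using cl(2,4) by (simp add: csubspace_def)
   fix b a assume ba: "b \<in> M" "a \<in> N"
   note c = Ml[OF ba(1)] Nl[OF ba(2)]
   have evc: "\<forall>\<^sub>F p in \<F> \<times>\<^sub>F \<G>. clin (fst p) & clin (snd p)" using ev by eventually_elim (simp add: Ml Nl)
   have "((%p. otimes s (b oo fst p) (a oo snd p)) ~~> otimes s b a) (\<F> \<times>\<^sub>F \<G>)"
    using fs[of "%e. b oo e", OF caiD(11)[OF M ba(1)]] sn[of "%e. a oo e", OF caiD(11)[OF N ba(2)]] c evc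
    by (intro otimes_tendsto[OF w]) (auto elim: eventually_mono)
   hence 1: "((%p. otimes s b a oo ?T p) ~~> otimes s b a) (\<F> \<times>\<^sub>F \<G>)"
    by (rule Lim_transform_eventually) (use evc in eventually_elim, simp add: otimes_comp[OF w] c)
   have "((%p. otimes s (fst p oo b) (snd p oo a)) ~~> otimes s b a) (\<F> \<times>\<^sub>F \<G>)"
    using fs[of "%e. e oo b", OF caiD(12)[OF M ba(1)]] sn[of "%e. e oo a", OF caiD(12)[OF N ba(2)]] c evc
    by (intro otimes_tendsto[OF w]) (auto elim: eventually_mono)
   hence 2: "((%p. ?T p oo otimes s b a) ~~> otimes s b a) (\<F> \<times>\<^sub>F \<G>)"
    by (rule Lim_transform_eventually) (use evc in eventually_elim, simp add: otimes_comp[OF w] c)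
   show "(clin (otimes s b a) & ((%p. otimes s b a oo ?T p) ~~> otimes s b a) (\<F> \<times>\<^sub>F \<G>)) &
     (clin (otimes s b a) & ((%p. ?T p oo otimes s b a) ~~> otimes s b a) (\<F> \<times>\<^sub>F \<G>))"
    using 1 2 clin_otimes[OF w c] by blast
  qed
  thus ?thesis by blast
 qed
 have "filtermap ?T (\<F> \<times>\<^sub>F \<G>) ~= bot"
  using caiD(8)[OF M] caiD(8)[OF N] by (simp add: filtermap_bot_iff prod_filter_eq_bot)
 thus ?thesis
  unfolding cai_def using min_tensor_csubspace Jl Rx R ev1 strong lim
  by (auto simp: eventually_filtermap filterlim_filtermap)
qed

lemma min_tensor_comp:
 fixes s :: "'p::chilbert_space => 'q::chilbert_space => 'r::chilbert_space"
 assumes s: "hilbert_tensor s" and C: "C <= Collect clin" "!!x y. x \<in> C ==> y \<in> C ==> x oo y \<in> C"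
  and D: "D <= Collect clin" "!!x y. x \<in> D ==> y \<in> D ==> x oo y \<in> D"
  and S: "S \<in> min_tensor s C D" and T: "T \<in> min_tensor s C D"
 shows "S oo T \<in> min_tensor s C D"
proof -
 let ?J = "min_tensor s C D"
 note w = hilbert_wtensor[OF s]
 have cl: "clin b" "clin a" if "b \<in> C" "a \<in> D" for b a using C(1) D(1) that by auto
 note ind = min_tensor_induct[OF s C(1) D(1)] and J = csubspaceD(1-3)[OF min_tensor_csubspace[of s C D]]
 show ?thesis
 proof (rule ind[OF S])
  show "closed {S. S oo T \<in> ?J}" by (rule closed_comp_mem(1)[OF min_tensor_closed])
  show "csubspace {S. S oo T \<in> ?J}" using J by (auto simp: csubspace_def comp_simps)
  fix b a assume ba: "b \<in> C" "a \<in> D"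
  note c = clin_otimes[OF w cl[OF ba]]
  show "otimes s b a oo T \<in> ?J"
  proof (rule ind[OF T])
   show "closed {T. otimes s b a oo T \<in> ?J}" by (rule closed_comp_mem(2)[OF min_tensor_closed])
   show "csubspace {T. otimes s b a oo T \<in> ?J}" using J c by (auto simp: csubspace_def comp_simps)
   show "otimes s b a oo otimes s b' a' \<in> ?J" if "b' \<in> C" "a' \<in> D" for b' a'
    using ba that cl by (simp add: otimes_comp[OF w] otimes_min_tensor[OF s C(1) D(1)] C(2) D(2))
  qed
 qed
qed

lemma cstar_min_tensor:
 fixes s :: "'p::chilbert_space => 'q::chilbert_space => 'r::chilbert_space"
 assumes s: "hilbert_tensor s" and C: "cstar_algebra C" and D: "cstar_algebra D"
 shows "cstar_algebra (min_tensor s C D)"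
proof (rule cstar_algebraI)
 let ?J = "min_tensor s C D"
 note w = hilbert_wtensor[OF s]
 note Cl = cstar_algebraD(1)[OF C] and Dl = cstar_algebraD(1)[OF D]
 have Cs: "C <= Collect clin" and Ds: "D <= Collect clin" using Cl Dl by auto
 note ind = min_tensor_induct[OF s Cs Ds] and J = csubspaceD(1-3)[OF min_tensor_csubspace[of s C D]]
 show Jl: "clin x" if "x \<in> ?J" for x using that by (rule clin_min_tensor[OF s Cs Ds])
 have E: "otimes s b a \<in> ?J" if "b \<in> C" "a \<in> D" for b a using that by (rule otimes_min_tensor[OF s Cs Ds])
 show "0 \<in> ?J" "!!S T. S \<in> ?J ==> T \<in> ?J ==> S + T \<in> ?J" "!!c T. T \<in> ?J ==> c *C T \<in> ?J" using J by auto
 show "T \<in> ?J" if "!!n. f n \<in> ?J" "f ---> T" for f T using that closed_sequentially[OF min_tensor_closed] by blast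
 show "S oo T \<in> ?J" if "S \<in> ?J" "T \<in> ?J" for S T
  using that by (intro min_tensor_comp[OF s Cs _ Ds]) (auto intro: cstar_comp[OF C] cstar_comp[OF D])
 show "hadj T \<in> ?J" if T: "T \<in> ?J" for T
 proof -
  have "clin T & hadj T \<in> ?J"
  proof (rule ind[OF T])
   show "closed {T. clin T & hadj T \<in> ?J}"
   proof (rule closed_seqI)
    fix f T assume f: "!!n. f n \<in> {T. clin T & hadj T \<in> ?J}" "f ---> T"
    have T: "clin T" by (rule clin_lim[OF _ f(2)]) (use f(1) in blast)
    have "(%n. hadj (f n)) ---> hadj T" by (rule tendsto_hadj[OF f(2) _ T]) (use f(1) in blast)
    moreover have "hadj (f n) \<in> ?J" for n using f(1) by blast
    ultimately have "hadj T \<in> ?J" by (rule closed_sequentially[OF min_tensor_closed, rotated])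
    thus "T \<in> {T. clin T & hadj T \<in> ?J}" using T by blast
   qed
   show "csubspace {T. clin T & hadj T \<in> ?J}" using J by (auto simp: csubspace_def)
  qed (use Cl Dl in \<open>auto simp: otimes_hadj[OF w] clin_otimes[OF w] intro!: E cstar_hadj[OF C] cstar_hadj[OF D]\<close>)
  thus ?thesis by blast
 qed
qed

lemma otimes_flip:
 assumes s: "wtensor s" and "clin S" "clin T"
 shows "otimes (%y x. s x y) T S = otimes s S T"
 by (rule otimes_eqI[OF s])
  (use assms otimes_apply[OF wtensor_flip[OF s]] otimes_torth[OF wtensor_flip[OF s]] clin_otimes[OF wtensor_flip[OF s]] in
   \<open>simp_all add: torth_flip[of s]\<close>)

text \<open>\<open>V\<close> need not be closed under products. In the product rule \<open>v\<close>
  is replaced by \<open>e oo v\<close> with \<open>e\<close> in \<open>V\<close>, so that the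
  product of \<open>S \<otimes> e\<close> and \<open>T \<otimes> v\<close> lies in \<open>G\<close>
  and tends to \<open>S T \<otimes> v\<close>.\<close>

lemma cstar_slices:
 assumes w: "wtensor s" and C: "cstar_algebra C" and G: "cstar_algebra G"
  and V: "!!v. v \<in> V ==> clin v" "!!v. v \<in> V ==> hadj v \<in> V"
  and \<F>: "\<F> ~= bot" "\<forall>\<^sub>F e in \<F>. e \<in> V" "!!v. v \<in> V ==> ((%e. e oo v) ~~> v) \<F>"
 shows "cstar_algebra {u \<in> C. \<forall>v\<in>V. otimes s u v \<in> G}"
proof (rule cstar_algebraI)
 note Cl = cstar_algebraD(1)[OF C]
 let ?S = "{u \<in> C. \<forall>v\<in>V. otimes s u v \<in> G}"
 have lim: "x \<in> G" if "(f ~~> x) \<H>" "\<forall>\<^sub>F e in \<H>. f e \<in> G" "\<H> ~= bot" for f x \<H>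
  using Lim_in_closed_set[OF cstar_algebraD(3)[OF G] that(2,3,1)] .
 show "clin T" if "T \<in> ?S" for T using that Cl by auto
 have "otimes s 0 b = 0" if "clin b" for b using otimes_scale_left[OF w _ that, of 0 0] by simp
 thus "0 \<in> ?S" using cstar_zero[OF C] cstar_zero[OF G] V(1) by simp
 show "S + T \<in> ?S" if "S \<in> ?S" "T \<in> ?S" for S T
  using that Cl V(1) by (auto simp: otimes_add_left[OF w] intro: cstar_add[OF C] cstar_add[OF G])
 show "c *C T \<in> ?S" if "T \<in> ?S" for c T
  using that Cl V(1) by (auto simp: otimes_scale_left[OF w] intro: cstar_scaleC[OF C] cstar_scaleC[OF G])
 show "T \<in> ?S" if f: "!!n. f n \<in> ?S" "f ---> T" "clin T" for f T
 proof -
  have "T \<in> C" using f closed_sequentially[OF cstar_algebraD(3)[OF C]] by blast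
  moreover have "otimes s T v \<in> G" if "v \<in> V" for v
  proof (rule lim)
   show "(%n. otimes s (f n) v) ---> otimes s T v"
    using f Cl V(1) that by (intro otimes_tendsto[OF w]) auto
  qed (use that f in auto)
  ultimately show ?thesis by auto
 qed
 show "S oo T \<in> ?S" if S: "S \<in> ?S" and T: "T \<in> ?S" for S T
 proof -
  have c: "clin S" "clin T" using S T Cl by auto
  have "otimes s (S oo T) v \<in> G" if v: "v \<in> V" for v
  proof (rule lim[OF _ _ \<F>(1)])
   show "((%e. otimes s (S oo T) (e oo v)) ~~> otimes s (S oo T) v) \<F>"
    using c V(1) v \<F>(2,3) by (intro otimes_tendsto[OF w]) (auto elim: eventually_mono)
   show "\<forall>\<^sub>F e in \<F>. otimes s (S oo T) (e oo v) \<in> G"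
    using \<F>(2)
   proof eventually_elim
    case (elim e)
    hence "otimes s S e oo otimes s T v \<in> G" using S T v by (intro cstar_comp[OF G]) auto
    thus ?case using c V(1) v elim by (simp add: otimes_comp[OF w])
   qed
  qed
  thus ?thesis using S T by (auto intro: cstar_comp[OF C])
 qed
 show "hadj T \<in> ?S" if T: "T \<in> ?S" for T
 proof -
  have "otimes s (hadj T) v = hadj (otimes s T (hadj v))" if "v \<in> V" for v
   using V(1)[OF that] T Cl by (simp add: otimes_hadj[OF w])
  thus ?thesis using T V(2) by (auto intro: cstar_hadj[OF C] cstar_hadj[OF G])
 qed
qed

text \<open>For the inclusion from right to left one factor is freed at a time: with the first entry
  in \<open>M\<close> or among its adjoints, the second may range over its generated algebra, and
  then so may the first. The start requires the mixed elements
  \<open>hadj b \<otimes> a\<close>.\<close>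

lemma cstar_gen_min_tensor:
 fixes s :: "'p::chilbert_space => 'q::chilbert_space => 'r::chilbert_space"
 assumes s: "hilbert_tensor s" and M: "cai M P \<F>" and N: "cai N Q \<G>"
 shows "cstar_gen (min_tensor s M N) = min_tensor s (cstar_gen M) (cstar_gen N)"
proof
 let ?J = "min_tensor s M N" and ?C = "cstar_gen M" and ?D = "cstar_gen N"
 note w = hilbert_wtensor[OF s]
 note Ml = caiD(2)[OF M] and Nl = caiD(2)[OF N]
 have Ms: "M <= Collect clin" and Ns: "N <= Collect clin" using Ml Nl by auto
 have C: "cstar_algebra ?C" and D: "cstar_algebra ?D" using Ml Nl by (auto intro!: cstar_gen)
 note Cl = cstar_algebraD(1)[OF C] and Dl = cstar_algebraD(1)[OF D]
 have Cs: "?C <= Collect clin" and Ds: "?D <= Collect clin" using Cl Dl by auto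
 have MC: "b \<in> ?C" if "b \<in> M" for b using that by (rule hull_inc)
 have ND: "a \<in> ?D" if "a \<in> N" for a using that by (rule hull_inc)
 show "cstar_gen ?J <= min_tensor s ?C ?D"
 proof (rule cstar_gen_subset[OF cstar_min_tensor[OF s C D]], rule)
  fix u assume "u \<in> ?J"
  thus "u \<in> min_tensor s ?C ?D"
   using min_tensor_closed[of s ?C ?D] min_tensor_csubspace[of s ?C ?D]
   by (rule min_tensor_induct[OF s Ms Ns, where Q = "%u. u \<in> min_tensor s ?C ?D", unfolded Collect_mem_eq])
    (auto intro: otimes_min_tensor[OF s Cs Ds] MC ND)
 qed
 define G where "G = cstar_gen ?J"
 have Jl: "clin x" if "x \<in> ?J" for x using that by (rule clin_min_tensor[OF s Ms Ns])
 have G: "cstar_algebra G" unfolding G_def using Jl by (rule cstar_gen)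
 have JG: "otimes s b a \<in> G" if "b \<in> M" "a \<in> N" for b a
  unfolding G_def by (rule hull_inc) (rule otimes_min_tensor[OF s Ms Ns that])
 have lim: "x \<in> G" if "(f ~~> x) \<H>" "\<forall>\<^sub>F e in \<H>. f e \<in> G" "\<H> ~= bot" for f x \<H>
  using Lim_in_closed_set[OF cstar_algebraD(3)[OF G] that(2,3,1)] .
 have evM: "\<forall>\<^sub>F e in \<F>. e \<in> M" and evN: "\<forall>\<^sub>F e in \<G>. e \<in> N"
  using caiD(9)[OF M] caiD(9)[OF N] by (auto elim: eventually_mono)
 define V where "V = M \<union> hadj ` M"
 have Vl: "clin b" if "b \<in> V" for b using that Ml by (auto simp: V_def)
 have VC: "b \<in> ?C" if "b \<in> V" for b using that MC cstar_hadj[OF C] by (auto simp: V_def)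
 define D1 where "D1 = {v \<in> ?D. \<forall>b\<in>V. otimes (%y x. s x y) v b \<in> G}"
 have D1: "D1 = {v \<in> ?D. \<forall>b\<in>V. otimes s b v \<in> G}"
  unfolding D1_def using Vl Dl by (auto simp: otimes_flip[OF w])
 have "cstar_algebra D1"
  unfolding D1_def using evM cai_cstar(1)[OF M VC] Ml Vl
  by (intro cstar_slices[OF wtensor_flip[OF w] D G _ _ caiD(8)[OF M]]) (auto simp: V_def elim: eventually_mono)
 moreover have "N <= D1"
 proof
  fix a assume a: "a \<in> N"
  \<comment> \<open>The mixed element is the limit of the products of
    \<open>hadj (b \<otimes> f)\<close> with \<open>e \<otimes> a\<close>, where \<open>e\<close>
    and \<open>f\<close> run through the two approximate identities.\<close>
  have "otimes s (hadj b) a \<in> G" if b: "b \<in> M" for b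
  proof (rule lim)
   have 1: "((%p. hadj b oo fst p) ~~> hadj b) (\<F> \<times>\<^sub>F \<G>)"
    by (rule filterlim_compose[OF cai_cstar(3)[OF M cstar_hadj[OF C MC[OF b]]] filterlim_fst])
   have 2: "((%p. hadj (snd p) oo a) ~~> a) (\<F> \<times>\<^sub>F \<G>)"
    by (rule filterlim_compose[OF cai_cstar(2)[OF N ND[OF a]] filterlim_snd])
   note ev = eventually_prodI[OF evM evN]
   show "((%p. otimes s (hadj b oo fst p) (hadj (snd p) oo a)) ~~> otimes s (hadj b) a) (\<F> \<times>\<^sub>F \<G>)"
    using 1 2 Ml[OF b] Nl[OF a] ev Ml Nl by (intro otimes_tendsto[OF w]) (auto elim!: eventually_mono)
   show "\<forall>\<^sub>F p in \<F> \<times>\<^sub>F \<G>. otimes s (hadj b oo fst p) (hadj (snd p) oo a) \<in> G"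
    using ev
   proof eventually_elim
    case (elim p)
    hence "hadj (otimes s b (snd p)) oo otimes s (fst p) a \<in> G" using a b by (intro cstar_comp[OF G] cstar_hadj[OF G] JG) auto
    thus ?case using a b Ml Nl elim by (simp add: otimes_comp[OF w] otimes_hadj[OF w])
   qed
  qed (use caiD(8)[OF M] caiD(8)[OF N] in \<open>simp add: prod_filter_eq_bot\<close>)
  thus "a \<in> D1" using a JG ND by (auto simp: D1 V_def)
 qed
 ultimately have DD: "?D <= D1" by (rule cstar_gen_subset)
 define C1 where "C1 = {u \<in> ?C. \<forall>v\<in>?D. otimes s u v \<in> G}"
 have "cstar_algebra C1"
  unfolding C1_def using evN cai_cstar(1)[OF N] ND
  by (intro cstar_slices[OF w C G Dl cstar_hadj[OF D] caiD(8)[OF N]]) (auto elim: eventually_mono)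
 moreover have "M <= C1" using DD MC by (auto simp: C1_def D1 V_def)
 ultimately have CC: "?C <= C1" by (rule cstar_gen_subset)
 show "min_tensor s ?C ?D <= cstar_gen ?J"
 proof
  fix u assume "u \<in> min_tensor s ?C ?D"
  hence "u \<in> G"
   using cstar_algebraD(3,2)[OF G]
   by (rule min_tensor_induct[OF s Cs Ds, where Q = "%u. u \<in> G", unfolded Collect_mem_eq])
    (use CC in \<open>auto simp: C1_def\<close>)
  thus "u \<in> cstar_gen ?J" by (simp add: G_def)
 qed
qed

section \<open>Rigidity of the tensor product\<close>

text \<open>In coordinates of the second factor, \<open>T \<otimes> 1\<close> is a direct sum of
  copies of \<open>T\<close>, so the kernel is positive coordinate by coordinate.\<close>

lemma left_amplification:
 fixes s :: "'p::chilbert_space => 'q::chilbert_space => 'r::chilbert_space"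
 assumes s: "wtensor s"
 shows "\<exists>Psi. cpc Psi & (\<forall>T. clin T --> Psi T = otimes s T \<one>)"
proof -
 define ka where "ka T i j = <<fst i, T $ fst j>> * <<snd i, snd j>>" for T :: "'p op" and i j :: "'p \<times> 'q"
 have "\<exists>Psi. cpc Psi & (\<forall>T. clin T --> (\<forall>i\<in>UNIV. \<forall>j\<in>UNIV. <<s (fst i) (snd i), Psi T $ s (fst j) (snd j)>> = ka T i j) &
   (\<forall>x. (\<forall>i\<in>UNIV. <<s (fst i) (snd i), x>> = 0) --> Psi T $ x = 0 & hadj (Psi T) $ x = 0))"
 proof (rule kernel_cp)
  show "ka (S + T) i j = ka S i j + ka T i j" "ka (c *C T) i j = c * ka T i j" for S T i j c
   by (simp_all add: ka_def cinner_simps algebra_simps)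
  show "0 <= Re (\<Sum>a<n. \<Sum>b<n. ka (C a b) (io a) (io b))"
   if Cl: "!!a b. a < n ==> b < n ==> clin (C a b)" and C: "acc {..<n::nat} C" for n C io
  proof -
   obtain u :: "'q => 'q ell2" where u: "!!y y'. <<u y, u y'>> = <<y, y'>>" using ell2_embedding by blast
   let ?y = "%a i. ell2_coord (u (snd (io a))) i"
   have "((%i. cnj (?y a i) * ?y b i) has_sum <<snd (io a), snd (io b)>>) UNIV" for a b
    unfolding u[symmetric] cinner_ell2_def by (intro has_sum_infsum ell2_cinner_summable)
   hence "((%i. \<Sum>a<n. \<Sum>b<n. <<fst (io a), C a b $ fst (io b)>> * (cnj (?y a i) * ?y b i))
     has_sum (\<Sum>a<n. \<Sum>b<n. ka (C a b) (io a) (io b))) UNIV"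
    unfolding ka_def by (intro has_sum_finite_sum has_sum_cmult_right)
   hence "((%i. Re (\<Sum>a<n. \<Sum>b<n. <<fst (io a), C a b $ fst (io b)>> * (cnj (?y a i) * ?y b i)))
     has_sum Re (\<Sum>a<n. \<Sum>b<n. ka (C a b) (io a) (io b))) UNIV"
    by (rule has_sum_Re)
   thus ?thesis
   proof (rule has_sum_nonneg)
    fix i
    have "(\<Sum>a<n. \<Sum>b<n. <<fst (io a), C a b $ fst (io b)>> * (cnj (?y a i) * ?y b i))
      = mform {..<n} C (%a. ?y a i *C fst (io a))"
     using Cl by (auto simp: mform_def clin_scaleC cinner_simps ac_simps intro!: sum.cong)
    thus "0 <= Re (\<Sum>a<n. \<Sum>b<n. <<fst (io a), C a b $ fst (io b)>> * (cnj (?y a i) * ?y b i))"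
     using C unfolding acc_def by presburger
   qed
  qed
  show "Re (\<Sum>i\<in>F. \<Sum>j\<in>F. cnj (c i) * c j * ka \<one> i j) <= (norm (\<Sum>i\<in>F. c i *C s (fst i) (snd i)))^2" for F c
  proof -
   have "(\<Sum>i\<in>F. \<Sum>j\<in>F. cnj (c i) * c j * ka \<one> i j)
     = <<\<Sum>i\<in>F. c i *C s (fst i) (snd i), \<Sum>i\<in>F. c i *C s (fst i) (snd i)>>"
    by (simp add: ka_def cinner_sum_sum wtensor_simps[OF s])
   thus ?thesis by (simp add: Re_cinner_self del: Re_sum)
  qed
 qed
 then obtain Psi where Psi: "cpc Psi" "!!T i j. clin T ==> <<s (fst i) (snd i), Psi T $ s (fst j) (snd j)>> = ka T i j"
  "!!T x. clin T ==> (!!i. <<s (fst i) (snd i), x>> = 0) ==> Psi T $ x = 0 & hadj (Psi T) $ x = 0"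
  by auto
 have "Psi T = otimes s T \<one>" if T: "clin T" for T
 proof (rule op_eqI_family[of _ _ UNIV "%i. s (fst i) (snd i)"])
  show "<<s (fst i) (snd i), Psi T $ s (fst j) (snd j)>> = <<s (fst i) (snd i), otimes s T \<one> $ s (fst j) (snd j)>>" for i j
   using T by (simp add: Psi(2) ka_def otimes_apply[OF s] wtensor_simps[OF s])
  fix x assume x: "!!i. i \<in> UNIV ==> <<s (fst i) (snd i), x>> = 0"
  thus "Psi T $ x = 0 & hadj (Psi T) $ x = 0" using Psi(3)[OF T] by blast
  have "x \<in> torth s" using x[of "(_, _)"] by (simp add: torth_def)
  thus "otimes s T \<one> $ x = 0 & hadj (otimes s T \<one>) $ x = 0"
   using otimes_torth[OF s T] otimes_torth_hadj[OF s T] by simp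
 qed (use T Psi(1) clin_otimes[OF s T] in auto)
 thus ?thesis using Psi(1) by blast
qed

lemma norm_projection: "clin P ==> hadj P = P ==> P oo P = P ==> norm P <= 1"
 using projection_le(1)[of P] by (intro norm_blinfun_bound) auto

text \<open>Compresses \<open>T \<otimes> 1\<close> by \<open>1 \<otimes> Q\<close>.\<close>

lemma tensor_projection_cpc:
 fixes s :: "'p::chilbert_space => 'q::chilbert_space => 'r::chilbert_space"
 assumes s: "wtensor s" and Q: "clin Q" "hadj Q = Q" "Q oo Q = Q"
 shows "\<exists>Psi. cpc Psi & (\<forall>T. clin T --> Psi T = otimes s T Q)"
proof -
 obtain Psi where Psi: "cpc Psi" "!!T. clin T ==> Psi T = otimes s T \<one>" using left_amplification[OF s] by blast
 let ?V = "otimes s \<one> Q"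
 have "norm (\<one> :: 'p op) * norm Q <= 1 * 1"
  using norm_projection[OF Q] by (intro mult_mono norm_blinfun_id_le) auto
 hence "norm ?V <= 1" using norm_otimes[OF s, of \<one> Q] Q(1) by simp
 hence "cpc (%T. sand ?V (Psi T))" by (intro cpc_comp[OF Psi(1)] cpc_sand clin_otimes[OF s]) (auto simp: Q)
 moreover have "sand ?V (Psi T) = otimes s T Q" if "clin T" for T
  using that Q by (simp add: sand_def Psi(2) otimes_hadj[OF s] otimes_comp[OF s])
 ultimately show ?thesis by blast
qed

lemma scaled_cpc:
 fixes Psi :: "'a::chilbert_space op => 'b::chilbert_space op"
 assumes Psi: "cpc Psi" and bound: "!!x. Re <<x, Psi \<one> $ x>> <= c * (norm x)^2"
 shows "0 < c ==> cpc (%T. complex_of_real (1 / c) *C Psi T)" and "c = 0 ==> clin T ==> Psi T = 0"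
proof -
 assume c: "0 < c"
 let ?c = "complex_of_real (1 / c)"
 have acc: "acc {..<n} (%i j. ?c *C Psi (C i j))" if "\<forall>i<n. \<forall>j<n. clin (C i j)" "acc {..<n} C" for n :: nat and C
 proof -
  have "acc {..<n} (%i j. Psi (C i j))" using that by (intro cpc_acc[OF Psi]) auto
  moreover have "mform {..<n} (%i j. ?c *C Psi (C i j)) xi = ?c * mform {..<n} (%i j. Psi (C i j)) xi" for xi
   by (simp add: mform_def cinner_simps sum_distrib_left)
  moreover have "Re (?c * z) = Re z / c" for z by (simp add: Re_divide_of_real)
  ultimately show ?thesis unfolding acc_def using c by (simp del: of_real_divide)
 qed
 show "cpc (%T. ?c *C Psi T)"
  unfolding cpc_def clinear_on_def cops_iff
 proof (intro conjI allI ballI impI)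
  show "Re <<x, (?c *C Psi \<one>) $ x>> <= (norm x)^2" for x
   using bound[of x] c by (simp add: cinner_simps Re_divide_of_real field_simps)
 qed (use acc Psi in \<open>auto simp: cops_iff cpc_add[OF Psi] cpc_scale[OF Psi] scaleC_add_right scaleC_scaleC mult.commute\<close>)
next
 assume c: "c = 0" and T: "clin T"
 show "Psi T = 0"
 proof (rule blinfun_eqI)
  fix x
  let ?n = "complex_of_real ((norm T)^2)"
  have "opos (?n *C \<one> - (hadj T oo T))"
   unfolding opos_def
  proof
   fix xi
   have "(norm (T $ xi))^2 <= (norm T * norm xi)^2" by (intro power_mono norm_blinfun) auto
   thus "0 <= Re <<xi, (?n *C \<one> - (hadj T oo T)) $ xi>>"
    using T by (simp add: cinner_simps hadj_right cinner_self power_mult_distrib flip: of_real_power of_real_mult)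
  qed
  hence "opos (Psi (?n *C \<one>) - Psi (hadj T oo T))" using T by (intro cpc_mono[OF Psi]) auto
  hence "Re <<x, Psi (hadj T oo T) $ x>> <= Re <<x, Psi (?n *C \<one>) $ x>>"
   unfolding opos_def by (simp add: cinner_simps)
  also have "... = (norm T)^2 * Re <<x, Psi \<one> $ x>>"
   by (simp add: cpc_scale[OF Psi] cinner_simps flip: of_real_power)
  also have "... <= 0" using bound[of x] c by (simp add: mult_nonneg_nonpos)
  finally show "Psi T $ x = 0 $ x"
   using cpc_schwarz(2)[OF Psi T, of x] by (metis blinfun.zero_left norm_eq_zero order_trans power2_less_eq_zero_iff)
 qed
qed

text \<open>Slicing multiplies by scalars, so the maps to which rigidity is applied fix
  \<open>R\<close> only up to a factor \<open>c\<close>. For \<open>c > 0\<close> they are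
  normalized; for \<open>c = 0\<close> they vanish by the Schwarz inequality.\<close>

lemma rigid_scaled:
 assumes phi: "cpc phi" and rigid: "\<forall>Phi\<in>fixers R. \<forall>a\<in>cstar_gen R. phi (Phi a) = phi a" and R: "!!r. r \<in> R ==> clin r"
  and Psi: "cpc Psi" and c: "0 <= c" and bound: "!!x. Re <<x, Psi \<one> $ x>> <= c * (norm x)^2"
  and fixed: "!!r. r \<in> R ==> Psi r = complex_of_real c *C r" and a: "a \<in> cstar_gen R"
 shows "phi (Psi a) = complex_of_real c *C phi a"
proof -
 have al: "clin a" using cstar_algebraD(1)[OF cstar_gen[OF R] a] by blast
 show ?thesis
 proof (cases "c = 0")
  case True
  thus ?thesis using scaled_cpc(2)[OF Psi bound True al] cpc_zero[OF phi] by simp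
 next
  case False
  hence "0 < c" using c by simp
  have "(%T. complex_of_real (1 / c) *C Psi T) \<in> fixers R"
   using scaled_cpc(1)[OF Psi bound \<open>0 < c\<close>] False by (simp add: fixers_def fixed scaleC_scaleC flip: of_real_mult)
  hence "phi (complex_of_real (1 / c) *C Psi a) = phi a" using bspec[OF bspec[OF rigid] a] by blast
  hence "complex_of_real c *C complex_of_real (1 / c) *C phi (Psi a) = complex_of_real c *C phi a"
   using al Psi by (simp add: cpc_scale[OF phi])
  thus ?thesis using False by (simp add: scaleC_scaleC flip: of_real_mult)
 qed
qed

lemma quad_eq_ball:
 fixes S T :: "'a::chilbert_space op"
 assumes c: "clin S" "clin T" and eq: "!!x. norm x <= 1 ==> <<x, S $ x>> = <<x, T $ x>>"
 shows "S = T"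
proof (rule quad_eq[OF c])
 fix x
 show "<<x, S $ x>> = <<x, T $ x>>"
 proof (cases "x = 0")
  case False
  let ?y = "complex_of_real (1 / norm x) *C x"
  have "<<?y, S $ ?y>> = <<?y, T $ ?y>>" using False by (intro eq) (simp add: norm_scaleC norm_divide)
  thus ?thesis using False c by (simp add: clin_scaleC cinner_simps)
 qed simp
qed

text \<open>\<open>M\<close> and \<open>N\<close> stand for the images of the factors in their
  envelopes, with units \<open>P\<close> and \<open>Q\<close>; \<open>phi\<close> and
  \<open>psi\<close> are maps as in \<open>rigid_factor\<close>, and \<open>Lam\<close> with its
  slices \<open>\<sigma>\<close> is their tensor product from \<open>tensor_cp\<close>. Rigidity
  refers to \<open>insert P M\<close>, since \<open>P\<close> may lie outside the algebra generated
  by \<open>M\<close>.\<close>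

locale rigid_pair =
 fixes s :: "'p::chilbert_space => 'q::chilbert_space => 'r::chilbert_space"
  and M :: "'p op set" and N :: "'q op set" and P Q \<F> \<G>
  and phi :: "'p op => 'v::chilbert_space op" and psi :: "'q op => 'w::chilbert_space op"
  and w :: "'v => 'w => 'z::chilbert_space"
  and Lam :: "'r op => 'z op" and \<sigma> :: "'v => 'v => 'r op => 'q op"
 assumes s: "hilbert_tensor s" and w: "wtensor w" and M: "cai M P \<F>" and N: "cai N Q \<G>"
  and phi: "cpc phi" and phi_md: "cstar_gen (insert P M) <= md phi"
  and phi_rigid: "\<forall>Phi\<in>fixers (insert P M). \<forall>a\<in>cstar_gen (insert P M). phi (Phi a) = phi a"
  and phi_inj: "!!a. a \<in> cstar_gen M ==> phi a = 0 ==> a = 0"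
  and psi: "cpc psi" and psi_md: "cstar_gen (insert Q N) <= md psi"
  and psi_rigid: "\<forall>Phi\<in>fixers (insert Q N). \<forall>a\<in>cstar_gen (insert Q N). psi (Phi a) = psi a"
  and psi_inj: "!!a. a \<in> cstar_gen N ==> psi a = 0 ==> a = 0"
  and Lam: "cpc Lam" and Lam_otimes: "!!S T. clin S ==> clin T ==> Lam (otimes s S T) = otimes w (phi S) (psi T)"
  and \<sigma>: "!!x. norm x <= 1 ==> cpc (\<sigma> x x)" and \<sigma>_clin: "!!T x' x. clin T ==> clin (\<sigma> x' x T)"
  and Lam_\<sigma>: "!!T x' x y' y. clin T ==> <<w x' y', Lam T $ w x y>> = <<y', psi (\<sigma> x' x T) $ y>>"
  and \<sigma>_slice: "!!T x' x y' y. clin T ==> <<y', \<sigma> x' x T $ y>> = <<x', phi (slice1 s y' y T) $ x>>"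
  and Lam_torth: "!!T z. clin T ==> z \<in> torth w ==> Lam T $ z = 0 & hadj (Lam T) $ z = 0"
begin

abbreviation "R1 \<equiv> insert P M"
abbreviation "R2 \<equiv> insert Q N"
abbreviation "I \<equiv> otimes s P Q"
abbreviation "J \<equiv> min_tensor s M N"
abbreviation "E \<equiv> min_tensor s (cstar_gen M) (cstar_gen N)"

lemmas sw = hilbert_wtensor[OF s]

lemma R1_clin: "b \<in> R1 ==> clin b" and R2_clin: "a \<in> R2 ==> clin a"
 using caiD(2,5)[OF M] caiD(2,5)[OF N] by auto

lemma C1: "cstar_algebra (cstar_gen R1)" and C2: "cstar_algebra (cstar_gen R2)"
 by (rule cstar_gen, erule R1_clin, rule cstar_gen, erule R2_clin)

lemma CM: "cstar_algebra (cstar_gen M)" and CN: "cstar_algebra (cstar_gen N)"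
 by (rule cstar_gen, rule R1_clin, simp, rule cstar_gen, rule R2_clin, simp)

lemma gen_sub: "b \<in> cstar_gen M ==> b \<in> cstar_gen R1" "a \<in> cstar_gen N ==> a \<in> cstar_gen R2"
 using hull_mono[of M R1 cstar_algebra] hull_mono[of N R2 cstar_algebra] by auto

lemma C1_clin: "b \<in> cstar_gen R1 ==> clin b" and C2_clin: "a \<in> cstar_gen R2 ==> clin a"
 using cstar_algebraD(1)[OF C1] cstar_algebraD(1)[OF C2] by auto

lemma gen_clin: "cstar_gen M <= Collect clin" "cstar_gen N <= Collect clin"
 using gen_sub C1_clin C2_clin by auto

lemma genD: "b \<in> cstar_gen M ==> clin b" "a \<in> cstar_gen N ==> clin a"
 using gen_clin by auto

lemmas E_induct = min_tensor_induct[OF s gen_clin]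

lemma E_cstar: "cstar_algebra E"
 by (rule cstar_min_tensor[OF s CM CN])

lemmas E_clin = cstar_algebraD(1)[OF E_cstar]

lemma gen_J: "cstar_gen J = E"
 by (rule cstar_gen_min_tensor[OF s M N])

lemma J_E: "x \<in> J ==> x \<in> E"
 unfolding gen_J[symmetric] by (rule hull_inc)

lemma caiJ: "cai J I (filtermap (%p. otimes s (fst p) (snd p)) (\<F> \<times>\<^sub>F \<G>))"
 by (rule cai_tensor[OF s M N])

lemmas I = caiD(5,6,7)[OF caiJ]

lemma PQ: "P \<in> cstar_gen R1" "Q \<in> cstar_gen R2"
 by (auto intro: hull_inc)

lemma otimes_md: "b \<in> cstar_gen R1 ==> a \<in> cstar_gen R2 ==> otimes s b a \<in> md Lam"
proof -
 assume b: "b \<in> cstar_gen R1" and a: "a \<in> cstar_gen R2"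
 note c = C1_clin[OF b] C2_clin[OF a]
 have m: "phi (hadj b oo b) = hadj (phi b) oo phi b" "phi (b oo hadj b) = phi b oo hadj (phi b)"
  "psi (hadj a oo a) = hadj (psi a) oo psi a" "psi (a oo hadj a) = psi a oo hadj (psi a)"
  using mdD(1)[OF subsetD[OF phi_md b], of "hadj b"] mdD(2)[OF subsetD[OF phi_md b], of "hadj b"]
   mdD(1)[OF subsetD[OF psi_md a], of "hadj a"] mdD(2)[OF subsetD[OF psi_md a], of "hadj a"] c
  by (simp_all add: cpc_hadj[OF phi] cpc_hadj[OF psi])
 have c': "clin (phi b)" "clin (psi a)" using c phi psi by auto
 show ?thesis
  by (rule mdI[OF Lam]) (use c c' in \<open>simp_all add: clin_otimes[OF sw] otimes_hadj[OF sw] otimes_comp[OF sw] Lam_otimes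
   otimes_hadj[OF w] otimes_comp[OF w] m\<close>)
qed

lemma E_md: "u \<in> E ==> u \<in> md Lam"
 by (erule E_induct)
  (use cstar_algebraD(2,3)[OF cstar_md[OF Lam]] in \<open>auto intro: otimes_md gen_sub\<close>)

lemma I_md: "I \<in> md Lam"
 by (rule otimes_md[OF PQ])

lemma \<sigma>_linear:
 assumes "clin S" "clin T"
 shows "\<sigma> x' x (S + T) = \<sigma> x' x S + \<sigma> x' x T" "\<sigma> x' x (c *C T) = c *C \<sigma> x' x T"
 by (intro blinfun_eqI cinner_eqI;
   simp add: \<sigma>_slice assms cinner_simps slice1_simps[OF sw] cpc_add[OF phi] cpc_scale[OF phi])+

lemma \<sigma>_norm:
 assumes T: "clin T" shows "norm (\<sigma> x' x T) <= norm x' * norm x * norm T"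
proof (intro norm_blinfun_bound norm_leI_cinner)
 fix y y'
 have c: "clin (slice1 s y' y T)" using T by (simp add: slice1_simps[OF sw])
 have "cmod <<y', \<sigma> x' x T $ y>> <= norm x' * norm (phi (slice1 s y' y T) $ x)"
  unfolding \<sigma>_slice[OF T] by (rule cauchy_schwarz)
 also have "... <= norm x' * (norm (phi (slice1 s y' y T)) * norm x)" by (intro mult_left_mono norm_blinfun) auto
 also have "... <= norm x' * ((norm y' * norm T * norm y) * norm x)"
  using cpc_norm[OF phi c] slice1_simps(5)[OF sw, of y' y T] by (intro mult_left_mono mult_right_mono) auto
 finally show "cmod <<y', \<sigma> x' x T $ y>> <= norm x' * norm x * norm T * norm y * norm y'" by (simp add: ac_simps)
qed auto

lemma \<sigma>_otimes:
 assumes "clin S" "clin T" shows "\<sigma> x' x (otimes s S T) = <<x', phi S $ x>> *C T"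
 by (intro blinfun_eqI cinner_eqI)
  (simp add: \<sigma>_slice clin_otimes[OF sw] slice1_otimes[OF sw] assms cpc_scale[OF phi] cinner_simps)

lemma E_slices:
 assumes u: "u \<in> E"
 shows "\<sigma> x' x u \<in> cstar_gen N" "slice1 s y' y u \<in> cstar_gen M"
proof -
 have "clin u & \<sigma> x' x u \<in> cstar_gen N"
 proof (rule E_induct[OF u])
  show "csubspace {u. clin u & \<sigma> x' x u \<in> cstar_gen N}"
   using \<sigma>_linear(2)[of 0 0 _ _ 0] cstar_zero[OF CN]
   by (auto simp: csubspace_def \<sigma>_linear intro: cstar_add[OF CN] cstar_scaleC[OF CN])
  show "closed {u. clin u & \<sigma> x' x u \<in> cstar_gen N}"
  proof (rule closed_seqI)
   fix f T assume f: "!!n. f n \<in> {u. clin u & \<sigma> x' x u \<in> cstar_gen N}" "f ---> T"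
   have T: "clin T" by (rule clin_lim[OF _ f(2)]) (use f(1) in blast)
   have "(%n. \<sigma> x' x (f n) - \<sigma> x' x T) ---> 0"
   proof (rule Lim_null_comparison)
    have "norm (\<sigma> x' x (f n) - \<sigma> x' x T) <= norm x' * norm x * norm (f n - T)" for n
     using \<sigma>_linear(1)[of "f n - T" T x' x] \<sigma>_norm[of "f n - T" x' x] f(1)[of n] T by simp
    thus "\<forall>\<^sub>F n in sequentially. norm (\<sigma> x' x (f n) - \<sigma> x' x T) <= norm x' * norm x * norm (f n - T)" by simp
    have "(%n. norm x' * norm x * norm (f n - T)) ---> norm x' * norm x * norm (T - T)" by (intro tendsto_intros f(2))
    thus "(%n. norm x' * norm x * norm (f n - T)) ---> 0" by simp
   qed
   hence "(%n. \<sigma> x' x (f n)) ---> \<sigma> x' x T" by (rule Lim_null[THEN iffD2])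
   moreover have "\<sigma> x' x (f n) \<in> cstar_gen N" for n using f(1) by blast
   ultimately have "\<sigma> x' x T \<in> cstar_gen N" by (rule closed_sequentially[OF cstar_algebraD(3)[OF CN], rotated])
   thus "T \<in> {u. clin u & \<sigma> x' x u \<in> cstar_gen N}" using T by simp
  qed
  show "clin (otimes s b a) & \<sigma> x' x (otimes s b a) \<in> cstar_gen N" if "b \<in> cstar_gen M" "a \<in> cstar_gen N" for b a
   using that by (auto simp: genD \<sigma>_otimes clin_otimes[OF sw] intro: cstar_scaleC[OF CN])
 qed
 thus "\<sigma> x' x u \<in> cstar_gen N" by blast
 show "slice1 s y' y u \<in> cstar_gen M"
 proof (rule E_induct[OF u])
  show "csubspace {u. slice1 s y' y u \<in> cstar_gen M}"
   using slice1_simps(4)[OF sw, of y' y 0 0] cstar_zero[OF CM]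
   by (auto simp: csubspace_def slice1_simps[OF sw] intro: cstar_add[OF CM] cstar_scaleC[OF CM])
  show "closed {u. slice1 s y' y u \<in> cstar_gen M}"
  proof (rule closed_seqI)
   fix f T assume f: "!!n. f n \<in> {u. slice1 s y' y u \<in> cstar_gen M}" "f ---> T"
   have "(%n. slice1 s y' y (f n)) ---> slice1 s y' y T"
    unfolding slice1_def by (intro tendsto_comp tendsto_const f(2))
   moreover have "slice1 s y' y (f n) \<in> cstar_gen M" for n using f(1) by blast
   ultimately have "slice1 s y' y T \<in> cstar_gen M" by (rule closed_sequentially[OF cstar_algebraD(3)[OF CM], rotated])
   thus "T \<in> {u. slice1 s y' y u \<in> cstar_gen M}" by simp
  qed
  show "slice1 s y' y (otimes s b a) \<in> cstar_gen M" if "b \<in> cstar_gen M" "a \<in> cstar_gen N" for b a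
   using that by (auto simp: genD slice1_otimes[OF sw] intro: cstar_scaleC[OF CM])
 qed
qed

text \<open>Two rounds of slicing: \<open>psi\<close> is injective on the algebra containing the
  slices \<open>\<sigma> x' x u\<close>, and then \<open>phi\<close> on the algebra containing the
  slices of \<open>u\<close> itself.\<close>

lemma E_inj:
 assumes u: "u \<in> E" and Lamu: "Lam u = 0" shows "u = 0"
proof -
 note c = E_clin[OF u]
 have "\<sigma> x' x u = 0" for x' x
 proof (rule psi_inj[OF E_slices(1)[OF u]])
  show "psi (\<sigma> x' x u) = 0" using Lam_\<sigma>[OF c] by (intro blinfun_eqI cinner_eqI) (simp add: Lamu)
 qed
 hence "phi (slice1 s y' y u) = 0" for y' y
  using \<sigma>_slice[OF c] by (intro blinfun_eqI cinner_eqI) simp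
 hence "slice1 s y' y u = 0" for y' y by (rule phi_inj[OF E_slices(2)[OF u]])
 hence eq: "<<s x' y', u $ s x y>> = 0" for x' y' x y
  using slice1_simps(2)[OF sw, of x' y' y u x] by simp
 show "u = 0"
 proof (rule op_eqI_family[of _ _ UNIV "%i. s (fst i) (snd i)"])
  fix z assume z: "!!i. i \<in> UNIV ==> <<s (fst i) (snd i), z>> = 0"
  have "z = 0" by (rule hilbert_torth[OF s]) (use z[of "(_, _)"] in \<open>simp add: torth_def\<close>)
  thus "u $ z = 0 & hadj u $ z = 0" "0 $ z = 0 & hadj 0 $ z = 0" by simp_all
 qed (use c eq in auto)
qed

text \<open>The algebra with \<open>I\<close> adjoined multiplies \<open>E\<close> into itself. So
  for \<open>z\<close> in \<open>E\<close> the product \<open>u oo z\<close> lies in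
  \<open>E\<close> and is annihilated by \<open>Lam\<close>, whence \<open>u oo z = 0\<close>;
  letting \<open>z\<close> run through the approximate identity gives \<open>u = 0\<close>.\<close>

lemma E1_inj:
 assumes u: "u \<in> cstar_gen (insert I J)" and Lamu: "Lam u = 0" shows "u = 0"
proof -
 define D where "D = {u. clin u & u oo I = u & I oo u = u & (\<forall>z\<in>E. u oo z \<in> E & z oo u \<in> E)}"
 have Ez: "z oo I = z" "I oo z = z" if "z \<in> E" for z
  using cai_cstar(5,6)[OF caiJ] that by (auto simp: gen_J)
 have "cstar_algebra D"
 proof (rule cstar_algebraI)
  show "0 \<in> D" using cstar_zero[OF E_cstar] by (auto simp: D_def)
  show "S + T \<in> D" if "S \<in> D" "T \<in> D" for S T
   using that by (auto simp: D_def comp_simps intro: cstar_add[OF E_cstar])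
  show "c *C T \<in> D" if "T \<in> D" for c T
   using that E_clin I(1) by (auto simp: D_def comp_simps intro: cstar_scaleC[OF E_cstar])
  show "S oo T \<in> D" if S: "S \<in> D" and T: "T \<in> D" for S T
  proof -
   have "(S oo T) oo z \<in> E" "z oo (S oo T) \<in> E" if "z \<in> E" for z
    using S T that unfolding comp_assoc[of S T z] comp_assoc[of z S T, symmetric] by (auto simp: D_def)
   moreover have "(S oo T) oo I = S oo T" "I oo (S oo T) = S oo T"
    using S T unfolding comp_assoc[of S T I] comp_assoc[of I S T, symmetric] by (auto simp: D_def)
   ultimately show ?thesis using S T by (simp add: D_def)
  qed
  show "hadj T \<in> D" if T: "T \<in> D" for T
  proof -
   have c: "clin T" using T by (simp add: D_def)
   have "hadj T oo z = hadj (hadj z oo T)" "z oo hadj T = hadj (T oo hadj z)" if "z \<in> E" for z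
    using E_clin[OF that] c by simp_all
   moreover have "hadj T oo I = hadj (I oo T)" "I oo hadj T = hadj (T oo I)" using c I by simp_all
   ultimately show ?thesis using T by (auto simp: D_def intro: cstar_hadj[OF E_cstar])
  qed
  show "T \<in> D" if f: "!!n. f n \<in> D" "f ---> T" "clin T" for f T
  proof -
   have "T oo I = T" "I oo T = T"
    using closed_sequentially[OF closed_comp_eq(1) _ f(2), of I] closed_sequentially[OF closed_comp_eq(2) _ f(2), of I] f(1)
    by (auto simp: D_def)
   moreover have "T oo z \<in> E" "z oo T \<in> E" if "z \<in> E" for z
    using closed_sequentially[OF closed_comp_mem(1)[OF cstar_algebraD(3)[OF E_cstar], of z] _ f(2)]
     closed_sequentially[OF closed_comp_mem(2)[OF cstar_algebraD(3)[OF E_cstar], of z] _ f(2)] f(1) that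
    by (auto simp: D_def)
   ultimately show ?thesis using f(3) by (simp add: D_def)
  qed
 qed (simp add: D_def)
 moreover have "insert I J <= D"
  using I J_E E_clin Ez cstar_comp[OF E_cstar] by (auto simp: D_def)
 ultimately have uD: "u \<in> D" using u cstar_gen_subset by blast
 hence uE: "clin u" "u oo I = u" "!!z. z \<in> E ==> u oo z \<in> E" by (auto simp: D_def)
 have uz: "u oo z = 0" if z: "z \<in> E" for z
 proof (rule E_inj[OF uE(3)[OF z]])
  show "Lam (u oo z) = 0" using mdD(1)[OF E_md[OF z] uE(1)] Lamu by simp
 qed
 let ?F = "filtermap (%p. otimes s (fst p) (snd p)) (\<F> \<times>\<^sub>F \<G>)"
 have "u $ (I $ xi) = 0" for xi
 proof (rule tendsto_unique[OF caiD(8)[OF caiJ]])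
  show "((%e. u $ (e $ xi)) ~~> u $ (I $ xi)) ?F" by (intro tendsto_intros caiD(10)[OF caiJ])
  show "((%e. u $ (e $ xi)) ~~> 0) ?F"
  proof (rule tendsto_eventually)
   show "\<forall>\<^sub>F e in ?F. u $ (e $ xi) = 0"
    using caiD(9)[OF caiJ] by eventually_elim (use comp_eq_apply[OF uz] J_E in auto)
  qed
 qed
 thus "u = 0" using comp_eq_apply[OF uE(2)] by (intro blinfun_eqI) simp
qed

end

lemma projection_inner: "clin P ==> hadj P = P ==> P oo P = P ==> <<xi, P $ xi>> = complex_of_real ((norm (P $ xi))^2)"
 using hadj_left[of P xi "P $ xi"] comp_eq_apply[of P P P xi] by (simp add: cinner_self)

lemma cpc_projection:
 assumes phi: "cpc phi" and P: "clin P" "hadj P = P" "P oo P = P" "P \<in> md phi"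
 shows "clin (phi P)" "hadj (phi P) = phi P" "phi P oo phi P = phi P"
 using cpc_clin[OF phi P(1)] cpc_hadj[OF phi P(1)] mdD(1)[OF P(4,1)] P by auto

context rigid_pair
begin

lemma Lam_eqI:
 assumes c: "clin Z" "clin S" "clin T"
  and eq: "!!x' x y' y. <<w x' y', Lam Z $ w x y>> = <<x', phi S $ x>> * <<y', psi T $ y>>"
 shows "Lam Z = Lam (otimes s S T)"
proof (rule op_eqI_family[of _ _ UNIV "%i. w (fst i) (snd i)"])
 have c': "clin (phi S)" "clin (psi T)" "clin (otimes s S T)" using c phi psi by (auto simp: clin_otimes[OF sw])
 show "<<w (fst i) (snd i), Lam Z $ w (fst j) (snd j)>> = <<w (fst i) (snd i), Lam (otimes s S T) $ w (fst j) (snd j)>>" for i j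
  using c c' by (simp add: eq Lam_otimes otimes_apply[OF w] wtensor_simps[OF w])
 fix z assume "!!i. i \<in> UNIV ==> <<w (fst i) (snd i), z>> = 0"
 from this[of "(_, _)"] have "z \<in> torth w" by (simp add: torth_def)
 thus "Lam Z $ z = 0 & hadj (Lam Z) $ z = 0" "Lam (otimes s S T) $ z = 0 & hadj (Lam (otimes s S T)) $ z = 0"
  using Lam_torth c(1) c'(3) by blast+
qed (use c Lam clin_otimes[OF sw] in auto)

context
 fixes Phi :: "'r op => 'r op"
 assumes Phi: "cpc Phi" and corner: "!!T. clin T ==> I oo (Phi T oo I) = Phi T"
begin

lemma corner_bound:
 assumes Z: "clin Z" "norm Z <= 1"
 shows "Re <<xi, Phi Z $ xi>> <= (norm (I $ xi))^2"
proof -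
 have "<<xi, Phi Z $ xi>> = <<I $ xi, Phi Z $ (I $ xi)>>"
  using hadj_left[OF I(1), of xi "Phi Z $ (I $ xi)"] comp_eq_apply[OF corner[OF Z(1)], of xi] I(2) by simp
 also have "Re ... <= norm (I $ xi) * norm (Phi Z $ (I $ xi))" using Re_cinner_le abs_le_D1 by blast
 also have "... <= norm (I $ xi) * norm (I $ xi)"
  using cpc_norm[OF Phi Z(1)] Z(2) by (intro mult_left_mono norm_apply_le) auto
 finally show ?thesis by (simp add: power2_eq_square)
qed

text \<open>Slicing \<open>Phi (b \<otimes> Q)\<close> at a vector \<open>y\<close> of the second
  factor is completely positive in \<open>b\<close> and multiplies \<open>R1\<close> by
  \<open>(norm (Q $ y))^2\<close>. Rigidity of \<open>phi\<close> thus determines the diagonal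
  slices, and polarization the others.\<close>

lemma rigid_left:
 assumes fixed: "!!b. b \<in> R1 ==> Phi (otimes s b Q) = otimes s b Q" and b: "b \<in> cstar_gen R1"
 shows "Lam (Phi (otimes s b Q)) = Lam (otimes s b Q)"
proof -
 note Q = caiD(5,6,7)[OF N] and P = caiD(5,6,7)[OF M] and bc = C1_clin[OF b]
 obtain A where A: "cpc A" "!!T. clin T ==> A T = otimes s T Q" using tensor_projection_cpc[OF sw Q] by blast
 define Z where "Z = Phi (otimes s b Q)"
 have Z: "clin Z" using bc Q Phi by (simp add: Z_def clin_otimes[OF sw])
 have diag: "phi (slice1 s y y Z) = complex_of_real ((norm (Q $ y))^2) *C phi b" if y: "norm y <= 1" for y
 proof -
  have "phi (slice1 s y y (Phi (A b))) = complex_of_real ((norm (Q $ y))^2) *C phi b"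
  proof (rule rigid_scaled[OF phi phi_rigid R1_clin cpc_comp[OF cpc_comp[OF A(1) Phi] slice1_cpc[OF sw y]] _ _ _ b])
   fix x
   have "norm (A \<one>) <= 1" using cpc_norm[OF A(1), of \<one>] norm_blinfun_id_le order_trans by fastforce
   hence "Re <<s x y, Phi (A \<one>) $ s x y>> <= (norm (I $ s x y))^2" using A(1) by (intro corner_bound) auto
   also have "... = (norm (P $ x))^2 * (norm (Q $ y))^2"
    using P Q by (simp add: otimes_apply[OF sw] wtensor_norm[OF sw] power_mult_distrib)
   also have "... <= (norm x)^2 * (norm (Q $ y))^2"
    using projection_le(1)[OF P] by (intro mult_right_mono power_mono) auto
   finally show "Re <<x, slice1 s y y (Phi (A \<one>)) $ x>> <= (norm (Q $ y))^2 * (norm x)^2"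
    by (simp add: slice1_simps(2)[OF sw] mult.commute)
  next
   fix r assume r: "r \<in> R1"
   thus "slice1 s y y (Phi (A r)) = complex_of_real ((norm (Q $ y))^2) *C r"
    using R1_clin[OF r] Q(1) projection_inner[OF Q, of y] by (simp add: A(2) fixed slice1_otimes[OF sw])
  qed auto
  thus ?thesis using bc by (simp add: A(2) Z_def)
 qed
 have "\<sigma> x' x Z = <<x', phi b $ x>> *C Q" for x' x
  by (rule quad_eq_ball)
   (use \<sigma>_clin[OF Z] Q diag projection_inner[OF Q] in \<open>auto simp: \<sigma>_slice[OF Z] cinner_simps mult.commute\<close>)
 thus ?thesis unfolding Z_def[symmetric]
  using Z bc Q by (intro Lam_eqI) (auto simp: Lam_\<sigma> cpc_scale[OF psi] cinner_simps)
qed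

text \<open>Not the mirror image of \<open>rigid_left\<close>: \<open>Lam\<close> sees the first
  factor through \<open>phi\<close>, so the scalar is now \<open>(norm (phi P $ x))^2\<close>, and
  the bound at the unit has to be carried through \<open>phi\<close>.\<close>

lemma rigid_right:
 assumes fixed: "!!a. a \<in> R2 ==> Phi (otimes s P a) = otimes s P a" and a: "a \<in> cstar_gen R2"
 shows "Lam (Phi (otimes s P a)) = Lam (otimes s P a)"
proof -
 note Q = caiD(5,6,7)[OF N] and P = caiD(5,6,7)[OF M] and ac = C2_clin[OF a]
 note phiP = cpc_projection[OF phi P subsetD[OF phi_md PQ(1)]]
 obtain A where A: "cpc A" "!!T. clin T ==> A T = otimes (%y x. s x y) T P"
  using tensor_projection_cpc[OF wtensor_flip[OF sw] P] by blast
 have A2: "A T = otimes s P T" if "clin T" for T using A(2)[OF that] otimes_flip[OF sw P(1) that] by simp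
 define Z where "Z = Phi (otimes s P a)"
 have Z: "clin Z" using ac P Phi by (simp add: Z_def clin_otimes[OF sw])
 have A1: "clin (A \<one>)" "norm (A \<one>) <= 1"
  using A(1) cpc_norm[OF A(1), of \<one>] norm_blinfun_id_le order_trans by fastforce+
 have diag: "psi (\<sigma> x x Z) = complex_of_real ((norm (phi P $ x))^2) *C psi a" if x: "norm x <= 1" for x
 proof -
  have "psi (\<sigma> x x (Phi (A a))) = complex_of_real ((norm (phi P $ x))^2) *C psi a"
  proof (rule rigid_scaled[OF psi psi_rigid R2_clin cpc_comp[OF cpc_comp[OF A(1) Phi] \<sigma>[OF x]] _ _ _ a])
   fix y
   let ?S = "slice1 s y y (Phi (A \<one>))" and ?n = "complex_of_real ((norm y)^2)"
   have Sc: "clin ?S" using A1 Phi by (simp add: slice1_simps[OF sw])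
   \<comment> \<open>The slice is compared with a multiple of \<open>P\<close> rather than of the
     unit, because the factor wanted after applying \<open>phi\<close> is the value of
     \<open>phi P\<close> at \<open>x\<close>.\<close>
   have "opos (?n *C P - ?S)"
    unfolding opos_def
   proof
    fix u
    have "Re <<u, ?S $ u>> <= (norm (I $ s u y))^2" using corner_bound[OF A1, of "s u y"] by (simp add: slice1_simps(2)[OF sw])
    also have "... = (norm (P $ u))^2 * (norm (Q $ y))^2"
     using P Q by (simp add: otimes_apply[OF sw] wtensor_norm[OF sw] power_mult_distrib)
    also have "... <= (norm (P $ u))^2 * (norm y)^2"
     using projection_le(1)[OF Q] by (intro mult_left_mono power_mono) auto
    finally show "0 <= Re <<u, (?n *C P - ?S) $ u>>"
     by (simp add: cinner_simps projection_inner[OF P] mult.commute flip: of_real_mult of_real_power)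
   qed
   hence "opos (phi (?n *C P) - phi ?S)" using Sc P by (intro cpc_mono[OF phi]) auto
   hence "Re <<x, phi ?S $ x>> <= Re <<x, phi (?n *C P) $ x>>" by (simp add: opos_def cinner_simps)
   also have "... = (norm (phi P $ x))^2 * (norm y)^2"
    by (simp add: cpc_scale[OF phi P(1)] cinner_simps projection_inner[OF phiP] mult.commute flip: of_real_mult of_real_power)
   finally show "Re <<y, \<sigma> x x (Phi (A \<one>)) $ y>> <= (norm (phi P $ x))^2 * (norm y)^2"
    using A1 Phi by (simp add: \<sigma>_slice)
  next
   fix r assume r: "r \<in> R2"
   thus "\<sigma> x x (Phi (A r)) = complex_of_real ((norm (phi P $ x))^2) *C r"
    using R2_clin[OF r] P(1) projection_inner[OF phiP, of x] by (simp add: A2 fixed \<sigma>_otimes)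
  qed auto
  thus ?thesis using ac by (simp add: A2 Z_def)
 qed
 have "slice1 w y' y (Lam Z) = <<y', psi a $ y>> *C phi P" for y' y
 proof (rule quad_eq_ball)
  fix x :: 'v assume "norm x <= 1"
  thus "<<x, slice1 w y' y (Lam Z) $ x>> = <<x, (<<y', psi a $ y>> *C phi P) $ x>>"
   by (simp add: slice1_simps(2)[OF w] Lam_\<sigma>[OF Z] diag cinner_simps projection_inner[OF phiP])
 qed (use Z Lam phiP slice1_simps(1)[OF w] in auto)
 hence "<<w x' y', Lam Z $ w x y>> = <<x', phi P $ x>> * <<y', psi a $ y>>" for x' x y' y
  unfolding slice1_simps(2)[OF w, symmetric] by (simp add: cinner_simps)
 thus ?thesis unfolding Z_def[symmetric] using Z ac P by (intro Lam_eqI) auto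
qed

text \<open>The factorization of \<open>b \<otimes> a\<close> into \<open>b \<otimes> Q\<close> and
  \<open>P \<otimes> a\<close> reduces the claim to the two one-sided cases, once
  \<open>b \<otimes> Q\<close> is known to lie in the multiplicative domain of
  \<open>\<Theta>\<close>.\<close>

lemma rigid_tensor:
 assumes f1: "!!b. b \<in> R1 ==> Phi (otimes s b Q) = otimes s b Q" and f2: "!!a. a \<in> R2 ==> Phi (otimes s P a) = otimes s P a"
  and u: "u \<in> E"
 shows "Lam (Phi u) = Lam u"
proof -
 define \<Theta> where "\<Theta> T = Lam (Phi T)" for T
 have \<Theta>: "cpc \<Theta>" unfolding \<Theta>_def by (rule cpc_comp[OF Phi Lam])
 note Q = caiD(5,6,7)[OF N] and P = caiD(5,6,7)[OF M]
 have left: "otimes s b Q \<in> md \<Theta>" if b: "b \<in> cstar_gen R1" for b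
 proof (rule mdI[OF \<Theta>])
  let ?z = "otimes s b Q"
  have c: "clin b" by (rule C1_clin[OF b])
  have m: "?z \<in> md Lam" by (rule otimes_md[OF b PQ(2)])
  show z: "clin ?z" using c Q by (simp add: clin_otimes[OF sw])
  have eq: "\<Theta> (otimes s x Q) = Lam (otimes s x Q)" if "x \<in> cstar_gen R1" for x
   unfolding \<Theta>_def by (rule rigid_left[OF f1 that])
  have "hadj ?z oo ?z = otimes s (hadj b oo b) Q" "?z oo hadj ?z = otimes s (b oo hadj b) Q"
   using c Q by (simp_all add: otimes_hadj[OF sw] otimes_comp[OF sw])
  thus "\<Theta> (hadj ?z oo ?z) = hadj (\<Theta> ?z) oo \<Theta> ?z" "\<Theta> (?z oo hadj ?z) = \<Theta> ?z oo hadj (\<Theta> ?z)"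
   using eq[OF b] eq[of "hadj b oo b"] eq[of "b oo hadj b"] mdD(1)[OF m, of "hadj ?z"] mdD(2)[OF m, of "hadj ?z"]
    cstar_comp[OF C1] cstar_hadj[OF C1] b z by (simp_all add: cpc_hadj[OF Lam])
 qed
 have "clin u & Lam (Phi u) = Lam u"
 proof (rule E_induct[OF u])
  show "csubspace {u. clin u & Lam (Phi u) = Lam u}"
   using Phi by (auto simp: csubspace_def cpc_zero[OF Phi] cpc_add[OF Phi] cpc_add[OF Lam] cpc_scale[OF Phi] cpc_scale[OF Lam])
  show "closed {u. clin u & Lam (Phi u) = Lam u}"
  proof (rule closed_seqI)
   fix f T assume f: "!!n. f n \<in> {u. clin u & Lam (Phi u) = Lam u}" "f ---> T"
   have T: "clin T" by (rule clin_lim[OF _ f(2)]) (use f(1) in blast)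
   have "(%n. \<Theta> (f n)) ---> \<Theta> T" by (rule cpc_tendsto[OF \<Theta> f(2) _ T]) (use f(1) in blast)
   moreover have "\<Theta> (f n) = Lam (f n)" for n using f(1) by (simp add: \<Theta>_def)
   moreover have "(%n. Lam (f n)) ---> Lam T" by (rule cpc_tendsto[OF Lam f(2) _ T]) (use f(1) in blast)
   ultimately have "\<Theta> T = Lam T" by (simp add: LIMSEQ_unique)
   thus "T \<in> {u. clin u & Lam (Phi u) = Lam u}" using T by (simp add: \<Theta>_def)
  qed
  fix b a assume b: "b \<in> cstar_gen M" and a: "a \<in> cstar_gen N"
  note c = genD(1)[OF b] genD(2)[OF a]
  have e: "otimes s b a = otimes s b Q oo otimes s P a"
   using c P Q cai_cstar(5)[OF N a] cai_cstar(6)[OF M b] by (simp add: otimes_comp[OF sw])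
  have cl: "clin (otimes s P a)" "clin (otimes s b Q)" using c P Q by (simp_all add: clin_otimes[OF sw])
  have "\<Theta> (otimes s b a) = \<Theta> (otimes s b Q) oo \<Theta> (otimes s P a)"
   unfolding e by (rule mdD(2)[OF left[OF gen_sub(1)[OF b]] cl(1)])
  also have "... = Lam (otimes s b Q) oo Lam (otimes s P a)"
  proof -
   have "Lam (Phi (otimes s b Q)) = Lam (otimes s b Q)" by (rule rigid_left[OF f1 gen_sub(1)[OF b]])
   moreover have "Lam (Phi (otimes s P a)) = Lam (otimes s P a)" by (rule rigid_right[OF f2 gen_sub(2)[OF a]])
   ultimately show ?thesis by (simp add: \<Theta>_def)
  qed
  also have "... = Lam (otimes s b a)"
   unfolding e by (rule mdD(2)[OF otimes_md[OF gen_sub(1)[OF b] PQ(2)] cl(1), symmetric])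
  finally show "clin (otimes s b a) & Lam (Phi (otimes s b a)) = Lam (otimes s b a)"
   using c by (simp add: \<Theta>_def clin_otimes[OF sw])
 qed
 thus ?thesis by blast
qed

end

text \<open>\<open>V\<close> and \<open>W\<close> restrict to mutually inverse complete order isomorphisms between \<open>J\<close> and a copy of it inside a
  competing cover.\<close>

lemma cover_map:
 fixes V :: "'r op => 'm::chilbert_space op"
 assumes V: "cpc V" and W: "cpc W" and WV: "!!y. y \<in> J ==> W (V y) = y"
 shows "\<exists>Om. cpc Om & (\<forall>y\<in>J. V y \<in> md Om & Om (V y) = Lam y) &
  (\<forall>q. clin q & hadj q = q & q oo q = q & (\<forall>y\<in>J. q oo V y = V y) --> q \<in> md Om & Om q = Lam I)"
proof -
 let ?H = "\<F> \<times>\<^sub>F \<G>" and ?u = "%p. otimes s (fst p) (snd p)"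
 \<comment> \<open>Compression by \<open>I\<close>: \<open>W\<close> is prescribed only on the image
   of \<open>J\<close> and may leave the corner of \<open>I\<close> elsewhere.\<close>
 define W1 where "W1 T = sand I (W T)" for T
 define Phi where "Phi T = W1 (V T)" for T
 have W1: "cpc W1" unfolding W1_def by (rule cpc_comp[OF W cpc_sand[OF I(1) norm_projection[OF I]]])
 have Phi: "cpc Phi" unfolding Phi_def by (rule cpc_comp[OF V W1])
 have Jl: "clin y" if "y \<in> J" for y using caiD(2)[OF caiJ that] .
 have W1I: "W1 T oo I = W1 T" "I oo W1 T = W1 T" for T
  using I by (simp_all add: W1_def sand_def comp_assoc) (simp flip: comp_assoc)
 have corner: "I oo (Phi T oo I) = Phi T" for T by (simp add: Phi_def W1I)
 have PhiJ: "Phi y = y" if "y \<in> J" for y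
  using that caiD(3,4)[OF caiJ that] by (simp add: Phi_def W1_def sand_def WV I comp_assoc)
 have ev: "\<forall>\<^sub>F p in ?H. fst p \<in> M & snd p \<in> N & (\<forall>x\<in>M. x oo fst p \<in> M) & (\<forall>x\<in>N. x oo snd p \<in> N)"
  using eventually_prodI[OF caiD(9)[OF M] caiD(9)[OF N]] by eventually_elim auto
 have evu: "\<forall>\<^sub>F p in ?H. ?u p \<in> J & norm (?u p) <= 1" and strong: "((%p. ?u p $ xi) ~~> I $ xi) ?H" for xi
  using caiD(9)[OF caiJ] caiD(10)[OF caiJ, of xi] by (auto simp: eventually_filtermap filterlim_filtermap elim: eventually_mono)
 have H: "?H ~= bot" using caiD(8)[OF caiJ] by (simp add: filtermap_bot_iff)
 \<comment> \<open>Meant for \<open>b \<otimes> Q\<close> and \<open>P \<otimes> a\<close>: they may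
   lie outside \<open>J\<close>, but their products with the approximate identity lie in it.\<close>
 have fixed: "Phi z = z" if z: "clin z" "z oo I = z" and zJ: "\<forall>\<^sub>F p in ?H. z oo ?u p \<in> J" for z
 proof (rule cpc_determined[OF Phi H _ _ I(3) z(1)])
  show "\<forall>\<^sub>F p in ?H. clin (?u p) & norm (?u p) <= 1" using evu by eventually_elim (simp add: Jl)
  show "((%p. Phi (?u p) $ xi) ~~> I $ xi) ?H" for xi
   by (rule Lim_transform_eventually[OF strong]) (use evu in eventually_elim, simp add: PhiJ)
  have "((%p. z $ (?u p $ xi)) ~~> z $ (I $ xi)) ?H" for xi by (intro tendsto_intros strong)
  thus "((%p. Phi (z oo ?u p) $ xi) ~~> z $ xi) ?H" for xi
   unfolding comp_eq_apply[OF z(2)] by (rule Lim_transform_eventually) (use zJ in eventually_elim, simp add: PhiJ)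
 qed (simp_all add: Phi_def W1I z)
 note Q = caiD(3-7)[OF N] and P = caiD(3-7)[OF M]
 have JM: "otimes s b a \<in> J" if "b \<in> M" "a \<in> N" for b a
  using that R1_clin R2_clin by (intro otimes_min_tensor[OF s]) auto
 have f1: "Phi (otimes s b Q) = otimes s b Q" if b: "b \<in> R1" for b
 proof (rule fixed)
  have c: "clin b" "b oo P = b" using R1_clin[OF b] b P by auto
  show "clin (otimes s b Q)" "otimes s b Q oo I = otimes s b Q"
   using c Q P by (simp_all add: clin_otimes[OF sw] otimes_comp[OF sw])
  show "\<forall>\<^sub>F p in ?H. otimes s b Q oo ?u p \<in> J"
   using ev by eventually_elim (use b c Q P R1_clin R2_clin in \<open>auto simp: otimes_comp[OF sw] intro!: JM\<close>)
 qed
 have f2: "Phi (otimes s P a) = otimes s P a" if a: "a \<in> R2" for a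
 proof (rule fixed)
  have c: "clin a" "a oo Q = a" using R2_clin[OF a] a Q by auto
  show "clin (otimes s P a)" "otimes s P a oo I = otimes s P a"
   using c Q P by (simp_all add: clin_otimes[OF sw] otimes_comp[OF sw])
  show "\<forall>\<^sub>F p in ?H. otimes s P a oo ?u p \<in> J"
   using ev by eventually_elim (use a c Q P R1_clin R2_clin in \<open>auto simp: otimes_comp[OF sw] intro!: JM\<close>)
 qed
 have rigid: "Lam (Phi y) = Lam y" if "y \<in> E" for y by (rule rigid_tensor[OF Phi corner f1 f2 that])
 define Om where "Om T = Lam (W1 T)" for T
 have Om: "cpc Om" unfolding Om_def by (rule cpc_comp[OF W1 Lam])
 have OmV: "Om (V y) = Lam y" if "y \<in> E" for y using rigid[OF that] by (simp add: Om_def Phi_def)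
 \<comment> \<open>The Schwarz inequality for \<open>V\<close>, followed by \<open>Om\<close>,
   bounds \<open>Om (hadj (V y) oo V y)\<close> from above by \<open>Om (V (hadj y oo y))\<close>,
   which is the product on the right because \<open>Lam\<close> is multiplicative on
   \<open>E\<close>. The Schwarz inequality for \<open>Om\<close> is the reverse bound.\<close>
 have half: "Om (hadj (V y) oo V y) = hadj (Om (V y)) oo Om (V y)" if y: "y \<in> E" for y
 proof -
  have c: "clin y" "clin (V y)" "clin (V (hadj y oo y))" "clin (Om (V y))" using E_clin[OF y] V Om by auto
  have yy: "hadj y oo y \<in> E" using y by (intro cstar_comp[OF E_cstar] cstar_hadj[OF E_cstar])
  have "Om (V (hadj y oo y)) = hadj (Om (V y)) oo Om (V y)"
   using mdD(1)[OF E_md[OF y], of "hadj y"] c(1) by (simp add: OmV y yy cpc_hadj[OF Lam])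
  hence "opos ((hadj (Om (V y)) oo Om (V y)) - Om (hadj (V y) oo V y))"
   using cpc_mono[OF Om _ c(3) cpc_schwarz(1)[OF V c(1)]] c by simp
  moreover have "hadj (Om (hadj (V y) oo V y)) = Om (hadj (V y) oo V y)"
   using c cpc_hadj[OF Om, of "hadj (V y) oo V y"] by simp
  moreover have "clin (Om (hadj (V y) oo V y))" using c cpc_clin[OF Om] by simp
  ultimately show ?thesis
   by (intro herm_eqI[of "Om (hadj (V y) oo V y)", OF _ _ _ _ cpc_schwarz(1)[OF Om c(2)]]) (use c in simp_all)
 qed
 have "V y \<in> md Om" if y: "y \<in> J" for y
 proof (rule mdI[OF Om])
  have c: "clin y" "clin (V y)" using Jl[OF y] V by auto
  thus "clin (V y)" by simp
  show "Om (hadj (V y) oo V y) = hadj (Om (V y)) oo Om (V y)" by (rule half[OF J_E[OF y]])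
  show "Om (V y oo hadj (V y)) = Om (V y) oo hadj (Om (V y))"
   using half[OF cstar_hadj[OF E_cstar J_E[OF y]]] c Om by (simp add: cpc_hadj[OF V] cpc_hadj[OF Om])
 qed
 moreover have "q \<in> md Om & Om q = Lam I"
  if q: "clin q" "hadj q = q" "q oo q = q" "!!y. y \<in> J ==> q oo V y = V y" for q
 proof -
  \<comment> \<open>\<open>q\<close> acts as a unit on the image of \<open>J\<close>, so inserting
    it in front of the image of the approximate identity changes nothing; the common limit
    \<open>I\<close> determines \<open>W1 q\<close>.\<close>
  have "W1 q = I"
  proof (rule cpc_determined[OF W1 H _ _ I(3) q(1)])
   show "\<forall>\<^sub>F p in ?H. clin (V (?u p)) & norm (V (?u p)) <= 1"
    using evu
   proof eventually_elim
    case (elim p)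
    thus ?case using Jl[of "?u p"] cpc_clin[OF V, of "?u p"] cpc_norm[OF V, of "?u p"] by linarith
   qed
   show 1: "((%p. W1 (V (?u p)) $ xi) ~~> I $ xi) ?H" for xi
    by (rule Lim_transform_eventually[OF strong]) (use evu in eventually_elim, simp add: PhiJ flip: Phi_def)
   show "((%p. W1 (q oo V (?u p)) $ xi) ~~> I $ xi) ?H" for xi
    by (rule Lim_transform_eventually[OF 1]) (use evu in eventually_elim, simp add: q(4))
  qed (simp_all add: W1I I)
  hence Omq: "Om q = Lam I" by (simp add: Om_def)
  note LamI = cpc_projection[OF Lam I I_md]
  have "q \<in> md Om" by (rule mdI[OF Om q(1)]) (simp_all add: q(2,3) Omq LamI)
  thus ?thesis using Omq by blast
 qed
 ultimately show ?thesis using Om OmV J_E by (intro exI[of _ Om]) auto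
qed

end

section \<open>Envelopes of tensor products\<close>

lemma cpc_completely_isometric:
 assumes j: "cpc j" and k: "cpc k" and X: "!!x. x \<in> X ==> clin x" "!!x. x \<in> X ==> k (j x) = x"
 shows "completely_isometric X j"
 unfolding completely_isometric_def clinear_on_def
proof (intro conjI ballI allI impI)
 fix n :: nat and T assume T: "\<forall>a<n. \<forall>b<n. T a b \<in> X"
 have "mat_norm n (%a b. j (T a b)) <= mat_norm n T" using T X by (intro cpc_mat_norm[OF j]) auto
 moreover have "mat_norm n (%a b. k (j (T a b))) <= mat_norm n (%a b. j (T a b))"
  using T X j by (intro cpc_mat_norm[OF k]) auto
 moreover have "mat_norm n (%a b. k (j (T a b))) = mat_norm n T" using T X by (simp add: mat_norm_def)
 ultimately show "mat_norm n (%a b. j (T a b)) = mat_norm n T" by simp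
qed (use X in \<open>simp_all add: cpc_add[OF j] cpc_scale[OF j]\<close>)

lemma closed_cpc_eq:
 assumes f: "cpc f" and g: "cpc g"
 shows "closed {x. clin x & f x = g x}" "csubspace {x. clin x & f x = g x}"
proof -
 show "closed {x. clin x & f x = g x}"
 proof (rule closed_seqI)
  fix u T assume u: "!!n. u n \<in> {x. clin x & f x = g x}" "u ---> T"
  have T: "clin T" by (rule clin_lim[OF _ u(2)]) (use u(1) in blast)
  have "(%n. f (u n)) ---> f T" by (rule cpc_tendsto[OF f u(2) _ T]) (use u(1) in blast)
  moreover have "(%n. g (u n)) ---> g T" by (rule cpc_tendsto[OF g u(2) _ T]) (use u(1) in blast)
  moreover have "f (u n) = g (u n)" for n using u(1) by blast
  ultimately have "f T = g T" by (simp add: LIMSEQ_unique)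
  thus "T \<in> {x. clin x & f x = g x}" using T by blast
 qed
 show "csubspace {x. clin x & f x = g x}"
  by (auto simp: csubspace_def cpc_zero[OF f] cpc_zero[OF g] cpc_add[OF f] cpc_add[OF g] cpc_scale[OF f] cpc_scale[OF g])
qed

lemma closed_cpc_mem:
 assumes f: "cpc f" and S: "closed S" "csubspace S"
 shows "closed {x. clin x & f x \<in> S}" "csubspace {x. clin x & f x \<in> S}"
proof -
 show "closed {x. clin x & f x \<in> S}"
 proof (rule closed_seqI)
  fix u T assume u: "!!n. u n \<in> {x. clin x & f x \<in> S}" "u ---> T"
  have T: "clin T" by (rule clin_lim[OF _ u(2)]) (use u(1) in blast)
  have "(%n. f (u n)) ---> f T" by (rule cpc_tendsto[OF f u(2) _ T]) (use u(1) in blast)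
  moreover have "f (u n) \<in> S" for n using u(1) by blast
  ultimately have "f T \<in> S" by (rule closed_sequentially[OF S(1), rotated])
  thus "T \<in> {x. clin x & f x \<in> S}" using T by blast
 qed
 show "csubspace {x. clin x & f x \<in> S}"
  using csubspaceD(1-3)[OF S(2)] by (auto simp: csubspace_def cpc_zero[OF f] cpc_add[OF f] cpc_scale[OF f])
qed

text \<open>Competing covers enter through completely positive maps \<open>V\<close>, \<open>W\<close> extending the embedding and its inverse.\<close>

lemma tensor_envelope:
 fixes t :: "'h::chilbert_space => 'k::chilbert_space => 'l::chilbert_space"
  and s :: "'p::chilbert_space => 'q::chilbert_space => 'r::chilbert_space"
  and B :: "'h op set" and A :: "'k op set"
  and jB :: "'h op => 'p op" and jA :: "'k op => 'q op"
 assumes t: "hilbert_tensor t" and s: "hilbert_tensor s"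
  and B: "cai B P0 \<F>" "completely_isometric B jB" "cai (jB ` B) P (filtermap jB \<F>)"
   "\<forall>\<^sub>F e in \<F>. \<forall>x\<in>B. jB (x oo e) = jB x oo jB e"
  and minB: "!!phi :: 'p op => ('p op ell2 \<Rightarrow>\<^sub>L 'p op ell2). cpc phi ==> cstar_gen (jB ` B) <= md phi ==>
   completely_isometric B (%x. phi (jB x)) ==>
   maps_onto B (cstar_gen ((%x. phi (jB x)) ` B)) (%x. phi (jB x)) (cstar_gen (jB ` B)) jB"
  and A: "cai A Q0 \<G>" "completely_isometric A jA" "cai (jA ` A) Q (filtermap jA \<G>)"
   "\<forall>\<^sub>F e in \<G>. \<forall>x\<in>A. jA (x oo e) = jA x oo jA e"
  and minA: "!!phi :: 'q op => ('q op ell2 \<Rightarrow>\<^sub>L 'q op ell2). cpc phi ==> cstar_gen (jA ` A) <= md phi ==>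
   completely_isometric A (%x. phi (jA x)) ==>
   maps_onto A (cstar_gen ((%x. phi (jA x)) ` A)) (%x. phi (jA x)) (cstar_gen (jA ` A)) jA"
 defines "X \<equiv> min_tensor t B A"
 shows "\<exists>j k. cpc j & cpc k & (\<forall>b\<in>B. \<forall>a\<in>A. j (otimes t b a) = otimes s (jB b) (jA a)) &
  j \<one> = otimes s P Q & k (otimes s P Q) = otimes t P0 Q0 & (\<forall>x\<in>X. k (j x) = x) &
  j ` X = min_tensor s (jB ` B) (jA ` A) &
  (\<forall>(V :: _ => 'm::chilbert_space op) W. cpc V & cpc W & (\<forall>x\<in>X. W (V x) = x) -->
   maps_onto X (cstar_gen (V ` X)) V (cstar_gen (j ` X)) j &
   (hadj (V \<one>) = V \<one> & V \<one> oo V \<one> = V \<one> & (\<forall>x\<in>X. V \<one> oo V x = V x) -->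
    maps_onto (unitization X) (cstar_gen (V ` unitization X)) V (cstar_gen (j ` unitization X)) j))"
proof -
 let ?J = "min_tensor s (jB ` B) (jA ` A)" and ?I = "otimes s P Q"
 note tw = hilbert_wtensor[OF t] and sw = hilbert_wtensor[OF s]
 note Bl = caiD(2)[OF B(1)] and Al = caiD(2)[OF A(1)] and Pc = caiD(5)[OF B(3)] and Qc = caiD(5)[OF A(3)]
 note P0c = caiD(5)[OF B(1)] and Q0c = caiD(5)[OF A(1)]
 have jl: "clin (jB b)" "clin (jA a)" if "b \<in> B" "a \<in> A" for b a using caiD(2)[OF B(3)] caiD(2)[OF A(3)] that by auto
 have jBl: "clin (jB b)" if "b \<in> B" for b using caiD(2)[OF B(3)] that by auto
 have jAl: "clin (jA a)" if "a \<in> A" for a using caiD(2)[OF A(3)] that by auto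
 have cs: "B <= Collect clin" "A <= Collect clin" "jB ` B <= Collect clin" "jA ` A <= Collect clin"
  using Bl Al jBl jAl by auto
 have Xl: "clin x" if "x \<in> X" for x using that unfolding X_def by (rule clin_min_tensor[OF t cs(1,2)])
 note caiJ = cai_tensor[OF s B(3) A(3)]
 note I = caiD(5,6,7)[OF caiJ]
 obtain \<alpha> \<beta> where \<alpha>: "cpc \<alpha>" "cpc \<beta>" "!!b. b \<in> B ==> \<alpha> b = jB b" "!!b. b \<in> B ==> \<beta> (jB b) = b" "\<alpha> P0 = P" "\<beta> P = P0"
  using cai_extension_inverse[OF B] by blast
 obtain \<alpha>' \<beta>' where \<alpha>': "cpc \<alpha>'" "cpc \<beta>'" "!!a. a \<in> A ==> \<alpha>' a = jA a" "!!a. a \<in> A ==> \<beta>' (jA a) = a" "\<alpha>' Q0 = Q" "\<beta>' Q = Q0"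
  using cai_extension_inverse[OF A] by blast
 obtain j0 where j0: "cpc j0" "!!S T. clin S ==> clin T ==> j0 (otimes t S T) = otimes s (\<alpha> S) (\<alpha>' T)"
  by (rule exE[OF tensor_cp[OF \<alpha>(1) \<alpha>'(1) tw sw]], elim exE conjE, rule that, assumption, simp)
 obtain k where k: "cpc k" "!!S T. clin S ==> clin T ==> k (otimes s S T) = otimes t (\<beta> S) (\<beta>' T)"
  by (rule exE[OF tensor_cp[OF \<alpha>(2) \<alpha>'(2) sw tw]], elim exE conjE, rule that, assumption, simp)
 \<comment> \<open>Compression leaves the values on \<open>X\<close> unchanged and turns
   \<open>j \<one>\<close> into exactly \<open>otimes s P Q\<close>, as the unitization
   requires.\<close>
 define j where "j T = sand ?I (j0 T)" for T
 have j: "cpc j" unfolding j_def by (rule cpc_comp[OF j0(1) cpc_sand[OF I(1) norm_projection[OF I]]])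
 have jt: "j (otimes t b a) = otimes s (jB b) (jA a)" if "b \<in> B" "a \<in> A" for b a
  using that Bl Al jBl jAl caiD(3,4)[OF B(3)] caiD(3,4)[OF A(3)] Pc Qc
  by (simp add: j_def j0(2) \<alpha>(3) \<alpha>'(3) sand_def I(2) otimes_comp[OF sw])
 have kt: "k (otimes s (jB b) (jA a)) = otimes t b a" if "b \<in> B" "a \<in> A" for b a
  using that jBl jAl by (simp add: k(2) \<alpha>(4) \<alpha>'(4))
 have jI0: "j (otimes t P0 Q0) = ?I" using P0c Q0c I by (simp add: j_def j0(2) \<alpha>(5) \<alpha>'(5) sand_def)
 have kI: "k ?I = otimes t P0 Q0" using Pc Qc by (simp add: k(2) \<alpha>(6) \<alpha>'(6))
 \<comment> \<open>From below by monotonicity, as \<open>j\<close> already sends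
   \<open>P0 \<otimes> Q0\<close> to \<open>P \<otimes> Q\<close>; from above by the
   compression.\<close>
 have j1: "j \<one> = ?I"
 proof (rule herm_eqI)
  let ?K = "otimes t P0 Q0"
  note I0 = caiD(5,6,7)[OF cai_tensor[OF t B(1) A(1)]]
  have "opos (\<one> - ?K)"
   unfolding opos_def using projection_le[OF I0] by (simp add: cinner_simps Re_cinner_self power_mono)
  thus "opos (j \<one> - ?I)" using cpc_mono[OF j I0(1), of \<one>] by (simp add: jI0)
  show "opos (?I - j \<one>)"
   unfolding opos_def
  proof
   fix xi
   have "Re <<xi, j \<one> $ xi>> = Re <<?I $ xi, j0 \<one> $ (?I $ xi)>>"
    unfolding j_def by (simp add: cinner_sand I(1))
   also have "... <= (norm (?I $ xi))^2" by (rule cpc_id[OF j0(1)])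
   finally show "0 <= Re <<xi, (?I - j \<one>) $ xi>>" by (simp add: cinner_simps projection_le(2)[OF I])
  qed
 qed (use cpc_clin[OF j] cpc_hadj[OF j, of \<one>] I in auto)
 have kj: "cpc (%T. k (j T))" and jk: "cpc (%T. j (k T))" by (rule cpc_comp[OF j k(1)], rule cpc_comp[OF k(1) j])
 have kjx: "k (j x) = x" if x: "x \<in> X" for x
 proof -
  have "clin x & k (j x) = x"
   by (rule min_tensor_induct[OF t cs(1,2) x[unfolded X_def] closed_cpc_eq[OF kj cpc_ident]])
    (auto simp: clin_otimes[OF tw] Bl Al jt kt)
  thus ?thesis by blast
 qed
 have jx: "j x \<in> ?J" if x: "x \<in> X" for x
 proof -
  have "clin x & j x \<in> ?J"
   by (rule min_tensor_induct[OF t cs(1,2) x[unfolded X_def] closed_cpc_mem[OF j min_tensor_closed min_tensor_csubspace]])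
    (auto simp: clin_otimes[OF tw] Bl Al jt intro!: otimes_min_tensor[OF s cs(3,4)])
  thus ?thesis by blast
 qed
 have jky: "k y \<in> X" "j (k y) = y" if y: "y \<in> ?J" for y
 proof -
  have "clin y & j (k y) = y"
   by (rule min_tensor_induct[OF s cs(3,4) y closed_cpc_eq[OF jk cpc_ident]])
    (auto simp: clin_otimes[OF sw] jBl jAl jt kt)
  thus "j (k y) = y" by blast
  have "clin y & k y \<in> X" unfolding X_def
   by (rule min_tensor_induct[OF s cs(3,4) y closed_cpc_mem[OF k(1) min_tensor_closed min_tensor_csubspace]])
    (auto simp: clin_otimes[OF sw] jBl jAl kt intro!: otimes_min_tensor[OF t cs(1,2)])
  thus "k y \<in> X" by blast
 qed
 have jX: "j ` X = ?J" using jx jky by (auto intro!: image_eqI)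
 obtain phi :: "'p op => ('p op ell2 \<Rightarrow>\<^sub>L 'p op ell2)"
  where phi: "cpc phi" "cstar_gen (insert P (jB ` B)) <= md phi"
   "\<forall>Phi\<in>fixers (insert P (jB ` B)). \<forall>a\<in>cstar_gen (insert P (jB ` B)). phi (Phi a) = phi a"
   "\<forall>a\<in>cstar_gen (jB ` B). phi a = 0 --> a = 0"
  by (rule exE[OF rigid_factor[OF B(2) _ Pc minB]], erule jBl, assumption+, elim conjE, rule that, assumption+)
 obtain psi :: "'q op => ('q op ell2 \<Rightarrow>\<^sub>L 'q op ell2)"
  where psi: "cpc psi" "cstar_gen (insert Q (jA ` A)) <= md psi"
   "\<forall>Phi\<in>fixers (insert Q (jA ` A)). \<forall>a\<in>cstar_gen (insert Q (jA ` A)). psi (Phi a) = psi a"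
   "\<forall>a\<in>cstar_gen (jA ` A). psi a = 0 --> a = 0"
  by (rule exE[OF rigid_factor[OF A(2) _ Qc minA]], erule jAl, assumption+, elim conjE, rule that, assumption+)
 obtain w :: "'p op ell2 => 'q op ell2 => ('p op ell2 \<times> 'q op ell2) ell2" where w: "wtensor w"
  using wtensor_ex by blast
 obtain Lam \<sigma> where Lam: "cpc Lam" "\<forall>x. norm x <= 1 --> cpc (\<sigma> x x)"
  "\<forall>S T. clin S --> clin T --> Lam (otimes s S T) = otimes w (phi S) (psi T)"
  "\<forall>T. clin T --> (\<forall>x' x. clin (\<sigma> x' x T)) & (\<forall>x' x y' y. <<w x' y', Lam T $ w x y>> = <<y', psi (\<sigma> x' x T) $ y>>) &
   (\<forall>x' x y' y. <<y', \<sigma> x' x T $ y>> = <<x', phi (slice1 s y' y T) $ x>>) &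
   (\<forall>z\<in>torth w. Lam T $ z = 0 & hadj (Lam T) $ z = 0)"
  by (rule exE[OF tensor_cp[OF phi(1) psi(1) sw w]], elim exE conjE, rule that, assumption+)
 interpret rigid_pair s "jB ` B" "jA ` A" P Q "filtermap jB \<F>" "filtermap jA \<G>" phi psi w Lam \<sigma>
  by unfold_locales (use s w B(3) A(3) phi psi Lam in simp_all)
 have maps: "maps_onto X (cstar_gen (V ` X)) V (cstar_gen (j ` X)) j &
   (hadj (V \<one>) = V \<one> & V \<one> oo V \<one> = V \<one> & (\<forall>x\<in>X. V \<one> oo V x = V x) -->
    maps_onto (unitization X) (cstar_gen (V ` unitization X)) V (cstar_gen (j ` unitization X)) j)"
  if V: "cpc V" "cpc W" "!!x. x \<in> X ==> W (V x) = x" for V :: "'l op => 'm op" and W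
 proof -
  let ?q = "V \<one>"
  \<comment> \<open>The image of \<open>J\<close> in the competing cover is reached by
    \<open>k\<close> followed by \<open>V\<close>; \<open>W\<close> followed by \<open>j\<close>
    leads back.\<close>
  obtain Om where Om: "cpc Om" "!!y. y \<in> ?J ==> V (k y) \<in> md Om & Om (V (k y)) = Lam y"
   and Omq: "!!q. clin q ==> hadj q = q ==> q oo q = q ==> (!!y. y \<in> ?J ==> q oo V (k y) = V (k y)) ==> q \<in> md Om & Om q = Lam ?I"
   using cover_map[OF cpc_comp[OF k(1) V(1)] cpc_comp[OF V(2) j]] V(3) jky by (auto 0 3)
  have OmX: "V x \<in> md Om" "Om (V x) = Lam (j x)" if "x \<in> X" for x using Om(2)[OF jx[OF that]] kjx[OF that] by auto
  have jm: "j x \<in> md Lam" if "x \<in> X" for x using E_md[OF J_E[OF jx[OF that]]] .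
  have "maps_onto X (cstar_gen (V ` X)) V (cstar_gen (j ` X)) j"
  proof (rule maps_onto_intro[OF Lam(1) _ _ Om(1)])
   show "u = 0" if "u \<in> cstar_gen (j ` X)" "Lam u = 0" for u
    using that E_inj unfolding jX gen_J by blast
  qed (use jm OmX in auto)
  \<comment> \<open>With \<open>\<one>\<close> adjoined, \<open>V \<one>\<close> has to lie in the
    multiplicative domain too. It is a projection acting as a unit on the image of \<open>X\<close>,
    so the second half of \<open>cover_map\<close> applies to it.\<close>
  moreover have "maps_onto (unitization X) (cstar_gen (V ` unitization X)) V (cstar_gen (j ` unitization X)) j"
   if q: "hadj ?q = ?q" "?q oo ?q = ?q" "\<forall>x\<in>X. ?q oo V x = V x"
  proof (rule maps_onto_intro[OF Lam(1) _ _ Om(1)])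
   have qm: "?q \<in> md Om" "Om ?q = Lam ?I" using Omq[of ?q] q V(1) jky by auto
   have ju: "j (x + c *C \<one>) = j x + c *C ?I" and Vu: "V (x + c *C \<one>) = V x + c *C ?q" if "x \<in> X" for x c
    using Xl[OF that] by (simp_all add: cpc_add[OF j] cpc_scale[OF j] j1 cpc_add[OF V(1)] cpc_scale[OF V(1)])
   note mLam = csubspaceD(2,3)[OF cstar_algebraD(2)[OF cstar_md[OF Lam(1)]]] and mOm = csubspaceD(2,3)[OF cstar_algebraD(2)[OF cstar_md[OF Om(1)]]]
   show "j ` unitization X <= md Lam" by (clarsimp simp: unitization_def ju mLam jm I_md)
   show "V ` unitization X <= md Om" by (clarsimp simp: unitization_def Vu mOm qm OmX)
   show "Om (V u) = Lam (j u)" if u: "u \<in> unitization X" for u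
   proof -
    obtain x c where x: "x \<in> X" "u = x + c *C \<one>" using u by (auto simp: unitization_def)
    have "Om (V x + c *C ?q) = Om (V x) + c *C Om ?q" "Lam (j x + c *C ?I) = Lam (j x) + c *C Lam ?I"
     using Xl[OF x(1)] V(1) j I(1) by (simp_all add: cpc_add[OF Om(1)] cpc_scale[OF Om(1)] cpc_add[OF Lam(1)] cpc_scale[OF Lam(1)])
    thus ?thesis using x by (simp add: ju Vu OmX qm)
   qed
   show "u = 0" if u: "u \<in> cstar_gen (j ` unitization X)" "Lam u = 0" for u
   proof (rule E1_inj[OF _ u(2)])
    have G: "cstar_algebra (cstar_gen (insert ?I ?J))" using I(1) J_E E_clin by (intro cstar_gen) auto
    have "j ` unitization X <= cstar_gen (insert ?I ?J)"
    proof (clarsimp simp: unitization_def ju)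
     fix x c assume "x \<in> X"
     hence "j x \<in> cstar_gen (insert ?I ?J)" "?I \<in> cstar_gen (insert ?I ?J)" using jx by (auto intro: hull_inc)
     thus "j x + c *C ?I \<in> cstar_gen (insert ?I ?J)" by (intro cstar_add[OF G] cstar_scaleC[OF G])
    qed
    thus "u \<in> cstar_gen (insert ?I ?J)" using u(1) cstar_gen_subset[OF G] by blast
   qed
  qed
  ultimately show ?thesis by blast
 qed
 show ?thesis
  by (intro exI[of _ j] exI[of _ k] conjI ballI allI impI j k(1) jt j1 kI kjx jX) (use maps in blast)+
qed

section \<open>Covers of operator systems\<close>

lemma csubspace_image:
 assumes i: "clinear_on X i" and X: "csubspace X" shows "csubspace (i ` X)"
 unfolding csubspace_def
proof (intro conjI ballI allI)
 have "i (0 *C 0) = 0 *C i 0" using i csubspaceD(1)[OF X] unfolding clinear_on_def by blast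
 thus "0 \<in> i ` X" using csubspaceD(1)[OF X] by (intro image_eqI[of _ _ 0]) auto
 fix x assume "x \<in> i ` X"
 then obtain u where u: "u \<in> X" "x = i u" by blast
 show "c *C x \<in> i ` X" for c
  using i u csubspaceD(3)[OF X] by (intro image_eqI[of _ _ "c *C u"]) (auto simp: clinear_on_def)
 fix y assume "y \<in> i ` X"
 then obtain v where "v \<in> X" "y = i v" by blast
 thus "x + y \<in> i ` X"
  using i u csubspaceD(2)[OF X] by (intro image_eqI[of _ _ "u + v"]) (auto simp: clinear_on_def)
qed

lemma maps_onto_cong: "(!!x. x \<in> X ==> i x = i' x) ==> maps_onto X F i E j ==> maps_onto X F i' E j"
 unfolding maps_onto_def by metis

lemma identity_unique: "identity_of e X ==> identity_of e' X ==> e' = e"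
 unfolding identity_of_def by metis

lemma cstar_identity_hadj:
 assumes "cstar_algebra C" "identity_of e C" shows "hadj e = e"
proof -
 have e: "e \<in> C" "!!x. x \<in> C ==> e oo x = x & x oo e = x" using assms(2) by (auto simp: identity_of_def)
 have c: "clin e" using cstar_algebraD(1)[OF assms(1) e(1)] .
 have "hadj e oo e = hadj e" using e cstar_hadj[OF assms(1) e(1)] by blast
 moreover have "hadj (hadj e oo e) = hadj e oo e" using c by simp
 ultimately have "hadj (hadj e) = hadj e" by simp
 thus ?thesis using c by simp
qed

text \<open>A unit is treated as a constant approximate identity, so that systems and algebras share
  one argument.\<close>

lemma unit_cai:
 assumes "csubspace X" "!!x. x \<in> X ==> clin x" "identity_of e X" "hadj e = e"
 shows "cai X e (principal {e})"
proof -
 have "e \<in> X" "e oo e = e" using assms(3) by (auto simp: identity_of_def)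
 thus ?thesis
  using assms norm_projection[of e] by (intro cai_unit) (auto simp: identity_of_def)
qed

lemma unit_cstar_gen:
 assumes "cai X e (principal {e})" "e \<in> X"
 shows "identity_of e (cstar_gen X)"
 using cai_cstar(5,6)[OF assms(1)] assms(2) by (auto simp: identity_of_def intro: hull_inc)

lemma filtermap_principal_single: "filtermap f (principal {e}) = principal {f e}"
 by simp

lemma operator_system_unit:
 assumes "operator_system X"
 shows "\<exists>e. identity_of e X & hadj e = e & csubspace X & X <= Collect clin"
proof -
 obtain C e where C: "cstar_algebra C" "identity_of e C" "e \<in> X" "X <= C" "csubspace X"
  using assms by (auto simp: operator_system_def)
 have "identity_of e X" using C by (auto simp: identity_of_def)
 moreover have "X <= Collect clin" using cstar_algebraD(1)[OF C(1)] C(4) by blast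
 ultimately show ?thesis using cstar_identity_hadj[OF C(1,2)] C(5) by blast
qed

lemma system_cover_cai:
 assumes X: "csubspace X" and e: "identity_of e X" and i: "system_cover X F i"
 shows "completely_isometric X i" "cai (i ` X) (i e) (filtermap i (principal {e}))"
  "\<forall>\<^sub>F e in principal {e}. \<forall>x\<in>X. i (x oo e) = i x oo i e" "F = cstar_gen (i ` X)"
proof -
 have F: "cstar_algebra F" "completely_isometric X i" "identity_of (i e) F" "cstar_gen (i ` X) = F"
  using i e by (auto simp: system_cover_def)
 thus "completely_isometric X i" "F = cstar_gen (i ` X)" by auto
 have iF: "i x \<in> F" if "x \<in> X" for x using that unfolding F(4)[symmetric] by (auto intro: hull_inc)
 have "identity_of (i e) (i ` X)" using F(3) e iF by (auto simp: identity_of_def)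
 thus "cai (i ` X) (i e) (filtermap i (principal {e}))"
  unfolding filtermap_principal_single
  using F(2) X iF cstar_algebraD(1)[OF F(1)] cstar_identity_hadj[OF F(1,3)]
  by (intro unit_cai) (auto simp: completely_isometric_def intro: csubspace_image)
 show "\<forall>\<^sub>F e in principal {e}. \<forall>x\<in>X. i (x oo e) = i x oo i e"
  using F(3) e iF by (auto simp: eventually_principal identity_of_def)
qed

text \<open>Turns \<open>phi\<close> after \<open>j\<close> into a competing cover, to which the
  minimality of the envelope can be applied. The unit survives because \<open>j e\<close> lies in
  the multiplicative domain of \<open>phi\<close>.\<close>

lemma system_cover_image:
 assumes X: "csubspace X" and j: "system_cover X E j"
  and phi: "cpc phi" "cstar_gen (j ` X) <= md phi" and ci: "completely_isometric X (%x. phi (j x))"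
 shows "system_cover X (cstar_gen ((%x. phi (j x)) ` X)) (%x. phi (j x))"
 unfolding system_cover_def
proof (intro conjI allI impI ci refl)
 let ?i = "%x. phi (j x)"
 have E: "cstar_algebra E" "cstar_gen (j ` X) = E" using j by (auto simp: system_cover_def)
 have jE: "j x \<in> E" if "x \<in> X" for x using that unfolding E(2)[symmetric] by (auto intro: hull_inc)
 have il: "clin (?i x)" if "x \<in> X" for x using cstar_algebraD(1)[OF E(1) jE[OF that]] phi(1) by simp
 thus "cstar_algebra (cstar_gen (?i ` X))" by (intro cstar_gen) auto
 fix e assume e: "identity_of e X"
 hence je: "identity_of (j e) E" using j by (auto simp: system_cover_def)
 hence jeE: "j e \<in> E" by (simp add: identity_of_def)
 have m: "j e \<in> md phi" using jeE phi(2) E(2) by blast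
 have "identity_of (?i e) (?i ` X)"
  unfolding identity_of_def
 proof (intro conjI ballI)
  show "?i e \<in> ?i ` X" using e by (auto simp: identity_of_def)
  fix y assume "y \<in> ?i ` X"
  then obtain x where x: "x \<in> X" "y = ?i x" by blast
  have "clin (j x)" "j e oo j x = j x" "j x oo j e = j x"
   using cstar_algebraD(1)[OF E(1) jE[OF x(1)]] je jE[OF x(1)] by (auto simp: identity_of_def)
  thus "?i e oo y = y" "y oo ?i e = y" using mdD(1,2)[OF m, of "j x"] x(2) by auto
 qed
 moreover have "hadj (?i e) = ?i e"
  using cpc_hadj[OF phi(1) mdD(3)[OF m]] cstar_identity_hadj[OF E(1) je] by simp
 ultimately have "cai (?i ` X) (?i e) (principal {?i e})"
  using csubspace_image X ci il by (intro unit_cai) (auto simp: completely_isometric_def)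
 thus "identity_of (?i e) (cstar_gen (?i ` X))"
  using e by (intro unit_cstar_gen) (auto simp: identity_of_def)
qed

lemma system_tensor_envelope:
 fixes t :: "'h::chilbert_space => 'k::chilbert_space => 'l::chilbert_space"
  and s :: "'p::chilbert_space => 'q::chilbert_space => 'r::chilbert_space"
 assumes t: "hilbert_tensor t" and s: "hilbert_tensor s" and B: "operator_system B" and A: "operator_system A"
  and eB: "system_envelope TYPE('p op ell2) B EB jB" and eA: "system_envelope TYPE('q op ell2) A EA jA"
 shows "\<exists>j. extends_tensor t s B A jB jA j &
  system_envelope TYPE('m::chilbert_space) (min_tensor t B A) (min_tensor s EB EA) j"
proof -
 let ?X = "min_tensor t B A" and ?J = "min_tensor s (jB ` B) (jA ` A)"
 obtain e where e: "identity_of e B" "hadj e = e" "csubspace B" "B <= Collect clin" using operator_system_unit[OF B] by blast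
 obtain f where f: "identity_of f A" "hadj f = f" "csubspace A" "A <= Collect clin" using operator_system_unit[OF A] by blast
 have ef: "e \<in> B" "f \<in> A" using e(1) f(1) by (auto simp: identity_of_def)
 have covB: "system_cover B EB jB" and covA: "system_cover A EA jA" using eB eA by (auto simp: system_envelope_def)
 note cB = system_cover_cai[OF e(3,1) covB] and cA = system_cover_cai[OF f(3,1) covA]
 have caiB: "cai B e (principal {e})" and caiA: "cai A f (principal {f})" using e f by (auto intro!: unit_cai)
 have minB: "maps_onto B (cstar_gen ((%x. phi (jB x)) ` B)) (%x. phi (jB x)) (cstar_gen (jB ` B)) jB"
  if "cpc phi" "cstar_gen (jB ` B) <= md phi" "completely_isometric B (%x. phi (jB x))"
  for phi :: "'p op => ('p op ell2 \<Rightarrow>\<^sub>L 'p op ell2)"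
  using eB system_cover_image[OF e(3) covB that] unfolding cB(4)[symmetric] system_envelope_def by blast
 have minA: "maps_onto A (cstar_gen ((%x. phi (jA x)) ` A)) (%x. phi (jA x)) (cstar_gen (jA ` A)) jA"
  if "cpc phi" "cstar_gen (jA ` A) <= md phi" "completely_isometric A (%x. phi (jA x))"
  for phi :: "'q op => ('q op ell2 \<Rightarrow>\<^sub>L 'q op ell2)"
  using eA system_cover_image[OF f(3) covA that] unfolding cA(4)[symmetric] system_envelope_def by blast
 obtain j k where jk: "cpc j" "cpc k" "\<forall>b\<in>B. \<forall>a\<in>A. j (otimes t b a) = otimes s (jB b) (jA a)" "\<forall>x\<in>?X. k (j x) = x"
  "j ` ?X = ?J"
  and env: "\<forall>(V :: _ => 'm op) W. cpc V & cpc W & (\<forall>x\<in>?X. W (V x) = x) -->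
   maps_onto ?X (cstar_gen (V ` ?X)) V (cstar_gen (j ` ?X)) j"
  by (rule exE[OF tensor_envelope[where 'm = 'm, OF t s caiB cB(1-3) minB caiA cA(1-3) minA]], assumption+,
    elim exE conjE, rule that, assumption+, simp)
 note caiX = cai_tensor[OF t caiB caiA] and caiJ = cai_tensor[OF s cB(2) cA(2)]
 have Xl: "clin x" if "x \<in> ?X" for x using caiD(2)[OF caiX that] .
 let ?e = "otimes t e f"
 have eX: "identity_of ?e ?X"
  using caiD(3,4)[OF caiX] otimes_min_tensor[OF t e(4) f(4) ef] by (auto simp: identity_of_def)
 have Jl: "jB ` B <= Collect clin" "jA ` A <= Collect clin" using caiD(2)[OF cB(2)] caiD(2)[OF cA(2)] by auto
 have E: "cstar_gen ?J = min_tensor s EB EA" using cstar_gen_min_tensor[OF s cB(2) cA(2)] cB(4) cA(4) by simp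
 have "identity_of (j ?e) (min_tensor s EB EA)"
  unfolding identity_of_def E[symmetric]
 proof (intro conjI ballI)
  have je: "j ?e = otimes s (jB e) (jA f)" using jk(3) ef by blast
  show "j ?e \<in> cstar_gen ?J" unfolding je using ef by (intro hull_inc otimes_min_tensor[OF s Jl]) auto
  show "j ?e oo x = x" "x oo j ?e = x" if "x \<in> cstar_gen ?J" for x
   unfolding je using cai_cstar(5,6)[OF caiJ that] by auto
 qed
 hence cov: "system_cover ?X (min_tensor s EB EA) j"
  unfolding system_cover_def jk(5) using E cstar_gen[of ?J] caiD(2)[OF caiJ] eX identity_unique
   cpc_completely_isometric[OF jk(1,2), of ?X] Xl jk(4) by metis
 have "maps_onto ?X F i (min_tensor s EB EA) j" if i: "system_cover ?X F i" for F and i :: "_ => 'm op"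
 proof -
  have X: "csubspace ?X" by (rule min_tensor_csubspace)
  note c = system_cover_cai[OF X eX i]
  have "cai ?X ?e (principal {?e})" using X Xl eX caiD(6)[OF caiX] by (rule unit_cai)
  \<comment> \<open>Any competing cover is realized by completely positive maps that agree with
    \<open>i\<close> and with its inverse where these are defined.\<close>
  from cai_extension_inverse[OF this c(1-3)] obtain V W where VW: "cpc V" "cpc W" "!!x. x \<in> ?X ==> V x = i x & W (i x) = x"
   by blast
  hence "maps_onto ?X (cstar_gen (V ` ?X)) V (cstar_gen (j ` ?X)) j"
   by (intro env[rule_format, of V W]) simp
  moreover have "V ` ?X = i ` ?X" using VW(3) by (auto simp: image_iff)
  ultimately show ?thesis using VW(3) by (intro maps_onto_cong[of ?X V i]) (auto simp: E jk(5) c(4))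
 qed
 hence "system_envelope TYPE('m) ?X (min_tensor s EB EA) j" using cov by (simp add: system_envelope_def)
 moreover have "extends_tensor t s B A jB jA j"
  unfolding extends_tensor_def using jk(3) e(4) f(4) Jl by (auto simp: op_tensor_otimes[OF t] op_tensor_otimes[OF s] image_subset_iff subset_iff)
 ultimately show ?thesis by blast
qed

section \<open>Covers and unitizations of approximately unital operator algebras\<close>

lemma algebra_cover_cai:
 assumes X: "csubspace X" "\<forall>x\<in>X. \<forall>y\<in>X. x oo y \<in> X" and c: "cai X P \<F>" and i: "algebra_cover X F i"
 shows "completely_isometric X i" "\<exists>P'. cai (i ` X) P' (filtermap i \<F>)"
  "\<forall>\<^sub>F e in \<F>. \<forall>x\<in>X. i (x oo e) = i x oo i e" "F = cstar_gen (i ` X)"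
proof -
 have F: "cstar_algebra F" "completely_isometric X i" "cstar_gen (i ` X) = F"
  and mult: "!!x y. x \<in> X ==> y \<in> X ==> i (x oo y) = i x oo i y"
  using i by (auto simp: algebra_cover_def)
 thus "completely_isometric X i" "F = cstar_gen (i ` X)" by auto
 show "\<forall>\<^sub>F e in \<F>. \<forall>x\<in>X. i (x oo e) = i x oo i e" using caiD(9)[OF c] by eventually_elim (simp add: mult)
 have iF: "i x \<in> F" if "x \<in> X" for x using that unfolding F(3)[symmetric] by (auto intro: hull_inc)
 have lin: "clinear_on X i" using F(2) by (simp add: completely_isometric_def)
 have diff: "norm (i x - i y) = norm (x - y)" if "x \<in> X" "y \<in> X" for x y
 proof -
  have d: "x - y \<in> X" using csubspaceD(5)[OF X(1)] that by blast
  have "i x = i (x - y) + i y" using lin d that unfolding clinear_on_def by (metis diff_add_cancel)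
  thus ?thesis using completely_isometric_norm[OF F(2) d] by simp
 qed
 have lim: "((%e. i (f e)) ~~> i x) \<F>" if "(f ~~> x) \<F>" "\<forall>\<^sub>F e in \<F>. f e \<in> X" "x \<in> X" for f x
 proof (rule Lim_null[THEN iffD2], rule Lim_null_comparison)
  show "\<forall>\<^sub>F e in \<F>. norm (i (f e) - i x) <= norm (f e - x)" using that(2) by eventually_elim (simp add: diff that(3))
  have "((%e. norm (f e - x)) ~~> norm (x - x)) \<F>" by (intro tendsto_intros that(1))
  thus "((%e. norm (f e - x)) ~~> 0) \<F>" by simp
 qed
 have ev: "\<forall>\<^sub>F e in \<F>. e \<in> X" using caiD(9)[OF c] by (auto elim: eventually_mono)
 show "\<exists>P'. cai (i ` X) P' (filtermap i \<F>)"
 proof (rule cai_algebra)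
  show "csubspace (i ` X)" by (rule csubspace_image[OF lin X(1)])
  show "clin x" if "x \<in> i ` X" for x using that iF cstar_algebraD(1)[OF F(1)] by auto
  show "x oo y \<in> i ` X" if "x \<in> i ` X" "y \<in> i ` X" for x y using that X(2) by (auto simp flip: mult)
  show "filtermap i \<F> ~= bot" using caiD(8)[OF c] by (simp add: filtermap_bot_iff)
  show "\<forall>\<^sub>F e in filtermap i \<F>. e \<in> i ` X & norm e <= 1"
   unfolding eventually_filtermap using caiD(9)[OF c] by eventually_elim (simp add: completely_isometric_norm[OF F(2)])
  fix y assume "y \<in> i ` X"
  then obtain x where x: "x \<in> X" "y = i x" by blast
  have "((%e. i (e oo x)) ~~> i x) \<F>" using ev by (intro lim caiD(12)[OF c] x) (auto elim!: eventually_mono intro: X(2)[rule_format] x)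
  thus "((%e. e oo y) ~~> y) (filtermap i \<F>)"
   unfolding filterlim_filtermap x(2) by (rule Lim_transform_eventually) (use ev in eventually_elim, simp add: mult x)
  have "((%e. i (x oo e)) ~~> i x) \<F>" using ev by (intro lim caiD(11)[OF c] x) (auto elim!: eventually_mono intro: X(2)[rule_format] x)
  thus "((%e. y oo e) ~~> y) (filtermap i \<F>)"
   unfolding filterlim_filtermap x(2) by (rule Lim_transform_eventually) (use ev in eventually_elim, simp add: mult x)
 qed
qed

lemma algebra_cover_image:
 assumes j: "algebra_cover X E j" and phi: "cpc phi" "cstar_gen (j ` X) <= md phi"
  and ci: "completely_isometric X (%x. phi (j x))"
 shows "algebra_cover X (cstar_gen ((%x. phi (j x)) ` X)) (%x. phi (j x))"
 unfolding algebra_cover_def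
proof (intro conjI ballI ci refl)
 have jm: "j x \<in> md phi" if "x \<in> X" for x using that phi(2) hull_inc[of "j x" "j ` X" cstar_algebra] by auto
 show "cstar_algebra (cstar_gen ((%x. phi (j x)) ` X))" using mdD(3)[OF jm] phi(1) by (intro cstar_gen) auto
 show "phi (j (x oo y)) = phi (j x) oo phi (j y)" if "x \<in> X" "y \<in> X" for x y
  using that j mdD(1)[OF jm[OF that(2)] mdD(3)[OF jm[OF that(1)]]] by (simp add: algebra_cover_def)
qed

text \<open>If the scalar part exceeded the norm, \<open>S = y + P\<close> would be a strict
  contraction. Its powers, applied to \<open>P\<close>, tend to \<open>0\<close>, while
  \<open>P\<close> minus each of them stays in \<open>X\<close>; by closedness \<open>P\<close>
  would be a unit in \<open>X\<close>.\<close>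

lemma nonunital_bound:
 assumes c: "cai X P \<F>" and X: "closed X" "!!x y. x \<in> X ==> y \<in> X ==> x oo y \<in> X"
  and nonunital: "\<not> unital_algebra X" and x: "x \<in> X"
 shows "cmod d <= norm (x + d *C P)"
proof (rule ccontr)
 assume "\<not> cmod d <= norm (x + d *C P)"
 hence less: "norm (x + d *C P) < cmod d" by simp
 hence d: "d ~= 0" by auto
 note Xs = csubspaceD[OF caiD(1)[OF c]] and P = caiD(5-7)[OF c]
 define y where "y = inverse d *C x"
 define S where "S = y + P"
 have y: "y \<in> X" using Xs(3) x by (simp add: y_def)
 have "S = inverse d *C (x + d *C P)" using d by (simp add: S_def y_def scaleC_add_right scaleC_scaleC)
 hence S1: "norm S < 1" using less d by (simp add: norm_scaleC norm_inverse norm_divide field_simps)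
 define f where "f n = ((%T. S oo T) ^^ n) P" for n
 have f: "P - f n \<in> X & norm (f n) <= norm S ^ n" for n
 proof (induction n)
  case 0
  thus ?case using norm_projection[OF P] Xs(1) by (simp add: f_def)
 next
  case (Suc n)
  have eq: "P - f (Suc n) = (P - f n) + (y oo (P - f n)) - y"
   using caiD(3)[OF c, of "P - f n"] Suc caiD(4)[OF c y] P by (simp add: f_def S_def comp_simps)
  have "P - f (Suc n) \<in> X" unfolding eq using Suc by (intro Xs(5)[OF Xs(2)[OF _ X(2)[OF y]] y]) simp_all
  moreover have "norm (f (Suc n)) <= norm S * norm (f n)" by (simp add: f_def norm_blinfun_compose)
  ultimately show ?case using Suc mult_left_mono[of "norm (f n)" "norm S ^ n" "norm S"] by fastforce
 qed
 have "(%n. norm S ^ n) ---> 0" using S1 by (intro LIMSEQ_realpow_zero) auto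
 hence "f ---> 0" by (rule Lim_null_comparison[rotated]) (simp add: f)
 hence "(%n. P - f n) ---> P - 0" by (intro tendsto_intros)
 hence "P - 0 \<in> X" using closed_sequentially[OF X(1), of "%n. P - f n"] f by blast
 hence "identity_of P X" using caiD(3,4)[OF c] by (simp add: identity_of_def)
 thus False using nonunital by (auto simp: unital_algebra_def)
qed

text \<open>The scalar part is a contractive functional by \<open>nonunital_bound\<close>, and a
  contractive functional is completely contractive: compressing the matrix with the coefficients
  \<open>\<mu>\<close> and \<open>b\<close> reduces the claim to a single element.\<close>

lemma scalar_part_bound:
 fixes a :: "nat => nat => complex"
 assumes c: "cai X P \<F>" and X: "closed X" "!!x y. x \<in> X ==> y \<in> X ==> x oo y \<in> X"
  and nonunital: "\<not> unital_algebra X" and x: "!!k l. k < n ==> l < n ==> x k l \<in> X"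
 defines "K \<equiv> mat_norm n (%k l. x k l + a k l *C P)"
 shows "(\<Sum>k<n. (cmod (\<Sum>l<n. a k l * b l))^2) <= K^2 * (\<Sum>l<n. (cmod (b l))^2)"
proof -
 let ?T = "%k l. x k l + a k l *C P"
 \<comment> \<open>The left coefficients are the image of \<open>b\<close>, so that the compressed
   element \<open>R\<close> has scalar part exactly \<open>L^2\<close>.\<close>
 define \<mu> where "\<mu> k = (\<Sum>l<n. a k l * b l)" for k
 define R where "R = (\<Sum>k<n. \<Sum>l<n. (cnj (\<mu> k) * b l) *C ?T k l)"
 define y where "y = (\<Sum>k<n. \<Sum>l<n. (cnj (\<mu> k) * b l) *C x k l)"
 define L where "L = L2_set (%k. cmod (\<mu> k)) {..<n}"
 define H where "H = L2_set (%l. cmod (b l)) {..<n}"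
 have K: "0 <= K" unfolding K_def by (rule mat_norm_nonneg)
 have LH: "0 <= L" "0 <= H" "L^2 = (\<Sum>k<n. (cmod (\<mu> k))^2)" "H^2 = (\<Sum>l<n. (cmod (b l))^2)"
  by (simp_all add: L_def H_def L2_set_def sum_nonneg)
 have Tl: "clin (?T k l)" if "k < n" "l < n" for k l using caiD(2)[OF c x[OF that]] caiD(5)[OF c] by simp
 have "y \<in> X"
  unfolding y_def using caiD(1)[OF c] x by (intro csubspace_sum csubspaceD(3)[OF caiD(1)[OF c]]) auto
 have "(\<Sum>l<n. (m * b l) * a k l) = m * \<mu> k" for m k by (simp add: \<mu>_def sum_distrib_left ac_simps)
 hence "(\<Sum>k<n. \<Sum>l<n. (cnj (\<mu> k) * b l) * a k l) = (\<Sum>k<n. cnj (\<mu> k) * \<mu> k)" by simp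
 also have "... = complex_of_real (L^2)"
  unfolding LH(3) of_real_sum by (intro sum.cong refl) (metis complex_norm_square mult.commute)
 finally have sum: "(\<Sum>k<n. \<Sum>l<n. (cnj (\<mu> k) * b l) * a k l) = complex_of_real (L^2)" .
 have sc: "(\<Sum>i\<in>F. f i *C P) = (\<Sum>i\<in>F. f i) *C P" for f and F :: "nat set"
  by (induction F rule: infinite_finite_induct) (auto simp: scaleC_add_left)
 have "R = y + (\<Sum>k<n. \<Sum>l<n. (cnj (\<mu> k) * b l) * a k l) *C P"
  by (simp add: R_def y_def scaleC_add_right scaleC_scaleC sum.distrib sc)
 hence "cmod (complex_of_real (L^2)) <= norm R" using nonunital_bound[OF c X nonunital \<open>y \<in> X\<close>] by (simp only: sum)
 hence 1: "L^2 <= norm R" by (simp add: norm_power)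
 have "norm R <= L * (K * H)"
 proof (intro norm_blinfun_bound norm_leI_cinner)
  fix xi \<zeta>
  define v where "v k = (\<Sum>l<n. ?T k l $ (b l *C xi))" for k
  have "<<\<zeta>, R $ xi>> = (\<Sum>k<n. cnj (\<mu> k) * <<\<zeta>, v k>>)"
   unfolding R_def v_def using Tl
   by (simp add: blinfun.sum_left cinner_sum_right cinner_simps clin_scaleC sum_distrib_left algebra_simps caiD(2)[OF c x] caiD(5)[OF c])
  hence "cmod <<\<zeta>, R $ xi>> <= (\<Sum>k<n. cmod (cnj (\<mu> k) * <<\<zeta>, v k>>))" using norm_sum by metis
  also have "... <= (\<Sum>k<n. \<bar>cmod (\<mu> k)\<bar> * \<bar>norm (v k)\<bar> * norm \<zeta>)"
   using cauchy_schwarz by (intro sum_mono) (auto simp: norm_mult mult.assoc mult.commute[of "norm (v _)"] intro!: mult_left_mono)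
  also have "... <= (L * L2_set (%k. norm (v k)) {..<n}) * norm \<zeta>"
   unfolding sum_distrib_right[symmetric] L_def by (intro mult_right_mono L2_set_mult_ineq) auto
  also have "... <= (L * (K * (H * norm xi))) * norm \<zeta>"
  proof (intro mult_right_mono mult_left_mono LH(1))
   have "(\<Sum>k<n. (norm (v k))^2) <= K^2 * (\<Sum>l<n. (norm (b l *C xi))^2)"
    unfolding v_def K_def by (rule mbound_mat_norm[unfolded mbound_def, rule_format])
   also have "... = (K * (H * norm xi))^2"
    by (simp add: norm_scaleC power_mult_distrib LH(4) sum_distrib_right)
   finally show "L2_set (%k. norm (v k)) {..<n} <= K * (H * norm xi)"
    unfolding L2_set_def using K LH(2) by (intro real_le_lsqrt) (auto simp: sum_nonneg)
  qed simp
  finally show "cmod <<\<zeta>, R $ xi>> <= L * (K * H) * norm xi * norm \<zeta>" by (simp add: ac_simps)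
 qed (use K LH in auto)
 hence "L * L <= L * (K * H)" using 1 by (simp add: power2_eq_square)
 hence "L <= K * H" using LH(1,2) K by (cases "L = 0") auto
 hence "L^2 <= (K * H)^2" using LH(1) by (intro power_mono)
 thus ?thesis by (simp add: power_mult_distrib LH \<mu>_def)
qed

text \<open>A scalar matrix acts on vectors coordinate by coordinate, so its bound carries over. The
  line spanned by \<open>e\<close> lets \<open>gram_has_sum\<close> supply the coordinate
  sums.\<close>

lemma vector_bound:
 fixes y :: "nat => 'k::chilbert_space"
 assumes K: "!!b. (\<Sum>k<n. (cmod (\<Sum>l<n. a k l * b l))^2) <= K^2 * (\<Sum>l<n. (cmod (b l))^2)"
 shows "(\<Sum>k<n. (norm (\<Sum>l<n. a k l *C y l))^2) <= K^2 * (\<Sum>l<n. (norm (y l))^2)"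
proof -
 obtain u :: "'k => 'k ell2" where u: "!!y y'. <<u y, u y'>> = <<y, y'>>" using ell2_embedding by blast
 define e :: "unit ell2" where "e = ebasis ()"
 have e: "<<e, e>> = 1" by (simp add: e_def cinner_ebasis coord_ebasis)
 hence "(norm e)^2 = 1" using cinner_self[of e] by (simp flip: of_real_power)
 hence ne: "norm e = 1" using power2_eq_1_iff[of "norm e"] norm_ge_zero[of e] by linarith
 let ?c = "%l i. ell2_coord (u (y l)) i"
 have 1: "((%i. (cmod (\<Sum>l<n. a k l * ?c l i))^2) has_sum (norm (\<Sum>l<n. a k l *C y l))^2) UNIV" for k
 proof -
  have sc: "(\<Sum>l\<in>F. f l *C e) = (\<Sum>l\<in>F. f l) *C e" for f and F :: "nat set"
   by (induction F rule: infinite_finite_induct) (auto simp: scaleC_add_left)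
  have "(norm (\<Sum>l<n. ?c l i *C (a k l *C e)))^2 = (cmod (\<Sum>l<n. a k l * ?c l i))^2" for i
   by (simp add: scaleC_scaleC sc norm_scaleC ne mult.commute)
  moreover have "Re (\<Sum>l<n. \<Sum>m<n. <<a k l *C e, a k m *C e>> * <<y l, y m>>) = (norm (\<Sum>l<n. a k l *C y l))^2"
   unfolding Re_cinner_self[symmetric] cinner_sum_sum by (simp add: cinner_simps e ac_simps)
  ultimately show ?thesis using gram_has_sum[OF u, where x = "%l. a k l *C e" and y = y and F = "{..<n}"] by simp
 qed
 have 2: "((%i. (cmod (?c l i))^2) has_sum (norm (y l))^2) UNIV" for l
  using gram_has_sum[OF u, where x = "%_. e" and y = y and F = "{l}"] by (simp add: norm_scaleC ne e Re_cinner_self)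
 show ?thesis
 proof (rule has_sum_mono)
  show "((%i. \<Sum>k<n. (cmod (\<Sum>l<n. a k l * ?c l i))^2) has_sum (\<Sum>k<n. (norm (\<Sum>l<n. a k l *C y l))^2)) UNIV"
   by (intro has_sum_finite_sum 1)
  show "((%i. K^2 * (\<Sum>l<n. (cmod (?c l i))^2)) has_sum K^2 * (\<Sum>l<n. (norm (y l))^2)) UNIV"
   by (intro has_sum_cmult_right has_sum_finite_sum 2)
 qed (rule K)
qed

text \<open>The matrix respects the splitting of the space by \<open>P\<close>. On the complement
  only its scalar part acts, and this is controlled by \<open>scalar_part_bound\<close>; hence
  adjoining \<open>\<one>\<close> gives no larger norms than adjoining \<open>P\<close>.\<close>

lemma unitization_mat_norm:
 fixes X :: "'a::chilbert_space op set"
 assumes c: "cai X P \<F>" and X: "closed X" "!!x y. x \<in> X ==> y \<in> X ==> x oo y \<in> X"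
  and nonunital: "\<not> unital_algebra X" and x: "!!k l. k < n ==> l < n ==> x k l \<in> X"
 shows "mat_norm n (%k l. x k l + a k l *C \<one>) <= mat_norm n (%k l. x k l + a k l *C P)"
  (is "_ <= ?K")
proof (rule mat_norm_le[OF mat_norm_nonneg], unfold mbound_def, rule)
 fix xi :: "nat => 'a"
 note P = caiD(5,6,7)[OF c]
 define eta where "eta l = xi l - P $ xi l" for l
 have Peta: "P $ eta l = 0" for l by (simp add: eta_def blinfun.diff_right comp_eq_apply[OF P(3)])
 have orth: "<<P $ u, v>> = 0" if "P $ v = 0" for u v using hadj_left[OF P(1), of u v] that P(2) by simp
 define p where "p k = (\<Sum>l<n. (x k l + a k l *C P) $ (P $ xi l))" for k
 define r where "r k = (\<Sum>l<n. a k l *C eta l)" for k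
 have dec: "(\<Sum>l<n. (x k l + a k l *C \<one>) $ xi l) = p k + r k" if k: "k < n" for k
  unfolding p_def r_def sum.distrib[symmetric]
 proof (intro sum.cong refl)
  fix l assume "l \<in> {..<n}"
  hence "x k l $ (P $ xi l) = x k l $ xi l" using comp_eq_apply[OF caiD(4)[OF c x[OF k]]] by simp
  thus "(x k l + a k l *C \<one>) $ xi l = (x k l + a k l *C P) $ (P $ xi l) + a k l *C eta l"
   by (simp add: eta_def comp_eq_apply[OF P(3)] flip: scaleC_add_right)
 qed
 have Pp: "P $ p k = p k" if k: "k < n" for k
  unfolding p_def blinfun.sum_right
 proof (intro sum.cong refl)
  fix l assume "l \<in> {..<n}"
  hence "P oo (x k l + a k l *C P) = x k l + a k l *C P"
   using caiD(3)[OF c x[OF k]] P by (simp add: comp_simps)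
  from comp_eq_apply[OF this] show "P $ ((x k l + a k l *C P) $ (P $ xi l)) = (x k l + a k l *C P) $ (P $ xi l)" .
 qed
 have "P $ r k = 0" for k unfolding r_def blinfun.sum_right by (simp add: clin_scaleC[OF P(1)] Peta)
 hence n1: "(norm (p k + r k))^2 = (norm (p k))^2 + (norm (r k))^2" if "k < n" for k
  using orth[of "r k" "p k"] Pp[OF that] by (simp add: norm_add_sq)
 have n2: "(norm (xi l))^2 = (norm (P $ xi l))^2 + (norm (eta l))^2" for l
  using norm_add_sq[of "P $ xi l" "eta l"] orth[OF Peta, of "xi l" l] by (simp add: eta_def)
 have "(\<Sum>k<n. (norm (\<Sum>l<n. (x k l + a k l *C \<one>) $ xi l))^2) = (\<Sum>k<n. (norm (p k))^2) + (\<Sum>k<n. (norm (r k))^2)"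
  unfolding sum.distrib[symmetric]
 proof (intro sum.cong refl)
  fix k assume "k \<in> {..<n}"
  hence "k < n" by simp
  thus "(norm (\<Sum>l<n. (x k l + a k l *C \<one>) $ xi l))^2 = (norm (p k))^2 + (norm (r k))^2"
   unfolding dec[OF \<open>k < n\<close>] by (rule n1)
 qed
 also have "... <= ?K^2 * (\<Sum>l<n. (norm (P $ xi l))^2) + ?K^2 * (\<Sum>l<n. (norm (eta l))^2)"
 proof (intro add_mono)
  show "(\<Sum>k<n. (norm (p k))^2) <= ?K^2 * (\<Sum>l<n. (norm (P $ xi l))^2)"
   unfolding p_def by (rule mbound_mat_norm[unfolded mbound_def, rule_format])
  show "(\<Sum>k<n. (norm (r k))^2) <= ?K^2 * (\<Sum>l<n. (norm (eta l))^2)"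
   unfolding r_def by (rule vector_bound, rule scalar_part_bound[OF c X nonunital x])
 qed
 also have "... = ?K^2 * (\<Sum>l<n. (norm (xi l))^2)" by (simp add: n2 sum.distrib distrib_left)
 finally show "(\<Sum>k<n. (norm (\<Sum>l<n. (x k l + a k l *C \<one>) $ xi l))^2) <= ?K^2 * (\<Sum>l<n. (norm (xi l))^2)" .
qed

lemma cpc_mult_closed:
 assumes j: "cpc j" and T: "clin T"
 shows "closed {S. clin S & j (S oo T) = j S oo j T}" "csubspace {S. clin S & j (S oo T) = j S oo j T}"
  "closed {S. clin S & j (T oo S) = j T oo j S}" "csubspace {S. clin S & j (T oo S) = j T oo j S}"
proof -
 have lim: "clin S & (%n. j (f n)) ---> j S" if "!!n. clin (f n)" "f ---> S" for f S
  using clin_lim[OF that] cpc_tendsto[OF j that(2,1)] by blast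
 show "closed {S. clin S & j (S oo T) = j S oo j T}"
 proof (rule closed_seqI)
  fix f S assume f: "!!n. f n \<in> {S. clin S & j (S oo T) = j S oo j T}" "f ---> S"
  have S: "clin S & (%n. j (f n)) ---> j S" by (rule lim[OF _ f(2)]) (use f(1) in blast)
  have "(%n. j (f n oo T)) ---> j (S oo T)"
   by (rule conjunct2[OF lim[OF _ tendsto_comp[OF f(2) tendsto_const]]]) (use f(1) T in auto)
  moreover have "(%n. j (f n) oo j T) ---> (j S oo j T)" by (rule tendsto_comp[OF conjunct2[OF S] tendsto_const])
  moreover have "j (f n oo T) = j (f n) oo j T" for n using f(1) by blast
  ultimately have "j (S oo T) = j S oo j T" by (simp add: LIMSEQ_unique)
  thus "S \<in> {S. clin S & j (S oo T) = j S oo j T}" using S by blast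
 qed
 show "closed {S. clin S & j (T oo S) = j T oo j S}"
 proof (rule closed_seqI)
  fix f S assume f: "!!n. f n \<in> {S. clin S & j (T oo S) = j T oo j S}" "f ---> S"
  have S: "clin S & (%n. j (f n)) ---> j S" by (rule lim[OF _ f(2)]) (use f(1) in blast)
  have "(%n. j (T oo f n)) ---> j (T oo S)"
   by (rule conjunct2[OF lim[OF _ tendsto_comp[OF tendsto_const f(2)]]]) (use f(1) T in auto)
  moreover have "(%n. j T oo j (f n)) ---> (j T oo j S)" by (rule tendsto_comp[OF tendsto_const conjunct2[OF S]])
  moreover have "j (T oo f n) = j T oo j (f n)" for n using f(1) by blast
  ultimately have "j (T oo S) = j T oo j S" by (simp add: LIMSEQ_unique)
  thus "S \<in> {S. clin S & j (T oo S) = j T oo j S}" using S by blast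
 qed
 show "csubspace {S. clin S & j (S oo T) = j S oo j T}" "csubspace {S. clin S & j (T oo S) = j T oo j S}"
  using T cpc_clin[OF j T]
  by (auto simp: csubspace_def cpc_zero[OF j] cpc_add[OF j] cpc_scale[OF j] comp_simps)
qed

lemma algebra_tensor_envelope:
 fixes t :: "'h::chilbert_space => 'k::chilbert_space => 'l::chilbert_space"
  and s :: "'p::chilbert_space => 'q::chilbert_space => 'r::chilbert_space"
 assumes t: "hilbert_tensor t" and s: "hilbert_tensor s"
  and B: "operator_algebra B" "approximately_unital B" and A: "operator_algebra A" "approximately_unital A"
  and eB: "algebra_envelope TYPE('p op ell2) B EB jB" and eA: "algebra_envelope TYPE('q op ell2) A EA jA"
 shows "\<exists>j. extends_tensor t s B A jB jA j &
  algebra_envelope TYPE('m::chilbert_space) (min_tensor t B A) (min_tensor s EB EA) j"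
proof -
 let ?X = "min_tensor t B A" and ?J = "min_tensor s (jB ` B) (jA ` A)" and ?E = "min_tensor s EB EA"
 let ?U = "unitization ?X"
 have Bs: "csubspace B" "B <= Collect clin" "!!x y. x \<in> B ==> y \<in> B ==> x oo y \<in> B"
   "\<forall>x\<in>B. \<forall>y\<in>B. x oo y \<in> B"
  and As: "csubspace A" "A <= Collect clin" "!!x y. x \<in> A ==> y \<in> A ==> x oo y \<in> A"
   "\<forall>x\<in>A. \<forall>y\<in>A. x oo y \<in> A"
  using B(1) A(1) by (auto simp: operator_algebra_def cops_iff)
 have cai_ex: "\<exists>\<F> P. cai C P \<F>" if "operator_algebra C" "approximately_unital C" for C :: "'z::chilbert_space op set"
 proof -
  obtain \<F> where "\<F> ~= bot" "\<forall>\<^sub>F e in \<F>. e \<in> C & norm e <= 1"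
   "\<forall>x\<in>C. ((%e. e oo x) ~~> x) \<F> & ((%e. x oo e) ~~> x) \<F>"
   using \<open>approximately_unital C\<close> unfolding approximately_unital_def by blast
  moreover have "csubspace C" "C <= cops" "\<forall>x\<in>C. \<forall>y\<in>C. x oo y \<in> C"
   using \<open>operator_algebra C\<close> by (auto simp: operator_algebra_def)
  ultimately have "\<exists>P. cai C P \<F>" by (intro cai_algebra) (auto simp: subset_iff cops_iff)
  thus ?thesis by blast
 qed
 obtain \<F> P0 where caiB: "cai B P0 \<F>" using cai_ex[OF B] by blast
 obtain \<G> Q0 where caiA: "cai A Q0 \<G>" using cai_ex[OF A] by blast
 have covB: "algebra_cover B EB jB" and covA: "algebra_cover A EA jA"
  and minB': "!!F i. algebra_cover B F (i :: _ => ('p op ell2 \<Rightarrow>\<^sub>L 'p op ell2)) ==> maps_onto B F i EB jB"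
  and minA': "!!F i. algebra_cover A F (i :: _ => ('q op ell2 \<Rightarrow>\<^sub>L 'q op ell2)) ==> maps_onto A F i EA jA"
  using eB eA by (auto simp: algebra_envelope_def minimal_algebra_cover_def)
 note cB = algebra_cover_cai[OF Bs(1,4) caiB covB] and cA = algebra_cover_cai[OF As(1,4) caiA covA]
 obtain P where P: "cai (jB ` B) P (filtermap jB \<F>)" using cB(2) by blast
 obtain Q where Q: "cai (jA ` A) Q (filtermap jA \<G>)" using cA(2) by blast
 have minB: "maps_onto B (cstar_gen ((%x. phi (jB x)) ` B)) (%x. phi (jB x)) (cstar_gen (jB ` B)) jB"
  if "cpc phi" "cstar_gen (jB ` B) <= md phi" "completely_isometric B (%x. phi (jB x))"
  for phi :: "'p op => ('p op ell2 \<Rightarrow>\<^sub>L 'p op ell2)"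
  unfolding cB(4)[symmetric] by (rule minB'[OF algebra_cover_image[OF covB that]])
 have minA: "maps_onto A (cstar_gen ((%x. phi (jA x)) ` A)) (%x. phi (jA x)) (cstar_gen (jA ` A)) jA"
  if "cpc phi" "cstar_gen (jA ` A) <= md phi" "completely_isometric A (%x. phi (jA x))"
  for phi :: "'q op => ('q op ell2 \<Rightarrow>\<^sub>L 'q op ell2)"
  unfolding cA(4)[symmetric] by (rule minA'[OF algebra_cover_image[OF covA that]])
 let ?I = "otimes s P Q" and ?I' = "otimes t P0 Q0"
 obtain j k where j: "cpc j" and k: "cpc k" and jt: "\<forall>b\<in>B. \<forall>a\<in>A. j (otimes t b a) = otimes s (jB b) (jA a)"
  and j1: "j \<one> = ?I" and kI: "k ?I = ?I'" and kj: "\<forall>x\<in>?X. k (j x) = x" and jX: "j ` ?X = ?J"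
  and env: "\<forall>(V :: _ => 'm op) W. cpc V & cpc W & (\<forall>x\<in>?X. W (V x) = x) -->
   maps_onto ?X (cstar_gen (V ` ?X)) V (cstar_gen (j ` ?X)) j &
   (hadj (V \<one>) = V \<one> & V \<one> oo V \<one> = V \<one> & (\<forall>x\<in>?X. V \<one> oo V x = V x) -->
    maps_onto ?U (cstar_gen (V ` ?U)) V (cstar_gen (j ` ?U)) j)"
  by (rule exE[OF tensor_envelope[where 'm = 'm, OF t s caiB cB(1) P cB(3) minB caiA cA(1) Q cA(3) minA]], assumption+,
    elim exE conjE, rule that, assumption+)
 note caiX = cai_tensor[OF t caiB caiA] and caiJ = cai_tensor[OF s P Q] and tw = hilbert_wtensor[OF t] and sw = hilbert_wtensor[OF s]
 note X = min_tensor_csubspace[of t B A] min_tensor_closed[of t B A]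
 have Xl: "clin x" if "x \<in> ?X" for x using caiD(2)[OF caiX that] .
 have Xm: "x oo y \<in> ?X" if "x \<in> ?X" "y \<in> ?X" for x y
  using that by (intro min_tensor_comp[OF t Bs(2) _ As(2)]) (auto intro: Bs(3) As(3))
 have BAl: "clin b" "clin a" "clin (jB b)" "clin (jA a)" if "b \<in> B" "a \<in> A" for b a
  using that Bs(2) As(2) caiD(2)[OF P] caiD(2)[OF Q] by auto
 \<comment> \<open>Multiplicativity is checked on elementary tensors and extended by continuity in
   one variable at a time.\<close>
 have jm: "j (x oo y) = j x oo j y" if x: "x \<in> ?X" and y: "y \<in> ?X" for x y
 proof -
  have "clin x & j (x oo y) = j x oo j y"
  proof (rule min_tensor_induct[OF t Bs(2) As(2) x cpc_mult_closed(1,2)[OF j Xl[OF y]]])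
   fix b a assume ba: "b \<in> B" "a \<in> A"
   have c: "clin (otimes t b a)" by (rule clin_otimes[OF tw BAl(1,2)[OF ba]])
   have "clin y & j (otimes t b a oo y) = j (otimes t b a) oo j y"
   proof (rule min_tensor_induct[OF t Bs(2) As(2) y cpc_mult_closed(3,4)[OF j c]])
    fix b' a' assume ba': "b' \<in> B" "a' \<in> A"
    have "jB (b oo b') = jB b oo jB b'" "jA (a oo a') = jA a oo jA a'"
     using covB covA ba ba' by (auto simp: algebra_cover_def)
    thus "clin (otimes t b' a') & j (otimes t b a oo otimes t b' a') = j (otimes t b a) oo j (otimes t b' a')"
     using jt BAl[OF ba] BAl[OF ba'] ba ba' Bs(3) As(3) by (simp add: clin_otimes[OF tw] otimes_comp[OF tw] otimes_comp[OF sw])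
   qed
   thus "clin (otimes t b a) & j (otimes t b a oo y) = j (otimes t b a) oo j y" using c by blast
  qed
  thus ?thesis by blast
 qed
 have E: "cstar_gen ?J = ?E" using cstar_gen_min_tensor[OF s P Q] cB(4) cA(4) by simp
 have cov: "algebra_cover ?X ?E j"
  unfolding algebra_cover_def jX E[symmetric]
  using cpc_completely_isometric[OF j k Xl] kj jm caiD(2)[OF caiJ] by (simp add: cstar_gen)
 have "maps_onto ?X F i ?E j" if i: "algebra_cover ?X F i" for F and i :: "_ => 'm op"
 proof -
  have "\<forall>x\<in>?X. \<forall>y\<in>?X. x oo y \<in> ?X" using Xm by blast
  note c = algebra_cover_cai[OF X(1) this caiX i]
  obtain P' where "cai (i ` ?X) P' (filtermap i (filtermap (%p. otimes t (fst p) (snd p)) (\<F> \<times>\<^sub>F \<G>)))" using c(2) by blast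
  from cai_extension_inverse[OF caiX c(1) this c(3)]
  obtain V W where VW: "cpc V" "cpc W" "!!x. x \<in> ?X ==> V x = i x & W (i x) = x" by blast
  hence "maps_onto ?X (cstar_gen (V ` ?X)) V (cstar_gen (j ` ?X)) j"
   by (intro env[rule_format, of V W, THEN conjunct1]) simp
  moreover have "V ` ?X = i ` ?X" using VW(3) by (auto simp: image_iff)
  ultimately show ?thesis using VW(3) by (intro maps_onto_cong[of ?X V i]) (auto simp: E jX c(4))
 qed
 hence minimal: "minimal_algebra_cover TYPE('m) ?X ?E j" using cov by (simp add: minimal_algebra_cover_def)
 \<comment> \<open>The envelope of the unitization is realized on the same space, generated by
   \<open>?J\<close> and \<open>otimes s P Q\<close>; the latter is the image of
   \<open>\<one>\<close> under \<open>j\<close>.\<close>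
 have "minimal_algebra_cover TYPE('m) ?U (cstar_gen (j ` ?U)) j" if nonunital: "\<not> unital_algebra ?X"
  unfolding minimal_algebra_cover_def
 proof (intro conjI allI impI)
  have Uex: "\<exists>x c. x \<in> ?X & u = x + c *C \<one>" if "u \<in> ?U" for u using that by (auto simp: unitization_def)
  have UI: "x + c *C \<one> \<in> ?U" if "x \<in> ?X" for x c using that by (auto simp: unitization_def)
  have U1: "\<one> \<in> ?U" using UI[OF csubspaceD(1)[OF X(1)], of 1] by simp
  have XU: "x \<in> ?U" if "x \<in> ?X" for x using UI[OF that, of 0] by simp
  have Ul: "clin u" if "u \<in> ?U" for u using Uex[OF that] Xl by auto
  have Us: "csubspace ?U"
   unfolding csubspace_def
  proof (intro conjI ballI allI)
   show "0 \<in> ?U" using XU csubspaceD(1)[OF X(1)] by blast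
   fix u assume "u \<in> ?U"
   then obtain x c where u: "x \<in> ?X" "u = x + c *C \<one>" using Uex by blast
   show "d *C u \<in> ?U" for d
    using UI[OF csubspaceD(3)[OF X(1) u(1)], of d "d * c"] u(2) by (simp add: scaleC_add_right scaleC_scaleC)
   fix v assume "v \<in> ?U"
   then obtain y d where v: "y \<in> ?X" "v = y + d *C \<one>" using Uex by blast
   have "u + v = (x + y) + (c + d) *C \<one>" using u v by (simp add: scaleC_add_left)
   thus "u + v \<in> ?U" using UI[OF csubspaceD(2)[OF X(1) u(1) v(1)], of "c + d"] by simp
  qed
  have ju: "j (x + c *C \<one>) = j x + c *C ?I" if "x \<in> ?X" for x c
   using Xl[OF that] by (simp add: cpc_add[OF j] cpc_scale[OF j] j1)
  have mult: "u oo v \<in> ?U & j (u oo v) = j u oo j v" if u: "u \<in> ?U" and v: "v \<in> ?U" for u v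
  proof -
   obtain x c where x: "x \<in> ?X" "u = x + c *C \<one>" using Uex[OF u] by blast
   obtain y d where y: "y \<in> ?X" "v = y + d *C \<one>" using Uex[OF v] by blast
   let ?z = "(x oo y) + (d *C x + c *C y)"
   have z: "?z \<in> ?X" using x(1) y(1) Xm csubspaceD(2,3)[OF X(1)] by simp
   have uv: "u oo v = ?z + (c * d) *C \<one>"
    using Xl[OF x(1)] Xl[OF y(1)] by (simp add: x(2) y(2) comp_simps scaleC_add_right scaleC_scaleC ac_simps)
   have jJ: "j x \<in> ?J" "j y \<in> ?J" using x(1) y(1) jX by auto
   have "j ?z = (j x oo j y) + (d *C j x + c *C j y)"
    using Xl[OF x(1)] Xl[OF y(1)] by (simp add: cpc_add[OF j] cpc_scale[OF j] jm x(1) y(1))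
   hence "j (u oo v) = j u oo j v"
    unfolding uv ju[OF z] unfolding x(2) y(2) ju[OF x(1)] ju[OF y(1)]
    using caiD(2-4)[OF caiJ jJ(1)] caiD(2-4)[OF caiJ jJ(2)] caiD(5,7)[OF caiJ]
    by (simp add: comp_simps scaleC_add_right scaleC_scaleC ac_simps)
   thus ?thesis using UI[OF z] uv by simp
  qed
  \<comment> \<open>Contractivity of \<open>j\<close> is one half. For the other, \<open>k\<close>
    returns \<open>f u + g u *C ?I'\<close> in place of \<open>u = f u + g u *C \<one>\<close>, and
    \<open>unitization_mat_norm\<close> compares the two.\<close>
  have ci: "completely_isometric ?U j"
   unfolding completely_isometric_def clinear_on_def
  proof (intro conjI ballI allI impI)
   fix n :: nat and T assume T: "\<forall>a<n. \<forall>b<n. T a b \<in> ?U"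
   have le: "mat_norm n (%a b. j (T a b)) <= mat_norm n T" using T Ul by (intro cpc_mat_norm[OF j]) auto
   have "\<forall>u\<in>?U. \<exists>x c. x \<in> ?X & u = x + c *C \<one>" using Uex by blast
   then obtain f g where fg: "!!u. u \<in> ?U ==> f u \<in> ?X & u = f u + g u *C \<one>" by metis
   have kju: "k (j u) = f u + g u *C ?I'" if u: "u \<in> ?U" for u
   proof -
    have fu: "f u \<in> ?X" "u = f u + g u *C \<one>" using fg[OF u] by auto
    have c: "clin (j (f u))" "clin ?I" using Xl[OF fu(1)] j caiD(5)[OF caiJ] by auto
    have "k (j u) = k (j (f u) + g u *C ?I)" by (subst fu(2), subst ju[OF fu(1)]) (rule refl)
    thus ?thesis using c fu(1) kj by (simp add: cpc_add[OF k] cpc_scale[OF k] kI)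
   qed
   have "mat_norm n T = mat_norm n (%a b. f (T a b) + g (T a b) *C \<one>)"
    using T fg by (simp add: mat_norm_def flip: fg)
   also have "... <= mat_norm n (%a b. f (T a b) + g (T a b) *C ?I')"
    using T fg by (intro unitization_mat_norm[OF caiX X(2) Xm nonunital]) auto
   also have "... = mat_norm n (%a b. k (j (T a b)))" using T by (simp add: mat_norm_def kju)
   also have "... <= mat_norm n (%a b. j (T a b))" using T Ul j by (intro cpc_mat_norm[OF k]) auto
   finally show "mat_norm n (%a b. j (T a b)) = mat_norm n T" using le by simp
  qed (use Ul in \<open>simp_all add: cpc_add[OF j] cpc_scale[OF j]\<close>)
  show "algebra_cover ?U (cstar_gen (j ` ?U)) j"
   unfolding algebra_cover_def using ci mult Ul j by (auto intro!: cstar_gen)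
  fix F and i :: "_ => 'm op" assume i: "algebra_cover ?U F i"
  \<comment> \<open>The unitization has a unit, so its covers are treated with the constant
    approximate identity.\<close>
  have caiU: "cai ?U \<one> (principal {\<one>})"
   using Us Ul U1 by (intro unit_cai) (auto simp: identity_of_def)
  have "\<forall>u\<in>?U. \<forall>v\<in>?U. u oo v \<in> ?U" using mult by blast
  note c = algebra_cover_cai[OF Us this caiU i]
  obtain q where q: "cai (i ` ?U) q (filtermap i (principal {\<one>}))" using c(2) by blast
  from cai_extension_inverse[OF caiU c(1) q c(3)]
  obtain V W where VW: "cpc V" "cpc W" "!!x. x \<in> ?U ==> V x = i x & W (i x) = x" "V \<one> = q" by blast
  \<comment> \<open>The extension \<open>V\<close> sends \<open>\<one>\<close> to the unit
    \<open>q\<close> of the competing cover, which meets the conditions imposed on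
    \<open>V \<one>\<close>.\<close>
  have "maps_onto ?U (cstar_gen (V ` ?U)) V (cstar_gen (j ` ?U)) j"
  proof (rule env[rule_format, of V W, THEN conjunct2, rule_format])
   show "cpc V & cpc W & (\<forall>x\<in>?X. W (V x) = x)" using VW XU by simp
   show "hadj (V \<one>) = V \<one> & V \<one> oo V \<one> = V \<one> & (\<forall>x\<in>?X. V \<one> oo V x = V x)"
    using caiD(3,6,7)[OF q] VW XU by simp
  qed
  moreover have "V ` ?U = i ` ?U" using VW(3) by (auto simp: image_iff)
  ultimately show "maps_onto ?U F i (cstar_gen (j ` ?U)) j"
   using VW(3) by (intro maps_onto_cong[of ?U V i]) (auto simp: c(4))
 qed
 hence "algebra_envelope TYPE('m) ?X ?E j"
  unfolding algebra_envelope_def using minimal E jX by (metis)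
 moreover have "extends_tensor t s B A jB jA j"
  unfolding extends_tensor_def using jt BAl by (simp add: op_tensor_otimes[OF t] op_tensor_otimes[OF s])
 ultimately show ?thesis by blast
qed

theorem theorem2p10:
  fixes t :: "'h::chilbert_space \<Rightarrow> 'k::chilbert_space \<Rightarrow> 'l::chilbert_space"
    and s :: "'p::chilbert_space \<Rightarrow> 'q::chilbert_space \<Rightarrow> 'r::chilbert_space"
    and B :: "('h \<Rightarrow>\<^sub>L 'h) set" and A :: "('k \<Rightarrow>\<^sub>L 'k) set"
    and EB :: "('p \<Rightarrow>\<^sub>L 'p) set" and EA :: "('q \<Rightarrow>\<^sub>L 'q) set"
    and jB :: "('h \<Rightarrow>\<^sub>L 'h) \<Rightarrow> ('p \<Rightarrow>\<^sub>L 'p)" and jA :: "('k \<Rightarrow>\<^sub>L 'k) \<Rightarrow> ('q \<Rightarrow>\<^sub>L 'q)"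
  assumes t: "hilbert_tensor t" and s: "hilbert_tensor s"
  shows "(operator_system B \<and> operator_system A \<and>
          system_envelope TYPE(('p \<Rightarrow>\<^sub>L 'p) ell2) B EB jB \<and>
          system_envelope TYPE(('q \<Rightarrow>\<^sub>L 'q) ell2) A EA jA
          \<longrightarrow> (\<exists>j. extends_tensor t s B A jB jA j \<and>
                   system_envelope TYPE('m::chilbert_space) (min_tensor t B A) (min_tensor s EB EA) j))
       \<and> (operator_algebra B \<and> approximately_unital B \<and>
          operator_algebra A \<and> approximately_unital A \<and>
          algebra_envelope TYPE(('p \<Rightarrow>\<^sub>L 'p) ell2) B EB jB \<and>
          algebra_envelope TYPE(('q \<Rightarrow>\<^sub>L 'q) ell2) A EA jA
          \<longrightarrow> (\<exists>j. extends_tensor t s B A jB jA j \<and>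
                   algebra_envelope TYPE('m) (min_tensor t B A) (min_tensor s EB EA) j))"
  using system_tensor_envelope[OF t s, of B A EB jB EA jA, where 'm = 'm]
    algebra_tensor_envelope[OF t s, of B A EB jB EA jA, where 'm = 'm] by blast

end
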